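(* Let $d\ge1$, $\alpha\in[-1/2,\infty)^d$, and let $\mathbf{R}=(R_1,\ldots,R_d)$ be the vector of Riesz transforms for Laguerre function expansions of convolution type with parameter $\alpha$ defined in the context. Then for every $1<p<\infty$ we have $$\|\mathbf{R}f\|_p\le48\,(p^*-1)\,\|f\|_p,\qquad f\in L^p(X,\mu),\quad p^*=\max\left(p,\frac p{p-1}\right).$$
   Context: All functions are real-valued, $\mathbb{N}=\{0,1,2,\ldots\}$. Let $X=(0,\infty)^d$ and $d\mu(x)=\prod_{i=1}^dx_i^{2\alpha_i+1}\,dx$; $L^p=L^p(X,\mu)$; for vector-valued functions $\|\mathbf{g}\|_p=\big(\int_X|\mathbf{g}|^p\,d\mu\big)^{1/p}$ with $|\cdot|$ the Euclidean norm. Let $\ell_k^\alpha=\ell_{k_1}^{\alpha_1}\otimes\cdots\otimes\ell_{k_d}^{\alpha_d}$, $k\in\mathbb{N}^d$, be the $L^2$-normalized Laguerre functions of convolution type, $\ell_n^{a}(x)=\Big(\frac{2\,n!}{\Gamma(n+a+1)}\Big)^{1/2}L_n^{a}(x^2)\,e^{-x^2/2}$, $x>0$, where $L_n^{a}$ is the classical Laguerre polynomial of degree $n$ and type $a$. They form an orthonormal basis of $L^2$ of eigenfunctions of $L=-\Delta+|x|^2-\sum_{i=1}^d\frac{2\alpha_i+1}{x_i}\partial_{x_i}$ with eigenvalues $\lambda_k=4|k|+2|\alpha|+2d$, where $|k|=\sum_ik_i$, $|\alpha|=\sum_i\alpha_i$. Let $\delta_i=\partial_{x_i}+x_i$; then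 $\delta_i\ell_k^\alpha=-2\sqrt{k_i}\,x_i\,\ell_{k-e_i}^{\alpha+e_i}$ (zero if $k_i=0$). The Riesz transforms ($R_i=\delta_iL^{-1/2}$) are $R_if=\sum_{k\in\mathbb{N}^d}\lambda_k^{-1/2}\langle f,\ell_k^\alpha\rangle_{L^2}\,\delta_i\ell_k^\alpha$ for $f\in L^2$, and $\mathbf{R}f=(R_1f,\ldots,R_df)$. For $f\in L^p$, $\mathbf{R}f$ is understood as the continuous extension of $\mathbf{R}$ from the dense subspace $\mathrm{lin}\{\ell_k^\alpha\}$ (existence of the extension is part of the claim). *)

theory Defs
  imports "HOL-Analysis.Analysis"
begin

text \<open>
  Functions represent their classes modulo equality almost everywhere.  For vector-valued functions
  \<open>norm\<close> on \<open>real ^ 'n\<close> is the Euclidean norm.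
\<close>

definition in_Lp :: "'a measure \<Rightarrow> real \<Rightarrow> ('a \<Rightarrow> 'b::euclidean_space) \<Rightarrow> bool" where
  "in_Lp M p f \<longleftrightarrow> f \<in> borel_measurable M \<and> integrable M (\<lambda>x. norm (f x) powr p)"

definition Lp_norm :: "'a measure \<Rightarrow> real \<Rightarrow> ('a \<Rightarrow> 'b::euclidean_space) \<Rightarrow> real" where
  "Lp_norm M p f = (\<integral>x. norm (f x) powr p \<partial>M) powr (1 / p)"

definition laguerre_measure :: "real ^ 'n \<Rightarrow> (real ^ 'n) measure" where
  "laguerre_measure \<alpha> =
     density (restrict_space lborel {x. \<forall>i. 0 < x $ i})
       (\<lambda>x. ennreal (\<Prod>i\<in>UNIV. x $ i powr (2 * \<alpha> $ i + 1)))"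

definition laguerre_poly :: "nat \<Rightarrow> real \<Rightarrow> real \<Rightarrow> real" where
  "laguerre_poly n a x =
     (\<Sum>j\<le>n. (-1) ^ j * ((real n + a) gchoose (n - j)) * x ^ j / fact j)"

definition laguerre_fun1 :: "nat \<Rightarrow> real \<Rightarrow> real \<Rightarrow> real" where
  "laguerre_fun1 n a x =
     sqrt (2 * fact n / Gamma (real n + a + 1)) * laguerre_poly n a (x\<^sup>2) * exp (- x\<^sup>2 / 2)"

definition laguerre_fun :: "real ^ 'n \<Rightarrow> nat ^ 'n \<Rightarrow> real ^ 'n \<Rightarrow> real" where
  "laguerre_fun \<alpha> k x = (\<Prod>i\<in>UNIV. laguerre_fun1 (k $ i) (\<alpha> $ i) (x $ i))"

definition laguerre_eigenvalue :: "real ^ 'n \<Rightarrow> nat ^ 'n \<Rightarrow> real" where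
  "laguerre_eigenvalue \<alpha> k =
     4 * (\<Sum>i\<in>UNIV. real (k $ i)) + 2 * (\<Sum>i\<in>UNIV. \<alpha> $ i) + 2 * real CARD('n)"

definition laguerre_lin :: "real ^ 'n \<Rightarrow> (real ^ 'n \<Rightarrow> real) set" where
  "laguerre_lin \<alpha> = {\<lambda>x. \<Sum>k\<in>F. c k * laguerre_fun \<alpha> k x | F c. finite F}"

definition partial_deriv :: "'n \<Rightarrow> (real ^ 'n \<Rightarrow> real) \<Rightarrow> real ^ 'n \<Rightarrow> real" where
  "partial_deriv i f x = deriv (\<lambda>t. f (x + t *\<^sub>R axis i 1)) 0"

definition delta :: "'n \<Rightarrow> (real ^ 'n \<Rightarrow> real) \<Rightarrow> real ^ 'n \<Rightarrow> real" where
  "delta i f x = partial_deriv i f x + x $ i * f x"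

definition riesz_term :: "real ^ 'n \<Rightarrow> 'n \<Rightarrow> (real ^ 'n \<Rightarrow> real) \<Rightarrow> nat ^ 'n \<Rightarrow> real ^ 'n \<Rightarrow> real" where
  "riesz_term \<alpha> i f k x =
     laguerre_eigenvalue \<alpha> k powr (- 1 / 2)
       * (\<integral>y. f y * laguerre_fun \<alpha> k y \<partial>laguerre_measure \<alpha>)
       * delta i (laguerre_fun \<alpha> k) x"

text \<open>
  \<open>is_riesz \<alpha> i f g\<close> says that \<open>g\<close> represents the \<open>i\<close>-th Riesz transform of \<open>f \<in> L\<^sup>2\<close>:
  the defining series over all multi-indices converges (unconditionally) to \<open>g\<close> in \<open>L\<^sup>2\<close>.
  This determines \<open>g\<close> almost everywhere.
\<close>

definition is_riesz ::
    "real ^ 'n \<Rightarrow> 'n \<Rightarrow> (real ^ 'n \<Rightarrow> real) \<Rightarrow> (real ^ 'n \<Rightarrow> real) \<Rightarrow> bool" where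
  "is_riesz \<alpha> i f g \<longleftrightarrow>
     in_Lp (laguerre_measure \<alpha>) 2 f \<and> in_Lp (laguerre_measure \<alpha>) 2 g \<and>
     ((\<lambda>F. Lp_norm (laguerre_measure \<alpha>) 2 (\<lambda>x. g x - (\<Sum>k\<in>F. riesz_term \<alpha> i f k x)))
        \<longlongrightarrow> 0) (finite_subsets_at_top UNIV)"

definition is_riesz_vector ::
    "real ^ 'n \<Rightarrow> (real ^ 'n \<Rightarrow> real) \<Rightarrow> (real ^ 'n \<Rightarrow> real ^ 'n) \<Rightarrow> bool" where
  "is_riesz_vector \<alpha> f g \<longleftrightarrow> (\<forall>i. is_riesz \<alpha> i f (\<lambda>x. g x $ i))"

text \<open>
  Continuity forces \<open>T\<close> to respect equality almost everywhere.  Linearity is not required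
  separately: it passes from \<open>laguerre_lin \<alpha>\<close> to \<open>L\<^sup>p\<close> by density and continuity.
\<close>

definition riesz_continuous_extension ::
    "real ^ 'n \<Rightarrow> real \<Rightarrow> ((real ^ 'n \<Rightarrow> real) \<Rightarrow> (real ^ 'n \<Rightarrow> real ^ 'n)) \<Rightarrow> bool" where
  "riesz_continuous_extension \<alpha> p T \<longleftrightarrow>
     (\<forall>f. in_Lp (laguerre_measure \<alpha>) p f \<longrightarrow> in_Lp (laguerre_measure \<alpha>) p (T f)) \<and>
     (\<forall>f. in_Lp (laguerre_measure \<alpha>) p f \<longrightarrow>
        (\<forall>\<epsilon>>0. \<exists>\<eta>>0. \<forall>g. in_Lp (laguerre_measure \<alpha>) p g \<longrightarrow>
           Lp_norm (laguerre_measure \<alpha>) p (\<lambda>x. g x - f x) < \<eta> \<longrightarrow>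
           Lp_norm (laguerre_measure \<alpha>) p (\<lambda>x. T g x - T f x) < \<epsilon>)) \<and>
     (\<forall>f\<in>laguerre_lin \<alpha>. is_riesz_vector \<alpha> f (T f))"

end

theory Submission imports Defs begin

text \<open>
  For \<open>f\<close> in the span of the Laguerre functions and \<open>g\<close> in the span of their images under the \<open>\<delta>\<^sub>j\<close>, let
  \<open>u(x,t)\<close> and \<open>v(x,t)\<close> be the Poisson extensions of \<open>f\<close> and \<open>g\<close>, the latter with respect to the operators
  \<open>L + [\<delta>\<^sub>j, \<delta>\<^sub>j\<^sup>*]\<close>.  Composing them with a Bellman function \<open>B\<close> (a smooth variant of the Nazarov-Treil function,
  with \<open>p\<^sup>* \<ge> 2\<close> as the exponent of its first argument) gives \<open>\<Phi>(t) = \<integral> B(u,v) d\<mu>\<close>.  The spatial part of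
  \<open>L\<close> integrates to zero, and \<open>\<alpha> \<ge> -1/2\<close> makes all potentials nonnegative, so the convexity of \<open>B\<close> gives
  \<open>\<Phi>'' \<ge> \<kappa> |W''|\<close>, where \<open>W'' = \<integral> \<Sum>\<^sub>j \<delta>\<^sub>j u \<partial>\<^sub>t v\<^sub>j d\<mu>\<close>.  By orthogonality \<open>W\<close> is an explicit sum of
  exponentials with \<open>W(0) = -\<langle>Rf, g\<rangle> / 4\<close>.  A bounded convex function on the half-line decreases, so
  \<open>\<kappa> |W(0)| \<le> \<Phi>(0)\<close>, a bilinear estimate with \<open>\<kappa> = (q - 1) / 8\<close> for the exponent \<open>q\<close> conjugate to \<open>p\<^sup>*\<close>.
  Duality and the density of both spans in the Lebesgue spaces give the bound (with 40 in place of 48).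
\<close>


section \<open>Lebesgue spaces\<close>

text \<open>The j-th coordinate of g is expanded in the functions delta_j l_k because they are
  eigenfunctions of the enlarged operator for the same eigenvalue as l_k. Both Poisson extensions
  then decay at equal rates, and pairing delta_j u with the time derivative of v_j is diagonal.
  Three obstacles shape the proof. Bellman functions of this kind are singular where an argument
  vanishes, so the squared radii are shifted by e > 0; as the measure is infinite, B(e,e) must be
  subtracted, and the limit e -> 0 needs an integrable bound that is uniform in e. The drift (2
  \<alpha>_i + 1) / x_i is singular at the faces of the orthant; parity helps, for the product of a
  component with its i-th derivative always contains a factor x_i. Finally B is not symmetric: its
  first argument carries the exponent that is at least 2, so for p < 2 the functions f and g
  exchange places, which the index sets I and J record.\<close>

lemma Lp_norm_nonneg [simp]: "Lp_norm M p f \<ge> 0"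
  by (simp add: Lp_norm_def)

lemma Lp_norm_powr: "p > 0 \<Longrightarrow> Lp_norm M p f powr p = (\<integral>x. norm (f x) powr p \<partial>M)"
  by (simp add: Lp_norm_def powr_powr)

lemma Lp_norm_le_iff:
  assumes "p > 0" "C \<ge> 0"
  shows "Lp_norm M p f \<le> C \<longleftrightarrow> (\<integral>x. norm (f x) powr p \<partial>M) \<le> C powr p"
  using assms by (metis Lp_norm_nonneg Lp_norm_powr powr_mono2 less_le not_le powr_less_mono2)

lemma Lp_cong_AE:
  assumes "AE x in M. f x = g x" "f \<in> borel_measurable M" "g \<in> borel_measurable M"
  shows "Lp_norm M p f = Lp_norm M p g" "in_Lp M p f \<longleftrightarrow> in_Lp M p g"
proof -
  have *: "AE x in M. norm (f x) powr p = norm (g x) powr p"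
    using assms(1) by eventually_elim simp
  show "Lp_norm M p f = Lp_norm M p g"
    unfolding Lp_norm_def using assms * by (intro arg_cong2[where f="(powr)"] integral_cong_AE) auto
  show "in_Lp M p f \<longleftrightarrow> in_Lp M p g"
    unfolding in_Lp_def using assms * by (simp add: integrable_cong_AE)
qed

lemma Lp_norm_cong:
  assumes "\<And>x. x \<in> space M \<Longrightarrow> norm (f x) = norm (g x)"
  shows "Lp_norm M p f = Lp_norm M p g"
  unfolding Lp_norm_def using assms by (simp cong: Bochner_Integration.integral_cong)

lemma in_Lp_cong:
  assumes "\<And>x. x \<in> space M \<Longrightarrow> f x = g x"
  shows "in_Lp M p f \<longleftrightarrow> in_Lp M p g"
  unfolding in_Lp_def using assms
  by (simp cong: measurable_cong Bochner_Integration.integrable_cong)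

lemma Lp_norm_eq_0_iff:
  assumes "p > 0" "in_Lp M p f"
  shows "Lp_norm M p f = 0 \<longleftrightarrow> (AE x in M. f x = 0)"
proof -
  have "Lp_norm M p f = 0 \<longleftrightarrow> (\<integral>x. norm (f x) powr p \<partial>M) = 0"
    using assms by (simp add: Lp_norm_def)
  also have "\<dots> \<longleftrightarrow> (AE x in M. norm (f x) powr p = 0)"
    using assms by (intro integral_nonneg_eq_0_iff_AE) (auto simp: in_Lp_def)
  finally show ?thesis by simp
qed

lemma in_Lp_zero [simp]: "in_Lp M p (\<lambda>x. 0)"
  by (simp add: in_Lp_def)

lemma Lp_norm_zero [simp]: "Lp_norm M p (\<lambda>x. 0) = 0"
  by (simp add: Lp_norm_def)

lemma in_Lp_scaleR:
  assumes "in_Lp M p f"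
  shows "in_Lp M p (\<lambda>x. c *\<^sub>R f x)"
  using assms by (auto simp: in_Lp_def powr_mult)

lemma Lp_norm_scaleR:
  assumes "p > 0"
  shows "Lp_norm M p (\<lambda>x. c *\<^sub>R f x) = \<bar>c\<bar> * Lp_norm M p f"
  using assms by (simp add: Lp_norm_def powr_mult powr_powr)

lemma in_Lp_bound:
  assumes "in_Lp M p f" "g \<in> borel_measurable M" "p > 0"
    and "AE x in M. norm (g x) \<le> C * norm (f x)"
  shows "in_Lp M p g"
  unfolding in_Lp_def
proof (rule conjI[OF assms(2) Bochner_Integration.integrable_bound])
  show "integrable M (\<lambda>x. \<bar>C\<bar> powr p * norm (f x) powr p)"
    using assms by (auto simp: in_Lp_def)
  show "AE x in M. norm (norm (g x) powr p) \<le> norm (\<bar>C\<bar> powr p * norm (f x) powr p)"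
    using assms(4)
  proof eventually_elim
    case (elim x)
    have "norm (g x) \<le> \<bar>C\<bar> * norm (f x)"
      using elim by (meson abs_ge_self mult_right_mono norm_ge_zero order_trans)
    then have "norm (g x) powr p \<le> (\<bar>C\<bar> * norm (f x)) powr p"
      using assms by (intro powr_mono2) auto
    then show ?case by (simp add: powr_mult)
  qed
qed (use assms in measurable)

lemma in_Lp_add:
  assumes "in_Lp M p f" "in_Lp M p g" "p > 0"
  shows "in_Lp M p (\<lambda>x. f x + g x)"
  unfolding in_Lp_def
proof (rule conjI[OF _ Bochner_Integration.integrable_bound])
  have [measurable]: "f \<in> borel_measurable M" "g \<in> borel_measurable M"
    using assms by (auto simp: in_Lp_def)
  show "(\<lambda>x. f x + g x) \<in> borel_measurable M" by measurable
  show "(\<lambda>x. norm (f x + g x) powr p) \<in> borel_measurable M" by measurable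
  show "integrable M (\<lambda>x. 2 powr p * (norm (f x) powr p + norm (g x) powr p))"
    using assms by (auto simp: in_Lp_def)
  show "AE x in M. norm (norm (f x + g x) powr p) \<le> norm (2 powr p * (norm (f x) powr p + norm (g x) powr p))"
  proof (rule AE_I2)
    fix x
    have "norm (f x + g x) \<le> 2 * max (norm (f x)) (norm (g x))"
      using norm_triangle_ineq[of "f x" "g x"] by linarith
    then have "norm (f x + g x) powr p \<le> (2 * max (norm (f x)) (norm (g x))) powr p"
      using assms by (intro powr_mono2) auto
    also have "\<dots> = 2 powr p * max (norm (f x)) (norm (g x)) powr p"
      by (simp add: powr_mult)
    also have "\<dots> \<le> 2 powr p * (norm (f x) powr p + norm (g x) powr p)"
      by (intro mult_left_mono) (auto simp: max_def)
    finally show "norm (norm (f x + g x) powr p) \<le> norm (2 powr p * (norm (f x) powr p + norm (g x) powr p))"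
      by simp
  qed
qed

lemma in_Lp_diff:
  assumes "in_Lp M p f" "in_Lp M p g" "p > 0"
  shows "in_Lp M p (\<lambda>x. f x - g x)"
  using in_Lp_add[OF assms(1) in_Lp_scaleR[OF assms(2), of "-1"] assms(3)] by simp

lemma in_Lp_sum:
  assumes "\<And>i. i \<in> I \<Longrightarrow> in_Lp M p (f i)" "p > 0"
  shows "in_Lp M p (\<lambda>x. \<Sum>i\<in>I. f i x)"
  using assms by (induction I rule: infinite_finite_induct) (auto intro: in_Lp_add)

lemma Lp_norm_minus_commute: "Lp_norm M p (\<lambda>x. f x - g x) = Lp_norm M p (\<lambda>x. g x - f x)"
  by (simp add: Lp_norm_def norm_minus_commute)

lemma Hoelder:
  fixes f :: "'a \<Rightarrow> real" and g :: "'a \<Rightarrow> real"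
  assumes p: "p > 1" "q > 1" "1 / p + 1 / q = 1"
    and f: "in_Lp M p f" and g: "in_Lp M q g"
  shows "integrable M (\<lambda>x. \<bar>f x * g x\<bar>)" (is ?A)
    and "(\<integral>x. \<bar>f x * g x\<bar> \<partial>M) \<le> Lp_norm M p f * Lp_norm M q g" (is ?B)
proof -
  have [measurable]: "f \<in> borel_measurable M" "g \<in> borel_measurable M"
    using assms by (auto simp: in_Lp_def)
  have fi: "integrable M (\<lambda>x. \<bar>f x\<bar> powr p)" and gi: "integrable M (\<lambda>x. \<bar>g x\<bar> powr q)"
    using f g by (auto simp: in_Lp_def)
  have Y: "\<bar>f x * g x\<bar> \<le> \<bar>f x\<bar> powr p / p + \<bar>g x\<bar> powr q / q" for x
    using Youngs_inequality[OF p, of "\<bar>f x\<bar>" "\<bar>g x\<bar>"] by (simp add: abs_mult)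
  show A: ?A
  proof (rule Bochner_Integration.integrable_bound)
    show "integrable M (\<lambda>x. \<bar>f x\<bar> powr p / p + \<bar>g x\<bar> powr q / q)"
      using fi gi by auto
    show "AE x in M. norm \<bar>f x * g x\<bar> \<le> norm (\<bar>f x\<bar> powr p / p + \<bar>g x\<bar> powr q / q)"
      using Y by (intro AE_I2) (smt (verit) real_norm_def)
  qed measurable
  define a b where "a = Lp_norm M p f" and "b = Lp_norm M q g"
  have ab: "a \<ge> 0" "b \<ge> 0" by (auto simp: a_def b_def)
  show ?B
  proof (cases "a = 0 \<or> b = 0")
    case True
    then have "AE x in M. \<bar>f x * g x\<bar> = 0"
      using Lp_norm_eq_0_iff[OF _ f] Lp_norm_eq_0_iff[OF _ g] p unfolding a_def b_def by auto
    then have "(\<integral>x. \<bar>f x * g x\<bar> \<partial>M) = 0"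
      by (intro integral_eq_zero_AE) auto
    then show ?thesis using ab unfolding a_def b_def by simp
  next
    case False
    then have ab: "a > 0" "b > 0" using ab by auto
    have "(\<integral>x. \<bar>f x * g x\<bar> / (a * b) \<partial>M) \<le> (\<integral>x. \<bar>f x\<bar> powr p / (p * a powr p) + \<bar>g x\<bar> powr q / (q * b powr q) \<partial>M)"
    proof (rule integral_mono)
      fix x
      show "\<bar>f x * g x\<bar> / (a * b) \<le> \<bar>f x\<bar> powr p / (p * a powr p) + \<bar>g x\<bar> powr q / (q * b powr q)"
        using Youngs_inequality[OF p, of "\<bar>f x\<bar> / a" "\<bar>g x\<bar> / b"] ab
        by (simp add: abs_mult powr_divide mult_ac)
    qed (use A fi gi in auto)
    also have "\<dots> = a powr p / (p * a powr p) + b powr q / (q * b powr q)"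
      using p fi gi unfolding a_def b_def by (simp add: Lp_norm_powr)
    also have "\<dots> = 1" using p ab by (simp add: field_simps)
    finally show ?thesis using ab unfolding a_def[symmetric] b_def[symmetric] by (simp add: field_simps)
  qed
qed

lemma Hoelder_inner:
  fixes f g :: "'a \<Rightarrow> 'b::euclidean_space"
  assumes p: "p > 1" "q > 1" "1 / p + 1 / q = 1"
    and f: "in_Lp M p f" and g: "in_Lp M q g"
  shows "integrable M (\<lambda>x. f x \<bullet> g x)"
    and "\<bar>\<integral>x. f x \<bullet> g x \<partial>M\<bar> \<le> Lp_norm M p f * Lp_norm M q g"
proof -
  have [measurable]: "f \<in> borel_measurable M" "g \<in> borel_measurable M"
    using assms by (auto simp: in_Lp_def)
  have f': "in_Lp M p (\<lambda>x. norm (f x))" and g': "in_Lp M q (\<lambda>x. norm (g x))"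
    using f g by (auto simp: in_Lp_def)
  note H = Hoelder[OF p f' g']
  have le: "\<bar>f x \<bullet> g x\<bar> \<le> \<bar>norm (f x) * norm (g x)\<bar>" for x
    using Cauchy_Schwarz_ineq2[of "f x" "g x"] by simp
  show i: "integrable M (\<lambda>x. f x \<bullet> g x)"
    by (rule Bochner_Integration.integrable_bound[OF H(1)]) (use le in auto)
  have "\<bar>\<integral>x. f x \<bullet> g x \<partial>M\<bar> \<le> (\<integral>x. \<bar>f x \<bullet> g x\<bar> \<partial>M)"
    using integral_abs_bound by blast
  also have "\<dots> \<le> (\<integral>x. \<bar>norm (f x) * norm (g x)\<bar> \<partial>M)"
    using le H(1) i by (intro integral_mono) auto
  also have "\<dots> \<le> Lp_norm M p f * Lp_norm M q g"
    using H(2) by (simp add: Lp_norm_def)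
  finally show "\<bar>\<integral>x. f x \<bullet> g x \<partial>M\<bar> \<le> Lp_norm M p f * Lp_norm M q g" .
qed

lemma conjugate_exponent:
  fixes p :: real
  assumes "p > 1"
  defines "q \<equiv> p / (p - 1)"
  shows "q > 1" "1 / p + 1 / q = 1" "(p - 1) * q = p" "p / q = p - 1" "(q - 1) * (p - 1) = 1" "(q - 1) * p = q"
  using assms by (auto simp: field_simps)

lemma Minkowski:
  fixes f g :: "'a \<Rightarrow> 'b::euclidean_space"
  assumes p: "p > 1" and f: "in_Lp M p f" and g: "in_Lp M p g"
  shows "Lp_norm M p (\<lambda>x. f x + g x) \<le> Lp_norm M p f + Lp_norm M p g"
proof -
  define q where "q = p / (p - 1)"
  note q = conjugate_exponent[OF p, folded q_def]
  have fg: "in_Lp M p (\<lambda>x. f x + g x)" using f g p by (intro in_Lp_add) auto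
  have [measurable]: "f \<in> borel_measurable M" "g \<in> borel_measurable M"
    using assms by (auto simp: in_Lp_def)
  define S where "S = Lp_norm M p (\<lambda>x. f x + g x)"
  have S0: "S \<ge> 0" by (simp add: S_def)
  define h where "h x = norm (f x + g x) powr (p - 1)" for x
  have [measurable]: "h \<in> borel_measurable M" by (simp add: h_def[abs_def])
  have hp: "norm (h x) powr q = norm (f x + g x) powr p" for x
    using q by (simp add: h_def powr_powr)
  have h: "in_Lp M q h"
    using fg unfolding in_Lp_def hp by auto
  have nh: "Lp_norm M q h = S powr (p - 1)"
    unfolding S_def Lp_norm_def hp using p by (simp add: powr_powr q_def)
  have f': "in_Lp M p (\<lambda>x. norm (f x))" and g': "in_Lp M p (\<lambda>x. norm (g x))"
    using f g by (auto simp: in_Lp_def)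
  have nf: "Lp_norm M p (\<lambda>x. norm (f x)) = Lp_norm M p f" "Lp_norm M p (\<lambda>x. norm (g x)) = Lp_norm M p g"
    by (auto simp: Lp_norm_def)
  note Hf = Hoelder[OF p q(1,2) f' h, unfolded nf nh] and Hg = Hoelder[OF p q(1,2) g' h, unfolded nf nh]
  have "S powr p = (\<integral>x. norm (f x + g x) powr p \<partial>M)"
    using p by (simp add: S_def Lp_norm_powr)
  also have "\<dots> \<le> (\<integral>x. \<bar>norm (f x) * h x\<bar> + \<bar>norm (g x) * h x\<bar> \<partial>M)"
  proof (rule integral_mono)
    fix x
    have "norm (f x + g x) powr p = norm (f x + g x) * h x"
      using p powr_add[of "norm (f x + g x)" 1 "p - 1"] by (simp add: h_def)
    also have "\<dots> \<le> (norm (f x) + norm (g x)) * h x"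
      by (intro mult_right_mono norm_triangle_ineq) (simp add: h_def)
    finally show "norm (f x + g x) powr p \<le> \<bar>norm (f x) * h x\<bar> + \<bar>norm (g x) * h x\<bar>"
      by (simp add: abs_mult distrib_right h_def)
  qed (use fg Hf Hg in \<open>auto simp: in_Lp_def\<close>)
  also have "\<dots> = (\<integral>x. \<bar>norm (f x) * h x\<bar> \<partial>M) + (\<integral>x. \<bar>norm (g x) * h x\<bar> \<partial>M)"
    by (intro Bochner_Integration.integral_add Hf Hg)
  also have "\<dots> \<le> (Lp_norm M p f + Lp_norm M p g) * S powr (p - 1)"
    using Hf(2) Hg(2) by (simp add: distrib_right)
  finally have *: "S powr p \<le> (Lp_norm M p f + Lp_norm M p g) * S powr (p - 1)" .
  show ?thesis
  proof (cases "S = 0")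
    case False
    then have "S > 0" using S0 by simp
    have "S powr p = S * S powr (p - 1)"
      using p powr_add[of S 1 "p - 1"] \<open>S > 0\<close> by simp
    then have "S * S powr (p - 1) \<le> (Lp_norm M p f + Lp_norm M p g) * S powr (p - 1)" using * by simp
    then show ?thesis using \<open>S > 0\<close> unfolding S_def[symmetric] by (simp add: mult_le_cancel_right)
  qed (use S_def in simp)
qed

lemma Minkowski_diff:
  fixes f g :: "'a \<Rightarrow> 'b::euclidean_space"
  assumes "p > 1" "in_Lp M p f" "in_Lp M p g" "in_Lp M p h"
  shows "Lp_norm M p (\<lambda>x. f x - h x) \<le> Lp_norm M p (\<lambda>x. f x - g x) + Lp_norm M p (\<lambda>x. g x - h x)"
  using Minkowski[of p M "\<lambda>x. f x - g x" "\<lambda>x. g x - h x"] assms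
  by (simp add: in_Lp_diff)

lemma Lp_norm_le_add_diff:
  fixes f g :: "'a \<Rightarrow> 'b::euclidean_space"
  assumes "p > 1" "in_Lp M p f" "in_Lp M p g"
  shows "Lp_norm M p f \<le> Lp_norm M p (\<lambda>x. f x - g x) + Lp_norm M p g"
  using Minkowski[of p M "\<lambda>x. f x - g x" g] assms by (simp add: in_Lp_diff)

lemma Minkowski_sum:
  fixes f :: "'i \<Rightarrow> 'a \<Rightarrow> 'b::euclidean_space"
  assumes "p > 1" "\<And>i. i \<in> I \<Longrightarrow> in_Lp M p (f i)"
  shows "Lp_norm M p (\<lambda>x. \<Sum>i\<in>I. f i x) \<le> (\<Sum>i\<in>I. Lp_norm M p (f i))"
  using assms(2)
proof (induction I rule: infinite_finite_induct)
  case (insert a I)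
  have "in_Lp M p (\<lambda>x. \<Sum>i\<in>I. f i x)" using insert assms(1) by (intro in_Lp_sum) auto
  then have "Lp_norm M p (\<lambda>x. f a x + (\<Sum>i\<in>I. f i x)) \<le> Lp_norm M p (f a) + Lp_norm M p (\<lambda>x. \<Sum>i\<in>I. f i x)"
    using insert assms(1) by (intro Minkowski) auto
  then show ?case using insert by fastforce
qed simp_all

section \<open>Convergence, completeness and duality in L^p\<close>

lemma Lp_dominated_convergence:
  fixes f :: "'a \<Rightarrow> 'b::euclidean_space"
  assumes p: "p > 0" and D: "in_Lp M p D"
    and f: "f \<in> borel_measurable M" and fn: "\<And>n. fn n \<in> borel_measurable M"
    and lim: "\<And>x. x \<in> space M \<Longrightarrow> (\<lambda>n. fn n x) \<longlonglongrightarrow> f x"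
    and dom: "\<And>n x. x \<in> space M \<Longrightarrow> norm (fn n x) \<le> norm (D x)"
  shows "in_Lp M p f" "\<And>n. in_Lp M p (fn n)" "(\<lambda>n. Lp_norm M p (\<lambda>x. fn n x - f x)) \<longlonglongrightarrow> 0"
proof -
  note [measurable] = f fn
  have domf: "norm (f x) \<le> norm (D x)" if "x \<in> space M" for x
    using lim[OF that] dom[OF that] by (intro LIMSEQ_le_const2[OF tendsto_norm]) auto
  show "in_Lp M p f" "\<And>n. in_Lp M p (fn n)"
    by (rule in_Lp_bound[OF D _ p, of _ 1]; use dom domf in auto)+
  have "(\<lambda>n. \<integral>x. norm (fn n x - f x) powr p \<partial>M) \<longlonglongrightarrow> (\<integral>x. 0 \<partial>M)"
  proof (rule integral_dominated_convergence[where w="\<lambda>x. 2 powr p * norm (D x) powr p"])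
    show "integrable M (\<lambda>x. 2 powr p * norm (D x) powr p)" using D by (auto simp: in_Lp_def)
    show "AE x in M. (\<lambda>n. norm (fn n x - f x) powr p) \<longlonglongrightarrow> 0"
    proof (rule AE_I2)
      fix x assume "x \<in> space M"
      from lim[OF this] have "(\<lambda>n. norm (fn n x - f x)) \<longlonglongrightarrow> 0"
        by (simp add: LIM_zero tendsto_norm_zero)
      from tendsto_powr'[OF this tendsto_const[of p]] show "(\<lambda>n. norm (fn n x - f x) powr p) \<longlonglongrightarrow> 0" using p by simp
    qed
    show "AE x in M. norm (norm (fn n x - f x) powr p) \<le> 2 powr p * norm (D x) powr p" for n
    proof (rule AE_I2)
      fix x assume x: "x \<in> space M"
      have "norm (fn n x - f x) \<le> 2 * norm (D x)"
        using dom[OF x, of n] domf[OF x] norm_triangle_ineq4[of "fn n x" "f x"] by linarith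
      then have "norm (fn n x - f x) powr p \<le> (2 * norm (D x)) powr p"
        using p by (intro powr_mono2) auto
      then show "norm (norm (fn n x - f x) powr p) \<le> 2 powr p * norm (D x) powr p"
        by (simp add: powr_mult)
    qed
  qed measurable
  then have *: "(\<lambda>n. \<integral>x. norm (fn n x - f x) powr p \<partial>M) \<longlonglongrightarrow> 0" by simp
  from tendsto_powr'[OF * tendsto_const[of "1 / p"]] p
  show "(\<lambda>n. Lp_norm M p (\<lambda>x. fn n x - f x)) \<longlonglongrightarrow> 0" by (simp add: Lp_norm_def)
qed

lemma nn_integral_Lp:
  assumes "in_Lp M p f" "p > 0"
  shows "(\<integral>\<^sup>+x. ennreal (norm (f x) powr p) \<partial>M) = ennreal (Lp_norm M p f powr p)"
  using assms by (subst nn_integral_eq_integral) (auto simp: in_Lp_def Lp_norm_powr)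

lemma Lp_Fatou:
  fixes f :: "'a \<Rightarrow> 'b::euclidean_space"
  assumes p: "p > 0" and f: "f \<in> borel_measurable M" and fn: "\<And>n. in_Lp M p (fn n)"
    and lim: "AE x in M. (\<lambda>n. fn n x) \<longlonglongrightarrow> f x"
    and bd: "\<And>n. Lp_norm M p (fn n) \<le> C"
  shows "in_Lp M p f" "Lp_norm M p f \<le> C"
proof -
  have [measurable]: "f \<in> borel_measurable M" "\<And>n. fn n \<in> borel_measurable M"
    using f fn by (auto simp: in_Lp_def)
  have C: "C \<ge> 0" using bd[of 0] Lp_norm_nonneg order_trans by blast
  have "(\<integral>\<^sup>+x. ennreal (norm (f x) powr p) \<partial>M) = (\<integral>\<^sup>+x. liminf (\<lambda>n. ennreal (norm (fn n x) powr p)) \<partial>M)"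
  proof (rule nn_integral_cong_AE)
    show "AE x in M. ennreal (norm (f x) powr p) = liminf (\<lambda>n. ennreal (norm (fn n x) powr p))"
      using lim
    proof eventually_elim
      case (elim x)
      have "(\<lambda>n. norm (fn n x) powr p) \<longlonglongrightarrow> norm (f x) powr p"
        using tendsto_powr'[OF tendsto_norm[OF elim] tendsto_const[of p]] p by simp
      then have "(\<lambda>n. ennreal (norm (fn n x) powr p)) \<longlonglongrightarrow> ennreal (norm (f x) powr p)"
        by (rule tendsto_ennrealI)
      then show ?case by (intro lim_imp_Liminf[symmetric] trivial_limit_sequentially)
    qed
  qed
  also have "\<dots> \<le> liminf (\<lambda>n. \<integral>\<^sup>+x. ennreal (norm (fn n x) powr p) \<partial>M)"
    by (rule nn_integral_liminf) measurable
  also have "\<dots> = liminf (\<lambda>n. ennreal (Lp_norm M p (fn n) powr p))"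
    using nn_integral_Lp[OF fn p] by simp
  also have "\<dots> \<le> liminf (\<lambda>n::nat. ennreal (C powr p))"
    using bd p by (intro Liminf_mono always_eventually allI) (auto intro!: ennreal_leI powr_mono2)
  also have "\<dots> = ennreal (C powr p)" by (simp add: Liminf_const)
  finally have *: "(\<integral>\<^sup>+x. ennreal (norm (f x) powr p) \<partial>M) \<le> ennreal (C powr p)" .
  then have "integrable M (\<lambda>x. norm (f x) powr p)"
    by (intro integrableI_bounded) (auto simp: le_less_trans[OF _ ennreal_less_top])
  then show f: "in_Lp M p f" by (simp add: in_Lp_def)
  show "Lp_norm M p f \<le> C"
    using * nn_integral_Lp[OF f p] p C by (simp add: Lp_norm_le_iff Lp_norm_powr)
qed

text \<open>Sequences with geometrically small increments are enough for the extension by density.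
  Minkowski and monotone convergence put the sum of the norms of the increments in L^p, so the
  telescoping series converges almost everywhere; Fatou then bounds the distance to the
  limit.\<close>

lemma Lp_complete:
  fixes fn :: "nat \<Rightarrow> 'a \<Rightarrow> 'b::euclidean_space"
  assumes p: "p > 1" and fn: "\<And>n. in_Lp M p (fn n)"
    and cau: "\<And>n. Lp_norm M p (\<lambda>x. fn (Suc n) x - fn n x) \<le> (1/2) ^ n"
  obtains f where "in_Lp M p f" "\<And>n. Lp_norm M p (\<lambda>x. fn n x - f x) \<le> 2 * (1/2) ^ n"
proof -
  have [measurable]: "\<And>n. fn n \<in> borel_measurable M" using fn by (auto simp: in_Lp_def)
  define d where "d n x = norm (fn (Suc n) x - fn n x)" for n x
  have [measurable]: "d n \<in> borel_measurable M" for n by (simp add: d_def[abs_def])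
  have dL: "in_Lp M p (d n)" for n
    using in_Lp_diff[OF fn[of "Suc n"] fn[of n]] p by (auto simp: in_Lp_def d_def)
  have dn: "Lp_norm M p (d n) \<le> (1/2) ^ n" for n
    using cau[of n] by (simp add: d_def Lp_norm_def)
  have geo: "(\<Sum>i<n. (1/2::real) ^ i) \<le> 2" for n
    using sum_gp_strict[of "1/2::real" n] by simp
  have SL: "Lp_norm M p (\<lambda>x. \<Sum>i<n. d i x) \<le> 2" for n
    using Minkowski_sum[of p "{..<n}" M d, OF p dL] sum_mono[of "{..<n}" "\<lambda>i. Lp_norm M p (d i)" "\<lambda>i. (1/2) ^ i"] dn geo[of n]
    by fastforce
  have SI: "in_Lp M p (\<lambda>x. \<Sum>i<n. d i x)" for n
    using p by (intro in_Lp_sum dL) auto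
  have d0: "d n x \<ge> 0" for n x by (simp add: d_def)
  \<comment> \<open>Extended-valued, because the series of increments is not yet known to converge
    anywhere; finiteness of its integral makes it finite almost everywhere.\<close>
  define s where "s x = (SUP n. ennreal ((\<Sum>i<n. d i x) powr p))" for x
  have [measurable]: "s \<in> borel_measurable M" unfolding s_def[abs_def] by measurable
  have "(\<integral>\<^sup>+x. s x \<partial>M) = (SUP n. \<integral>\<^sup>+x. ennreal ((\<Sum>i<n. d i x) powr p) \<partial>M)"
    unfolding s_def
  proof (rule nn_integral_monotone_convergence_SUP)
    show "incseq (\<lambda>n x. ennreal ((\<Sum>i<n. d i x) powr p))"
      unfolding incseq_def le_fun_def using p d0
      by (auto intro!: ennreal_leI powr_mono2 sum_nonneg sum_mono2)
  qed measurable
  also have "\<dots> \<le> ennreal (2 powr p)"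
  proof (rule SUP_least)
    fix n
    have "(\<integral>\<^sup>+x. ennreal ((\<Sum>i<n. d i x) powr p) \<partial>M) = ennreal (Lp_norm M p (\<lambda>x. \<Sum>i<n. d i x) powr p)"
      using nn_integral_Lp[OF SI[of n]] p by (simp add: sum_nonneg d0)
    also have "\<dots> \<le> ennreal (2 powr p)"
      using SL[of n] p by (intro ennreal_leI powr_mono2) auto
    finally show "(\<integral>\<^sup>+x. ennreal ((\<Sum>i<n. d i x) powr p) \<partial>M) \<le> ennreal (2 powr p)" .
  qed
  finally have "(\<integral>\<^sup>+x. s x \<partial>M) \<noteq> \<infinity>" by (auto simp: top_unique)
  then have "AE x in M. s x \<noteq> \<infinity>" by (intro nn_integral_PInf_AE) auto
  then have conv: "AE x in M. convergent (\<lambda>n. fn n x)"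
  proof eventually_elim
    case (elim x)
    then obtain r where r: "s x = ennreal r" "r \<ge> 0" by (cases "s x") auto
    have "(\<Sum>i<n. d i x) \<le> r powr (1 / p)" for n
    proof -
      have "ennreal ((\<Sum>i<n. d i x) powr p) \<le> s x" unfolding s_def by (rule SUP_upper) simp
      then have "(\<Sum>i<n. d i x) powr p \<le> r" using r by simp
      then have "((\<Sum>i<n. d i x) powr p) powr (1 / p) \<le> r powr (1 / p)"
        using p by (intro powr_mono2) auto
      then show ?thesis using p d0 by (simp add: powr_powr sum_nonneg)
    qed
    then have "(\<Sum>i\<le>n. d i x) \<le> r powr (1 / p)" for n
      unfolding lessThan_Suc_atMost[symmetric] by blast
    then have "summable (\<lambda>i. d i x)"
      using d0 by (intro bounded_imp_summable[where B="r powr (1/p)"])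
    then have "summable (\<lambda>i. fn (Suc i) x - fn i x)" unfolding d_def by (rule summable_norm_cancel)
    then have "convergent (\<lambda>n. \<Sum>i<n. fn (Suc i) x - fn i x)" by (simp add: summable_iff_convergent)
    then have "convergent (\<lambda>n. fn n x - fn 0 x)" by (subst (asm) sum_lessThan_telescope)
    then have "convergent (\<lambda>n. (fn n x - fn 0 x) + fn 0 x)" by (intro convergent_add convergent_const)
    then show ?case by simp
  qed
  define f where "f x = lim (\<lambda>n. fn n x)" for x
  have [measurable]: "f \<in> borel_measurable M"
    unfolding f_def[abs_def] by (rule borel_measurable_lim_metric) measurable
  have fl: "AE x in M. (\<lambda>n. fn n x) \<longlonglongrightarrow> f x"
    using conv by eventually_elim (simp add: f_def convergent_LIMSEQ_iff)
  have *: "Lp_norm M p (\<lambda>x. fn (m + n) x - fn n x) \<le> (\<Sum>i<m. (1/2) ^ (i + n))" for m n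
  proof (induction m)
    case (Suc m)
    have "Lp_norm M p (\<lambda>x. fn (Suc (m + n)) x - fn n x) \<le> Lp_norm M p (\<lambda>x. fn (Suc (m + n)) x - fn (m + n) x) + Lp_norm M p (\<lambda>x. fn (m + n) x - fn n x)"
      by (intro Minkowski_diff fn p)
    then show ?case using Suc cau[of "m + n"] by simp
  qed simp
  have **: "Lp_norm M p (\<lambda>x. fn (m + n) x - fn n x) \<le> 2 * (1/2) ^ n" for m n
  proof -
    have "(\<Sum>i<m. (1/2) ^ (i + n)) = (\<Sum>i<m. (1/2) ^ i) * (1/2::real) ^ n"
      by (simp add: power_add sum_distrib_right)
    also have "\<dots> \<le> 2 * (1/2) ^ n" using geo[of m] by (intro mult_right_mono) auto
    finally show ?thesis using *[of m n] by simp
  qed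
  \<comment> \<open>Fatou is applied to differences, so that one application gives both membership
    in L^p and the rate; so far \<open>f\<close> is only known to be measurable.\<close>
  have diff: "in_Lp M p (\<lambda>x. f x - fn n x)" "Lp_norm M p (\<lambda>x. f x - fn n x) \<le> 2 * (1/2) ^ n" for n
  proof -
    have l: "AE x in M. (\<lambda>m. fn (m + n) x - fn n x) \<longlonglongrightarrow> f x - fn n x"
      using fl by eventually_elim (intro tendsto_diff tendsto_const LIMSEQ_ignore_initial_segment)
    have i: "in_Lp M p (\<lambda>x. fn (m + n) x - fn n x)" for m using p by (intro in_Lp_diff fn) auto
    have mm: "(\<lambda>x. f x - fn n x) \<in> borel_measurable M" by measurable
    have p0: "0 < p" using p by simp
    show "in_Lp M p (\<lambda>x. f x - fn n x)" "Lp_norm M p (\<lambda>x. f x - fn n x) \<le> 2 * (1/2) ^ n"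
      using Lp_Fatou[OF p0 mm i l **] by auto
  qed
  have "in_Lp M p f" using in_Lp_add[OF diff(1)[of 0] fn[of 0]] p by simp
  then show ?thesis using that diff(2) Lp_norm_minus_commute[of M p f] by metis
qed

text \<open>The converse of Hoelder's inequality with test functions from a dense class. The
  estimate passes to all of L^q by continuity of the pairing and is then evaluated at the extremal
  function.\<close>

lemma Lp_norm_le_dual:
  fixes h :: "'a \<Rightarrow> 'b::euclidean_space"
  assumes p: "p > 1" "q > 1" "1 / p + 1 / q = 1" and h: "in_Lp M p h" and C: "C \<ge> 0"
    and G: "\<And>g. g \<in> G \<Longrightarrow> in_Lp M q g"
    and dense: "\<And>g e. in_Lp M q g \<Longrightarrow> e > 0 \<Longrightarrow> \<exists>g'\<in>G. Lp_norm M q (\<lambda>x. g x - g' x) < e"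
    and bd: "\<And>g. g \<in> G \<Longrightarrow> \<bar>\<integral>x. h x \<bullet> g x \<partial>M\<bar> \<le> C * Lp_norm M q g"
  shows "Lp_norm M p h \<le> C"
proof -
  have [measurable]: "h \<in> borel_measurable M" using h by (simp add: in_Lp_def)
  have bd': "\<bar>\<integral>x. h x \<bullet> g x \<partial>M\<bar> \<le> C * Lp_norm M q g" if g: "in_Lp M q g" for g
  proof (rule field_le_epsilon)
    fix e :: real assume "e > 0"
    \<comment> \<open>The error g - g' is paid for twice, once against \<open>h\<close> and once in
      the bound for \<open>g'\<close>; the summand 1 keeps the divisor positive.\<close>
    define K where "K = Lp_norm M p h + C + 1"
    have K: "K > 0" using C Lp_norm_nonneg[of M p h] unfolding K_def by linarith
    obtain g' where g': "g' \<in> G" "Lp_norm M q (\<lambda>x. g x - g' x) < e / K"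
      using dense[OF g, of "e / K"] \<open>e > 0\<close> K by auto
    note i = Hoelder_inner[OF p h]
    have d: "in_Lp M q (\<lambda>x. g x - g' x)" using g G[OF g'(1)] p by (intro in_Lp_diff) auto
    have "(\<integral>x. h x \<bullet> g x \<partial>M) = (\<integral>x. h x \<bullet> (g x - g' x) \<partial>M) + (\<integral>x. h x \<bullet> g' x \<partial>M)"
      by (subst Bochner_Integration.integral_add[symmetric, OF i(1)[OF d] i(1)[OF G[OF g'(1)]]]) (simp add: inner_diff_right)
    then have "\<bar>\<integral>x. h x \<bullet> g x \<partial>M\<bar> \<le> Lp_norm M p h * Lp_norm M q (\<lambda>x. g x - g' x) + C * Lp_norm M q g'"
      using i(2)[OF d] bd[OF g'(1)] by linarith
    also have "Lp_norm M q g' \<le> Lp_norm M q (\<lambda>x. g x - g' x) + Lp_norm M q g"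
      using Lp_norm_le_add_diff[OF p(2) G[OF g'(1)] g] by (simp add: Lp_norm_minus_commute[of M q g])
    finally have "\<bar>\<integral>x. h x \<bullet> g x \<partial>M\<bar> \<le> (Lp_norm M p h + C) * Lp_norm M q (\<lambda>x. g x - g' x) + C * Lp_norm M q g"
      using mult_left_mono[OF _ C] by (simp add: algebra_simps)
    also have "(Lp_norm M p h + C) * Lp_norm M q (\<lambda>x. g x - g' x) \<le> K * (e / K)"
      using g'(2) C by (intro mult_mono) (auto simp: K_def)
    finally show "\<bar>\<integral>x. h x \<bullet> g x \<partial>M\<bar> \<le> C * Lp_norm M q g + e" using K by simp
  qed
  \<comment> \<open>Equality case of Hoelder: the pairing with \<open>h\<close> gives the p-th power
    of the norm of \<open>h\<close>, while the L^q norm of \<open>g\<close> is the power p - 1 of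
    it.\<close>
  define g where "g x = norm (h x) powr (p - 2) *\<^sub>R h x" for x
  have ng: "norm (g x) = norm (h x) powr (p - 1)" for x
  proof (cases "h x = 0")
    case False
    then have "norm (h x) powr (p - 1) = norm (h x) powr (p - 2) * norm (h x)"
      using powr_add[of "norm (h x)" "p - 2" 1] by simp
    then show ?thesis by (simp add: g_def)
  qed (use p in \<open>simp add: g_def\<close>)
  have pq: "(p - 1) * q = p" "p / q = p - 1" using p by (auto simp: field_simps)
  have ngq: "norm (g x) powr q = norm (h x) powr p" for x
    by (simp add: ng powr_powr pq)
  have g: "in_Lp M q g" using h unfolding in_Lp_def ngq by (auto simp: g_def[abs_def])
  have hg: "h x \<bullet> g x = norm (h x) powr p" for x
  proof (cases "h x = 0")
    case False
    then have "norm (h x) powr p = norm (h x) powr (p - 2) * (norm (h x))\<^sup>2"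
      using powr_add[of "norm (h x)" "p - 2" 2] by (simp add: powr_numeral)
    then show ?thesis by (simp add: g_def power2_norm_eq_inner)
  qed (use p in \<open>simp add: g_def\<close>)
  define S where "S = Lp_norm M p h"
  have Sp: "(\<integral>x. norm (h x) powr p \<partial>M) = S powr p" using p by (simp add: S_def Lp_norm_powr)
  have "Lp_norm M q g = S powr (p - 1)"
    unfolding Lp_norm_def ngq Sp by (simp add: powr_powr pq)
  then have *: "S powr p \<le> C * S powr (p - 1)" using bd'[OF g] by (simp add: hg Sp)
  show ?thesis
  proof (cases "S = 0")
    case False
    then have "S > 0" using Lp_norm_nonneg[of M p h] unfolding S_def by linarith
    have "S powr p = S * S powr (p - 1)"
      using p powr_add[of S 1 "p - 1"] \<open>S > 0\<close> by simp
    then have "S * S powr (p - 1) \<le> C * S powr (p - 1)" using * by simp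
    then show ?thesis using \<open>S > 0\<close> unfolding S_def[symmetric] by (simp add: mult_le_cancel_right)
  qed (use S_def C in simp)
qed

section \<open>The Laguerre measure\<close>

text \<open>\<open>lborel\<close> on \<open>real ^ 'n\<close> is the image of a product measure
  indexed by \<open>Basis\<close>; the bijection from coordinates to axis vectors turns products
  over \<open>Basis\<close> into products over coordinates.\<close>

lemma lborel_prod_vec:
  fixes f :: "'n::finite \<Rightarrow> real \<Rightarrow> real"
  assumes int: "\<And>i. integrable lborel (f i)"
  shows "integrable lborel (\<lambda>x::real^'n. \<Prod>i\<in>UNIV. f i (x $ i))"
    and "integral\<^sup>L lborel (\<lambda>x::real^'n. \<Prod>i\<in>UNIV. f i (x $ i)) = (\<Prod>i\<in>UNIV. integral\<^sup>L lborel (f i))"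
proof -
  have [measurable]: "f i \<in> borel_measurable borel" for i using int[of i] by simp
  define e :: "'n \<Rightarrow> real^'n" where "e i = axis i 1" for i
  have bij: "bij_betw e UNIV Basis"
    by (auto simp: bij_betw_def e_def Basis_vec_def inj_on_def axis_eq_axis)
  define g where "g b = f (the_inv_into UNIV e b)" for b
  have ge: "g (e i) = f i" for i
    using bij by (simp add: g_def the_inv_into_f_f bij_betw_def)
  have gint: "integrable lborel (g b)" for b unfolding g_def by (rule int)
  then have [measurable]: "g b \<in> borel_measurable borel" for b by auto
  interpret product_sigma_finite "\<lambda>b::real^'n. lborel :: real measure" ..
  have nth: "(\<Sum>b\<in>Basis. h b *\<^sub>R b) $ i = h (e i)" for h :: "real^'n \<Rightarrow> real" and i
    using inner_sum_left_Basis[of "e i" h] by (simp add: e_def axis_in_Basis_iff cart_eq_inner_axis)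
  have eq: "(\<Prod>i\<in>UNIV. f i ((\<Sum>b\<in>Basis. h b *\<^sub>R b) $ i)) = (\<Prod>b\<in>Basis. g b (h b))" for h :: "real^'n \<Rightarrow> real"
    using prod.reindex_bij_betw[OF bij, of "\<lambda>b. g b (h b)"] by (simp add: nth ge del: sum_component)
  have m: "(\<lambda>x::real^'n. \<Prod>i\<in>UNIV. f i (x $ i)) \<in> borel_measurable borel" by measurable
  have m2: "(\<lambda>h. \<Sum>b\<in>Basis. h b *\<^sub>R b) \<in> measurable (\<Pi>\<^sub>M b\<in>(Basis::(real^'n) set). lborel) (borel :: (real^'n) measure)"
    by measurable
  show "integrable lborel (\<lambda>x::real^'n. \<Prod>i\<in>UNIV. f i (x $ i))"
    apply (subst lborel_eq)
    apply (subst integrable_distr_eq[OF m2 m])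
    unfolding eq by (rule product_integrable_prod) (auto simp: gint)
  have "integral\<^sup>L lborel (\<lambda>x::real^'n. \<Prod>i\<in>UNIV. f i (x $ i)) = (\<Prod>b\<in>Basis. integral\<^sup>L lborel (g b))"
    apply (subst lborel_eq)
    apply (subst integral_distr[OF m2 m])
    unfolding eq by (rule product_integral_prod) (auto simp: gint)
  also have "\<dots> = (\<Prod>i\<in>UNIV. integral\<^sup>L lborel (f i))"
    using prod.reindex_bij_betw[OF bij, of "\<lambda>b. integral\<^sup>L lborel (g b)"] by (simp add: ge)
  finally show "integral\<^sup>L lborel (\<lambda>x::real^'n. \<Prod>i\<in>UNIV. f i (x $ i)) = (\<Prod>i\<in>UNIV. integral\<^sup>L lborel (f i))" .
qed

abbreviation orthant :: "(real^'n) set" where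
  "orthant \<equiv> {x. \<forall>i. 0 < x $ i}"

text \<open>The indicator is built in so that integrals over the orthant become integrals over the
  whole space with an integrand that still factors by coordinates.\<close>

definition laguerre_weight :: "real \<Rightarrow> real \<Rightarrow> real" where
  "laguerre_weight a x = indicator {0<..} x * x powr (2 * a + 1)"

lemma orthant_borel [measurable]: "orthant \<in> sets (borel :: (real^'n) measure)"
  by measurable

lemma orthant_prod: "indicator orthant x = (\<Prod>i\<in>UNIV. indicator {0<..} ((x::real^'n) $ i) :: real)"
proof (cases "x \<in> orthant")
  case False
  then obtain i where "indicator {0<..} (x $ i) = (0::real)" by (auto simp: indicator_def)
  then have "(\<Prod>i\<in>UNIV. indicator {0<..} (x $ i) :: real) = 0" by (intro prod_zero) auto
  then show ?thesis using False by simp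
qed auto

lemma weight_measurable [measurable]: "laguerre_weight a \<in> borel_measurable borel"
  unfolding laguerre_weight_def[abs_def] by measurable

lemma prod_laguerre_weight:
  "(\<Prod>i\<in>UNIV. laguerre_weight (\<alpha> $ i) (x $ i)) = indicator orthant x * (\<Prod>i\<in>UNIV. x $ i powr (2 * \<alpha> $ i + 1))"
  unfolding laguerre_weight_def prod.distrib orthant_prod ..

lemma space_laguerre_measure [simp]: "space (laguerre_measure \<alpha>) = orthant"
  by (simp add: laguerre_measure_def space_restrict_space)

lemma sets_laguerre_measure: "sets (laguerre_measure \<alpha>) = sets (restrict_space borel orthant)"
  by (simp add: laguerre_measure_def cong: sets_restrict_space_cong)

lemma measurable_laguerre_measure: "f \<in> borel_measurable borel \<Longrightarrow> f \<in> borel_measurable (laguerre_measure \<alpha>)"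
  unfolding measurable_cong_sets[OF sets_laguerre_measure refl] by (rule measurable_restrict_space1)

lemma laguerre_measure_integral:
  fixes f :: "real^'n \<Rightarrow> 'b::{banach, second_countable_topology}"
  assumes [measurable]: "f \<in> borel_measurable borel"
  shows "integrable (laguerre_measure \<alpha>) f \<longleftrightarrow> integrable lborel (\<lambda>x. (\<Prod>i\<in>UNIV. laguerre_weight (\<alpha> $ i) (x $ i)) *\<^sub>R f x)"
    and "integral\<^sup>L (laguerre_measure \<alpha>) f = (\<integral>x. (\<Prod>i\<in>UNIV. laguerre_weight (\<alpha> $ i) (x $ i)) *\<^sub>R f x \<partial>lborel)"
proof -
  have m: "f \<in> borel_measurable (restrict_space lborel orthant)"
    by (rule measurable_restrict_space1) measurable
  have m2: "(\<lambda>x. \<Prod>i\<in>UNIV. x $ i powr (2 * \<alpha> $ i + 1)) \<in> borel_measurable (restrict_space lborel orthant)"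
    by (rule measurable_restrict_space1) measurable
  have nn: "AE x in restrict_space lborel orthant. 0 \<le> (\<Prod>i\<in>UNIV. x $ i powr (2 * \<alpha> $ i + 1))"
    by (auto intro!: AE_I2 prod_nonneg)
  have o: "orthant \<inter> space lborel \<in> sets (lborel :: (real^'n) measure)"
    using orthant_borel by simp
  show "integrable (laguerre_measure \<alpha>) f \<longleftrightarrow> integrable lborel (\<lambda>x. (\<Prod>i\<in>UNIV. laguerre_weight (\<alpha> $ i) (x $ i)) *\<^sub>R f x)"
    unfolding laguerre_measure_def
    by (subst integrable_density[OF m m2 nn], subst integrable_restrict_space[OF o]) (simp add: prod_laguerre_weight)
  show "integral\<^sup>L (laguerre_measure \<alpha>) f = (\<integral>x. (\<Prod>i\<in>UNIV. laguerre_weight (\<alpha> $ i) (x $ i)) *\<^sub>R f x \<partial>lborel)"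
    unfolding laguerre_measure_def
    by (subst integral_density[OF m m2 nn], subst integral_restrict_space[OF o]) (simp add: prod_laguerre_weight)
qed

lemma laguerre_measure_prod:
  fixes f :: "'n::finite \<Rightarrow> real \<Rightarrow> real"
  assumes [measurable]: "\<And>i. f i \<in> borel_measurable borel"
    and int: "\<And>i. integrable lborel (\<lambda>t. laguerre_weight (\<alpha> $ i) t * f i t)"
  shows "integrable (laguerre_measure \<alpha>) (\<lambda>x. \<Prod>i\<in>UNIV. f i (x $ i))"
    and "(\<integral>x. (\<Prod>i\<in>UNIV. f i (x $ i)) \<partial>laguerre_measure \<alpha>) = (\<Prod>i\<in>UNIV. \<integral>t. laguerre_weight (\<alpha> $ i) t * f i t \<partial>lborel)"
proof -
  have m: "(\<lambda>x::real^'n. \<Prod>i\<in>UNIV. f i (x $ i)) \<in> borel_measurable borel" by measurable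
  show "integrable (laguerre_measure \<alpha>) (\<lambda>x. \<Prod>i\<in>UNIV. f i (x $ i))"
    "(\<integral>x. (\<Prod>i\<in>UNIV. f i (x $ i)) \<partial>laguerre_measure \<alpha>) = (\<Prod>i\<in>UNIV. \<integral>t. laguerre_weight (\<alpha> $ i) t * f i t \<partial>lborel)"
    using lborel_prod_vec[OF int] unfolding laguerre_measure_integral[OF m]
    by (simp_all add: prod.distrib)
qed

text \<open>Substitution of x^2 in the Gamma integral. The substitution is carried out for integrals
  over sets with respect to completed Lebesgue measure, and the result is then moved to
  \<open>lborel\<close>.\<close>

lemma gauss_moment:
  assumes r: "r > - 1"
  shows "integrable lborel (\<lambda>x::real. indicator {0<..} x * (x powr r * exp (- x\<^sup>2)))" (is "integrable _ ?F")
    and "(\<integral>x. indicator {0<..} x * (x powr r * exp (- x\<^sup>2)) \<partial>lborel) = Gamma ((r + 1) / 2) / 2"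
proof -
  define s where "s = (r + 1) / 2"
  have s: "s > 0" using r by (simp add: s_def)
  let ?f = "\<lambda>t::real. t powr (s - 1) / exp t"
  have "(?f has_integral Gamma s) {0<..}"
    by (subst has_integral_spike_set_eq[where T="{0..}"])
       (use Gamma_integral_real[OF s] in \<open>auto intro: negligible_subset[of "{0}"]\<close>)
  moreover from this have "?f absolutely_integrable_on {0<..}"
    by (intro nonnegative_absolutely_integrable_1) (auto simp: integrable_on_def)
  ultimately have G: "?f absolutely_integrable_on {0<..}" "integral {0<..} ?f = Gamma s"
    by (auto simp: integral_unique)
  have img: "(\<lambda>x::real. x\<^sup>2) ` {0<..} = {0<..}"
  proof -
    have "x \<in> (\<lambda>x::real. x\<^sup>2) ` {0<..}" if "x > 0" for x
      using that by (intro image_eqI[of _ _ "sqrt x"]) auto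
    then show ?thesis by auto
  qed
  have C: "(\<lambda>x. \<bar>2 * x\<bar> * ?f (x\<^sup>2)) absolutely_integrable_on {0<..} \<and> integral {0<..} (\<lambda>x. \<bar>2 * x\<bar> * ?f (x\<^sup>2)) = Gamma s"
  proof (rule iffD2[OF has_absolute_integral_change_of_variables_1'[where g="\<lambda>x. x\<^sup>2" and g'="\<lambda>x. 2 * x"]])
    show "inj_on (\<lambda>x::real. x\<^sup>2) {0<..}" by (auto simp: inj_on_def)
    show "((\<lambda>x. x\<^sup>2) has_real_derivative 2 * x) (at x within {0<..})" for x :: real
      by (auto intro!: derivative_eq_intros)
    show "?f absolutely_integrable_on (\<lambda>x. x\<^sup>2) ` {0<..} \<and> integral ((\<lambda>x. x\<^sup>2) ` {0<..}) ?f = Gamma s"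
      unfolding img using G by simp
  qed simp
  have eq: "\<bar>2 * x\<bar> * ?f (x\<^sup>2) = 2 * (x powr r * exp (- x\<^sup>2))" if "x \<in> {0<..}" for x
  proof -
    have x: "x > 0" using that by simp
    have "(x\<^sup>2) powr (s - 1) = x powr (2 * (s - 1))"
      using x by (simp add: powr_powr flip: powr_numeral)
    also have "2 * (s - 1) = r - 1" by (simp add: s_def field_simps)
    also have "x powr (r - 1) = x powr r / x" using x by (simp add: powr_diff)
    finally show ?thesis using x by (simp add: exp_minus field_simps)
  qed
  have "((\<lambda>x. \<bar>2 * x\<bar> * ?f (x\<^sup>2)) absolutely_integrable_on {0<..}) = ((\<lambda>x. 2 * (x powr r * exp (- x\<^sup>2))) absolutely_integrable_on {0<..})"
    by (rule set_integrable_cong[OF refl refl eq])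
  moreover have "integral {0<..} (\<lambda>x. \<bar>2 * x\<bar> * ?f (x\<^sup>2)) = integral {0<..} (\<lambda>x. 2 * (x powr r * exp (- x\<^sup>2)))"
    by (rule Henstock_Kurzweil_Integration.integral_cong[OF eq])
  ultimately have A: "(\<lambda>x. 2 * (x powr r * exp (- x\<^sup>2))) absolutely_integrable_on {0<..}"
      "integral {0<..} (\<lambda>x. 2 * (x powr r * exp (- x\<^sup>2))) = Gamma s"
    using C by (simp_all only:)
  have [measurable]: "?F \<in> borel_measurable borel" by measurable
  have i2: "integrable lebesgue (\<lambda>x. 2 * ?F x)"
    using A(1) unfolding set_integrable_def by (simp add: mult_ac)
  then have "integrable lborel (\<lambda>x. 2 * ?F x)"
    by (subst (asm) integrable_completion) measurable
  then show int: "integrable lborel ?F" by simp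
  have "integral\<^sup>L lebesgue (\<lambda>x. 2 * ?F x) = Gamma s"
    using A(2) set_lebesgue_integral_eq_integral(2)[OF A(1)]
    by (simp add: set_lebesgue_integral_def mult_ac)
  then have "integral\<^sup>L lborel (\<lambda>x. 2 * ?F x) = Gamma s"
    by (subst (asm) integral_completion) measurable
  then show "integral\<^sup>L lborel ?F = Gamma ((r + 1) / 2) / 2" by (simp add: s_def)
qed

text \<open>Reduced to c = 1 by the dilation with factor \<open>sqrt c\<close>. Other rates arise
  from powers of Gaussians and from dilated arguments.\<close>

lemma gauss_weight_integrable:
  assumes a: "a > - 1" and c: "c > 0"
  shows "integrable lborel (\<lambda>x. laguerre_weight a x * exp (- c * x\<^sup>2))"
proof -
  define k where "k = sqrt c"
  have k: "k > 0" "k\<^sup>2 = c" using c by (auto simp: k_def)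
  have "integrable lborel (\<lambda>x. indicator {0<..} (0 + k * x) * ((0 + k * x) powr (2 * a + 1) * exp (- (0 + k * x)\<^sup>2)))"
    using gauss_moment(1)[of "2 * a + 1"] a k by (intro lborel_integrable_real_affine) auto
  then have "integrable lborel (\<lambda>x. k powr (- (2 * a + 1)) * (indicator {0<..} (0 + k * x) * ((0 + k * x) powr (2 * a + 1) * exp (- (0 + k * x)\<^sup>2))))"
    by (rule integrable_mult_right)
  also have "(\<lambda>x. k powr (- (2 * a + 1)) * (indicator {0<..} (0 + k * x) * ((0 + k * x) powr (2 * a + 1) * exp (- (0 + k * x)\<^sup>2))))
     = (\<lambda>x. laguerre_weight a x * exp (- c * x\<^sup>2))"
  proof
    fix x :: real
    show "k powr (- (2 * a + 1)) * (indicator {0<..} (0 + k * x) * ((0 + k * x) powr (2 * a + 1) * exp (- (0 + k * x)\<^sup>2))) = laguerre_weight a x * exp (- c * x\<^sup>2)"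
    proof (cases "x > 0")
      case True
      have "k powr (- (2 * a + 1)) * (k * x) powr (2 * a + 1) = x powr (2 * a + 1)"
        using True k by (simp add: powr_mult powr_minus del: minus_add_distrib)
      then show ?thesis using True k
        by (simp add: laguerre_weight_def power_mult_distrib indicator_def mult.assoc[symmetric])
    next
      case False
      then show ?thesis using k by (simp add: laguerre_weight_def indicator_def zero_less_mult_iff)
    qed
  qed
  finally show ?thesis .
qed

lemma norm_vec_power2: "(norm (x::real^'n))\<^sup>2 = (\<Sum>i\<in>UNIV. (x $ i)\<^sup>2)"
  by (simp add: norm_vec_def L2_set_def sum_nonneg)

lemma gauss_prod: "exp (- c * (norm (x::real^'n))\<^sup>2) = (\<Prod>i\<in>UNIV. exp (- c * (x $ i)\<^sup>2))"
  by (simp add: norm_vec_power2 sum_distrib_left exp_sum sum_negf[symmetric] del: sum_negf)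

lemma gauss_integrable:
  fixes \<alpha> :: "real^'n"
  assumes "\<And>i. \<alpha> $ i > - 1" "c > 0"
  shows "integrable (laguerre_measure \<alpha>) (\<lambda>x. exp (- c * (norm x)\<^sup>2))"
  unfolding gauss_prod
  by (intro laguerre_measure_prod(1) gauss_weight_integrable assms) measurable

section \<open>One-dimensional Laguerre functions\<close>

text \<open>A class containing the one-dimensional Laguerre functions and closed under
  differentiation and multiplication by x, so that calculus with them becomes algebra of
  polynomials.\<close>

definition gauss_poly :: "real poly \<Rightarrow> real \<Rightarrow> real" where
  "gauss_poly p x = poly p x * exp (- x\<^sup>2 / 2)"

text \<open>Extended by 0 beyond the degree, so that the recursion and the coefficient comparisons
  hold for every index.\<close>

definition lag_coeff :: "nat \<Rightarrow> real \<Rightarrow> nat \<Rightarrow> real" where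
  "lag_coeff n a j = (if j \<le> n then (-1) ^ j * ((real n + a) gchoose (n - j)) / fact j else 0)"

definition lag_classical :: "nat \<Rightarrow> real \<Rightarrow> real poly" where
  "lag_classical n a = Poly (map (lag_coeff n a) [0..<Suc n])"

definition lag_const :: "nat \<Rightarrow> real \<Rightarrow> real" where
  "lag_const n a = sqrt (2 * fact n / Gamma (real n + a + 1))"

definition lag_poly :: "nat \<Rightarrow> real \<Rightarrow> real poly" where
  "lag_poly n a = smult (lag_const n a) (pcompose (lag_classical n a) [:0, 0, 1:])"

lemma coeff_lag_classical: "coeff (lag_classical n a) j = lag_coeff n a j"
  by (cases "j \<le> n") (auto simp: lag_classical_def lag_coeff_def nth_default_def simp del: upt_Suc)

lemma degree_lag_classical: "degree (lag_classical n a) = n"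
proof (rule antisym)
  show "degree (lag_classical n a) \<le> n"
    by (rule degree_le) (simp add: coeff_lag_classical lag_coeff_def)
  show "n \<le> degree (lag_classical n a)"
    by (rule le_degree) (simp add: coeff_lag_classical lag_coeff_def)
qed

lemma laguerre_poly_eq: "laguerre_poly n a x = poly (lag_classical n a) x"
  unfolding poly_altdef degree_lag_classical coeff_lag_classical laguerre_poly_def lag_coeff_def
  by (intro sum.cong) auto

lemma laguerre_fun1_eq: "laguerre_fun1 n a = gauss_poly (lag_poly n a)"
  by (rule ext) (simp add: laguerre_fun1_def gauss_poly_def lag_poly_def laguerre_poly_eq poly_pcompose
      lag_const_def power2_eq_square)

lemma pderiv_lag_classical: "pderiv (lag_classical (Suc n) a) = - lag_classical n (a + 1)"
proof (rule poly_eqI)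
  fix j
  have "real (Suc n) + a = real n + (a + 1)" by simp
  then have "real (Suc n) + a gchoose (n - j) = real n + (a + 1) gchoose (n - j)" by (simp only:)
  then show "coeff (pderiv (lag_classical (Suc n) a)) j = coeff (- lag_classical n (a + 1)) j"
    by (auto simp: coeff_pderiv coeff_lag_classical lag_coeff_def fact_Suc simp del: of_nat_Suc)
qed

lemma pderiv_lag_classical_0: "pderiv (lag_classical 0 a) = 0"
  by (simp add: pderiv_eq_0_iff degree_lag_classical)

text \<open>This is the Laguerre differential equation read off coefficientwise. At j = n both sides
  vanish, the left one by the extension of the coefficients by 0.\<close>

lemma lag_coeff_rec: "real (Suc j) * (real j + a + 1) * lag_coeff n a (Suc j) = (real j - real n) * lag_coeff n a j"
proof (cases "Suc j \<le> n")
  case True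
  define k where "k = n - Suc j"
  have k: "n - j = Suc k" "n = Suc (j + k)" using True by (auto simp: k_def)
  have "real (Suc k) * ((real n + a) gchoose (Suc k)) = (real n + a - real k) * ((real n + a) gchoose k)"
    using gbinomial_mult_1[of "real n + a" k] by (simp add: algebra_simps)
  then have "real (Suc k) * ((real n + a) gchoose (n - j)) = (real j + a + 1) * ((real n + a) gchoose (n - Suc j))"
    unfolding k(1) k_def[symmetric] using k(2) by (simp add: algebra_simps)
  moreover have "real (Suc k) = real n - real j" using k by simp
  ultimately show ?thesis using True
    by (simp add: lag_coeff_def fact_Suc field_simps del: of_nat_Suc)
qed (auto simp: lag_coeff_def not_le less_Suc_eq_le)

lemma lag_classical_ode:
  "[:0, 1:] * pderiv (pderiv (lag_classical n a)) + [:a + 1, -1:] * pderiv (lag_classical n a)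
     + smult (real n) (lag_classical n a) = 0" (is "?L = 0")
proof (rule poly_eqI)
  fix j
  have "coeff ?L j = real (Suc j) * (real j + a + 1) * lag_coeff n a (Suc j) - (real j - real n) * lag_coeff n a j"
    by (cases j) (simp_all add: coeff_pderiv coeff_lag_classical algebra_simps)
  also have "\<dots> = 0" unfolding lag_coeff_rec by simp
  finally show "coeff ?L j = coeff 0 j" by simp
qed

text \<open>The Laguerre equation after the substitution of x^2. It is cleared of the denominator x,
  so that it is an identity on the whole line and can be differentiated.\<close>

lemma lag_poly_ode:
  "x * poly (pderiv (pderiv (lag_poly n a))) x + (2 * a + 1 - 2 * x\<^sup>2) * poly (pderiv (lag_poly n a)) x
     + 4 * real n * x * poly (lag_poly n a) x = 0"
proof -
  let ?L = "lag_classical n a"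
  have 1: "poly (pderiv (lag_poly n a)) x = lag_const n a * (2 * x * poly (pderiv ?L) (x\<^sup>2))" for x
    by (simp add: lag_poly_def pderiv_smult pderiv_pcompose poly_pcompose pderiv_pCons power2_eq_square)
  have 2: "poly (pderiv (pderiv (lag_poly n a))) x = lag_const n a * (2 * poly (pderiv ?L) (x\<^sup>2) + 4 * x\<^sup>2 * poly (pderiv (pderiv ?L)) (x\<^sup>2))"
    by (simp add: lag_poly_def pderiv_smult pderiv_pcompose poly_pcompose pderiv_pCons pderiv_mult pderiv_add power2_eq_square algebra_simps)
  have 0: "poly (lag_poly n a) x = lag_const n a * poly ?L (x\<^sup>2)"
    by (simp add: lag_poly_def poly_pcompose power2_eq_square)
  have "poly ([:0, 1:] * pderiv (pderiv ?L) + [:a + 1, -1:] * pderiv ?L + smult (real n) ?L) (x\<^sup>2) = 0"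
    by (simp only: lag_classical_ode poly_0)
  then have "x\<^sup>2 * poly (pderiv (pderiv ?L)) (x\<^sup>2) + (a + 1 - x\<^sup>2) * poly (pderiv ?L) (x\<^sup>2) + real n * poly ?L (x\<^sup>2) = 0"
    by (simp add: algebra_simps)
  then have "4 * x * lag_const n a * (x\<^sup>2 * poly (pderiv (pderiv ?L)) (x\<^sup>2) + (a + 1 - x\<^sup>2) * poly (pderiv ?L) (x\<^sup>2) + real n * poly ?L (x\<^sup>2)) = 0"
    by simp
  then show ?thesis unfolding 0 1 2 by (simp add: algebra_simps power2_eq_square)
qed

text \<open>Differentiate the equation of \<open>lag_poly\<close> and use that equation once more to
  eliminate the polynomial itself. The new term of order 1 / x^2 is what enlarges the potential for
  the vector-valued extension.\<close>

lemma pderiv_lag_poly_ode: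
  fixes n a
  defines "r \<equiv> pderiv (lag_poly n a)"
  assumes x: "x \<noteq> 0"
  shows "poly (pderiv (pderiv r)) x - 2 * x * poly (pderiv r) x + (2 * a + 1) / x * poly (pderiv r) x
     + (4 * real n - 2 - (2 * a + 1) / x\<^sup>2) * poly r x = 0"
proof -
  define p where "p = lag_poly n a"
  have D: "((\<lambda>x. x * poly (pderiv r) x + (2 * a + 1 - 2 * x\<^sup>2) * poly r x + 4 * real n * x * poly p x) has_real_derivative
     (poly (pderiv r) x + x * poly (pderiv (pderiv r)) x + (2 * a + 1 - 2 * x\<^sup>2) * poly (pderiv r) x - 4 * x * poly r x
       + 4 * real n * poly p x + 4 * real n * x * poly r x)) (at x)"
    unfolding r_def p_def by (auto intro!: derivative_eq_intros poly_DERIV simp: algebra_simps)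
  have Z: "(\<lambda>x. x * poly (pderiv r) x + (2 * a + 1 - 2 * x\<^sup>2) * poly r x + 4 * real n * x * poly p x) = (\<lambda>x. 0)"
    unfolding r_def p_def by (rule ext) (rule lag_poly_ode)
  have E: "poly (pderiv r) x + x * poly (pderiv (pderiv r)) x + (2 * a + 1 - 2 * x\<^sup>2) * poly (pderiv r) x - 4 * x * poly r x
       + 4 * real n * poly p x + 4 * real n * x * poly r x = 0"
    using D unfolding Z by (metis DERIV_const DERIV_unique)
  have E2: "x * poly (pderiv r) x + (2 * a + 1 - 2 * x\<^sup>2) * poly r x + 4 * real n * x * poly p x = 0"
    using lag_poly_ode[of x n a] unfolding r_def p_def .
  have "x\<^sup>2 * (poly (pderiv (pderiv r)) x - 2 * x * poly (pderiv r) x + (2 * a + 1) / x * poly (pderiv r) x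
     + (4 * real n - 2 - (2 * a + 1) / x\<^sup>2) * poly r x)
   = x * (poly (pderiv r) x + x * poly (pderiv (pderiv r)) x + (2 * a + 1 - 2 * x\<^sup>2) * poly (pderiv r) x - 4 * x * poly r x
       + 4 * real n * poly p x + 4 * real n * x * poly r x)
     - (x * poly (pderiv r) x + (2 * a + 1 - 2 * x\<^sup>2) * poly r x + 4 * real n * x * poly p x)"
    using x by (simp add: field_simps power2_eq_square)
  then show ?thesis using x E E2 by simp
qed

lemma lag_const_Suc: "lag_const (Suc n) a = sqrt (real (Suc n)) * lag_const n (a + 1)"
proof -
  have "real (Suc n) + a + 1 = real n + (a + 1) + 1" by simp
  then show ?thesis
    unfolding lag_const_def fact_Suc by (simp only: real_sqrt_mult[symmetric] of_nat_mult of_nat_fact mult_ac times_divide_eq_right)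
qed

text \<open>On functions p(x) exp (- x^2 / 2) the operator d/dx + x differentiates only p, so this
  is the formula expressing the image of a Laguerre function of type \<open>a\<close> by one of type
  \<open>a + 1\<close>.\<close>

lemma pderiv_lag_poly_Suc: "pderiv (lag_poly (Suc n) a) = smult (- 2 * sqrt (real (Suc n))) ([:0, 1:] * lag_poly n (a + 1))"
  unfolding lag_poly_def lag_const_Suc pderiv_smult pderiv_pcompose pderiv_lag_classical
  by (simp add: pderiv_pCons pcompose_uminus mult_ac)

lemma pderiv_lag_poly_0: "pderiv (lag_poly 0 a) = 0"
  by (simp add: lag_poly_def pderiv_smult pderiv_pcompose pderiv_lag_classical_0)

text \<open>Up to sign these are n-th finite differences of a polynomial in z of degree m with
  leading coefficient 1: they annihilate degrees below n and are constant for degree n.\<close>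

lemma alternating_pochhammer_sum:
  fixes z :: real
  shows "m < n \<Longrightarrow> (\<Sum>j\<le>n. (-1) ^ j * real (n choose j) * pochhammer (z + real j) m) = 0"
    and "(\<Sum>j\<le>n. (-1) ^ j * real (n choose j) * pochhammer (z + real j) n) = (-1) ^ n * fact n"
proof -
  \<comment> \<open>Pascal's rule: the alternating sum of order n + 1 is the sum of order n applied
    to first differences.\<close>
  have step: "(\<Sum>j\<le>Suc n. (-1) ^ j * real (Suc n choose j) * f j) = (\<Sum>j\<le>n. (-1) ^ j * real (n choose j) * (f j - f (Suc j)))"
    for n and f :: "nat \<Rightarrow> real"
  proof -
    have "(\<Sum>j\<le>Suc n. (-1) ^ j * real (Suc n choose j) * f j)
        = f 0 + (\<Sum>j\<le>n. (-1) ^ Suc j * real (Suc n choose Suc j) * f (Suc j))"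
      by (subst sum.atMost_Suc_shift) simp
    also have "\<dots> = (f 0 + (\<Sum>j\<le>n. (-1) ^ Suc j * real (n choose Suc j) * f (Suc j)))
        + (\<Sum>j\<le>n. (-1) ^ Suc j * real (n choose j) * f (Suc j))"
      by (simp add: sum.distrib[symmetric] algebra_simps)
    also have "f 0 + (\<Sum>j\<le>n. (-1) ^ Suc j * real (n choose Suc j) * f (Suc j)) = (\<Sum>j\<le>Suc n. (-1) ^ j * real (n choose j) * f j)"
      by (subst sum.atMost_Suc_shift) simp
    also have "\<dots> = (\<Sum>j\<le>n. (-1) ^ j * real (n choose j) * f j)" by simp
    finally show ?thesis by (simp add: sum.distrib[symmetric] algebra_simps)
  qed
  \<comment> \<open>The difference of a rising factorial is a rising factorial of one degree less at
    a shifted base point; hence \<open>z\<close> and \<open>m\<close> both vary in the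
    induction.\<close>
  have diff: "pochhammer z (Suc m) - pochhammer (z + 1) (Suc m) = - real (Suc m) * pochhammer (z + 1) m" for z :: real and m
    using pochhammer_rec[of z m] pochhammer_rec'[of "z + 1" m] by (simp add: algebra_simps)
  have main: "(m < n \<longrightarrow> (\<Sum>j\<le>n. (-1) ^ j * real (n choose j) * pochhammer (z + real j) m) = 0)
    \<and> (\<Sum>j\<le>n. (-1) ^ j * real (n choose j) * pochhammer (z + real j) n) = (-1) ^ n * fact n" for n m and z :: real
  proof (induction n arbitrary: m z)
    case (Suc n)
    have r: "(\<Sum>j\<le>Suc n. (-1) ^ j * real (Suc n choose j) * pochhammer (z + real j) (Suc m))
        = - real (Suc m) * (\<Sum>j\<le>n. (-1) ^ j * real (n choose j) * pochhammer ((z + 1) + real j) m)" for m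
    proof -
      have "pochhammer (z + real j) (Suc m) - pochhammer (z + real (Suc j)) (Suc m) = - real (Suc m) * pochhammer ((z + 1) + real j) m" for j
        using diff[of "z + real j" m] by (simp add: add_ac)
      then show ?thesis unfolding step by (simp add: sum_distrib_left mult_ac)
    qed
    have "(\<Sum>j\<le>Suc n. (-1) ^ j * real (Suc n choose j) * pochhammer (z + real j) m) = 0" if "m < Suc n"
    proof (cases m)
      case 0
      then show ?thesis unfolding step by simp
    next
      case (Suc m')
      then show ?thesis using r[of m'] Suc.IH[of m' "z + 1"] that by simp
    qed
    moreover have "(\<Sum>j\<le>Suc n. (-1) ^ j * real (Suc n choose j) * pochhammer (z + real j) (Suc n)) = (-1) ^ Suc n * fact (Suc n)"
      unfolding r using Suc.IH[of 0 "z + 1"] by (simp add: fact_Suc del: of_nat_Suc)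
    ultimately show ?case by blast
  qed simp
  show "m < n \<Longrightarrow> (\<Sum>j\<le>n. (-1) ^ j * real (n choose j) * pochhammer (z + real j) m) = 0"
    "(\<Sum>j\<le>n. (-1) ^ j * real (n choose j) * pochhammer (z + real j) n) = (-1) ^ n * fact n"
    using main by blast+
qed

lemma weight_moment:
  assumes a: "a > - 1"
  shows "integrable lborel (\<lambda>x. laguerre_weight a x * ((x\<^sup>2) ^ j * exp (- x\<^sup>2)))"
    and "(\<integral>x. laguerre_weight a x * ((x\<^sup>2) ^ j * exp (- x\<^sup>2)) \<partial>lborel) = Gamma (a + real j + 1) / 2"
proof -
  have eq: "laguerre_weight a x * ((x\<^sup>2) ^ j * exp (- x\<^sup>2)) = indicator {0<..} x * (x powr (2 * a + 1 + 2 * real j) * exp (- x\<^sup>2))" for x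
  proof (cases "x > 0")
    case True
    have "(x\<^sup>2) ^ j = x powr real (2 * j)" using True by (simp only: powr_realpow power_mult)
    then show ?thesis using True by (simp add: laguerre_weight_def powr_add)
  qed (simp add: laguerre_weight_def)
  have r: "2 * a + 1 + 2 * real j > - 1" using a by simp
  have "(2 * a + 1 + 2 * real j + 1) / 2 = a + real j + 1" by (simp add: field_simps)
  with gauss_moment[OF r] show "integrable lborel (\<lambda>x. laguerre_weight a x * ((x\<^sup>2) ^ j * exp (- x\<^sup>2)))"
    "(\<integral>x. laguerre_weight a x * ((x\<^sup>2) ^ j * exp (- x\<^sup>2)) \<partial>lborel) = Gamma (a + real j + 1) / 2"
    unfolding eq by (simp_all only:)
qed

lemma weight_poly:
  assumes a: "a > - 1"
  shows "integrable lborel (\<lambda>x. laguerre_weight a x * (poly p (x\<^sup>2) * exp (- x\<^sup>2)))"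
    and "(\<integral>x. laguerre_weight a x * (poly p (x\<^sup>2) * exp (- x\<^sup>2)) \<partial>lborel)
       = (\<Sum>j\<le>degree p. coeff p j * (Gamma (a + real j + 1) / 2))"
proof -
  have eq: "laguerre_weight a x * (poly p (x\<^sup>2) * exp (- x\<^sup>2)) = (\<Sum>j\<le>degree p. coeff p j * (laguerre_weight a x * ((x\<^sup>2) ^ j * exp (- x\<^sup>2))))" for x
    by (simp add: poly_altdef sum_distrib_left sum_distrib_right mult_ac)
  show "integrable lborel (\<lambda>x. laguerre_weight a x * (poly p (x\<^sup>2) * exp (- x\<^sup>2)))"
    unfolding eq by (intro Bochner_Integration.integrable_sum integrable_mult_right weight_moment a)
  show "(\<integral>x. laguerre_weight a x * (poly p (x\<^sup>2) * exp (- x\<^sup>2)) \<partial>lborel)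
       = (\<Sum>j\<le>degree p. coeff p j * (Gamma (a + real j + 1) / 2))"
    unfolding eq by (subst Bochner_Integration.integral_sum) (simp_all add: weight_moment[OF a] integrable_mult_right)
qed

text \<open>All moments are Gamma values. Divided by the Gamma factors inside the coefficients they
  become rising factorials, and what is left is the alternating binomial sum above.\<close>

lemma lag_classical_moment:
  assumes a: "a > - 1" and mn: "m \<le> n"
  shows "(\<integral>x. laguerre_weight a x * (poly (lag_classical n a * monom 1 m) (x\<^sup>2) * exp (- x\<^sup>2)) \<partial>lborel)
    = (if m = n then (-1) ^ n * Gamma (real n + a + 1) / 2 else 0)"
proof -
  have eq: "laguerre_weight a x * (poly (lag_classical n a * monom 1 m) (x\<^sup>2) * exp (- x\<^sup>2))
     = (\<Sum>j\<le>n. lag_coeff n a j * (laguerre_weight a x * ((x\<^sup>2) ^ (j + m) * exp (- x\<^sup>2))))" for x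
    by (simp add: poly_altdef[of "lag_classical n a"] degree_lag_classical coeff_lag_classical poly_monom
        sum_distrib_left sum_distrib_right power_add mult_ac)
  have nz: "\<Gamma> > 0" if "\<Gamma> = Gamma (a + real j + 1)" for \<Gamma> j using a that by (simp add: Gamma_real_pos)
  have gb: "((real n + a) gchoose (n - j)) = Gamma (real n + a + 1) / (fact (n - j) * Gamma (a + real j + 1))" if "j \<le> n" for j
  proof -
    have "real n + a + 1 \<notin> \<int>\<^sub>\<le>\<^sub>0" using a by (auto elim!: nonpos_Ints_cases)
    then show ?thesis using gbinomial_Gamma[of "real n + a" "n - j"] that by (simp add: of_nat_diff algebra_simps)
  qed
  have poc: "Gamma (a + real (j + m) + 1) = pochhammer (a + 1 + real j) m * Gamma (a + real j + 1)" for j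
  proof -
    have "a + 1 + real j \<notin> \<int>\<^sub>\<le>\<^sub>0" using a by (auto elim!: nonpos_Ints_cases)
    from pochhammer_Gamma[OF this, of m] nz[OF refl, of j] show ?thesis by (simp add: field_simps add_ac)
  qed
  have "(\<integral>x. laguerre_weight a x * (poly (lag_classical n a * monom 1 m) (x\<^sup>2) * exp (- x\<^sup>2)) \<partial>lborel)
      = (\<Sum>j\<le>n. lag_coeff n a j * (Gamma (a + real (j + m) + 1) / 2))"
    unfolding eq by (subst Bochner_Integration.integral_sum) (simp_all add: weight_moment[OF a] integrable_mult_right del: of_nat_add)
  also have "\<dots> = (\<Sum>j\<le>n. Gamma (real n + a + 1) / (2 * fact n) * ((-1) ^ j * real (n choose j) * pochhammer (a + 1 + real j) m))"
  proof (intro sum.cong refl)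
    fix j assume "j \<in> {..n}"
    then have j: "j \<le> n" by simp
    show "lag_coeff n a j * (Gamma (a + real (j + m) + 1) / 2)
      = Gamma (real n + a + 1) / (2 * fact n) * ((-1) ^ j * real (n choose j) * pochhammer (a + 1 + real j) m)"
      using nz[OF refl, of j] j unfolding poc lag_coeff_def gb[OF j] binomial_fact[OF j]
      by (simp add: field_simps)
  qed
  finally have "(\<integral>x. laguerre_weight a x * (poly (lag_classical n a * monom 1 m) (x\<^sup>2) * exp (- x\<^sup>2)) \<partial>lborel)
     = Gamma (real n + a + 1) / (2 * fact n) * (\<Sum>j\<le>n. (-1) ^ j * real (n choose j) * pochhammer (a + 1 + real j) m)"
    by (simp add: sum_distrib_left)
  then show ?thesis using mn alternating_pochhammer_sum(1)[of m n "a + 1"] alternating_pochhammer_sum(2)[of n "a + 1"] by auto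
qed

lemma lag_orthonormal:
  assumes a: "a > - 1"
  shows "integrable lborel (\<lambda>x. laguerre_weight a x * (gauss_poly (lag_poly n a) x * gauss_poly (lag_poly m a) x))"
    and "(\<integral>x. laguerre_weight a x * (gauss_poly (lag_poly n a) x * gauss_poly (lag_poly m a) x) \<partial>lborel) = (if n = m then 1 else 0)"
proof -
  have eq: "laguerre_weight a x * (gauss_poly (lag_poly n a) x * gauss_poly (lag_poly m a) x)
    = (lag_const n a * lag_const m a) * (laguerre_weight a x * (poly (lag_classical n a * lag_classical m a) (x\<^sup>2) * exp (- x\<^sup>2)))" for x n m
  proof -
    have "exp (- x\<^sup>2 / 2) * exp (- x\<^sup>2 / 2) = exp (- x\<^sup>2)" by (simp add: exp_add[symmetric])
    then show ?thesis by (simp add: gauss_poly_def lag_poly_def poly_pcompose power2_eq_square)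
  qed
  show "integrable lborel (\<lambda>x. laguerre_weight a x * (gauss_poly (lag_poly n a) x * gauss_poly (lag_poly m a) x))"
    unfolding eq by (intro integrable_mult_right weight_poly a)
  \<comment> \<open>The polynomial of smaller degree is expanded in monomials, of which only the top
    one can contribute; the other case follows by symmetry.\<close>
  have main: "(\<integral>x. laguerre_weight a x * (gauss_poly (lag_poly n a) x * gauss_poly (lag_poly m a) x) \<partial>lborel) = (if n = m then 1 else 0)"
    if mn: "m \<le> n" for n m
  proof -
    have eq2: "laguerre_weight a x * (poly (lag_classical n a * lag_classical m a) (x\<^sup>2) * exp (- x\<^sup>2))
       = (\<Sum>j\<le>m. lag_coeff m a j * (laguerre_weight a x * (poly (lag_classical n a * monom 1 j) (x\<^sup>2) * exp (- x\<^sup>2))))" for x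
      by (simp add: poly_altdef[of "lag_classical m a"] degree_lag_classical coeff_lag_classical poly_monom
        sum_distrib_left sum_distrib_right mult_ac)
    have "(\<integral>x. laguerre_weight a x * (poly (lag_classical n a * lag_classical m a) (x\<^sup>2) * exp (- x\<^sup>2)) \<partial>lborel)
      = (\<Sum>j\<le>m. lag_coeff m a j * (\<integral>x. laguerre_weight a x * (poly (lag_classical n a * monom 1 j) (x\<^sup>2) * exp (- x\<^sup>2)) \<partial>lborel))"
      unfolding eq2 by (subst Bochner_Integration.integral_sum) (simp_all add: weight_poly[OF a] integrable_mult_right del: poly_mult)
    also have "\<dots> = (\<Sum>j\<le>m. if j = n then lag_coeff m a j * ((-1) ^ n * Gamma (real n + a + 1) / 2) else 0)"
      using mn by (intro sum.cong refl) (subst lag_classical_moment[OF a], auto)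
    also have "\<dots> = (if n = m then Gamma (real n + a + 1) / (2 * fact n) else 0)"
      using mn by (auto simp: sum.delta lag_coeff_def power_mult_distrib[symmetric])
    finally have "(\<integral>x. laguerre_weight a x * (gauss_poly (lag_poly n a) x * gauss_poly (lag_poly m a) x) \<partial>lborel)
      = lag_const n a * lag_const m a * (if n = m then Gamma (real n + a + 1) / (2 * fact n) else 0)"
      unfolding eq by simp
    moreover have "Gamma (real n + a + 1) > 0" using a by (simp add: Gamma_real_pos)
    ultimately show ?thesis by (auto simp: lag_const_def)
  qed
  show "(\<integral>x. laguerre_weight a x * (gauss_poly (lag_poly n a) x * gauss_poly (lag_poly m a) x) \<partial>lborel) = (if n = m then 1 else 0)"
    using main[of m n] main[of n m] by (cases "m \<le> n") (simp_all add: mult.commute)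
qed

text \<open>Derivatives are multiples of x times Laguerre polynomials of type \<open>a + 1\<close>,
  and the resulting x^2 turns the weight into that of type \<open>a + 1\<close>. The value 4n is the
  square of the factor 2 sqrt n.\<close>

lemma pderiv_lag_orthogonal:
  assumes a: "a > - 1"
  shows "integrable lborel (\<lambda>x. laguerre_weight a x * (gauss_poly (pderiv (lag_poly n a)) x * gauss_poly (pderiv (lag_poly m a)) x))"
    and "(\<integral>x. laguerre_weight a x * (gauss_poly (pderiv (lag_poly n a)) x * gauss_poly (pderiv (lag_poly m a)) x) \<partial>lborel) = (if n = m then 4 * real n else 0)"
proof -
  have "integrable lborel (\<lambda>x. laguerre_weight a x * (gauss_poly (pderiv (lag_poly n a)) x * gauss_poly (pderiv (lag_poly m a)) x)) \<and>
    (\<integral>x. laguerre_weight a x * (gauss_poly (pderiv (lag_poly n a)) x * gauss_poly (pderiv (lag_poly m a)) x) \<partial>lborel) = (if n = m then 4 * real n else 0)"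
  proof (cases "n = 0 \<or> m = 0")
    case True
    then show ?thesis by (auto simp: pderiv_lag_poly_0 gauss_poly_def)
  next
    case False
    then obtain n' m' where nm: "n = Suc n'" "m = Suc m'" by (meson not0_implies_Suc)
    have w: "laguerre_weight a x * (x * x) = laguerre_weight (a + 1) x" for x
    proof (cases "x > 0")
      case True
      have "x powr (2 * (a + 1) + 1) = x powr (2 * a + 1) * x powr 2" by (simp add: powr_add[symmetric] algebra_simps)
      then show ?thesis using True by (simp add: laguerre_weight_def power2_eq_square)
    qed (simp add: laguerre_weight_def)
    have eq: "laguerre_weight a x * (gauss_poly (pderiv (lag_poly n a)) x * gauss_poly (pderiv (lag_poly m a)) x)
       = (4 * sqrt n * sqrt m) * (laguerre_weight (a + 1) x * (gauss_poly (lag_poly n' (a + 1)) x * gauss_poly (lag_poly m' (a + 1)) x))" for x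
      unfolding nm pderiv_lag_poly_Suc w[symmetric] by (simp add: gauss_poly_def algebra_simps)
    have "a + 1 > - 1" using a by simp
    from lag_orthonormal[OF this, of n' m'] show ?thesis
      unfolding eq using nm real_sqrt_mult_self[of "real m"] by (auto intro: integrable_mult_right simp: mult.assoc)
  qed
  then show "integrable lborel (\<lambda>x. laguerre_weight a x * (gauss_poly (pderiv (lag_poly n a)) x * gauss_poly (pderiv (lag_poly m a)) x))"
    "(\<integral>x. laguerre_weight a x * (gauss_poly (pderiv (lag_poly n a)) x * gauss_poly (pderiv (lag_poly m a)) x) \<partial>lborel) = (if n = m then 4 * real n else 0)"
    by auto
qed

section \<open>Density of products\<close>

definition tensor :: "('n::finite \<Rightarrow> real \<Rightarrow> real) \<Rightarrow> real^'n \<Rightarrow> real" where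
  "tensor \<phi> x = (\<Prod>i\<in>UNIV. \<phi> i (x $ i))"

lemma tensor_upd: "tensor (\<phi>(j := \<psi>)) x = \<psi> (x $ j) * (\<Prod>i\<in>UNIV - {j}. \<phi> i (x $ i))"
  unfolding tensor_def by (subst prod.remove[of _ j]) (auto intro!: prod.cong)

definition lin_span :: "(real \<Rightarrow> real) set \<Rightarrow> (real \<Rightarrow> real) set" where
  "lin_span \<Phi> = {\<lambda>x. \<Sum>i\<in>I. c i * \<phi> i x | (I :: nat set) c \<phi>. finite I \<and> (\<forall>i\<in>I. \<phi> i \<in> \<Phi>)}"

lemma lin_spanI: "finite (I :: nat set) \<Longrightarrow> (\<And>i. i \<in> I \<Longrightarrow> \<phi> i \<in> \<Phi>) \<Longrightarrow> (\<lambda>x. \<Sum>i\<in>I. c i * \<phi> i x) \<in> lin_span \<Phi>"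
  unfolding lin_span_def by blast

lemma lin_span_superset: "\<phi> \<in> \<Phi> \<Longrightarrow> \<phi> \<in> lin_span \<Phi>"
  using lin_spanI[of "{0}" "\<lambda>_. \<phi>" \<Phi> "\<lambda>_. 1"] by simp

section \<open>Exponential series and Gaussian bounds\<close>

lemma exp_series_sums: "(\<lambda>n. \<Sum>j<n. (z::real) ^ j / fact j) \<longlonglongrightarrow> exp z"
  and exp_partial_le: "\<bar>\<Sum>j<n. z ^ j / fact j\<bar> \<le> exp \<bar>z\<bar>"
proof -
  have s: "(\<lambda>j. y ^ j / fact j) sums exp y" for y :: real
    using exp_converges[of y] by (simp add: scaleR_conv_of_real field_simps)
  from s[of z] show "(\<lambda>n. \<Sum>j<n. z ^ j / fact j) \<longlonglongrightarrow> exp z" by (simp add: sums_def)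
  have "\<bar>\<Sum>j<n. z ^ j / fact j\<bar> \<le> (\<Sum>j<n. \<bar>z\<bar> ^ j / fact j)"
    by (rule order_trans[OF sum_abs]) (simp add: power_abs)
  also have "\<dots> \<le> exp \<bar>z\<bar>"
    unfolding sums_unique[OF s] using s[of "\<bar>z\<bar>"] by (intro sum_le_suminf) (auto simp: sums_iff)
  finally show "\<bar>\<Sum>j<n. z ^ j / fact j\<bar> \<le> exp \<bar>z\<bar>" .
qed

lemma power_gauss_bounded:
  assumes "c > (0::real)"
  shows "\<exists>K\<ge>0. \<forall>x. \<bar>x\<bar> ^ n * exp (- c * x\<^sup>2) \<le> K"
proof -
  \<comment> \<open>The 1 serves \<bar>x\<bar> \<le> 1; the quotient comes from comparing exp (c
    x^2) with the n-th term of its series when \<bar>x\<bar> > 1.\<close>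
  define K where "K = 1 + fact n / c ^ n"
  have "\<bar>x\<bar> ^ n * exp (- c * x\<^sup>2) \<le> K" for x :: real
  proof -
    have e: "exp (- c * x\<^sup>2) \<le> 1" using assms by simp
    have K: "1 \<le> K" using assms by (simp add: K_def)
    show ?thesis
    proof (cases "\<bar>x\<bar> \<le> 1")
      case True
      then have "\<bar>x\<bar> ^ n * exp (- c * x\<^sup>2) \<le> 1 * 1"
        using e by (intro mult_mono) (auto simp: power_le_one)
      then show ?thesis using K by simp
    next
      case False
      have "(c * x\<^sup>2) ^ n / fact n \<le> exp (c * x\<^sup>2)"
      proof -
        have "(c * x\<^sup>2) ^ n / fact n \<le> (\<Sum>k<Suc n. (c * x\<^sup>2) ^ k / fact k)"
          using assms by (simp add: sum_nonneg)
        also have "\<dots> \<le> exp (c * x\<^sup>2)"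
          using exp_partial_le[of "c * x\<^sup>2" "Suc n"] assms by (simp add: sum_nonneg)
        finally show ?thesis .
      qed
      then have "c ^ n * (\<bar>x\<bar> ^ n * \<bar>x\<bar> ^ n) \<le> fact n * exp (c * x\<^sup>2)"
        by (simp add: field_simps power_mult_distrib power2_eq_square flip: power_mult_distrib)
      moreover have "\<bar>x\<bar> ^ n * 1 \<le> \<bar>x\<bar> ^ n * \<bar>x\<bar> ^ n"
        using False by (intro mult_left_mono one_le_power) auto
      ultimately have "c ^ n * \<bar>x\<bar> ^ n \<le> fact n * exp (c * x\<^sup>2)"
        using assms by (smt (verit, best) mult_left_mono zero_less_power)
      then have "\<bar>x\<bar> ^ n * exp (- c * x\<^sup>2) \<le> fact n / c ^ n"
        using assms by (simp add: exp_minus field_simps)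
      then show ?thesis by (simp add: K_def)
    qed
  qed
  moreover have "K \<ge> 0" using assms by (simp add: K_def)
  ultimately show ?thesis by blast
qed

lemma poly_gauss_bounded:
  assumes "c > 0"
  shows "\<exists>K\<ge>0. \<forall>x. \<bar>poly p (x::real)\<bar> * exp (- c * x\<^sup>2) \<le> K"
proof -
  obtain K where K: "\<And>n. K n \<ge> 0" "\<And>n x. \<bar>x\<bar> ^ n * exp (- c * x\<^sup>2) \<le> K n"
    using power_gauss_bounded[OF assms] by metis
  have "\<bar>poly p x\<bar> * exp (- c * x\<^sup>2) \<le> (\<Sum>n\<le>degree p. \<bar>coeff p n\<bar> * K n)" for x
  proof -
    have "\<bar>poly p x\<bar> \<le> (\<Sum>n\<le>degree p. \<bar>coeff p n\<bar> * \<bar>x\<bar> ^ n)"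
      unfolding poly_altdef by (rule order_trans[OF sum_abs]) (simp add: abs_mult power_abs)
    then have "\<bar>poly p x\<bar> * exp (- c * x\<^sup>2) \<le> (\<Sum>n\<le>degree p. \<bar>coeff p n\<bar> * \<bar>x\<bar> ^ n) * exp (- c * x\<^sup>2)"
      by (intro mult_right_mono) auto
    also have "\<dots> = (\<Sum>n\<le>degree p. \<bar>coeff p n\<bar> * (\<bar>x\<bar> ^ n * exp (- c * x\<^sup>2)))"
      by (simp add: sum_distrib_right mult.assoc)
    also have "\<dots> \<le> (\<Sum>n\<le>degree p. \<bar>coeff p n\<bar> * K n)"
      by (intro sum_mono mult_left_mono K) auto
    finally show ?thesis .
  qed
  moreover have "(\<Sum>n\<le>degree p. \<bar>coeff p n\<bar> * K n) \<ge> 0" using K by (intro sum_nonneg) auto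
  ultimately show ?thesis by blast
qed

text \<open>All Gaussians in use have rate at least 1/4. Half of that absorbs polynomial factors,
  and the remaining rate 1/8 is a common domination for everything.\<close>

definition gauss_bdd :: "(real \<Rightarrow> real) \<Rightarrow> bool" where
  "gauss_bdd \<phi> \<longleftrightarrow> \<phi> \<in> borel_measurable borel \<and> (\<exists>K\<ge>0. \<forall>x>0. \<bar>\<phi> x\<bar> \<le> K * exp (- (1/8) * x\<^sup>2))"

lemma gauss_poly_measurable [measurable]: "gauss_poly p \<in> borel_measurable borel"
  unfolding gauss_poly_def[abs_def] by (intro borel_measurable_continuous_onI continuous_intros) auto

lemma gauss_bdd_poly:
  assumes "c \<ge> 1/4"
  shows "\<exists>K\<ge>0. \<forall>x::real. \<bar>poly p x * exp (- c * x\<^sup>2)\<bar> \<le> K * exp (- (1/8) * x\<^sup>2)"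
proof -
  obtain K where K: "K \<ge> 0" "\<And>x. \<bar>poly p x\<bar> * exp (- (1/8) * x\<^sup>2) \<le> K"
    using poly_gauss_bounded[of "1/8" p] by auto
  have "\<bar>poly p x * exp (- c * x\<^sup>2)\<bar> \<le> K * exp (- (1/8) * x\<^sup>2)" for x
  proof -
    have "\<bar>poly p x * exp (- c * x\<^sup>2)\<bar> \<le> \<bar>poly p x\<bar> * exp (- (1/4) * x\<^sup>2)"
      using mult_right_mono[OF assms, of "x\<^sup>2"] by (auto simp: abs_mult intro!: mult_left_mono)
    also have "\<dots> = (\<bar>poly p x\<bar> * exp (- (1/8) * x\<^sup>2)) * exp (- (1/8) * x\<^sup>2)"
      by (simp add: mult.assoc exp_add[symmetric])
    also have "\<dots> \<le> K * exp (- (1/8) * x\<^sup>2)" by (intro mult_right_mono K) auto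
    finally show ?thesis .
  qed
  then show ?thesis using K by blast
qed

lemma gauss_in_Lp:
  fixes \<alpha> :: "real^'n"
  assumes "\<And>i. \<alpha> $ i > - 1" "q > 0"
  shows "in_Lp (laguerre_measure \<alpha>) q (\<lambda>x. K * exp (- (1/8) * (norm x)\<^sup>2))"
proof -
  have "(\<lambda>x::real^'n. exp (- (1/8) * (norm x)\<^sup>2)) \<in> borel_measurable borel" by measurable
  then have "in_Lp (laguerre_measure \<alpha>) q (\<lambda>x. exp (- (1/8) * (norm x)\<^sup>2))"
    unfolding in_Lp_def using gauss_integrable[of \<alpha> "q / 8"] assms
    by (simp add: measurable_laguerre_measure exp_powr_real mult.commute)
  then show ?thesis using in_Lp_scaleR[of "laguerre_measure \<alpha>" q "\<lambda>x. exp (- (1/8) * (norm x)\<^sup>2)" K] by simp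
qed

text \<open>
  Products of one-variable functions are approximated in stages, changing the class of admissible factors
  one coordinate at a time: monomials times \<open>exp (- x\<^sup>2 / 2)\<close>, then times faster Gaussians (by the exponential
  series, dominated for small rates), polynomials and continuous functions of \<open>exp (- x\<^sup>2 / 4)\<close>, and
  finally indicators of half-lines.  The coordinates in \<open>J\<close> carry an additional factor \<open>x\<close>.
\<close>

locale laguerre_density =
  fixes \<alpha> :: "real^'n" and q :: real and \<S> :: "(real^'n \<Rightarrow> real) set"
    and \<Phi>0 :: "'n \<Rightarrow> (real \<Rightarrow> real) set" and J :: "'n set"
  assumes \<alpha>: "\<And>i. \<alpha> $ i > - 1" and q: "q > 1"
    and S_zero: "(\<lambda>x. 0) \<in> \<S>"
    and S_add: "\<And>f g. f \<in> \<S> \<Longrightarrow> g \<in> \<S> \<Longrightarrow> (\<lambda>x. f x + g x) \<in> \<S>"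
    and S_scale: "\<And>f c. f \<in> \<S> \<Longrightarrow> (\<lambda>x. c * f x) \<in> \<S>"
    and \<Phi>0_bdd: "\<And>i \<phi>. \<phi> \<in> \<Phi>0 i \<Longrightarrow> gauss_bdd \<phi>"
    and \<Phi>0_tensor: "\<And>\<phi>. (\<And>i. \<phi> i \<in> \<Phi>0 i) \<Longrightarrow> tensor \<phi> \<in> \<S>"
    and \<Phi>0_span: "\<And>i m. (\<lambda>x. (if i \<in> J then x else 1) * x ^ (2 * m) * exp (- x\<^sup>2 / 2)) \<in> lin_span (\<Phi>0 i)"
begin

abbreviation M where "M \<equiv> laguerre_measure \<alpha>"

text \<open>Membership in the L^q closure of \<open>\<S>\<close>. The elements of
  \<open>\<S>\<close> may lie outside L^q, hence the explicit condition on \<open>g\<close>.\<close>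

definition approx :: "(real^'n \<Rightarrow> real) \<Rightarrow> bool" where
  "approx f \<longleftrightarrow> in_Lp M q f \<and> (\<forall>e>0. \<exists>g\<in>\<S>. in_Lp M q g \<and> Lp_norm M q (\<lambda>x. f x - g x) < e)"

lemma q0: "q > 0" using q by simp

lemma approx_zero: "approx (\<lambda>x. 0)"
  unfolding approx_def using S_zero by (auto intro!: bexI[of _ "\<lambda>x. 0"])

lemma approx_scale: "approx f \<Longrightarrow> approx (\<lambda>x. c * f x)"
  unfolding approx_def
proof (intro conjI allI impI)
  assume f: "in_Lp M q f \<and> (\<forall>e>0. \<exists>g\<in>\<S>. in_Lp M q g \<and> Lp_norm M q (\<lambda>x. f x - g x) < e)"
  then show "in_Lp M q (\<lambda>x. c * f x)" using in_Lp_scaleR[of M q f c] by simp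
  fix e :: real assume e: "e > 0"
  then obtain g where g: "g \<in> \<S>" "in_Lp M q g" "Lp_norm M q (\<lambda>x. f x - g x) < e / (\<bar>c\<bar> + 1)"
    using f by (metis abs_ge_zero add_nonneg_pos divide_pos_pos zero_less_one)
  have "Lp_norm M q (\<lambda>x. c * f x - c * g x) = \<bar>c\<bar> * Lp_norm M q (\<lambda>x. f x - g x)"
    using Lp_norm_scaleR[OF q0, of M c "\<lambda>x. f x - g x"] by (simp add: algebra_simps)
  also have "\<dots> \<le> (\<bar>c\<bar> + 1) * Lp_norm M q (\<lambda>x. f x - g x)" by (intro mult_right_mono) auto
  also have "\<dots> < e" using g by (simp add: field_simps)
  finally show "\<exists>g\<in>\<S>. in_Lp M q g \<and> Lp_norm M q (\<lambda>x. c * f x - g x) < e"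
    using S_scale[OF g(1), of c] in_Lp_scaleR[OF g(2), of c] by auto
qed

lemma approx_add: "approx f \<Longrightarrow> approx h \<Longrightarrow> approx (\<lambda>x. f x + h x)"
  unfolding approx_def
proof (intro conjI allI impI)
  assume f: "in_Lp M q f \<and> (\<forall>e>0. \<exists>g\<in>\<S>. in_Lp M q g \<and> Lp_norm M q (\<lambda>x. f x - g x) < e)"
    and h: "in_Lp M q h \<and> (\<forall>e>0. \<exists>g\<in>\<S>. in_Lp M q g \<and> Lp_norm M q (\<lambda>x. h x - g x) < e)"
  then show "in_Lp M q (\<lambda>x. f x + h x)" using q0 by (intro in_Lp_add) auto
  fix e :: real assume e: "e > 0"
  obtain g1 where g1: "g1 \<in> \<S>" "in_Lp M q g1" "Lp_norm M q (\<lambda>x. f x - g1 x) < e / 2"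
    using f e by (meson half_gt_zero)
  obtain g2 where g2: "g2 \<in> \<S>" "in_Lp M q g2" "Lp_norm M q (\<lambda>x. h x - g2 x) < e / 2"
    using h e by (meson half_gt_zero)
  have "Lp_norm M q (\<lambda>x. (f x - g1 x) + (h x - g2 x)) \<le> Lp_norm M q (\<lambda>x. f x - g1 x) + Lp_norm M q (\<lambda>x. h x - g2 x)"
    using f h g1 g2 q q0 by (intro Minkowski in_Lp_diff) auto
  then have "Lp_norm M q (\<lambda>x. (f x + h x) - (g1 x + g2 x)) < e"
    using g1 g2 by (simp add: algebra_simps)
  moreover have "in_Lp M q (\<lambda>x. g1 x + g2 x)" using g1 g2 q0 by (intro in_Lp_add) auto
  ultimately show "\<exists>g\<in>\<S>. in_Lp M q g \<and> Lp_norm M q (\<lambda>x. f x + h x - g x) < e"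
    using S_add[OF g1(1) g2(1)] by blast
qed

lemma approx_sum: "(\<And>i. i \<in> I \<Longrightarrow> approx (f i)) \<Longrightarrow> approx (\<lambda>x. \<Sum>i\<in>I. f i x)"
  by (induction I rule: infinite_finite_induct) (auto intro: approx_zero approx_add)

lemma approx_limit:
  assumes "in_Lp M q f" "(\<lambda>n. Lp_norm M q (\<lambda>x. fn n x - f x)) \<longlonglongrightarrow> 0" "\<And>n::nat. approx (fn n)"
  shows "approx f"
  unfolding approx_def
proof (intro conjI allI impI assms)
  fix e :: real assume e: "e > 0"
  then have "eventually (\<lambda>n. Lp_norm M q (\<lambda>x. fn n x - f x) < e / 2) sequentially"
    using assms(2) by (intro order_tendstoD(2)[of _ 0]) auto
  then obtain n where n: "Lp_norm M q (\<lambda>x. fn n x - f x) < e / 2" by (auto simp: eventually_sequentially)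
  obtain g where g: "g \<in> \<S>" "in_Lp M q g" "Lp_norm M q (\<lambda>x. fn n x - g x) < e / 2"
    using assms(3)[of n] e unfolding approx_def by (meson half_gt_zero)
  have "Lp_norm M q (\<lambda>x. f x - g x) \<le> Lp_norm M q (\<lambda>x. f x - fn n x) + Lp_norm M q (\<lambda>x. fn n x - g x)"
    using assms g q by (intro Minkowski_diff) (auto simp: approx_def)
  also have "\<dots> < e" using n g by (simp add: Lp_norm_minus_commute[of M q f])
  finally show "\<exists>g\<in>\<S>. in_Lp M q g \<and> Lp_norm M q (\<lambda>x. f x - g x) < e" using g by blast
qed

lemma approx_dominated:
  assumes "in_Lp M q D" "f \<in> borel_measurable M" "\<And>n::nat. approx (fn n)"
    and "\<And>x. x \<in> orthant \<Longrightarrow> (\<lambda>n. fn n x) \<longlonglongrightarrow> f x"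
    and "\<And>n x. x \<in> orthant \<Longrightarrow> \<bar>fn n x\<bar> \<le> \<bar>D x :: real\<bar>"
  shows "approx f"
proof -
  have m: "fn n \<in> borel_measurable M" for n using assms(3)[of n] by (auto simp: approx_def in_Lp_def)
  have a: "\<And>x. x \<in> space M \<Longrightarrow> (\<lambda>n. fn n x) \<longlonglongrightarrow> f x" using assms(4) by simp
  have b: "\<And>n x. x \<in> space M \<Longrightarrow> norm (fn n x) \<le> norm (D x)" using assms(5) by simp
  show ?thesis
    by (rule approx_limit[OF Lp_dominated_convergence(1)[OF q0 assms(1,2) m a b]
        Lp_dominated_convergence(3)[OF q0 assms(1,2) m a b] assms(3)])
qed

lemma approx_cong:
  assumes "\<And>x. x \<in> orthant \<Longrightarrow> f x = g x" "approx f"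
  shows "approx g"
proof -
  have "in_Lp M q f \<longleftrightarrow> in_Lp M q g" using assms by (intro in_Lp_cong) simp
  moreover have "Lp_norm M q (\<lambda>x. f x - h x) = Lp_norm M q (\<lambda>x. g x - h x)" for h
    using assms by (intro Lp_norm_cong) simp
  ultimately show ?thesis using assms(2) unfolding approx_def by simp
qed

lemma gauss_in_Lp_q: "in_Lp M q (\<lambda>x. K * exp (- (1/8) * (norm x)\<^sup>2))"
  by (intro gauss_in_Lp \<alpha> q0)

lemma tensor_measurable:
  assumes "\<And>i. \<phi> i \<in> borel_measurable borel"
  shows "tensor \<phi> \<in> borel_measurable M"
proof -
  note [measurable] = assms
  have "tensor \<phi> \<in> borel_measurable borel" unfolding tensor_def[abs_def] by measurable
  then show ?thesis by (rule measurable_laguerre_measure)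
qed

lemma tensor_bound:
  assumes "\<And>i x. x > 0 \<Longrightarrow> \<bar>\<phi> i x\<bar> \<le> K i * exp (- (1/8) * x\<^sup>2)" "x \<in> orthant"
  shows "\<bar>tensor \<phi> x\<bar> \<le> (\<Prod>i\<in>UNIV. K i) * exp (- (1/8) * (norm x)\<^sup>2)"
  unfolding tensor_def abs_prod gauss_prod prod.distrib[symmetric]
  using assms by (intro prod_mono) auto

definition good :: "('n \<Rightarrow> (real \<Rightarrow> real) set) \<Rightarrow> bool" where
  "good \<Phi> \<longleftrightarrow> (\<forall>i. \<forall>\<phi>\<in>\<Phi> i. gauss_bdd \<phi>) \<and> (\<forall>\<phi>. (\<forall>i. \<phi> i \<in> \<Phi> i) \<longrightarrow> approx (tensor \<phi>))"

definition limit_of :: "(real \<Rightarrow> real) set \<Rightarrow> (real \<Rightarrow> real) \<Rightarrow> bool" where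
  "limit_of \<Phi> \<psi> \<longleftrightarrow> \<psi> \<in> borel_measurable borel \<and>
    (\<exists>s K. (\<forall>n::nat. s n \<in> lin_span \<Phi>) \<and> (\<forall>x>0. (\<lambda>n. s n x) \<longlonglongrightarrow> \<psi> x)
       \<and> (\<forall>n. \<forall>x>0. \<bar>s n x\<bar> \<le> K * exp (- (1/8) * x\<^sup>2)))"

lemma limit_of_gauss_bdd: "limit_of \<Phi> \<psi> \<Longrightarrow> gauss_bdd \<psi>"
  unfolding limit_of_def gauss_bdd_def
proof (elim conjE exE, intro conjI)
  fix s K assume lim: "\<forall>x>0. (\<lambda>n. s n x) \<longlonglongrightarrow> \<psi> x" and b: "\<forall>n. \<forall>x>0. \<bar>s n x\<bar> \<le> K * exp (- (1/8) * x\<^sup>2)"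
  have "\<bar>\<psi> x\<bar> \<le> K * exp (- (1/8) * x\<^sup>2)" if "x > 0" for x
    using lim b that by (intro LIMSEQ_le_const2[OF tendsto_rabs[of "\<lambda>n. s n x" "\<psi> x"]]) auto
  moreover have "0 \<le> K * exp (- (1/8) * 1\<^sup>2)" using b by (meson abs_ge_zero order_trans zero_less_one)
  then have "K \<ge> 0" by (simp add: zero_le_mult_iff)
  ultimately show "\<exists>K\<ge>0. \<forall>x>0. \<bar>\<psi> x\<bar> \<le> K * exp (- (1/8) * x\<^sup>2)" by blast
qed

lemma lin_span_limit: 
  assumes "\<psi> \<in> lin_span \<Phi>" "\<And>\<phi>. \<phi> \<in> \<Phi> \<Longrightarrow> gauss_bdd \<phi>"
  shows "limit_of \<Phi> \<psi>"
proof -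
  obtain I :: "nat set" and c \<phi> where I: "finite I" "\<And>i. i \<in> I \<Longrightarrow> \<phi> i \<in> \<Phi>" "\<psi> = (\<lambda>x. \<Sum>i\<in>I. c i * \<phi> i x)"
    using assms(1) unfolding lin_span_def by blast
  have "\<forall>i\<in>I. \<exists>K\<ge>0. \<forall>x>0. \<bar>\<phi> i x\<bar> \<le> K * exp (- (1/8) * x\<^sup>2)"
    using I(2) assms(2) unfolding gauss_bdd_def by blast
  then obtain K where K: "\<And>i x. i \<in> I \<Longrightarrow> x > 0 \<Longrightarrow> \<bar>\<phi> i x\<bar> \<le> K i * exp (- (1/8) * x\<^sup>2)" by metis
  have "\<bar>\<psi> x\<bar> \<le> (\<Sum>i\<in>I. \<bar>c i\<bar> * K i) * exp (- (1/8) * x\<^sup>2)" if "x > 0" for x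
  proof -
    have "\<bar>\<psi> x\<bar> \<le> (\<Sum>i\<in>I. \<bar>c i\<bar> * \<bar>\<phi> i x\<bar>)"
      unfolding I(3) by (rule order_trans[OF sum_abs]) (simp add: abs_mult)
    also have "\<dots> \<le> (\<Sum>i\<in>I. \<bar>c i\<bar> * (K i * exp (- (1/8) * x\<^sup>2)))"
      using K that by (intro sum_mono mult_left_mono) auto
    also have "\<dots> = (\<Sum>i\<in>I. \<bar>c i\<bar> * K i) * exp (- (1/8) * x\<^sup>2)" by (simp add: sum_distrib_right mult.assoc)
    finally show ?thesis .
  qed
  moreover have "\<psi> \<in> borel_measurable borel"
    unfolding I(3) using I(2) assms(2) by (intro borel_measurable_sum borel_measurable_times) (auto simp: gauss_bdd_def)
  ultimately show ?thesis unfolding limit_of_def using assms(1)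
    by (intro conjI exI[of _ "\<lambda>_. \<psi>"] exI[of _ "\<Sum>i\<in>I. \<bar>c i\<bar> * K i"]) auto
qed

lemma approx_upd_span:
  assumes "\<And>\<eta>. \<eta> \<in> \<Phi> \<Longrightarrow> approx (tensor (\<phi>(j := \<eta>)))" "\<psi> \<in> lin_span \<Phi>"
  shows "approx (tensor (\<phi>(j := \<psi>)))"
proof -
  obtain I :: "nat set" and c \<eta> where I: "finite I" "\<And>i. i \<in> I \<Longrightarrow> \<eta> i \<in> \<Phi>" "\<psi> = (\<lambda>x. \<Sum>i\<in>I. c i * \<eta> i x)"
    using assms(2) unfolding lin_span_def by blast
  have eq: "tensor (\<phi>(j := \<psi>)) = (\<lambda>x. \<Sum>i\<in>I. c i * tensor (\<phi>(j := \<eta> i)) x)"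
    unfolding tensor_upd I(3) fun_eq_iff by (simp add: tensor_upd sum_distrib_right mult.assoc)
  show ?thesis unfolding eq using assms(1) I(2) by (intro approx_sum approx_scale) auto
qed

lemma good_upgrade:
  assumes good: "good \<Phi>" and lim: "\<And>i \<psi>. \<psi> \<in> \<Psi> i \<Longrightarrow> limit_of (\<Phi> i) \<psi>"
  shows "good \<Psi>"
proof -
  have bdd: "gauss_bdd \<psi>" if "\<psi> \<in> \<Phi> i \<or> \<psi> \<in> \<Psi> i" for i \<psi>
    using that good limit_of_gauss_bdd[OF lim] by (auto simp: good_def)
  \<comment> \<open>\<open>S\<close> collects the coordinates already upgraded. Stating the claim
    for mixed tuples lets the induction hypothesis cover every approximant of the next
    factor.\<close>
  have "\<forall>\<phi>. (\<forall>i\<in>S. \<phi> i \<in> \<Psi> i) \<and> (\<forall>i\<in>-S. \<phi> i \<in> \<Phi> i) \<longrightarrow> approx (tensor \<phi>)" for S :: "'n set"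
    using finite[of S]
  proof (induction S rule: finite_induct)
    case empty
    then show ?case using good by (auto simp: good_def)
  next
    case (insert j S)
    show ?case
    proof (intro allI impI)
      fix \<phi> assume \<phi>: "(\<forall>i\<in>insert j S. \<phi> i \<in> \<Psi> i) \<and> (\<forall>i\<in>-insert j S. \<phi> i \<in> \<Phi> i)"
      have step: "approx (tensor (\<phi>(j := \<eta>)))" if "\<eta> \<in> \<Phi> j" for \<eta>
      proof -
        have "(\<forall>i\<in>S. (\<phi>(j := \<eta>)) i \<in> \<Psi> i) \<and> (\<forall>i\<in>-S. (\<phi>(j := \<eta>)) i \<in> \<Phi> i)"
          using that \<phi> insert.hyps(2) by auto
        then show ?thesis using insert.IH by blast
      qed
      have bd: "gauss_bdd (\<phi> i)" for i using \<phi> bdd[of "\<phi> i" i] by auto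
      then have "\<forall>i. \<exists>K\<ge>0. \<forall>x>0. \<bar>\<phi> i x\<bar> \<le> K * exp (- (1/8) * x\<^sup>2)" unfolding gauss_bdd_def by blast
      then obtain K where K: "\<And>i x. x > 0 \<Longrightarrow> \<bar>\<phi> i x\<bar> \<le> K i * exp (- (1/8) * x\<^sup>2)" by metis
      have "limit_of (\<Phi> j) (\<phi> j)" using \<phi> lim by auto
      then obtain s Kj where s: "\<And>n::nat. s n \<in> lin_span (\<Phi> j)" "\<And>x. x > 0 \<Longrightarrow> (\<lambda>n. s n x) \<longlonglongrightarrow> \<phi> j x"
        "\<And>n x. x > 0 \<Longrightarrow> \<bar>s n x\<bar> \<le> Kj * exp (- (1/8) * x\<^sup>2)" unfolding limit_of_def by blast
      define K' where "K' = (\<Prod>i\<in>UNIV. (K(j := Kj)) i)"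
      show "approx (tensor \<phi>)"
      proof (rule approx_dominated[of "\<lambda>x. K' * exp (- (1/8) * (norm x)\<^sup>2)" _ "\<lambda>n. tensor (\<phi>(j := s n))"])
        show "in_Lp M q (\<lambda>x. K' * exp (- (1/8) * (norm x)\<^sup>2))" by (rule gauss_in_Lp_q)
        show "tensor \<phi> \<in> borel_measurable M" using bd by (intro tensor_measurable) (auto simp: gauss_bdd_def)
        show "approx (tensor (\<phi>(j := s n)))" for n using approx_upd_span[OF step s(1)] .
        show "(\<lambda>n. tensor (\<phi>(j := s n)) x) \<longlonglongrightarrow> tensor \<phi> x" if "x \<in> orthant" for x
        proof -
          have "tensor \<phi> x = tensor (\<phi>(j := \<phi> j)) x" by simp
          then show ?thesis unfolding tensor_upd using that by (auto intro!: tendsto_intros s(2))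
        qed
        show "\<bar>tensor (\<phi>(j := s n)) x\<bar> \<le> \<bar>K' * exp (- (1/8) * (norm x)\<^sup>2)\<bar>" if "x \<in> orthant" for n x
        proof -
          have "\<bar>tensor (\<phi>(j := s n)) x\<bar> \<le> K' * exp (- (1/8) * (norm x)\<^sup>2)"
            unfolding K'_def using that K s(3) by (intro tensor_bound) auto
          then show ?thesis by linarith
        qed
      qed
    qed
  qed
  from this[of UNIV] have "\<And>\<phi>. (\<forall>i. \<phi> i \<in> \<Psi> i) \<Longrightarrow> approx (tensor \<phi>)" by simp
  with bdd show ?thesis unfolding good_def by blast
qed

lemma good_\<Phi>0: "good \<Phi>0"
  unfolding good_def approx_def
proof (intro conjI allI impI ballI)
  fix \<phi> assume \<phi>: "\<forall>i. \<phi> i \<in> \<Phi>0 i"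
  have bd: "gauss_bdd (\<phi> i)" for i using \<phi> \<Phi>0_bdd by auto
  then have "\<forall>i. \<exists>K\<ge>0. \<forall>x>0. \<bar>\<phi> i x\<bar> \<le> K * exp (- (1/8) * x\<^sup>2)" unfolding gauss_bdd_def by blast
  then obtain K where K: "\<And>i x. x > 0 \<Longrightarrow> \<bar>\<phi> i x\<bar> \<le> K i * exp (- (1/8) * x\<^sup>2)" by metis
  show i: "in_Lp M q (tensor \<phi>)"
  proof (rule in_Lp_bound[OF gauss_in_Lp_q[of "\<Prod>i\<in>UNIV. K i"] _ q0, of _ 1])
    show "tensor \<phi> \<in> borel_measurable M" using bd by (intro tensor_measurable) (auto simp: gauss_bdd_def)
    show "AE x in M. norm (tensor \<phi> x) \<le> 1 * norm ((\<Prod>i\<in>UNIV. K i) * exp (- (1/8) * (norm x)\<^sup>2))"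
      using tensor_bound[of \<phi> K, OF K] by (intro AE_I2) (smt (verit) real_norm_def space_laguerre_measure)
  qed
  show "\<exists>g\<in>\<S>. in_Lp M q g \<and> Lp_norm M q (\<lambda>x. tensor \<phi> x - g x) < e" if "e > 0" for e
    using \<Phi>0_tensor[of \<phi>] \<phi> i that by (intro bexI[of _ "tensor \<phi>"]) auto
qed (use \<Phi>0_bdd in auto)

definition mon :: "'n \<Rightarrow> real \<Rightarrow> real" where "mon i x = (if i \<in> J then x else 1)"

text \<open>The rate grows in steps of 1/4: from a rate of at least 1/2 the partial sums of the
  series for exp (- x^2 / 4) are dominated by exp (x^2 / 4), which still leaves decay of rate at
  least 1/4. A long jump would destroy the domination.\<close>

definition \<Phi>2 :: "nat \<Rightarrow> 'n \<Rightarrow> (real \<Rightarrow> real) set" where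
  "\<Phi>2 N i = {\<lambda>x. mon i x * x ^ (2 * m) * exp (- (1/2 + real N' / 4) * x\<^sup>2) | m N'. N' \<le> N}"

lemma \<Phi>2_mem: "N' \<le> N \<Longrightarrow> (\<lambda>x. mon i x * x ^ (2 * m) * exp (- (1/2 + real N' / 4) * x\<^sup>2)) \<in> \<Phi>2 N i"
  unfolding \<Phi>2_def by blast

lemma mon_poly: "mon i x * x ^ m = poly (monom 1 (m + (if i \<in> J then 1 else 0))) x"
  by (simp add: mon_def poly_monom)

lemma mon_exp_bdd:
  assumes "c \<ge> 1/4"
  shows "\<exists>K\<ge>0. \<forall>x. \<bar>mon i x * x ^ m * exp (- c * x\<^sup>2)\<bar> \<le> K * exp (- (1/8) * x\<^sup>2)"
  unfolding mon_poly by (rule gauss_bdd_poly[OF assms])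

lemma mon_measurable [measurable]: "mon i \<in> borel_measurable borel"
  unfolding mon_def[abs_def] by simp

lemma good_\<Phi>2: "good (\<Phi>2 N)"
proof (induction N)
  case 0
  show ?case
  proof (rule good_upgrade[OF good_\<Phi>0])
    fix i \<psi> assume "\<psi> \<in> \<Phi>2 0 i"
    then obtain m where "\<psi> = (\<lambda>x. mon i x * x ^ (2 * m) * exp (- (1/2 + real 0 / 4) * x\<^sup>2))"
      unfolding \<Phi>2_def by auto
    then have "\<psi> = (\<lambda>x. (if i \<in> J then x else 1) * x ^ (2 * m) * exp (- x\<^sup>2 / 2))"
      by (simp add: mon_def)
    then show "limit_of (\<Phi>0 i) \<psi>" using \<Phi>0_span[of i m] \<Phi>0_bdd by (intro lin_span_limit) auto
  qed
next
  case (Suc N)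
  show ?case
  proof (rule good_upgrade[OF Suc])
    fix i \<psi> assume "\<psi> \<in> \<Phi>2 (Suc N) i"
    then obtain m N' where \<psi>: "N' \<le> Suc N" "\<psi> = (\<lambda>x. mon i x * x ^ (2 * m) * exp (- (1/2 + real N' / 4) * x\<^sup>2))"
      unfolding \<Phi>2_def by auto
    show "limit_of (\<Phi>2 N i) \<psi>"
    proof (cases "N' \<le> N")
      case True
      then have "\<psi> \<in> \<Phi>2 N i" using \<psi> by (auto simp: \<Phi>2_def)
      then show ?thesis using Suc by (intro lin_span_limit lin_span_superset) (auto simp: good_def)
    next
      case False
      then have N': "N' = Suc N" using \<psi> by simp
      define b where "b = 1/2 + real N / 4"
      define s where "s n x = (\<Sum>j<n. ((-1/4) ^ j / fact j) * (mon i x * x ^ (2 * (m + j)) * exp (- b * x\<^sup>2)))" for n x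
      have s_eq: "s n x = (mon i x * x ^ (2 * m) * exp (- b * x\<^sup>2)) * (\<Sum>j<n. (- x\<^sup>2 / 4) ^ j / fact j)" for n x
      proof -
        have "(-1/4 :: real) ^ j * (x ^ (2 * j)) = (- x\<^sup>2 / 4) ^ j" for j
          by (simp add: power_mult flip: power_mult_distrib)
        then show ?thesis unfolding s_def sum_distrib_left
          by (intro sum.cong refl) (simp add: power_add mult_ac distrib_left)
      qed
      have mem: "s n \<in> lin_span (\<Phi>2 N i)" for n
        unfolding s_def[abs_def] b_def by (intro lin_spanI \<Phi>2_mem) auto
      have lim: "(\<lambda>n. s n x) \<longlonglongrightarrow> \<psi> x" for x
      proof -
        have "(\<lambda>n. s n x) \<longlonglongrightarrow> (mon i x * x ^ (2 * m) * exp (- b * x\<^sup>2)) * exp (- x\<^sup>2 / 4)"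
          unfolding s_eq by (intro tendsto_intros exp_series_sums)
        also have "(mon i x * x ^ (2 * m) * exp (- b * x\<^sup>2)) * exp (- x\<^sup>2 / 4) = \<psi> x"
          by (simp add: \<psi> N' b_def mult.assoc exp_add[symmetric] algebra_simps)
        finally show ?thesis .
      qed
      obtain K where K: "\<And>x. \<bar>mon i x * x ^ (2 * m) * exp (- (1/4) * x\<^sup>2)\<bar> \<le> K * exp (- (1/8) * x\<^sup>2)"
        using mon_exp_bdd[of "1/4" i "2 * m"] by auto
      have bd: "\<bar>s n x\<bar> \<le> K * exp (- (1/8) * x\<^sup>2)" for n x
      proof -
        have "\<bar>s n x\<bar> \<le> \<bar>mon i x * x ^ (2 * m) * exp (- b * x\<^sup>2)\<bar> * exp \<bar>- x\<^sup>2 / 4\<bar>"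
          unfolding s_eq abs_mult by (intro mult_left_mono exp_partial_le) auto
        also have "\<dots> = \<bar>mon i x * x ^ (2 * m)\<bar> * exp (x\<^sup>2 / 4 - b * x\<^sup>2)"
          by (simp add: abs_mult mult.assoc exp_add[symmetric])
        also have "\<dots> \<le> \<bar>mon i x * x ^ (2 * m)\<bar> * exp (- (1/4) * x\<^sup>2)"
        proof (intro mult_left_mono iffD2[OF exp_le_cancel_iff])
          have "1/2 * x\<^sup>2 \<le> b * x\<^sup>2" by (intro mult_right_mono) (auto simp: b_def)
          then show "x\<^sup>2 / 4 - b * x\<^sup>2 \<le> - (1/4) * x\<^sup>2" by simp
        qed auto
        also have "\<dots> \<le> K * exp (- (1/8) * x\<^sup>2)" using K[of x] by (simp add: abs_mult)
        finally show ?thesis .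
      qed
      have "\<psi> \<in> borel_measurable borel" unfolding \<psi> by measurable
      then show ?thesis unfolding limit_of_def using mem lim bd by blast
    qed
  qed
qed

text \<open>The map from x to exp (- x^2 / 4) identifies the half-line with the interval (0,1), and
  its powers are the available Gaussian steps. Polynomials \<open>h\<close> are thus covered, and
  the Weierstrass theorem on [0,1] applies.\<close>

definition cexp :: "(real \<Rightarrow> real) \<Rightarrow> 'n \<Rightarrow> real \<Rightarrow> real" where
  "cexp h i x = mon i x * exp (- x\<^sup>2 / 2) * h (exp (- x\<^sup>2 / 4))"

lemma cexp_bound:
  "\<exists>K\<ge>0. \<forall>h B x. B \<ge> 0 \<longrightarrow> \<bar>h (exp (- x\<^sup>2 / 4))\<bar> \<le> B \<longrightarrow> \<bar>cexp h i x\<bar> \<le> (K * B) * exp (- (1/8) * x\<^sup>2)"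
proof -
  obtain K where K: "K \<ge> 0" "\<And>x. \<bar>mon i x * x ^ 0 * exp (- (1/2) * x\<^sup>2)\<bar> \<le> K * exp (- (1/8) * x\<^sup>2)"
    using mon_exp_bdd[of "1/2" i 0] by auto
  have "\<bar>cexp h i x\<bar> \<le> (K * B) * exp (- (1/8) * x\<^sup>2)" if "B \<ge> 0" "\<bar>h (exp (- x\<^sup>2 / 4))\<bar> \<le> B" for h B x
  proof -
    have "\<bar>cexp h i x\<bar> = \<bar>mon i x * x ^ 0 * exp (- (1/2) * x\<^sup>2)\<bar> * \<bar>h (exp (- x\<^sup>2 / 4))\<bar>"
      by (simp add: cexp_def abs_mult)
    also have "\<dots> \<le> (K * exp (- (1/8) * x\<^sup>2)) * B" using that K by (intro mult_mono) auto
    finally show ?thesis by (simp add: mult_ac)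
  qed
  then show ?thesis using K(1) by blast
qed

definition \<Phi>3 :: "'n \<Rightarrow> (real \<Rightarrow> real) set" where
  "\<Phi>3 i = {cexp (\<lambda>z. \<Sum>j\<le>n. a j * z ^ j) i | a n. True}"

lemma good_\<Phi>3: "good \<Phi>3"
proof -
  define \<Psi> where "\<Psi> N i = {cexp (\<lambda>z. \<Sum>j\<le>n. a j * z ^ j) i | a n. n \<le> N}" for N i
  have g: "good (\<Psi> N)" for N
  proof (rule good_upgrade[OF good_\<Phi>2[of N]])
    fix i \<psi> assume "\<psi> \<in> \<Psi> N i"
    then obtain a n where \<psi>: "n \<le> N" "\<psi> = cexp (\<lambda>z. \<Sum>j\<le>n. a j * z ^ j) i" by (auto simp: \<Psi>_def)
    have "\<psi> = (\<lambda>x. \<Sum>j\<le>n. a j * (mon i x * x ^ (2 * 0) * exp (- (1/2 + real j / 4) * x\<^sup>2)))"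
    proof
      fix x
      have "exp (- x\<^sup>2 / 2) * exp (- x\<^sup>2 / 4) ^ j = exp (- (1/2 + real j / 4) * x\<^sup>2)" for j
        by (simp add: exp_of_nat_mult[symmetric] exp_add[symmetric] algebra_simps)
      then show "\<psi> x = (\<Sum>j\<le>n. a j * (mon i x * x ^ (2 * 0) * exp (- (1/2 + real j / 4) * x\<^sup>2)))"
        by (simp add: \<psi> cexp_def sum_distrib_left mult_ac)
    qed
    moreover have "(\<lambda>x. \<Sum>j\<le>n. a j * (mon i x * x ^ (2 * 0) * exp (- (1/2 + real j / 4) * x\<^sup>2))) \<in> lin_span (\<Phi>2 N i)"
      using \<psi>(1) by (intro lin_spanI[of "{..n}"] \<Phi>2_mem) auto
    ultimately have "\<psi> \<in> lin_span (\<Phi>2 N i)" by simp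
    then show "limit_of (\<Phi>2 N i) \<psi>"
      using good_\<Phi>2[of N] by (intro lin_span_limit) (auto simp: good_def)
  qed
  have sub: "\<exists>N. \<psi> \<in> \<Psi> N i" if "\<psi> \<in> \<Phi>3 i" for i \<psi>
    using that unfolding \<Psi>_def \<Phi>3_def by blast
  show ?thesis unfolding good_def
  proof (intro conjI allI ballI impI)
    show "gauss_bdd \<psi>" if "\<psi> \<in> \<Phi>3 i" for i \<psi> using sub[OF that] g by (auto simp: good_def)
    fix \<phi> assume "\<forall>i. \<phi> i \<in> \<Phi>3 i"
    then have "\<forall>i. \<exists>N. \<phi> i \<in> \<Psi> N i" using sub by blast
    then obtain N where N: "\<And>i. \<phi> i \<in> \<Psi> (N i) i" by metis
    \<comment> \<open>Each factor has its own degree; finitely many coordinates admit a common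
      bound, so one stage of the construction contains the whole tuple.\<close>
    define m where "m = Max (range N)"
    have "\<phi> i \<in> \<Psi> m i" for i
    proof -
      have "N i \<le> m" by (simp add: m_def)
      then show ?thesis using N[of i] unfolding \<Psi>_def by fastforce
    qed
    then show "approx (tensor \<phi>)" using g[of m] by (auto simp: good_def)
  qed
qed

definition \<Phi>4 :: "'n \<Rightarrow> (real \<Rightarrow> real) set" where
  "\<Phi>4 i = {cexp h i | h. continuous_on UNIV h}"

lemma good_\<Phi>4: "good \<Phi>4"
proof (rule good_upgrade[OF good_\<Phi>3])
  fix i \<psi> assume "\<psi> \<in> \<Phi>4 i"
  then obtain h where h: "continuous_on UNIV h" "\<psi> = cexp h i" by (auto simp: \<Phi>4_def)
  have hc: "continuous_on {0..1} h" using h continuous_on_subset by blast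
  have "\<forall>n. \<exists>g. real_polynomial_function g \<and> (\<forall>z\<in>{0..1}. \<bar>h z - g z\<bar> < 1 / real (Suc n))"
  proof
    fix n
    show "\<exists>g. real_polynomial_function g \<and> (\<forall>z\<in>{0..1}. \<bar>h z - g z\<bar> < 1 / real (Suc n))"
      by (rule Stone_Weierstrass_real_polynomial_function[OF compact_Icc hc, of "1 / real (Suc n)"]) auto
  qed
  then obtain g where g: "\<And>n. real_polynomial_function (g n)" "\<And>n z. z \<in> {0..1} \<Longrightarrow> \<bar>h z - g n z\<bar> < 1 / real (Suc n)"
    by metis
  obtain B where B: "\<And>z. z \<in> {0..1} \<Longrightarrow> \<bar>h z\<bar> \<le> B"
  proof -
    obtain B where "\<forall>y\<in>h ` {0..1}. norm y \<le> B"
      using compact_imp_bounded[OF compact_continuous_image[OF hc compact_Icc]] unfolding bounded_iff by blast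
    then have "\<bar>h z\<bar> \<le> B" if "z \<in> {0..1}" for z using that by simp
    then show ?thesis using that by blast
  qed
  have B0: "B \<ge> 0" using B[of 0] by simp
  have gB: "\<bar>g n z\<bar> \<le> B + 1" if "z \<in> {0..1}" for n z
  proof -
    have "1 / real (Suc n) \<le> 1" by simp
    then show ?thesis using g(2)[OF that, of n] B[OF that] by linarith
  qed
  have gl: "(\<lambda>n. g n z) \<longlonglongrightarrow> h z" if "z \<in> {0..1}" for z
  proof -
    have "(\<lambda>n. h z - g n z) \<longlonglongrightarrow> 0"
    proof (rule tendsto_rabs_zero_cancel, rule tendsto_sandwich[of "\<lambda>_. 0" _ _ "\<lambda>n. 1 / real (Suc n)"])
      show "(\<lambda>n. 1 / real (Suc n)) \<longlonglongrightarrow> 0" by (rule LIMSEQ_Suc[OF lim_1_over_n])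
      show "\<forall>\<^sub>F n in sequentially. \<bar>h z - g n z\<bar> \<le> 1 / real (Suc n)"
        using g(2)[OF that] by (auto intro!: always_eventually less_imp_le)
    qed auto
    from tendsto_diff[OF tendsto_const[of "h z"] this] show ?thesis by simp
  qed
  obtain K where K: "K \<ge> 0" "\<And>h B x. B \<ge> 0 \<Longrightarrow> \<bar>h (exp (- x\<^sup>2 / 4))\<bar> \<le> B \<Longrightarrow> \<bar>cexp h i x\<bar> \<le> (K * B) * exp (- (1/8) * x\<^sup>2)"
    using cexp_bound[of i] by blast
  have z01: "exp (- x\<^sup>2 / 4) \<in> {0..1}" for x :: real by simp
  have "\<psi> \<in> borel_measurable borel"
  proof -
    have [measurable]: "h \<in> borel_measurable borel" using h by (intro borel_measurable_continuous_onI)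
    show ?thesis unfolding h cexp_def[abs_def] by measurable
  qed
  moreover have "cexp (g n) i \<in> lin_span (\<Phi>3 i)" for n
  proof -
    obtain a m where "g n = (\<lambda>z. \<Sum>j\<le>m. a j * z ^ j)"
      using g(1)[of n] unfolding real_polynomial_function_iff_sum by blast
    then show ?thesis by (intro lin_span_superset) (auto simp: \<Phi>3_def)
  qed
  moreover have "(\<lambda>n. cexp (g n) i x) \<longlonglongrightarrow> \<psi> x" for x
    unfolding h cexp_def by (intro tendsto_intros gl z01)
  moreover have "\<bar>cexp (g n) i x\<bar> \<le> (K * (B + 1)) * exp (- (1/8) * x\<^sup>2)" for n x
    using gB[OF z01] B0 by (intro K) auto
  ultimately show "limit_of (\<Phi>3 i) \<psi>" unfolding limit_of_def
    by (intro conjI exI[of _ "\<lambda>n. cexp (g n) i"] exI[of _ "K * (B + 1)"]) auto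
qed

definition \<Phi>5 :: "'n \<Rightarrow> (real \<Rightarrow> real) set" where
  "\<Phi>5 i = {\<lambda>x. mon i x * exp (- x\<^sup>2 / 2) * indicator {..a} x | a. True}"

lemma good_\<Phi>5: "good \<Phi>5"
proof (rule good_upgrade[OF good_\<Phi>4])
  fix i \<psi> assume "\<psi> \<in> \<Phi>5 i"
  then obtain a where \<psi>: "\<psi> = (\<lambda>x. mon i x * exp (- x\<^sup>2 / 2) * indicator {..a} x)" by (auto simp: \<Phi>5_def)
  \<comment> \<open>For a \<le> 0 no positive x lies in the half-line; the value 2 is out of reach
    of exp (- x^2 / 4) and makes the limit vanish.\<close>
  define c where "c = (if a > 0 then exp (- a\<^sup>2 / 4) else 2)"
  \<comment> \<open>Ramps of slope n that are 1 from \<open>c\<close> on and tend to 0 at every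
    point below \<open>c\<close>.\<close>
  define h where "h n z = max 0 (min 1 (1 + real n * (z - c)))" for n z
  obtain K where K: "K \<ge> 0" "\<And>h B x. B \<ge> 0 \<Longrightarrow> \<bar>h (exp (- x\<^sup>2 / 4))\<bar> \<le> B \<Longrightarrow> \<bar>cexp h i x\<bar> \<le> (K * B) * exp (- (1/8) * x\<^sup>2)"
    using cexp_bound[of i] by blast
  have hl: "(\<lambda>n. h n z) \<longlonglongrightarrow> (if z \<ge> c then 1 else 0)" for z
  proof (cases "z \<ge> c")
    case True
    then have "h n z = 1" for n by (simp add: h_def)
    then show ?thesis using True by simp
  next
    case False
    obtain N :: nat where N: "1 / (c - z) < N" using reals_Archimedean2 by blast
    have "h n z = 0" if "n \<ge> N" for n
    proof -
      have "1 / (c - z) \<le> n" using N that by linarith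
      then have "1 \<le> n * (c - z)" using False by (simp add: field_simps)
      then show ?thesis by (simp add: h_def algebra_simps)
    qed
    then have "eventually (\<lambda>n. h n z = (if z \<ge> c then 1 else 0)) sequentially"
      using False by (auto simp: eventually_sequentially)
    then show ?thesis by (rule tendsto_eventually)
  qed
  have ind: "indicator {..a} x = (if exp (- x\<^sup>2 / 4) \<ge> c then 1 else 0 :: real)" if "x > 0" for x
  proof (cases "a > 0")
    case True
    have "x \<le> a \<longleftrightarrow> x\<^sup>2 \<le> a\<^sup>2" using True that by (simp add: power_mono_iff)
    then show ?thesis using True by (auto simp: c_def)
  next
    case False
    have "exp (- x\<^sup>2 / 4) < 2" by (rule le_less_trans[of _ 1]) auto
    then show ?thesis using False that by (auto simp: c_def)
  qed
  have "\<psi> \<in> borel_measurable borel" unfolding \<psi> by measurable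
  moreover have "cexp (h n) i \<in> lin_span (\<Phi>4 i)" for n
  proof -
    have "continuous_on UNIV (h n)" unfolding h_def by (intro continuous_intros)
    then show ?thesis by (intro lin_span_superset) (auto simp: \<Phi>4_def)
  qed
  moreover have "(\<lambda>n. cexp (h n) i x) \<longlonglongrightarrow> \<psi> x" if "x > 0" for x
    unfolding \<psi> cexp_def ind[OF that] by (intro tendsto_intros hl)
  moreover have "\<bar>cexp (h n) i x\<bar> \<le> (K * 1) * exp (- (1/8) * x\<^sup>2)" for n x
    by (intro K) (auto simp: h_def)
  ultimately show "limit_of (\<Phi>4 i) \<psi>" unfolding limit_of_def
    by (intro conjI exI[of _ "\<lambda>n. cexp (h n) i"] exI[of _ "K * 1"]) auto
qed

text \<open>A strictly positive profile in L^q. Indicators of Borel sets need not belong to L^q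
  since the measure is infinite, but their products with \<open>W\<close> do.\<close>

definition W :: "real^'n \<Rightarrow> real" where
  "W x = (\<Prod>i\<in>UNIV. mon i (x $ i) * exp (- (x $ i)\<^sup>2 / 2))"

lemma W_pos: "x \<in> orthant \<Longrightarrow> W x > 0"
  unfolding W_def by (intro prod_pos) (auto simp: mon_def)

lemma W_measurable [measurable]: "W \<in> borel_measurable borel"
  unfolding W_def[abs_def] by measurable

lemma approx_box: "approx (\<lambda>x. W x * indicator {..a} x)"
proof -
  define \<phi> where "\<phi> i = (\<lambda>x. mon i x * exp (- x\<^sup>2 / 2) * indicator {..a $ i} x)" for i
  have "\<phi> i \<in> \<Phi>5 i" for i unfolding \<phi>_def \<Phi>5_def by blast
  then have "approx (tensor \<phi>)" using good_\<Phi>5 unfolding good_def by blast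
  moreover have "tensor \<phi> x = W x * indicator {..a} x" for x
  proof -
    have "indicator {..a} x = (\<Prod>i\<in>UNIV. indicator {..a $ i} (x $ i) :: real)"
    proof (cases "x \<le> a")
      case False
      then obtain i where "\<not> x $ i \<le> a $ i" by (auto simp: less_eq_vec_def)
      then have "(\<Prod>i\<in>UNIV. indicator {..a $ i} (x $ i) :: real) = 0"
        by (intro prod_zero bexI[of _ i]) auto
      then show ?thesis using False by simp
    qed (auto simp: less_eq_vec_def)
    then show ?thesis by (simp add: tensor_def \<phi>_def W_def prod.distrib)
  qed
  ultimately show ?thesis by (auto intro: approx_cong[of "tensor \<phi>"])
qed

lemma W_in_Lp: "in_Lp M q W"
  and approx_W: "approx W"
proof -
  have "\<forall>i. \<exists>K\<ge>0. \<forall>x. \<bar>mon i x * x ^ 0 * exp (- (1/2) * x\<^sup>2)\<bar> \<le> K * exp (- (1/8) * x\<^sup>2)"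
    using mon_exp_bdd[of "1/2" _ 0] by auto
  then obtain K where K: "\<And>i x. \<bar>mon i x * x ^ 0 * exp (- (1/2) * x\<^sup>2)\<bar> \<le> K i * exp (- (1/8) * x\<^sup>2)" by metis
  have Wt: "W = tensor (\<lambda>i x. mon i x * x ^ 0 * exp (- (1/2) * x\<^sup>2))" by (simp add: W_def tensor_def fun_eq_iff)
  have b: "\<bar>W x\<bar> \<le> (\<Prod>i\<in>UNIV. K i) * exp (- (1/8) * (norm x)\<^sup>2)" if "x \<in> orthant" for x
    unfolding Wt using that K by (intro tensor_bound)
  have Wm: "W \<in> borel_measurable M" by (intro measurable_laguerre_measure) measurable
  show L: "in_Lp M q W"
    using b by (intro in_Lp_bound[OF gauss_in_Lp_q[of "\<Prod>i\<in>UNIV. K i"] Wm q0, of 1] AE_I2) force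
  show "approx W"
  proof (rule approx_dominated[OF L Wm, of "\<lambda>n x. W x * indicator {..\<chi> i. real n} x"])
    show "approx (\<lambda>x. W x * indicator {..\<chi> i. real n} x)" for n by (rule approx_box)
    fix x :: "real^'n" assume x: "x \<in> orthant"
    obtain N :: nat where N: "norm x \<le> N" using real_arch_simple by blast
    have "x \<in> {..\<chi> i. real n}" if "n \<ge> N" for n
      using component_le_norm_cart[of x] N that by (auto simp: less_eq_vec_def) (smt (verit) of_nat_mono)
    then have "eventually (\<lambda>n. W x * indicator {..\<chi> i. real n} x = W x) sequentially"
      unfolding eventually_sequentially by (intro exI[of _ N]) simp
    then show "(\<lambda>n. W x * indicator {..\<chi> i. real n} x) \<longlonglongrightarrow> W x" by (rule tendsto_eventually)
    show "\<bar>W x * indicator {..\<chi> i. real n} x\<bar> \<le> \<bar>W x\<bar>" for n by (auto simp: indicator_def)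
  qed
qed

text \<open>A Dynkin argument: the lower orthants are stable under intersection and generate the
  Borel sets, complements use the approximability of \<open>W\<close>, and disjoint unions use
  dominated convergence under \<open>W\<close>.\<close>

lemma approx_indicator:
  assumes "A \<in> sets borel"
  shows "approx (\<lambda>x. W x * indicator A x)"
proof -
  let ?E = "range (atMost :: real^'n \<Rightarrow> _)"
  have "Int_stable ?E"
  proof (rule Int_stableI, elim rangeE, clarify)
    fix a b :: "real^'n"
    have "{..a} \<inter> {..b} = {..inf a b}" by auto
    then show "{..a} \<inter> {..b} \<in> ?E" by blast
  qed
  moreover have "?E \<subseteq> Pow UNIV" by simp
  moreover have "A \<in> sigma_sets UNIV ?E"
    using assms unfolding borel_eq_atMost by simp
  ultimately show ?thesis
  proof (induction rule: sigma_sets_induct_disjoint)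
    case (basic A)
    then show ?case using approx_box by auto
  next
    case empty
    then show ?case using approx_zero by simp
  next
    case (compl A)
    have "approx (\<lambda>x. W x + (-1) * (W x * indicator A x))"
      by (intro approx_add approx_scale approx_W compl)
    moreover have "W x + (-1) * (W x * indicator A x) = W x * indicator (UNIV - A) x" for x
      by (auto simp: indicator_def)
    ultimately show ?case by simp
  next
    case (union A)
    have Am: "A i \<in> sets borel" for i using union.hyps(2) unfolding borel_eq_atMost by auto
    show ?case
    proof (rule approx_dominated[OF W_in_Lp, of _ "\<lambda>n x. \<Sum>i<n. W x * indicator (A i) x"])
      show "(\<lambda>x. W x * indicator (\<Union>i. A i) x) \<in> borel_measurable M"
        using Am by (intro measurable_laguerre_measure borel_measurable_times W_measurable borel_measurable_indicator sets.countable_UN) auto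
      show "approx (\<lambda>x. \<Sum>i<n. W x * indicator (A i) x)" for n by (intro approx_sum union.IH)
      have eq: "(\<Sum>i<n. W x * indicator (A i) x) = W x * indicator (\<Union>i<n. A i) x" for n x
        by (subst indicator_UN_disjoint) (use union.hyps(1) in \<open>auto simp: sum_distrib_left disjoint_family_on_def\<close>)
      show "\<bar>\<Sum>i<n. W x * indicator (A i) x\<bar> \<le> \<bar>W x\<bar>" for n x
        unfolding eq by (auto simp: indicator_def)
      show "(\<lambda>n. \<Sum>i<n. W x * indicator (A i) x) \<longlonglongrightarrow> W x * indicator (\<Union>i. A i) x" for x
        unfolding eq by (intro tendsto_intros LIMSEQ_indicator_UN)
    qed
  qed
qed

text \<open>Simple functions are chosen for f / W, with modulus at most twice that of f / W;
  multiplication by the positive \<open>W\<close> returns to \<open>f\<close> with an L^q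
  domination.\<close>

theorem approx_all:
  assumes f: "in_Lp M q f"
  shows "approx f"
proof -
  have fm: "f \<in> borel_measurable M" using f by (simp add: in_Lp_def)
  have Wm: "W \<in> borel_measurable M" by (intro measurable_laguerre_measure) measurable
  have "(\<lambda>x. f x / W x) \<in> borel_measurable M" using fm Wm by measurable
  from borel_measurable_implies_sequence_metric[OF this, of 0]
  obtain F where F: "\<And>n. simple_function M (F n)" "\<And>x. x \<in> space M \<Longrightarrow> (\<lambda>n. F n x) \<longlonglongrightarrow> f x / W x"
    "\<And>n x. x \<in> space M \<Longrightarrow> dist (F n x) 0 \<le> 2 * dist (f x / W x) 0" by blast
  show ?thesis
  proof (rule approx_dominated[of "\<lambda>x. 2 * f x", OF _ fm, of "\<lambda>n x. W x * F n x"])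
    show "in_Lp M q (\<lambda>x. 2 * f x)" using in_Lp_scaleR[OF f, of 2] by simp
    fix n and x :: "real^'n" assume x: "x \<in> orthant"
    have "\<bar>W x\<bar> * \<bar>F n x\<bar> \<le> \<bar>W x\<bar> * (2 * \<bar>f x / W x\<bar>)" using F(3)[of x n] x by (intro mult_left_mono) auto
    then show "\<bar>W x * F n x\<bar> \<le> \<bar>2 * f x\<bar>" using W_pos[OF x] by (simp add: abs_mult)
  next
    fix x :: "real^'n" assume x: "x \<in> orthant"
    have "(\<lambda>n. W x * F n x) \<longlonglongrightarrow> W x * (f x / W x)" using F(2) x by (intro tendsto_intros) auto
    then show "(\<lambda>n. W x * F n x) \<longlonglongrightarrow> f x" using W_pos[OF x] by simp
  next
    fix n
    have fin: "finite (F n ` orthant)" using F(1)[of n] by (simp add: simple_function_def)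
    \<comment> \<open>The level sets are measurable in the restricted space only, so they are
      replaced by Borel sets with the same trace on the orthant.\<close>
    have "\<exists>B\<in>sets borel. F n -` {y} \<inter> orthant = B \<inter> orthant" if "y \<in> F n ` orthant" for y
    proof -
      have "F n -` {y} \<inter> orthant \<in> sets M" using F(1)[of n] that by (auto simp: simple_function_def)
      then show ?thesis by (auto simp: sets_laguerre_measure sets_restrict_space)
    qed
    then obtain B where B: "\<And>y. y \<in> F n ` orthant \<Longrightarrow> B y \<in> sets borel"
      "\<And>y. y \<in> F n ` orthant \<Longrightarrow> F n -` {y} \<inter> orthant = B y \<inter> orthant" by metis
    have "approx (\<lambda>x. \<Sum>y\<in>F n ` orthant. y * (W x * indicator (B y) x))"
      using B(1) by (intro approx_sum approx_scale approx_indicator)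
    then show "approx (\<lambda>x. W x * F n x)"
    proof (rule approx_cong[rotated])
      fix x :: "real^'n" assume x: "x \<in> orthant"
      have "(\<Sum>y\<in>F n ` orthant. y * (W x * indicator (B y) x)) = (\<Sum>y\<in>F n ` orthant. if y = F n x then y * W x else 0)"
      proof (intro sum.cong refl)
        fix y assume y: "y \<in> F n ` orthant"
        have "x \<in> B y \<longleftrightarrow> F n x = y" using B(2)[OF y] x by blast
        then show "y * (W x * indicator (B y) x) = (if y = F n x then y * W x else 0)" by (auto simp: indicator_def)
      qed
      also have "\<dots> = W x * F n x" using fin x by (subst sum.delta) auto
      finally show "(\<Sum>y\<in>F n ` orthant. y * (W x * indicator (B y) x)) = W x * F n x" .
    qed
  qed
qed

end

section \<open>The Bellman function\<close>

lemma powr_add_le_add_powr: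
  fixes x y r :: real
  assumes "x \<ge> 0" "y \<ge> 0" "0 < r" "r \<le> 1"
  shows "(x + y) powr r \<le> x powr r + y powr r"
proof (cases "x + y = 0")
  case False
  define s where "s = x + y"
  have s: "s > 0" using False assms by (simp add: s_def)
  have *: "z / s \<le> (z / s) powr r" if "0 \<le> z" "z \<le> s" for z
    using that s assms powr_mono'[of r 1 "z / s"] by (simp add: divide_le_eq)
  have "1 = x / s + y / s" using s by (simp add: s_def add_divide_distrib[symmetric])
  also have "\<dots> \<le> (x / s) powr r + (y / s) powr r"
    using *[of x] *[of y] assms s_def by auto
  also have "\<dots> = (x powr r + y powr r) / s powr r"
    using s assms by (simp add: powr_divide add_divide_distrib)
  finally show ?thesis using s unfolding s_def[symmetric] by (simp add: field_simps)
qed (use assms in auto)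

text \<open>The exponent \<open>th\<close> is fixed by th p = p - 2 and th q = 2 - q: with w the sum
  of \<bar>\<xi>\<bar>^p and \<bar>\<eta>\<bar>^q, the power \<open>w powr th\<close> is comparable
  to the larger of \<bar>\<xi>\<bar>^(p-2) and \<bar>\<eta>\<bar>^(2-q).\<close>

locale bellman =
  fixes p q th kap :: real
  assumes p2: "p \<ge> 2"
  defines "q \<equiv> p / (p - 1)" and "th \<equiv> 1 - 2 / p" and "kap \<equiv> (q - 1) / 8"
begin

lemma q_bounds: "1 < q" "q \<le> 2" "0 \<le> th" "th < 1" "th * q = 2 - q" "th * p = p - 2" "0 < kap" "kap \<le> 1 / 8"
    "(1 - th) * p = 2" "(q - 1) * p = q" "(q - 1) * (p - 1) = 1" "(1 - th) * q = 2 * (q - 1)"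
  using p2 unfolding q_def th_def kap_def by (auto simp: field_simps)

text \<open>
  \<open>X\<close> and \<open>Y\<close> are squared radii, so that \<open>P\<close> and \<open>R\<close>, twice the partial derivatives of \<open>B\<close>, are the radial
  derivatives divided by the radii.  The factor \<open>X * w X Y powr th\<close> is a smooth replacement of the truncated
  term \<open>\<bar>\<xi>\<bar>\<^sup>2 \<bar>\<eta>\<bar>\<^bsup>2 - q\<^esup>\<close> of Nazarov and Treil.
\<close>

definition w where "w X Y = X powr (p / 2) + Y powr (q / 2)"
definition B where "B X Y = kap * X * w X Y powr th + Y powr (q / 2)"
definition P where "P X Y = kap * w X Y powr (th - 1) * (p * X powr (p / 2) + 2 * Y powr (q / 2))"
definition R where "R X Y = q * (Y powr (q / 2) / Y) * (1 + kap * th * X * w X Y powr (th - 1))"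
text \<open>The partial derivatives of \<open>P\<close> and \<open>R\<close>; both come from
  \<open>B\<close>, so the mixed one, \<open>PY\<close>, is also the derivative of \<open>R\<close>
  in X. Writing \<open>Y powr (q / 2) / Y\<close> for one more power keeps every formula rational in
  X, Y and a few powers.\<close>

definition PX where "PX X Y = kap * (p - 2) * w X Y powr (th - 2) * X powr (p / 2) * (p * X powr (p / 2) + (p + 2) * Y powr (q / 2)) / (2 * X)"
definition PY where "PY X Y = kap * th * q * Y powr (q / 2) * (Y powr (q / 2) / Y) * w X Y powr (th - 2)"
definition RY where "RY X Y = q * (Y powr (q / 2) / Y) * ((q - 2) + kap * th * X * w X Y powr (th - 2) * ((q - 2) * X powr (p / 2) - q * Y powr (q / 2))) / (2 * Y)"

lemma w_pos: "X > 0 \<Longrightarrow> Y > 0 \<Longrightarrow> w X Y > 0"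
  by (simp add: w_def add_pos_pos)

lemma powr_pred:
  fixes z r :: real
  assumes "z > 0"
  shows "z powr (r - 1) = z powr r / z"
  using assms by (simp add: powr_diff)

lemma w_powr:
  assumes "X > 0" "Y > 0"
  shows "w X Y powr (th - 1) = w X Y powr (th - 2) * w X Y" "w X Y powr th = w X Y powr (th - 2) * (w X Y)\<^sup>2"
proof -
  have "w X Y > 0" using assms by (rule w_pos)
  then show "w X Y powr (th - 1) = w X Y powr (th - 2) * w X Y" "w X Y powr th = w X Y powr (th - 2) * (w X Y)\<^sup>2"
    using powr_add[of "w X Y" "th - 2" 1] powr_add[of "w X Y" "th - 2" 2] by (simp_all add: powr_numeral)
qed

section \<open>Derivatives of the Bellman function along a curve\<close>

context
  fixes f g :: "real \<Rightarrow> real" and f' g' s :: real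
  assumes f: "(f has_real_derivative f') (at s)" and g: "(g has_real_derivative g') (at s)"
    and fg: "f s > 0" "g s > 0"
begin

lemma DERIV_powr_at:
  assumes h: "(h has_real_derivative h') (at s)" "h s > 0"
  shows "((\<lambda>t. h t powr r) has_real_derivative r * (h s powr r / h s) * h') (at s)"
  using DERIV_fun_powr[OF h, of r] unfolding of_nat_1 powr_pred[OF h(2), of r] .

lemma DERIV_w: "((\<lambda>t. w (f t) (g t)) has_real_derivative
    (p / 2 * (f s powr (p / 2) / f s) * f' + q / 2 * (g s powr (q / 2) / g s) * g')) (at s)"
  unfolding w_def by (intro DERIV_add DERIV_powr_at f g fg)

lemma DERIV_B: "((\<lambda>t. B (f t) (g t)) has_real_derivative (P (f s) (g s) * f' + R (f s) (g s) * g') / 2) (at s)"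
proof -
  define X Y a b where "X = f s" and "Y = g s" and "a = X powr (p / 2)" and "b = Y powr (q / 2)"
  have pos: "X > 0" "Y > 0" "w X Y > 0" using fg w_pos by (auto simp: X_def Y_def)
  note n = X_def[symmetric] Y_def[symmetric] a_def[symmetric] b_def[symmetric]
  \<comment> \<open>Expressed by \<open>z\<close>, the occurring powers of the sum a + b are
    polynomial; what remains is rational algebra together with th p = p - 2.\<close>
  define z where "z = w X Y powr (th - 2)"
  note z = w_powr[OF pos(1,2), folded z_def]
  have wab: "w X Y = a + b" by (simp add: w_def a_def b_def)
  note zz = z[unfolded wab]
  have wp: "w (f s) (g s) > 0" using pos n by simp
  have D: "((\<lambda>t. B (f t) (g t)) has_real_derivative
     ((kap * f') * w X Y powr th + (th * (w X Y powr th / w X Y) * (p / 2 * (a / X) * f' + q / 2 * (b / Y) * g')) * (kap * X))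
        + q / 2 * (b / Y) * g') (at s)"
    unfolding B_def using DERIV_add[OF DERIV_mult[OF DERIV_cmult[OF f, of kap] DERIV_powr_at[OF DERIV_w wp, of th]]
      DERIV_powr_at[OF g fg(2), of "q / 2"]] by (simp add: n)
  have ne: "X \<noteq> 0" "Y \<noteq> 0" "a + b \<noteq> 0" using pos wab by auto
  have thp: "th * p = p - 2" by (rule q_bounds)
  have 1: "w X Y powr th / w X Y = z * (a + b)" using ne by (simp add: zz wab power2_eq_square)
  have "kap * f' * (z * (a + b)\<^sup>2) + th * (z * (a + b)) * (p / 2 * (a / X) * f' + q / 2 * (b / Y) * g') * (kap * X) + q / 2 * (b / Y) * g'
     = (kap * (z * (a + b)) * (2 * (a + b) + (th * p) * a) * f' + q * (b / Y) * (1 + kap * th * X * (z * (a + b))) * g') / 2"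
    using ne by (simp add: field_simps power2_eq_square)
  also have "\<dots> = (P X Y * f' + R X Y * g') / 2"
    unfolding P_def R_def n wab zz thp by (simp add: algebra_simps)
  finally have "kap * f' * (z * (a + b)\<^sup>2) + th * (z * (a + b)) * (p / 2 * (a / X) * f' + q / 2 * (b / Y) * g') * (kap * X) + q / 2 * (b / Y) * g'
     = (P X Y * f' + R X Y * g') / 2" .
  with D show ?thesis unfolding 1 unfolding wab zz n by (simp only:)
qed

lemma DERIV_P: "((\<lambda>t. P (f t) (g t)) has_real_derivative (PX (f s) (g s) * f' + PY (f s) (g s) * g')) (at s)"
proof -
  define X Y a b where "X = f s" and "Y = g s" and "a = X powr (p / 2)" and "b = Y powr (q / 2)"
  have pos: "X > 0" "Y > 0" "w X Y > 0" using fg w_pos by (auto simp: X_def Y_def)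
  note n = X_def[symmetric] Y_def[symmetric] a_def[symmetric] b_def[symmetric]
  define z where "z = w X Y powr (th - 2)"
  note z = w_powr[OF pos(1,2), folded z_def]
  have wab: "w X Y = a + b" by (simp add: w_def a_def b_def)
  note zz = z[unfolded wab]
  have wp: "w (f s) (g s) > 0" using pos n by simp
  have ne: "X \<noteq> 0" "Y \<noteq> 0" "a + b \<noteq> 0" using pos wab by auto
  have 1: "w X Y powr (th - 1) / w X Y = z" using ne by (simp add: zz wab)
  have D: "((\<lambda>t. P (f t) (g t)) has_real_derivative
     (kap * ((th - 1) * z * (p / 2 * (a / X) * f' + q / 2 * (b / Y) * g'))) * (p * a + 2 * b)
       + (p * (p / 2 * (a / X) * f') + 2 * (q / 2 * (b / Y) * g')) * (kap * w X Y powr (th - 1))) (at s)"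
    unfolding P_def using DERIV_mult[OF DERIV_cmult[OF DERIV_powr_at[OF DERIV_w wp, of "th - 1"], of kap]
        DERIV_add[OF DERIV_cmult[OF DERIV_powr_at[OF f fg(1), of "p / 2"], of p] DERIV_cmult[OF DERIV_powr_at[OF g fg(2), of "q / 2"], of 2]]]
    by (simp add: n 1)
  have thp: "(1 - th) * p = 2" by (rule q_bounds)
  have "kap * ((th - 1) * z * (p / 2 * (a / X) * f' + q / 2 * (b / Y) * g')) * (p * a + 2 * b)
       + (p * (p / 2 * (a / X) * f') + 2 * (q / 2 * (b / Y) * g')) * (kap * (z * (a + b)))
     = kap * z * a * (p * p * (a + b) - ((1 - th) * p) * (p * a + 2 * b)) / (2 * X) * f'
       + kap * z * q * (b / Y) * (2 * a + 2 * b - ((1 - th) * p) * a - 2 * (1 - th) * b) / 2 * g'"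
    using ne by (simp add: field_simps)
  also have "\<dots> = PX X Y * f' + PY X Y * g'"
    unfolding PX_def PY_def n z_def[symmetric] thp by (simp add: field_simps)
  finally show ?thesis using D unfolding wab zz n by simp
qed

lemma DERIV_R: "((\<lambda>t. R (f t) (g t)) has_real_derivative (PY (f s) (g s) * f' + RY (f s) (g s) * g')) (at s)"
proof -
  define X Y a b where "X = f s" and "Y = g s" and "a = X powr (p / 2)" and "b = Y powr (q / 2)"
  have pos: "X > 0" "Y > 0" "w X Y > 0" using fg w_pos by (auto simp: X_def Y_def)
  note n = X_def[symmetric] Y_def[symmetric] a_def[symmetric] b_def[symmetric]
  define z where "z = w X Y powr (th - 2)"
  note z = w_powr[OF pos(1,2), folded z_def]
  have wab: "w X Y = a + b" by (simp add: w_def a_def b_def)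
  note zz = z[unfolded wab]
  have wp: "w (f s) (g s) > 0" using pos n by simp
  have ne: "X \<noteq> 0" "Y \<noteq> 0" "a + b \<noteq> 0" "g s \<noteq> 0" using pos wab n by auto
  have 1: "w X Y powr (th - 1) / w X Y = z" using ne by (simp add: zz wab)
  have D: "((\<lambda>t. R (f t) (g t)) has_real_derivative
     (q * ((q / 2 * (b / Y) * g' * Y - b * g') / (Y * Y))) * (1 + kap * th * X * w X Y powr (th - 1))
       + ((kap * th * f') * w X Y powr (th - 1) + ((th - 1) * z * (p / 2 * (a / X) * f' + q / 2 * (b / Y) * g')) * (kap * th * X)) * (q * (b / Y))) (at s)"
    unfolding R_def using DERIV_mult[OF DERIV_cmult[OF DERIV_divide[OF DERIV_powr_at[OF g fg(2), of "q / 2"] g ne(4)], of q]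
        DERIV_add[OF DERIV_const[of 1] DERIV_mult[OF DERIV_cmult[OF f, of "kap * th"] DERIV_powr_at[OF DERIV_w wp, of "th - 1"]]]]
    by (simp add: n 1)
  have thp: "(1 - th) * p = 2" and thq: "(1 - th) * q = 2 * (q - 1)" by (rule q_bounds)+
  have "(q * ((q / 2 * (b / Y) * g' * Y - b * g') / (Y * Y))) * (1 + kap * th * X * (z * (a + b)))
       + ((kap * th * f') * (z * (a + b)) + ((th - 1) * z * (p / 2 * (a / X) * f' + q / 2 * (b / Y) * g')) * (kap * th * X)) * (q * (b / Y))
     = kap * th * q * (b / Y) * z * (2 * (a + b) - ((1 - th) * p) * a) / 2 * f'
       + q * (b / Y) * ((q - 2) + kap * th * X * z * ((q - 2) * (a + b) - ((1 - th) * q) * b)) / (2 * Y) * g'"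
    using ne by (simp add: field_simps)
  also have "\<dots> = PY X Y * f' + RY X Y * g'"
    unfolding RY_def PY_def n z_def[symmetric] thp thq by (simp add: field_simps)
  finally show ?thesis using D unfolding wab zz n by simp
qed

end

text \<open>\<open>w powr th\<close> is the weight that balances the two gradients. The bounds for
  \<open>P\<close> and \<open>R\<close> also let the potential terms join the energy. The third
  bound holds because Y^(1 - q/2) is the power th of Y^(q/2), hence at most
  \<open>w powr th\<close>.\<close>

lemma tau_bounds:
  assumes "X > 0" "Y > 0"
  shows "2 * kap * w X Y powr th \<le> P X Y" "kap / w X Y powr th \<le> R X Y"
    "1 / w X Y powr th \<le> Y powr (q / 2) / Y" "0 < w X Y powr th"
proof -
  define a b where "a = X powr (p / 2)" and "b = Y powr (q / 2)"
  have pos: "a > 0" "b > 0" "w X Y > 0" using assms w_pos by (auto simp: a_def b_def)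
  define z where "z = w X Y powr (th - 2)"
  note z = w_powr[OF assms, folded z_def]
  have z0: "z > 0" using pos by (simp add: z_def)
  have wab: "w X Y = a + b" by (simp add: w_def a_def b_def)
  note zz = z[unfolded wab]
  note q = q_bounds
  have "2 * kap * (z * (a + b)\<^sup>2) \<le> kap * (z * (a + b)) * (p * a + 2 * b)"
  proof -
    have "kap * (z * (a + b)) * (2 * (a + b)) \<le> kap * (z * (a + b)) * (p * a + 2 * b)"
      using q p2 pos z0 by (intro mult_left_mono) auto
    then show ?thesis by (simp add: algebra_simps power2_eq_square)
  qed
  then show "2 * kap * w X Y powr th \<le> P X Y"
    unfolding P_def a_def[symmetric] b_def[symmetric] wab zz .
  show "0 < w X Y powr th" using pos by simp
  have "Y / b = Y powr (1 - q / 2)" using assms by (simp add: powr_diff b_def)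
  also have "1 - q / 2 = (q / 2) * th" using q by (simp add: mult.commute)
  also have "Y powr ((q / 2) * th) = b powr th" by (simp add: b_def powr_powr)
  also have "\<dots> \<le> w X Y powr th" using pos q unfolding wab by (intro powr_mono2) auto
  finally have *: "Y / b \<le> w X Y powr th" .
  then show **: "1 / w X Y powr th \<le> Y powr (q / 2) / Y"
    unfolding b_def[symmetric] using pos assms \<open>0 < w X Y powr th\<close> by (simp add: field_simps)
  have "kap / w X Y powr th = kap * (1 / w X Y powr th)" by simp
  also have "\<dots> \<le> q * (b / Y)"
    using ** q pos assms unfolding b_def[symmetric] by (intro mult_mono) auto
  also have "\<dots> \<le> q * (b / Y) * (1 + kap * th * X * w X Y powr (th - 1))"
    using mult_left_mono[of 1 "1 + kap * th * X * w X Y powr (th - 1)" "q * (b / Y)"] q pos assms by simp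
  finally show "kap / w X Y powr th \<le> R X Y" by (simp add: R_def b_def)
qed

text \<open>The radial second derivative in the first variable is nonnegative and is dropped; in the second variable
  it is negative and is absorbed, together with the mixed term, using \<open>kap \<le> (q - 1) / 8\<close>.\<close>

lemma hessian_lower_bound:
  assumes XY: "X > 0" "Y > 0" and AD: "A \<ge> 0" "D \<ge> 0"
    and x1: "x1\<^sup>2 \<le> 4 * X * A" and y1: "y1\<^sup>2 \<le> 4 * Y * D"
  shows "kap * (w X Y powr th * A + D / w X Y powr th)
    \<le> (PX X Y * x1\<^sup>2 + 2 * PY X Y * x1 * y1 + RY X Y * y1\<^sup>2) / 2 + P X Y * A + R X Y * D"
proof -
  \<comment> \<open>X and Y are thought of as shifted squared lengths of vectors moving with squared
    speeds A and D, and x1, y1 as the derivatives of X and Y; the assumptions on x1 and y1 are then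
    Cauchy-Schwarz.\<close>
  define a b where "a = X powr (p / 2)" and "b = Y powr (q / 2)"
  have pos: "a > 0" "b > 0" "w X Y > 0" using XY w_pos by (auto simp: a_def b_def)
  define z where "z = w X Y powr (th - 2)"
  note z = w_powr[OF XY, folded z_def]
  have z0: "z > 0" using pos by (simp add: z_def)
  have wab: "w X Y = a + b" by (simp add: w_def a_def b_def)
  note zz = z[unfolded wab]
  note n = a_def[symmetric] b_def[symmetric] z_def[symmetric]
  note q = q_bounds
  define t where "t = w X Y powr th"
  have t: "t = z * (a + b)\<^sup>2" "t > 0" using zz pos z0 by (auto simp: t_def wab)
  define m where "m = b / Y"
  have m: "m > 0" "1 / t \<le> m" using tau_bounds(3)[OF XY] pos XY by (auto simp: m_def b_def t_def)
  \<comment> \<open>X is the power 1 - th of \<open>a\<close> and so never exceeds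
    \<open>w powr (1 - th)\<close>. This single bound controls all perturbations caused by the
    \<open>kap\<close> term.\<close>
  have Xz: "X * z * (a + b) \<le> 1"
  proof -
    have "X = a powr (1 - th)" using XY q by (simp add: a_def powr_powr mult.commute th_def)
    also have "\<dots> \<le> w X Y powr (1 - th)" using pos q unfolding wab by (intro powr_mono2) auto
    also have "\<dots> = 1 / w X Y powr (th - 1)" using pos by (simp add: powr_minus_divide[symmetric])
    finally have "X \<le> 1 / (z * (a + b))" unfolding wab zz .
    then have "X * (z * (a + b)) \<le> 1" using pos z0 by (simp add: pos_le_divide_eq)
    then show ?thesis by (simp add: mult.assoc)
  qed
  have "0 \<le> PX X Y"
    using q p2 pos z0 XY unfolding PX_def n by (intro divide_nonneg_pos mult_nonneg_nonneg) auto
  then have i1: "0 \<le> PX X Y * x1\<^sup>2 / 2" by simp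
  have RY: "2 * Y * RY X Y = q * m * ((q - 2) + kap * th * X * z * ((q - 2) * a - q * b))"
    using XY by (simp add: RY_def n m_def)
  have neg: "(q - 2) + kap * th * X * z * ((q - 2) * a - q * b) \<le> 0"
  proof -
    have "(q - 2) * a - q * b \<le> 0" using q pos by (smt (verit) mult_nonneg_nonneg mult_nonpos_nonneg)
    then have "kap * th * X * z * ((q - 2) * a - q * b) \<le> 0"
      using q XY z0 by (intro mult_nonneg_nonpos) auto
    then show ?thesis using q by simp
  qed
  have RY0: "RY X Y \<le> 0"
  proof -
    have "2 * Y * RY X Y \<le> 0" unfolding RY using neg q m by (intro mult_nonneg_nonpos) auto
    then show ?thesis using XY by (simp add: mult_le_0_iff)
  qed
  have "RY X Y * (4 * Y * D) \<le> RY X Y * y1\<^sup>2"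
    using y1 RY0 by (intro mult_left_mono_neg)
  then have i2: "D * (2 * Y * RY X Y) \<le> RY X Y * y1\<^sup>2 / 2" by (simp add: algebra_simps)
  \<comment> \<open>The second derivative in the radial direction of \<eta>. For the pure power
    \<bar>\<eta>\<bar>^q it is q (q - 1) m, and the term with \<open>kap\<close> changes the factor
    1 by at most \<open>kap\<close>.\<close>
  have Reff: "R X Y + 2 * Y * RY X Y = q * (q - 1) * m * (1 + kap * th * X * z * (a - b))"
    unfolding RY R_def n m_def[symmetric] wab zz by (simp add: algebra_simps)
  have i3: "q * (q - 1) * m * (1 - kap) \<le> R X Y + 2 * Y * RY X Y"
    unfolding Reff
  proof (intro mult_left_mono)
    have "X * z * (b - a) \<le> X * z * (a + b)" using pos z0 XY by (intro mult_left_mono) auto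
    then have "X * z * (b - a) \<le> 1" using Xz by simp
    then have "(kap * th) * (X * z * (b - a)) \<le> (kap * th) * 1" using q by (intro mult_left_mono) auto
    also have "\<dots> \<le> kap" using q by simp
    finally show "1 - kap \<le> 1 + kap * th * X * z * (a - b)" by (simp add: algebra_simps)
  qed (use q m in auto)
  define c where "c = 2 - q"
  have c: "0 \<le> c" "c \<le> 1" using q by (auto simp: c_def)
  have PY1: "PY X Y = kap * c * b * m * z"
    using q by (simp add: PY_def n m_def c_def)
  then have PY: "PY X Y = kap * c * b * m * z" "0 \<le> PY X Y"
    using q pos z0 m c by (auto intro!: mult_nonneg_nonneg)
  have xy: "\<bar>x1 * y1\<bar> \<le> 4 * sqrt (X * Y * A * D)"
  proof (rule power2_le_imp_le)
    have "\<bar>x1 * y1\<bar>\<^sup>2 = x1\<^sup>2 * y1\<^sup>2" by (simp add: power_mult_distrib)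
    also have "\<dots> \<le> (4 * X * A) * (4 * Y * D)" using x1 y1 XY AD by (intro mult_mono) auto
    also have "\<dots> = (4 * sqrt (X * Y * A * D))\<^sup>2" using XY AD by (simp add: power_mult_distrib)
    finally show "\<bar>x1 * y1\<bar>\<^sup>2 \<le> (4 * sqrt (X * Y * A * D))\<^sup>2" .
  qed (use XY AD in auto)
  \<comment> \<open>After squaring, the left side contains b^3 X z. Two of the factors b are
    estimated into \<open>t\<close>, and the third is cancelled by \<open>Xz\<close>.\<close>
  have cross: "b * m * z * sqrt (X * Y * A * D) \<le> sqrt (t * A) * sqrt (m * D)"
  proof -
    have "(b * m * z)\<^sup>2 * (X * Y * A * D) = (m * A * D * z) * (b^3 * (X * z))"
      using XY by (simp add: m_def power2_eq_square power3_eq_cube)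
    also have "b^3 * (X * z) \<le> (a + b)^3 * (X * z)"
      using pos XY z0 by (intro mult_right_mono power_mono) auto
    also have "\<dots> = (a + b)\<^sup>2 * (X * z * (a + b))" by (simp add: power2_eq_square power3_eq_cube)
    also have "\<dots> \<le> (a + b)\<^sup>2 * 1" using Xz by (intro mult_left_mono) auto
    finally have "(b * m * z)\<^sup>2 * (X * Y * A * D) \<le> (m * A * D * z) * (a + b)\<^sup>2"
      using m AD z0 by (simp add: mult_left_mono)
    then have "(b * m * z)\<^sup>2 * (X * Y * A * D) \<le> (t * A) * (m * D)" by (simp add: t(1) mult_ac)
    then have "sqrt ((b * m * z)\<^sup>2 * (X * Y * A * D)) \<le> sqrt ((t * A) * (m * D))" by (rule real_sqrt_le_mono)
    then show ?thesis using pos m z0 by (simp add: real_sqrt_mult abs_mult)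
  qed
  have "- (PY X Y * x1 * y1) \<le> PY X Y * \<bar>x1 * y1\<bar>"
    using PY(2) by (metis abs_ge_minus_self abs_mult abs_of_nonneg mult.assoc)
  also have "\<dots> \<le> PY X Y * (4 * sqrt (X * Y * A * D))" by (rule mult_left_mono[OF xy PY(2)])
  also have "\<dots> = 4 * kap * c * (b * m * z * sqrt (X * Y * A * D))" by (simp add: PY(1))
  also have "\<dots> \<le> 4 * kap * c * (sqrt (t * A) * sqrt (m * D))"
    using cross q c by (intro mult_left_mono) auto
  also have "\<dots> \<le> kap * (t * A) + 4 * kap * c\<^sup>2 * (m * D)"
  proof -
    \<comment> \<open>The weight 2c is chosen so that the mixed term spends only one of the two
      copies of kap t A granted by \<open>tau_bounds\<close>; the other copy is the one in the
      claim.\<close>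
    have "0 \<le> kap * (sqrt (t * A) - 2 * c * sqrt (m * D))\<^sup>2" using q by simp
    also have "\<dots> = kap * ((sqrt (t * A))\<^sup>2 - 4 * c * (sqrt (t * A) * sqrt (m * D)) + 4 * c\<^sup>2 * (sqrt (m * D))\<^sup>2)"
      by (simp add: power2_diff power_mult_distrib algebra_simps)
    also have "\<dots> = kap * (t * A) - 4 * kap * c * (sqrt (t * A) * sqrt (m * D)) + 4 * kap * c\<^sup>2 * (m * D)"
      using t m AD by (simp add: algebra_simps)
    finally show ?thesis by simp
  qed
  finally have i4: "- (PY X Y * x1 * y1) \<le> kap * (t * A) + 4 * kap * c\<^sup>2 * (m * D)" .
  have i5: "2 * kap * (t * A) \<le> P X Y * A"
    using mult_right_mono[OF tau_bounds(1)[OF XY] AD(1)] by (simp add: t_def mult.assoc)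
  have i6: "q * (q - 1) * (1 - kap) * (m * D) \<le> (R X Y + 2 * Y * RY X Y) * D"
    using mult_right_mono[OF i3 AD(2)] by (simp add: mult_ac)
  \<comment> \<open>Here the value of \<open>kap\<close> enters: the left side is at most 5 kap =
    (5/8) (q - 1), the right side at least (7/8) (q - 1).\<close>
  have coeff: "kap + 4 * kap * c\<^sup>2 \<le> q * (q - 1) * (1 - kap)"
  proof -
    have "c\<^sup>2 \<le> 1" using c by (simp add: power_le_one)
    then have "kap * (1 + 4 * c\<^sup>2) \<le> kap * 5" using q by (intro mult_left_mono) auto
    also have "\<dots> = (q - 1) * (5 / 8)" by (simp add: kap_def)
    also have "\<dots> \<le> (q - 1) * (q * (1 - kap))"
    proof (intro mult_left_mono)
      have "1 * (7 / 8) \<le> q * (1 - kap)" using q by (intro mult_mono) auto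
      then show "5 / 8 \<le> q * (1 - kap)" by simp
    qed (use q in auto)
    finally show ?thesis by (simp add: algebra_simps)
  qed
  have "kap * (D / t) \<le> kap * (m * D)"
    using mult_right_mono[OF m(2) AD(2)] q by (intro mult_left_mono) auto
  also have "\<dots> \<le> (q * (q - 1) * (1 - kap) - 4 * kap * c\<^sup>2) * (m * D)"
    using coeff m AD by (intro mult_right_mono) auto
  finally have i7: "kap * (D / t) + 4 * kap * c\<^sup>2 * (m * D) \<le> q * (q - 1) * (1 - kap) * (m * D)"
    by (simp add: algebra_simps)
  have "kap * (t * A + D / t) \<le> PX X Y * x1\<^sup>2 / 2 + PY X Y * x1 * y1 + RY X Y * y1\<^sup>2 / 2 + P X Y * A + R X Y * D"
    using i1 i2 i4 i5 i6 i7 by (simp add: algebra_simps)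
  then show ?thesis unfolding t_def by (simp add: add_divide_distrib)
qed

section \<open>Size of the Bellman function and of its derivatives\<close>

lemma continuous_on_coeffs:
  "continuous_on ({0<..} \<times> {0<..}) (\<lambda>(X, Y). P X Y)"
  "continuous_on ({0<..} \<times> {0<..}) (\<lambda>(X, Y). R X Y)"
  "continuous_on ({0<..} \<times> {0<..}) (\<lambda>(X, Y). PX X Y)"
  "continuous_on ({0<..} \<times> {0<..}) (\<lambda>(X, Y). PY X Y)"
  "continuous_on ({0<..} \<times> {0<..}) (\<lambda>(X, Y). RY X Y)"
  unfolding P_def R_def PX_def PY_def RY_def case_prod_unfold w_def
  by (intro continuous_intros ballI; auto simp: add_pos_pos add_nonneg_eq_0_iff)+

lemma coeffs_bounded:
  assumes "0 < e"
  shows "\<exists>C. \<forall>X\<in>{e..N}. \<forall>Y\<in>{e..N}. \<bar>P X Y\<bar> \<le> C \<and> \<bar>R X Y\<bar> \<le> C \<and> \<bar>PX X Y\<bar> \<le> C \<and> \<bar>PY X Y\<bar> \<le> C \<and> \<bar>RY X Y\<bar> \<le> C"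
proof -
  have *: "\<exists>C. \<forall>X\<in>{e..N}. \<forall>Y\<in>{e..N}. \<bar>F X Y\<bar> \<le> C"
    if "continuous_on ({0<..} \<times> {0<..}) (\<lambda>(X, Y). F X Y)" for F :: "real \<Rightarrow> real \<Rightarrow> real"
  proof -
    have "continuous_on ({e..N} \<times> {e..N}) (\<lambda>(X, Y). F X Y)"
      using assms by (intro continuous_on_subset[OF that]) auto
    then have "bounded ((\<lambda>(X, Y). F X Y) ` ({e..N} \<times> {e..N}))"
      by (intro compact_imp_bounded compact_continuous_image compact_Times compact_Icc)
    then obtain C where "\<forall>x\<in>(\<lambda>(X, Y). F X Y) ` ({e..N} \<times> {e..N}). norm x \<le> C" by (auto simp: bounded_iff)
    then show ?thesis by (intro exI[of _ C]) force
  qed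
  obtain C1 C2 C3 C4 C5 where
    "\<forall>X\<in>{e..N}. \<forall>Y\<in>{e..N}. \<bar>P X Y\<bar> \<le> C1" "\<forall>X\<in>{e..N}. \<forall>Y\<in>{e..N}. \<bar>R X Y\<bar> \<le> C2"
    "\<forall>X\<in>{e..N}. \<forall>Y\<in>{e..N}. \<bar>PX X Y\<bar> \<le> C3" "\<forall>X\<in>{e..N}. \<forall>Y\<in>{e..N}. \<bar>PY X Y\<bar> \<le> C4"
    "\<forall>X\<in>{e..N}. \<forall>Y\<in>{e..N}. \<bar>RY X Y\<bar> \<le> C5"
    using *[OF continuous_on_coeffs(1)] *[OF continuous_on_coeffs(2)] *[OF continuous_on_coeffs(3)]
      *[OF continuous_on_coeffs(4)] *[OF continuous_on_coeffs(5)] by (elim exE)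
  then show ?thesis
    by (intro exI[of _ "max C1 (max C2 (max C3 (max C4 C5)))"]) (meson max.coboundedI1 max.coboundedI2 order_refl)
qed

lemma B_mono:
  assumes "0 \<le> X" "X \<le> X'" "0 \<le> Y" "Y \<le> Y'"
  shows "B X Y \<le> B X' Y'"
proof -
  note q = q_bounds
  have "w X Y \<le> w X' Y'" unfolding w_def using assms q p2 by (intro add_mono powr_mono2) auto
  moreover have "0 \<le> w X Y" by (simp add: w_def)
  ultimately have "w X Y powr th \<le> w X' Y' powr th" using q by (intro powr_mono2) auto
  then show ?thesis unfolding B_def using assms q
    by (intro add_mono mult_mono[of "kap * X" "kap * X'"] mult_left_mono powr_mono2[of "q / 2"]) auto
qed

text \<open>The weighted arithmetic-geometric mean inequality with weights 1 - th and th, since X is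
  the power 1 - th of X^(p/2).\<close>

lemma B_upper:
  assumes "X > 0" "Y > 0"
  shows "B X Y \<le> kap * (X powr (p / 2) + th * Y powr (q / 2)) + Y powr (q / 2)"
proof -
  note q = q_bounds
  have "X * w X Y powr th = (X powr (p / 2)) powr (1 - th) * w X Y powr th"
    using assms q by (simp add: powr_powr mult.commute th_def)
  also have "\<dots> \<le> (1 - th) * X powr (p / 2) + th * w X Y"
    using q assms by (intro Youngs_inequality_0) (auto intro: w_pos)
  also have "\<dots> = X powr (p / 2) + th * Y powr (q / 2)" by (simp add: w_def algebra_simps)
  finally have "X * w X Y powr th \<le> X powr (p / 2) + th * Y powr (q / 2)" .
  then have "kap * (X * w X Y powr th) \<le> kap * (X powr (p / 2) + th * Y powr (q / 2))"
    using q by (intro mult_left_mono) auto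
  then show ?thesis by (simp add: B_def mult.assoc)
qed

text \<open>A bound with the right limit as e tends to 0. The constant terms containing e have
  infinite integral, so it has to be combined with the next lemma.\<close>

lemma B_diff_upper:
  assumes e: "0 < e" "e \<le> 1" and xy: "0 \<le> x" "0 \<le> y"
  shows "B (x + e) (y + e) - B e e \<le> kap * ((x + e) powr (p / 2) + th * (y + e) powr (q / 2)) + y powr (q / 2)"
proof -
  note q = q_bounds
  have "(y + e) powr (q / 2) \<le> y powr (q / 2) + e powr (q / 2)"
    using e xy q by (intro powr_add_le_add_powr) auto
  moreover have "e powr (q / 2) \<le> B e e" using e q by (simp add: B_def)
  ultimately show ?thesis using B_upper[of "x + e" "y + e"] e xy by simp
qed

text \<open>The increment from the base point is bounded uniformly in e by an expression that
  vanishes at x = y = 0 and is integrable along the flow. This is what makes the limit e -> 0 a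
  dominated one.\<close>

lemma B_diff_dominated:
  "\<exists>C\<ge>0. \<forall>e x y. 0 < e \<longrightarrow> e \<le> 1 \<longrightarrow> 0 \<le> x \<longrightarrow> x \<le> N \<longrightarrow> 0 \<le> y \<longrightarrow> y \<le> N \<longrightarrow>
     B (x + e) (y + e) - B e e \<le> C * (x + y powr (q / 2))"
proof -
  note q = q_bounds
  \<comment> \<open>A Lipschitz constant of the power p/2 on [0, N + 1]; this is where p \<ge> 2 and
    the upper bound N are used.\<close>
  define L where "L = (p / 2) * (N + 1) powr (p / 2 - 1)"
  define W where "W = w (N + 1) (N + 1)"
  define C where "C = W powr th + L + 2"
  have L0: "L \<ge> 0" using p2 by (simp add: L_def)
  have main: "B (x + e) (y + e) - B e e \<le> C * (x + y powr (q / 2))"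
    if H: "0 < e" "e \<le> 1" "0 \<le> x" "x \<le> N" "0 \<le> y" "y \<le> N" for e x y
  proof -
    define w1 w0 where "w1 = w (x + e) (y + e)" and "w0 = w e e"
    have w0: "w0 > 0" using H by (auto simp: w0_def intro: w_pos)
    have w01: "w0 \<le> w1" unfolding w0_def w1_def w_def using H q p2 by (intro add_mono powr_mono2) auto
    have w1W: "w1 \<le> W" unfolding W_def w1_def w_def using H q p2 by (intro add_mono powr_mono2) auto
    have dX: "(x + e) powr (p / 2) - e powr (p / 2) \<le> L * x"
    proof (cases "x = 0")
      case False
      then have "x > 0" using H by simp
      have "\<exists>z. e < z \<and> z < x + e \<and> (x + e) powr (p / 2) - e powr (p / 2) = (x + e - e) * ((p / 2) * z powr (p / 2 - 1))"
        using H \<open>x > 0\<close> by (intro MVT2) (auto intro!: derivative_eq_intros)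
      then obtain z where z: "e < z" "z < x + e" "(x + e) powr (p / 2) - e powr (p / 2) = x * ((p / 2) * z powr (p / 2 - 1))" by auto
      have "z powr (p / 2 - 1) \<le> (N + 1) powr (p / 2 - 1)" using z H p2 by (intro powr_mono2) auto
      then have "x * ((p / 2) * z powr (p / 2 - 1)) \<le> x * L" unfolding L_def using p2 H by (intro mult_left_mono) auto
      then show ?thesis unfolding z(3) by (simp only: mult.commute)
    qed simp
    have dY: "(y + e) powr (q / 2) - e powr (q / 2) \<le> y powr (q / 2)"
      using powr_add_le_add_powr[of y e "q / 2"] H q by simp
    have dw: "w1 - w0 \<le> L * x + y powr (q / 2)" using dX dY by (simp add: w1_def w0_def w_def)
    \<comment> \<open>The derivative of \<open>w powr th\<close> may blow up as e tends to 0.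
      Young's inequality bounds the increment by the quotient of w1 - w0 and
      \<open>w0 powr (1 - th)\<close>; the denominator is at least e because e is the power 1 - th
      of e^(p/2), and the prefactor e cancels it.\<close>
    have conc: "e * (w1 powr th - w0 powr th) \<le> L * x + y powr (q / 2)"
    proof -
      have "w1 powr th = (w1 powr th) * (w0 powr (1 - th)) / w0 powr (1 - th)" using w0 by simp
      also have "\<dots> \<le> (th * w1 + (1 - th) * w0) / w0 powr (1 - th)"
        using Youngs_inequality_0[of th "1 - th" w1 w0] q w0 w01 by (intro divide_right_mono) auto
      also have "\<dots> = (w0 + th * (w1 - w0)) / w0 powr (1 - th)" by (simp add: algebra_simps)
      also have "\<dots> \<le> (w0 + 1 * (w1 - w0)) / w0 powr (1 - th)"
        using q w01 by (intro divide_right_mono add_left_mono mult_right_mono) auto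
      also have "\<dots> = w0 powr th + (w1 - w0) / w0 powr (1 - th)"
        using w0 by (simp add: powr_diff field_simps)
      finally have "w1 powr th - w0 powr th \<le> (w1 - w0) / w0 powr (1 - th)" by simp
      also have "\<dots> \<le> (w1 - w0) / e"
      proof (intro divide_left_mono)
        have "e = (e powr (p / 2)) powr (1 - th)" using H q by (simp add: powr_powr mult.commute th_def)
        also have "\<dots> \<le> w0 powr (1 - th)" unfolding w0_def w_def using q by (intro powr_mono2) auto
        finally show "e \<le> w0 powr (1 - th)" .
      qed (use w01 w0 H in auto)
      finally have "e * (w1 powr th - w0 powr th) \<le> w1 - w0" using H by (simp add: field_simps)
      then show ?thesis using dw by simp
    qed
    have "w1 powr th \<le> W powr th" using w1W w01 w0 q by (intro powr_mono2) auto
    then have i: "x * w1 powr th \<le> x * W powr th" using H by (intro mult_left_mono) auto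
    have "(x + e) * w1 powr th - e * w0 powr th = x * w1 powr th + e * (w1 powr th - w0 powr th)"
      by (simp add: algebra_simps)
    also have "\<dots> \<le> (W powr th + L) * x + y powr (q / 2)" using i conc by (simp add: algebra_simps)
    finally have j: "(x + e) * w1 powr th - e * w0 powr th \<le> (W powr th + L) * x + y powr (q / 2)" .
    have rhs0: "0 \<le> (W powr th + L) * x + y powr (q / 2)" using L0 H by simp
    have "kap * ((x + e) * w1 powr th - e * w0 powr th) \<le> kap * ((W powr th + L) * x + y powr (q / 2))"
      using q by (intro mult_left_mono j) auto
    also have "\<dots> \<le> 1 * ((W powr th + L) * x + y powr (q / 2))"
      using q rhs0 by (intro mult_right_mono) auto
    finally have "kap * ((x + e) * w1 powr th - e * w0 powr th) \<le> (W powr th + L) * x + y powr (q / 2)" by simp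
    then have "B (x + e) (y + e) - B e e \<le> (W powr th + L) * x + 2 * y powr (q / 2)"
      using dY by (simp add: B_def w1_def w0_def algebra_simps)
    also have "\<dots> \<le> C * x + C * y powr (q / 2)"
    proof -
      have "W powr th + L \<le> C" "2 \<le> C" using L0 by (auto simp: C_def)
      then show ?thesis using H by (intro add_mono[of "(W powr th + L) * x"] mult_right_mono) auto
    qed
    finally show ?thesis by (simp add: distrib_left)
  qed
  have "C \<ge> 0" using L0 by (simp add: C_def)
  with main show ?thesis by blast
qed

end

section \<open>Integration by parts\<close>

text \<open>Difference quotients along sequences, dominated through the mean value inequality.
  Measurability of the derivative comes from its being a limit of these quotients.\<close>

lemma has_derivative_integral_dominated:
  fixes f f' :: "real \<Rightarrow> 'a \<Rightarrow> real"
  assumes S: "open S" "convex S" "t0 \<in> S"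
    and der: "\<And>t x. t \<in> S \<Longrightarrow> x \<in> space M \<Longrightarrow> ((\<lambda>t. f t x) has_real_derivative f' t x) (at t)"
    and bd: "\<And>t x. t \<in> S \<Longrightarrow> x \<in> space M \<Longrightarrow> \<bar>f' t x\<bar> \<le> D x"
    and D: "integrable M D"
    and int: "\<And>t. t \<in> S \<Longrightarrow> integrable M (f t)"
  shows "integrable M (f' t0)" "((\<lambda>t. \<integral>x. f t x \<partial>M) has_real_derivative (\<integral>x. f' t0 x \<partial>M)) (at t0)"
proof -
  have main: "integrable M (f' t0) \<and> (\<lambda>n. ((\<integral>x. f (t0 + X n) x \<partial>M) - (\<integral>x. f t0 x \<partial>M)) / X n) \<longlonglongrightarrow> (\<integral>x. f' t0 x \<partial>M)"
    if X: "\<And>n::nat. X n \<noteq> 0" "X \<longlonglongrightarrow> 0" for X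
  proof -
    have "(\<lambda>n. t0 + X n) \<longlonglongrightarrow> t0 + 0" by (intro tendsto_intros X)
    then have "eventually (\<lambda>n. t0 + X n \<in> S) sequentially"
      using S by (intro topological_tendstoD) auto
    then obtain N where N: "\<And>n. n \<ge> N \<Longrightarrow> t0 + X n \<in> S" by (auto simp: eventually_sequentially)
    define Q where "Q n x = (f (t0 + X (n + N)) x - f t0 x) / X (n + N)" for n x
    have Qi: "integrable M (Q n)" for n
      unfolding Q_def using int N S by (intro Bochner_Integration.integrable_divide_zero Bochner_Integration.integrable_diff) auto
    have lim: "(\<lambda>n. Q n x) \<longlonglongrightarrow> f' t0 x" if x: "x \<in> space M" for x
    proof -
      have "((\<lambda>h. (f (t0 + h) x - f t0 x) / h) \<longlongrightarrow> f' t0 x) (at 0)"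
        using der[OF S(3) x] by (simp add: DERIV_def)
      moreover have "filterlim (\<lambda>n. X (n + N)) (at 0) sequentially"
        using X LIMSEQ_ignore_initial_segment[OF X(2), of N] by (auto simp: filterlim_at)
      ultimately show ?thesis unfolding Q_def by (rule filterlim_compose)
    qed
    have bdQ: "\<bar>Q n x\<bar> \<le> D x" if x: "x \<in> space M" for n x
    proof -
      have "norm (f (t0 + X (n + N)) x - f t0 x) \<le> D x * norm (t0 + X (n + N) - t0)"
      proof (rule field_differentiable_bound[OF S(2)])
        show "((\<lambda>t. f t x) has_field_derivative f' t x) (at t within S)" if "t \<in> S" for t
          using der[OF that x] by (rule has_field_derivative_at_within)
        show "norm (f' t x) \<le> D x" if "t \<in> S" for t using bd[OF that x] by simp
      qed (use N S in auto)
      then show ?thesis using X(1)[of "n + N"] by (simp add: Q_def divide_le_eq)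
    qed
    have m: "f' t0 \<in> borel_measurable M"
      using lim by (rule borel_measurable_LIMSEQ_metric[rotated]) (use Qi in auto)
    have i: "integrable M (f' t0)"
      using bd[OF S(3)] by (intro Bochner_Integration.integrable_bound[OF D m] AE_I2) force
    have "(\<lambda>n. \<integral>x. Q n x \<partial>M) \<longlonglongrightarrow> (\<integral>x. f' t0 x \<partial>M)"
      using lim bdQ Qi by (intro integral_dominated_convergence[OF m _ D]) auto
    moreover have "(\<integral>x. Q n x \<partial>M) = ((\<integral>x. f (t0 + X (n + N)) x \<partial>M) - (\<integral>x. f t0 x \<partial>M)) / X (n + N)" for n
      unfolding Q_def using int N S by (simp add: Bochner_Integration.integral_diff)
    ultimately have "(\<lambda>n. ((\<integral>x. f (t0 + X (n + N)) x \<partial>M) - (\<integral>x. f t0 x \<partial>M)) / X (n + N)) \<longlonglongrightarrow> (\<integral>x. f' t0 x \<partial>M)" by simp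
    then have "(\<lambda>n. ((\<integral>x. f (t0 + X n) x \<partial>M) - (\<integral>x. f t0 x \<partial>M)) / X n) \<longlonglongrightarrow> (\<integral>x. f' t0 x \<partial>M)"
      by (rule LIMSEQ_offset)
    with i show ?thesis by blast
  qed
  have "(\<lambda>n. 1 / real (Suc n)) \<longlonglongrightarrow> 0" by (rule LIMSEQ_Suc[OF lim_1_over_n])
  then show "integrable M (f' t0)" using main[of "\<lambda>n. 1 / real (Suc n)"] by simp
  show "((\<lambda>t. \<integral>x. f t x \<partial>M) has_real_derivative (\<integral>x. f' t0 x \<partial>M)) (at t0)"
    unfolding DERIV_def tendsto_at_iff_sequentially o_def using main by auto
qed

text \<open>If \<open>F\<close> increased somewhere, its derivative would be positive at some point
  and stay bounded below from there on, which forces linear growth past the bound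
  \<open>C\<close>.\<close>

lemma convex_bounded_antimono:
  fixes F :: "real \<Rightarrow> real"
  assumes F: "\<And>t. t \<ge> 0 \<Longrightarrow> (F has_real_derivative F' t) (at t)"
    and F': "\<And>t. t \<ge> 0 \<Longrightarrow> (F' has_real_derivative F'' t) (at t)"
    and pos: "\<And>t. t \<ge> 0 \<Longrightarrow> F'' t \<ge> 0"
    and bd: "\<And>t. t \<ge> 0 \<Longrightarrow> F t \<le> C" and t: "t \<ge> 0"
  shows "F t \<le> F 0"
proof (rule ccontr)
  assume "\<not> F t \<le> F 0"
  then have lt: "F 0 < F t" and t0: "0 < t" using t by (auto simp: less_le)
  obtain z where z: "0 < z" "z < t" "F t - F 0 = (t - 0) * F' z"
    using MVT2[OF t0, of F F'] F by auto
  then have zp: "F' z > 0" using lt t0 by (metis diff_gt_0_iff_gt diff_zero zero_less_mult_pos)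
  \<comment> \<open>Far enough to the right that a slope of at least F' z lifts the value F z above
    \<open>C\<close>.\<close>
  define s where "s = z + (\<bar>C\<bar> + \<bar>F z\<bar> + 1) / F' z"
  have s: "z < s" using zp by (simp add: s_def)
  obtain y where y: "z < y" "y < s" "F s - F z = (s - z) * F' y"
    using MVT2[OF s, of F F'] F z by auto
  have "F' z \<le> F' y"
  proof (rule DERIV_nonneg_imp_nondecreasing[of z y F'])
    fix u assume "z \<le> u" "u \<le> y"
    then have "u \<ge> 0" using z by simp
    then show "\<exists>d. (F' has_real_derivative d) (at u) \<and> 0 \<le> d" using F' pos by blast
  qed (use y in simp)
  then have "(s - z) * F' z \<le> F s - F z" unfolding y(3) using s by (intro mult_left_mono) auto
  moreover have "(s - z) * F' z = \<bar>C\<bar> + \<bar>F z\<bar> + 1" using zp by (simp add: s_def)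
  ultimately have "F s > C" by linarith
  then show False using bd[of s] s z by simp
qed

section \<open>Dilation of one coordinate\<close>

definition vec_upd :: "real^'n \<Rightarrow> 'n \<Rightarrow> real \<Rightarrow> real^'n" where
  "vec_upd x i r = (\<chi> j. if j = i then r else x $ j)"

lemma vec_upd_nth [simp]: "vec_upd x i r $ j = (if j = i then r else x $ j)"
  by (simp add: vec_upd_def)

lemma vec_upd_same [simp]: "vec_upd x i (x $ i) = x"
  by (simp add: vec_eq_iff)

lemma vec_upd_upd [simp]: "vec_upd (vec_upd x i r) i s = vec_upd x i s"
  by (simp add: vec_eq_iff)

lemma vec_upd_measurable: "(\<lambda>x. vec_upd x i (s * x $ i)) \<in> borel_measurable borel"
proof -
  have "continuous_on UNIV (\<lambda>x. if j = i then s * x $ i else x $ j)" for j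
    by (cases "j = i") (auto intro!: continuous_intros)
  then show ?thesis
    unfolding vec_upd_def by (intro borel_measurable_continuous_onI continuous_on_vec_lambda)
qed

text \<open>Lebesgue measure contributes one factor s and the density contributes s^(2 \<alpha>_i +
  1), which together give the exponent.\<close>

lemma laguerre_measure_dilation:
  fixes h :: "real^'n \<Rightarrow> real"
  assumes h: "h \<in> borel_measurable borel" and s: "s > 0"
  shows "integrable (laguerre_measure \<alpha>) h \<Longrightarrow> integrable (laguerre_measure \<alpha>) (\<lambda>x. h (vec_upd x i (s * x $ i)))"
    and "(\<integral>x. h (vec_upd x i (s * x $ i)) \<partial>laguerre_measure \<alpha>)
      = s powr (- (2 * \<alpha> $ i + 2)) * (\<integral>x. h x \<partial>laguerre_measure \<alpha>)"
proof -
  define c where "c b = (if b = axis i 1 then s else 1)" for b :: "real^'n"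
  define T where "T x = vec_upd x i (s * x $ i)" for x :: "real^'n"
  have T_eq: "0 + (\<Sum>b\<in>Basis. (c b * (x \<bullet> b)) *\<^sub>R b) = T x" for x
  proof (rule vec_eq_iff[THEN iffD2], rule allI)
    fix j
    have "(0 + (\<Sum>b\<in>Basis. (c b * (x \<bullet> b)) *\<^sub>R b)) $ j = (\<Sum>b\<in>Basis. (c b * (x \<bullet> b)) *\<^sub>R b) \<bullet> axis j 1"
      by (simp add: cart_eq_inner_axis)
    also have "\<dots> = c (axis j 1) * x $ j"
      by (subst inner_sum_left_Basis) (simp_all add: axis_in_Basis_iff cart_eq_inner_axis)
    also have "\<dots> = T x $ j" by (simp add: c_def T_def axis_eq_axis)
    finally show "(0 + (\<Sum>b\<in>Basis. (c b * (x \<bullet> b)) *\<^sub>R b)) $ j = T x $ j" .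
  qed
  have prodc: "(\<Prod>b\<in>Basis. \<bar>c b\<bar>) = s"
  proof -
    have "(\<Prod>b\<in>Basis. \<bar>c b\<bar>) = (\<Prod>b\<in>(Basis::(real^'n) set). if b = axis i 1 then s else 1)"
      using s by (intro prod.cong) (auto simp: c_def)
    also have "\<dots> = s" by (subst prod.delta) (auto simp: axis_in_Basis_iff)
    finally show ?thesis .
  qed
  have "lborel = density (distr lborel borel (\<lambda>x. 0 + (\<Sum>b\<in>Basis. (c b * (x \<bullet> b)) *\<^sub>R b))) (\<lambda>_. ennreal (\<Prod>b\<in>(Basis::(real^'n) set). \<bar>c b\<bar>))"
    using lborel_affine_euclidean[of c "0::real^'n"] s by (auto simp: c_def split: if_splits)
  then have lb: "lborel = density (distr lborel borel T) (\<lambda>_. ennreal s)"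
    unfolding T_eq prodc .
  have Tm: "T \<in> measurable lborel borel" using vec_upd_measurable[of i s] by (simp add: T_def[abs_def])
  define w where "w x = (\<Prod>j\<in>UNIV. laguerre_weight (\<alpha> $ j) (x $ j))" for x :: "real^'n"
  have wm [measurable]: "w \<in> borel_measurable borel" unfolding w_def[abs_def] by measurable
  have wT: "w (T x) = s powr (2 * \<alpha> $ i + 1) * w x" for x
  proof -
    have "laguerre_weight (\<alpha> $ i) (s * x $ i) = s powr (2 * \<alpha> $ i + 1) * laguerre_weight (\<alpha> $ i) (x $ i)"
      using s by (auto simp: laguerre_weight_def indicator_def powr_mult zero_less_mult_iff)
    moreover have "(\<Prod>j\<in>UNIV - {i}. laguerre_weight (\<alpha> $ j) (T x $ j)) = (\<Prod>j\<in>UNIV - {i}. laguerre_weight (\<alpha> $ j) (x $ j))"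
      by (intro prod.cong) (auto simp: T_def)
    ultimately show ?thesis unfolding w_def
      by (subst (1 2) prod.remove[of _ i]) (auto simp: T_def)
  qed
  note hm [measurable] = h
  have gm: "(\<lambda>x. w x * h x) \<in> borel_measurable borel" by measurable
  have hTm: "(\<lambda>x. h (T x)) \<in> borel_measurable borel" using measurable_compose[OF Tm hm] by simp
  define k where "k = s * s powr (2 * \<alpha> $ i + 1)"
  have k: "k > 0" using s by (simp add: k_def)
  have I1: "integrable lborel (\<lambda>x. w x * h x) \<longleftrightarrow> integrable lborel (\<lambda>x. k * (w x * h (T x)))"
    by (subst lb, subst integrable_density, (use gm s in simp_all)[3], subst integrable_distr_eq[OF Tm])
       (use gm in \<open>simp_all add: wT mult.assoc k_def\<close>)
  have I2: "(\<integral>x. w x * h x \<partial>lborel) = (\<integral>x. k * (w x * h (T x)) \<partial>lborel)"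
    by (subst lb, subst integral_density, (use gm s in simp_all)[3], subst integral_distr[OF Tm])
       (use gm in \<open>simp_all add: wT mult.assoc k_def\<close>)
  note L = laguerre_measure_integral[OF h, of \<alpha>, folded w_def] laguerre_measure_integral[OF hTm, of \<alpha>, folded w_def]
  show "integrable (laguerre_measure \<alpha>) h \<Longrightarrow> integrable (laguerre_measure \<alpha>) (\<lambda>x. h (vec_upd x i (s * x $ i)))"
    using L(1,3) I1 k unfolding T_def by simp
  have "k powr - 1 = s powr (- (2 * \<alpha> $ i + 2))"
  proof -
    have "k = s powr (2 * \<alpha> $ i + 2)" using s powr_add[of s 1 "2 * \<alpha> $ i + 1"] by (simp add: k_def add.commute)
    then have "k powr - 1 = s powr ((2 * \<alpha> $ i + 2) * (- 1))" by (simp only: powr_powr)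
    also have "(2 * \<alpha> $ i + 2) * (- 1) = - (2 * \<alpha> $ i + 2)" by simp
    finally show ?thesis .
  qed
  moreover have "(\<integral>x. w x * h (T x) \<partial>lborel) = k powr - 1 * (\<integral>x. w x * h x \<partial>lborel)"
    using I2 k by (simp add: powr_minus)
  ultimately show "(\<integral>x. h (vec_upd x i (s * x $ i)) \<partial>laguerre_measure \<alpha>)
      = s powr (- (2 * \<alpha> $ i + 2)) * (\<integral>x. h x \<partial>laguerre_measure \<alpha>)"
    using L(2,4) unfolding T_def by simp
qed

text \<open>Obtained by differentiating the scaling law of the measure: no boundary term can arise because the
  orthant is invariant under dilations.\<close>

lemma laguerre_measure_ibp:
  fixes h h' :: "real^'n \<Rightarrow> real"
  assumes \<alpha>: "\<And>i. \<alpha> $ i > - 1"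
    and h: "h \<in> borel_measurable borel" "integrable (laguerre_measure \<alpha>) h"
    and der: "\<And>x. x \<in> orthant \<Longrightarrow> ((\<lambda>r. h (vec_upd x i r)) has_real_derivative h' x) (at (x $ i))"
    and bd: "\<And>x. x \<in> orthant \<Longrightarrow> \<bar>x $ i * h' x\<bar> \<le> K * exp (- (1/8) * (norm x)\<^sup>2)"
  shows "integrable (laguerre_measure \<alpha>) (\<lambda>x. x $ i * h' x)"
    and "(\<integral>x. x $ i * h' x \<partial>laguerre_measure \<alpha>) = - (2 * \<alpha> $ i + 2) * (\<integral>x. h x \<partial>laguerre_measure \<alpha>)"
proof -
  let ?M = "laguerre_measure \<alpha>"
  define f where "f t x = h (vec_upd x i (t * x $ i))" for t x
  define f' where "f' t x = h' (vec_upd x i (t * x $ i)) * x $ i" for t x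
  have der': "((\<lambda>t. f t x) has_real_derivative f' t x) (at t)" if "t \<in> {1/2<..<2}" "x \<in> space ?M" for t x
  proof -
    have o: "vec_upd x i (t * x $ i) \<in> orthant" using that by auto
    have "((\<lambda>r. h (vec_upd x i r)) has_real_derivative h' (vec_upd x i (t * x $ i))) (at (t * x $ i))"
      using der[OF o] by simp
    moreover have "((\<lambda>t. t * x $ i) has_real_derivative x $ i) (at t)" by (auto intro!: derivative_eq_intros)
    ultimately show ?thesis unfolding f_def f'_def by (rule DERIV_chain2)
  qed
  \<comment> \<open>For t > 1/2 the dilated point has at least half the norm of x, so the Gaussian
    rate drops from 1/8 to 1/32 at worst; the factor 2 bounds 1 / t.\<close>
  have bd': "\<bar>f' t x\<bar> \<le> (2 * \<bar>K\<bar>) * exp (- (1/32) * (norm x)\<^sup>2)" if t: "t \<in> {1/2<..<2}" and x: "x \<in> space ?M" for t x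
  proof -
    define y where "y = vec_upd x i (t * x $ i)"
    have o: "y \<in> orthant" using t x by (auto simp: y_def)
    have "(1/4) * (norm x)\<^sup>2 \<le> (norm y)\<^sup>2"
      unfolding norm_vec_power2 sum_distrib_left
    proof (intro sum_mono)
      fix j
      have "(1/2)\<^sup>2 * (x $ j)\<^sup>2 \<le> t\<^sup>2 * (x $ j)\<^sup>2" using t by (intro mult_right_mono power_mono) auto
      then show "(1/4) * (x $ j)\<^sup>2 \<le> (y $ j)\<^sup>2"
        unfolding y_def by (cases "j = i") (simp_all add: power_mult_distrib power_divide)
    qed
    then have e: "exp (- (1/8) * (norm y)\<^sup>2) \<le> exp (- (1/32) * (norm x)\<^sup>2)" by simp
    have "f' t x = (1 / t) * (y $ i * h' y)" using t by (simp add: f'_def y_def)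
    then have "\<bar>f' t x\<bar> = (1 / t) * \<bar>y $ i * h' y\<bar>" using t by (simp add: abs_mult)
    also have "\<dots> \<le> 2 * (\<bar>K\<bar> * exp (- (1/8) * (norm y)\<^sup>2))"
    proof (intro mult_mono)
      show "1 / t \<le> 2" using t by (simp add: field_simps)
      show "\<bar>y $ i * h' y\<bar> \<le> \<bar>K\<bar> * exp (- (1/8) * (norm y)\<^sup>2)"
        by (rule order_trans[OF bd[OF o] mult_right_mono[OF abs_ge_self]]) simp
    qed (use t in auto)
    also have "\<dots> \<le> 2 * (\<bar>K\<bar> * exp (- (1/32) * (norm x)\<^sup>2))" using e by (intro mult_left_mono) auto
    finally show ?thesis by simp
  qed
  have Di: "integrable ?M (\<lambda>x. (2 * \<bar>K\<bar>) * exp (- (1/32) * (norm x)\<^sup>2))"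
    by (intro integrable_mult_right gauss_integrable \<alpha>) simp
  have fi: "integrable ?M (f t)" if "t \<in> {1/2<..<2}" for t
    using laguerre_measure_dilation(1)[OF h(1) _ h(2), of t i] that by (simp add: f_def[abs_def])
  note R = has_derivative_integral_dominated[of "{1/2<..<2}" 1 ?M f f', OF _ _ _ der' bd' Di fi]
  have f'1: "f' 1 = (\<lambda>x. x $ i * h' x)" by (simp add: f'_def fun_eq_iff)
  show "integrable ?M (\<lambda>x. x $ i * h' x)" using R(1) unfolding f'1 by simp
  have D1: "((\<lambda>t. \<integral>x. f t x \<partial>?M) has_real_derivative (\<integral>x. x $ i * h' x \<partial>?M)) (at 1)"
    using R(2) unfolding f'1 by simp
  have ev: "eventually (\<lambda>t. (\<integral>x. f t x \<partial>?M) = t powr (- (2 * \<alpha> $ i + 2)) * (\<integral>x. h x \<partial>?M)) (nhds 1)"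
  proof (rule eventually_nhds_in_open[of "{0<..}" "1::real", THEN eventually_mono])
    fix t :: real assume "t \<in> {0<..}"
    then show "(\<integral>x. f t x \<partial>?M) = t powr (- (2 * \<alpha> $ i + 2)) * (\<integral>x. h x \<partial>?M)"
      unfolding f_def using laguerre_measure_dilation(2)[OF h(1)] by simp
  qed auto
  \<comment> \<open>Differentiating the right-hand side of the scaling law at t = 1; uniqueness of
    derivatives then gives the identity.\<close>
  have "((\<lambda>t. t powr (- (2 * \<alpha> $ i + 2)) * (\<integral>x. h x \<partial>?M)) has_real_derivative - (2 * \<alpha> $ i + 2) * (\<integral>x. h x \<partial>?M)) (at 1)"
    by (auto intro!: derivative_eq_intros)
  then have "((\<lambda>t. \<integral>x. f t x \<partial>?M) has_real_derivative - (2 * \<alpha> $ i + 2) * (\<integral>x. h x \<partial>?M)) (at 1)"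
    using DERIV_cong_ev[OF refl ev refl] by simp
  with D1 show "(\<integral>x. x $ i * h' x \<partial>?M) = - (2 * \<alpha> $ i + 2) * (\<integral>x. h x \<partial>?M)" by (rule DERIV_unique)
qed

section \<open>Monotonicity along the Poisson flow\<close>

locale bellman_sums = bellman +
  fixes I J :: "'c set" and e :: real
  assumes fin: "finite I" "finite J" and e: "0 < e" "e \<le> 1"
begin

text \<open>The shift by \<open>e\<close> keeps both arguments of \<open>B\<close> in the open
  quadrant where its derivatives exist and are bounded on bounded sets.\<close>

definition SX where "SX z = (\<Sum>c\<in>I. (z c)\<^sup>2) + e"
definition SY where "SY z = (\<Sum>c\<in>J. (z c)\<^sup>2) + e"

text \<open>Subtracting the value at the origin makes \<open>b0\<close> integrable along the flow
  although the measure is infinite. \<open>b1\<close> and \<open>b2\<close> are its first two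
  derivatives along a curve with velocity z' and acceleration z''.\<close>

definition b0 where "b0 z = B (SX z) (SY z) - B e e"
definition b1 where "b1 z z' = P (SX z) (SY z) * (\<Sum>c\<in>I. z c * z' c) + R (SX z) (SY z) * (\<Sum>c\<in>J. z c * z' c)"
definition b2 where "b2 z z' z'' =
   (PX (SX z) (SY z) * (2 * (\<Sum>c\<in>I. z c * z' c))\<^sup>2 + 2 * PY (SX z) (SY z) * (2 * (\<Sum>c\<in>I. z c * z' c)) * (2 * (\<Sum>c\<in>J. z c * z' c))
      + RY (SX z) (SY z) * (2 * (\<Sum>c\<in>J. z c * z' c))\<^sup>2) / 2
   + P (SX z) (SY z) * (\<Sum>c\<in>I. (z' c)\<^sup>2 + z c * z'' c) + R (SX z) (SY z) * (\<Sum>c\<in>J. (z' c)\<^sup>2 + z c * z'' c)"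

lemma S_ge: "e \<le> SX z" "e \<le> SY z"
  by (auto simp: SX_def SY_def sum_nonneg)

lemma S_pos: "0 < SX z" "0 < SY z"
  using S_ge[of z] e by auto

lemma DERIV_S:
  assumes "\<And>c. (z c has_real_derivative z' c) (at s)"
  shows "((\<lambda>r. SX (\<lambda>c. z c r)) has_real_derivative 2 * (\<Sum>c\<in>I. z c s * z' c)) (at s)"
    and "((\<lambda>r. SY (\<lambda>c. z c r)) has_real_derivative 2 * (\<Sum>c\<in>J. z c s * z' c)) (at s)"
  unfolding SX_def SY_def sum_distrib_left
  by (auto intro!: derivative_eq_intros assms sum.cong)

lemma DERIV_b0:
  assumes "\<And>c. (z c has_real_derivative z' c) (at s)"
  shows "((\<lambda>r. b0 (\<lambda>c. z c r)) has_real_derivative b1 (\<lambda>c. z c s) z') (at s)"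
proof -
  note D = DERIV_diff[OF DERIV_B[OF DERIV_S[of z z' s, OF assms] S_pos] DERIV_const[of "B e e"]]
  show ?thesis unfolding b0_def b1_def using D by (simp add: algebra_simps add_divide_distrib)
qed

lemma DERIV_b1:
  assumes z: "\<And>c. (z c has_real_derivative z' c s) (at s)" and z': "\<And>c. (z' c has_real_derivative z'' c) (at s)"
  shows "((\<lambda>r. b1 (\<lambda>c. z c r) (\<lambda>c. z' c r)) has_real_derivative b2 (\<lambda>c. z c s) (\<lambda>c. z' c s) z'') (at s)"
proof -
  have s: "((\<lambda>r. \<Sum>c\<in>A. z c r * z' c r) has_real_derivative (\<Sum>c\<in>A. (z' c s)\<^sup>2 + z c s * z'' c)) (at s)" for A
    by (auto intro!: derivative_eq_intros z z' sum.cong simp: power2_eq_square)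
  note D = DERIV_add[OF DERIV_mult[OF DERIV_P[OF DERIV_S[OF z] S_pos] s[of I]] DERIV_mult[OF DERIV_R[OF DERIV_S[OF z] S_pos] s[of J]]]
  show ?thesis unfolding b1_def
  proof (rule DERIV_cong[OF D])
    define X Y x y where "X = SX (\<lambda>c. z c s)" and "Y = SY (\<lambda>c. z c s)" and "x = (\<Sum>c\<in>I. z c s * z' c s)" and "y = (\<Sum>c\<in>J. z c s * z' c s)"
    show "(PX X Y * (2 * x) + PY X Y * (2 * y)) * x + (\<Sum>c\<in>I. (z' c s)\<^sup>2 + z c s * z'' c) * P X Y
      + ((PY X Y * (2 * x) + RY X Y * (2 * y)) * y + (\<Sum>c\<in>J. (z' c s)\<^sup>2 + z c s * z'' c) * R X Y)
      = b2 (\<lambda>c. z c s) (\<lambda>c. z' c s) z''"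
      unfolding b2_def X_def[symmetric] Y_def[symmetric] x_def[symmetric] y_def[symmetric]
      by (simp add: power2_eq_square algebra_simps)
  qed
qed

text \<open>Cauchy-Schwarz supplies the hypotheses of the Hessian estimate. The acceleration enters
  linearly and is kept, because the differential equation will evaluate its sum over all
  directions.\<close>

lemma b2_lower:
  "kap * (w (SX z) (SY z) powr th * (\<Sum>c\<in>I. (z' c)\<^sup>2) + (\<Sum>c\<in>J. (z' c)\<^sup>2) / w (SX z) (SY z) powr th)
     + P (SX z) (SY z) * (\<Sum>c\<in>I. z c * z'' c) + R (SX z) (SY z) * (\<Sum>c\<in>J. z c * z'' c) \<le> b2 z z' z''"
proof -
  have cs: "(2 * (\<Sum>c\<in>A. z c * z' c))\<^sup>2 \<le> 4 * ((\<Sum>c\<in>A. (z c)\<^sup>2) + e) * (\<Sum>c\<in>A. (z' c)\<^sup>2)" for A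
  proof -
    have "(\<Sum>c\<in>A. z c * z' c)\<^sup>2 \<le> (\<Sum>c\<in>A. (z c)\<^sup>2) * (\<Sum>c\<in>A. (z' c)\<^sup>2)" by (rule Cauchy_Schwarz_ineq_sum)
    also have "\<dots> \<le> ((\<Sum>c\<in>A. (z c)\<^sup>2) + e) * (\<Sum>c\<in>A. (z' c)\<^sup>2)"
      using e by (intro mult_right_mono sum_nonneg) auto
    finally have "4 * (\<Sum>c\<in>A. z c * z' c)\<^sup>2 \<le> 4 * (((\<Sum>c\<in>A. (z c)\<^sup>2) + e) * (\<Sum>c\<in>A. (z' c)\<^sup>2))" by simp
    then show ?thesis by (simp only: power_mult_distrib mult.assoc) simp
  qed
  from hessian_lower_bound[OF S_pos sum_nonneg sum_nonneg cs[of I, folded SX_def] cs[of J, folded SY_def]]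
  show ?thesis unfolding b2_def by (simp add: sum.distrib algebra_simps)
qed

lemma b0_nonneg: "0 \<le> b0 z"
  using B_mono[OF _ S_ge(1) _ S_ge(2), of z z] e by (simp add: b0_def)

lemma sum_bound:
  assumes "\<And>c. c \<in> A \<Longrightarrow> \<bar>f c\<bar> \<le> (k::real)" "card A \<le> n" "0 \<le> k"
  shows "\<bar>\<Sum>c\<in>A. f c\<bar> \<le> real n * k"
proof -
  have "\<bar>\<Sum>c\<in>A. f c\<bar> \<le> (\<Sum>c\<in>A. \<bar>f c\<bar>)" by (rule sum_abs)
  also have "\<dots> \<le> real (card A) * k" using assms(1) by (rule sum_bounded_above)
  also have "\<dots> \<le> real n * k" using assms by (intro mult_right_mono) auto
  finally show ?thesis .
qed

definition num where "num = card I + card J"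

lemma S_le:
  assumes "\<And>c. \<bar>z c\<bar> \<le> K"
  shows "SX z \<le> real num * K\<^sup>2 + 1" "SY z \<le> real num * K\<^sup>2 + 1"
proof -
  have "\<bar>(z c)\<^sup>2\<bar> \<le> K\<^sup>2" for c using assms[of c] by (simp add: abs_le_square_iff[symmetric])
  then have "\<bar>\<Sum>c\<in>A. (z c)\<^sup>2\<bar> \<le> real num * K\<^sup>2" if "card A \<le> num" for A
    using that by (intro sum_bound) auto
  from this[of I] this[of J] show "SX z \<le> real num * K\<^sup>2 + 1" "SY z \<le> real num * K\<^sup>2 + 1"
    using e by (auto simp: SX_def SY_def num_def)
qed

lemma coeff_bound:
  "\<exists>C\<ge>0. \<forall>z. (\<forall>c. \<bar>z c\<bar> \<le> K) \<longrightarrow> \<bar>P (SX z) (SY z)\<bar> \<le> C \<and> \<bar>R (SX z) (SY z)\<bar> \<le> C \<and> \<bar>PX (SX z) (SY z)\<bar> \<le> C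
     \<and> \<bar>PY (SX z) (SY z)\<bar> \<le> C \<and> \<bar>RY (SX z) (SY z)\<bar> \<le> C"
proof -
  obtain C where C: "\<And>X Y. X \<in> {e..real num * K\<^sup>2 + 1} \<Longrightarrow> Y \<in> {e..real num * K\<^sup>2 + 1} \<Longrightarrow>
     \<bar>P X Y\<bar> \<le> C \<and> \<bar>R X Y\<bar> \<le> C \<and> \<bar>PX X Y\<bar> \<le> C \<and> \<bar>PY X Y\<bar> \<le> C \<and> \<bar>RY X Y\<bar> \<le> C"
    using coeffs_bounded[OF e(1), of "real num * K\<^sup>2 + 1"] by blast
  have "\<bar>P (SX z) (SY z)\<bar> \<le> \<bar>C\<bar> \<and> \<bar>R (SX z) (SY z)\<bar> \<le> \<bar>C\<bar> \<and> \<bar>PX (SX z) (SY z)\<bar> \<le> \<bar>C\<bar>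
     \<and> \<bar>PY (SX z) (SY z)\<bar> \<le> \<bar>C\<bar> \<and> \<bar>RY (SX z) (SY z)\<bar> \<le> \<bar>C\<bar>" if "\<forall>c. \<bar>z c\<bar> \<le> K" for z
    using C[of "SX z" "SY z"] S_ge[of z] S_le[of z K] that by (auto intro: order_trans[OF _ abs_ge_self])
  then show ?thesis by (intro exI[of _ "\<bar>C\<bar>"]) auto
qed

text \<open>The bound is linear in the products z c z' c. A factor x_i contained in these products
  therefore survives and can cancel the singular 1 / x_i of the drift.\<close>

lemma b1_bound:
  "\<exists>L\<ge>0. \<forall>z z' k. (\<forall>c. \<bar>z c\<bar> \<le> K) \<longrightarrow> 0 \<le> k \<longrightarrow> (\<forall>c. \<bar>z c * z' c\<bar> \<le> k) \<longrightarrow> \<bar>b1 z z'\<bar> \<le> L * k"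
proof -
  obtain C where C: "C \<ge> 0" "\<And>z. (\<forall>c. \<bar>z c\<bar> \<le> K) \<Longrightarrow> \<bar>P (SX z) (SY z)\<bar> \<le> C \<and> \<bar>R (SX z) (SY z)\<bar> \<le> C"
    using coeff_bound[of K] by blast
  have "\<bar>b1 z z'\<bar> \<le> (2 * C * real num) * k" if z: "\<forall>c. \<bar>z c\<bar> \<le> K" and k: "0 \<le> k" "\<forall>c. \<bar>z c * z' c\<bar> \<le> k" for z z' k
  proof -
    have s: "\<bar>\<Sum>c\<in>A. z c * z' c\<bar> \<le> real num * k" if "card A \<le> num" for A
      using k that by (intro sum_bound) auto
    have "\<bar>b1 z z'\<bar> \<le> \<bar>P (SX z) (SY z)\<bar> * \<bar>\<Sum>c\<in>I. z c * z' c\<bar> + \<bar>R (SX z) (SY z)\<bar> * \<bar>\<Sum>c\<in>J. z c * z' c\<bar>"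
      unfolding b1_def abs_mult[symmetric] by (rule abs_triangle_ineq)
    also have "\<dots> \<le> C * (real num * k) + C * (real num * k)"
      using C(2)[OF z] s[of I] s[of J] C(1) by (intro add_mono mult_mono) (auto simp: num_def)
    finally show ?thesis by (simp add: algebra_simps)
  qed
  moreover have "2 * C * real num \<ge> 0" using C by simp
  ultimately show ?thesis by blast
qed

text \<open>Here \<open>g\<close> stands for the value of a Gaussian. All terms are quadratic in the
  data, and g^2 is estimated by g.\<close>

lemma b2_bound:
  assumes K: "K \<ge> 0"
  shows "\<exists>L\<ge>0. \<forall>z z' z'' g. 0 \<le> g \<longrightarrow> g \<le> 1 \<longrightarrow> (\<forall>c. \<bar>z c\<bar> \<le> K * g) \<longrightarrow> (\<forall>c. \<bar>z' c\<bar> \<le> K * g) \<longrightarrow> (\<forall>c. \<bar>z'' c\<bar> \<le> K * g)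
    \<longrightarrow> \<bar>b2 z z' z''\<bar> \<le> L * g"
proof -
  obtain C where C: "C \<ge> 0" "\<And>z. (\<forall>c. \<bar>z c\<bar> \<le> K) \<Longrightarrow> \<bar>P (SX z) (SY z)\<bar> \<le> C \<and> \<bar>R (SX z) (SY z)\<bar> \<le> C \<and> \<bar>PX (SX z) (SY z)\<bar> \<le> C
     \<and> \<bar>PY (SX z) (SY z)\<bar> \<le> C \<and> \<bar>RY (SX z) (SY z)\<bar> \<le> C"
    using coeff_bound[of K] by blast
  define D where "D = real num * K\<^sup>2"
  have D: "D \<ge> 0" by (simp add: D_def)
  define L where "L = 8 * C * D\<^sup>2 + 4 * C * D"
  have main: "\<bar>b2 z z' z''\<bar> \<le> L * g"
    if g: "0 \<le> g" "g \<le> 1" and z: "\<forall>c. \<bar>z c\<bar> \<le> K * g" "\<forall>c. \<bar>z' c\<bar> \<le> K * g" "\<forall>c. \<bar>z'' c\<bar> \<le> K * g" for z z' z'' g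
  proof -
    have zK: "\<forall>c. \<bar>z c\<bar> \<le> K" using z(1) mult_left_mono[OF g(2) K] by (auto intro: order_trans)
    note CC = C(2)[OF zK]
    have gg: "g\<^sup>2 \<le> g" using g by (simp add: power2_eq_square mult_left_le)
    have m: "\<bar>u * v\<bar> \<le> K\<^sup>2 * g" if "\<bar>u\<bar> \<le> K * g" "\<bar>v\<bar> \<le> K * g" for u v
    proof -
      have "\<bar>u * v\<bar> \<le> (K * g) * (K * g)" unfolding abs_mult using that g K by (intro mult_mono) auto
      also have "\<dots> = K\<^sup>2 * g\<^sup>2" by (simp add: power2_eq_square)
      also have "\<dots> \<le> K\<^sup>2 * g" using gg by (intro mult_left_mono) auto
      finally show ?thesis .
    qed
    have s1: "\<bar>\<Sum>c\<in>A. z c * z' c\<bar> \<le> D * g" if "card A \<le> num" for A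
      using sum_bound[of A "\<lambda>c. z c * z' c" "K\<^sup>2 * g" num] m z that g by (simp add: D_def mult.assoc)
    have s2: "\<bar>\<Sum>c\<in>A. (z' c)\<^sup>2 + z c * z'' c\<bar> \<le> 2 * D * g" if "card A \<le> num" for A
    proof -
      have "\<bar>(z' c)\<^sup>2 + z c * z'' c\<bar> \<le> 2 * (K\<^sup>2 * g)" for c
        using m[of "z' c" "z' c"] m[of "z c" "z'' c"] z by (smt (verit, best) power2_eq_square)
      then show ?thesis using sum_bound[of A "\<lambda>c. (z' c)\<^sup>2 + z c * z'' c" "2 * (K\<^sup>2 * g)" num] that g
        by (simp add: D_def algebra_simps)
    qed
    define x y u v where "x = (\<Sum>c\<in>I. z c * z' c)" and "y = (\<Sum>c\<in>J. z c * z' c)"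
      and "u = (\<Sum>c\<in>I. (z' c)\<^sup>2 + z c * z'' c)" and "v = (\<Sum>c\<in>J. (z' c)\<^sup>2 + z c * z'' c)"
    have xy: "\<bar>x\<bar> \<le> D * g" "\<bar>y\<bar> \<le> D * g" "\<bar>u\<bar> \<le> 2 * D * g" "\<bar>v\<bar> \<le> 2 * D * g"
      using s1[of I] s1[of J] s2[of I] s2[of J] by (auto simp: x_def y_def u_def v_def num_def)
    have prod: "\<bar>a * s * t\<bar> \<le> C * D\<^sup>2 * g" if "\<bar>a\<bar> \<le> C" "\<bar>s\<bar> \<le> D * g" "\<bar>t\<bar> \<le> D * g" for a s t
    proof -
      have "\<bar>a * s * t\<bar> \<le> C * (D * g) * (D * g)" unfolding abs_mult using that C D g by (intro mult_mono) auto
      also have "\<dots> = C * D\<^sup>2 * g\<^sup>2" by (simp add: power2_eq_square)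
      also have "\<dots> \<le> C * D\<^sup>2 * g" using gg C by (intro mult_left_mono) auto
      finally show ?thesis .
    qed
    have prod2: "\<bar>a * s\<bar> \<le> C * (2 * D * g)" if "\<bar>a\<bar> \<le> C" "\<bar>s\<bar> \<le> 2 * D * g" for a s
      unfolding abs_mult using that C D g by (intro mult_mono) auto
    define c1 c2 c3 c4 c5 where "c1 = PX (SX z) (SY z)" and "c2 = PY (SX z) (SY z)" and "c3 = RY (SX z) (SY z)"
      and "c4 = P (SX z) (SY z)" and "c5 = R (SX z) (SY z)"
    have "b2 z z' z'' = 2 * (c1 * x * x) + 4 * (c2 * x * y) + 2 * (c3 * y * y) + c4 * u + c5 * v"
      unfolding b2_def x_def[symmetric] y_def[symmetric] u_def[symmetric] v_def[symmetric]
        c1_def[symmetric] c2_def[symmetric] c3_def[symmetric] c4_def[symmetric] c5_def[symmetric]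
      by (simp add: power2_eq_square)
    moreover have "\<bar>c1 * x * x\<bar> \<le> C * D\<^sup>2 * g" "\<bar>c2 * x * y\<bar> \<le> C * D\<^sup>2 * g" "\<bar>c3 * y * y\<bar> \<le> C * D\<^sup>2 * g"
       "\<bar>c4 * u\<bar> \<le> C * (2 * D * g)" "\<bar>c5 * v\<bar> \<le> C * (2 * D * g)"
      using CC xy by (auto simp: c1_def c2_def c3_def c4_def c5_def intro!: prod prod2)
    ultimately have "\<bar>b2 z z' z''\<bar> \<le> 8 * (C * D\<^sup>2 * g) + 2 * (C * (2 * D * g))" by linarith
    then show ?thesis by (simp add: L_def algebra_simps)
  qed
  have "L \<ge> 0" using C D by (simp add: L_def)
  with main show ?thesis by blast
qed

text \<open>In the dominating expression the second variable occurs as a power q/2 of a multiple of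
  g^2, that is as a multiple of g^q, and q > 1 makes this at most linear in g.\<close>

lemma b0_bound:
  assumes K: "K \<ge> 0"
  shows "\<exists>L\<ge>0. \<forall>z g. 0 \<le> g \<longrightarrow> g \<le> 1 \<longrightarrow> (\<forall>c. \<bar>z c\<bar> \<le> K * g) \<longrightarrow> \<bar>b0 z\<bar> \<le> L * g"
proof -
  define D where "D = real num * K\<^sup>2"
  have D: "D \<ge> 0" by (simp add: D_def)
  obtain C where C: "C \<ge> 0" "\<And>x y. 0 \<le> x \<Longrightarrow> x \<le> D \<Longrightarrow> 0 \<le> y \<Longrightarrow> y \<le> D \<Longrightarrow> B (x + e) (y + e) - B e e \<le> C * (x + y powr (q / 2))"
    using B_diff_dominated[of D] e by blast
  have main: "\<bar>b0 z\<bar> \<le> (C * (D + D powr (q / 2))) * g" if g: "0 \<le> g" "g \<le> 1" and z: "\<forall>c. \<bar>z c\<bar> \<le> K * g" for z g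
  proof -
    have gg: "g\<^sup>2 \<le> g" using g by (simp add: power2_eq_square mult_left_le)
    have s: "(\<Sum>c\<in>A. (z c)\<^sup>2) \<le> D * g\<^sup>2" if "card A \<le> num" for A
    proof -
      have "\<bar>(z c)\<^sup>2\<bar> \<le> (K * g)\<^sup>2" for c using z K g by (simp add: abs_le_square_iff[symmetric])
      then have "\<bar>\<Sum>c\<in>A. (z c)\<^sup>2\<bar> \<le> real num * (K * g)\<^sup>2" using that by (intro sum_bound) auto
      then show ?thesis by (simp add: D_def power_mult_distrib)
    qed
    define x y where "x = (\<Sum>c\<in>I. (z c)\<^sup>2)" and "y = (\<Sum>c\<in>J. (z c)\<^sup>2)"
    have xy: "0 \<le> x" "0 \<le> y" "x \<le> D * g\<^sup>2" "y \<le> D * g\<^sup>2"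
      using s[of I] s[of J] by (auto simp: x_def y_def num_def sum_nonneg)
    have Dg: "D * g\<^sup>2 \<le> D" "D * g\<^sup>2 \<le> D * g"
      using gg g D by (auto intro: mult_left_mono mult_left_le simp: power_le_one)
    have "b0 z = B (x + e) (y + e) - B e e" by (simp add: b0_def SX_def SY_def x_def y_def)
    also have "\<dots> \<le> C * (x + y powr (q / 2))" using xy Dg by (intro C) auto
    also have "\<dots> \<le> C * (D * g + D powr (q / 2) * g)"
    proof (intro mult_left_mono C add_mono)
      show "x \<le> D * g" using xy Dg by simp
      have "y powr (q / 2) \<le> (D * g\<^sup>2) powr (q / 2)" using xy q_bounds by (intro powr_mono2) auto
      also have "\<dots> = D powr (q / 2) * (g\<^sup>2) powr (q / 2)" using D by (simp add: powr_mult)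
      also have "(g\<^sup>2) powr (q / 2) \<le> g"
      proof (cases "g = 0")
        case False
        then have "(g\<^sup>2) powr (q / 2) = g powr q" using g by (simp add: powr_powr flip: powr_numeral)
        also have "\<dots> \<le> g powr 1" using g False q_bounds by (intro powr_mono') auto
        finally show ?thesis using g by simp
      qed simp
      finally show "y powr (q / 2) \<le> D powr (q / 2) * g" by (simp add: mult_left_mono)
    qed
    finally show ?thesis using b0_nonneg[of z] by (simp add: algebra_simps)
  qed
  have "C * (D + D powr (q / 2)) \<ge> 0" using C D by simp
  with main show ?thesis by blast
qed

lemma b_measurable:
  assumes "\<And>c. z c \<in> borel_measurable M" "\<And>c. z' c \<in> borel_measurable M"
  shows "(\<lambda>x. b0 (\<lambda>c. z c x)) \<in> borel_measurable M" "(\<lambda>x. b1 (\<lambda>c. z c x) (\<lambda>c. z' c x)) \<in> borel_measurable M"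
proof -
  note [measurable] = assms
  show "(\<lambda>x. b0 (\<lambda>c. z c x)) \<in> borel_measurable M" "(\<lambda>x. b1 (\<lambda>c. z c x) (\<lambda>c. z' c x)) \<in> borel_measurable M"
    unfolding b0_def b1_def SX_def SY_def B_def P_def R_def w_def by measurable
qed

end

locale flow = bellman_sums p q th kap I J e
  for p q th kap e :: real and I J :: "'c set" +
  fixes \<alpha> :: "real^'n" and Z Zt Ztt :: "'c \<Rightarrow> real \<Rightarrow> real^'n \<Rightarrow> real"
    and Zi Zii :: "'n \<Rightarrow> 'c \<Rightarrow> real \<Rightarrow> real^'n \<Rightarrow> real" and pot :: "'c \<Rightarrow> real^'n \<Rightarrow> real" and K :: real
  assumes \<alpha>: "\<And>i. \<alpha> $ i > - 1"
    and meas: "\<And>c t. Z c t \<in> borel_measurable borel" "\<And>c t. Zt c t \<in> borel_measurable borel" "\<And>i c t. Zi i c t \<in> borel_measurable borel"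
    and dt: "\<And>c t x. t > - 1 \<Longrightarrow> x \<in> orthant \<Longrightarrow> ((\<lambda>t. Z c t x) has_real_derivative Zt c t x) (at t)"
      "\<And>c t x. t > - 1 \<Longrightarrow> x \<in> orthant \<Longrightarrow> ((\<lambda>t. Zt c t x) has_real_derivative Ztt c t x) (at t)"
    and dx: "\<And>i c t x. t > - 1 \<Longrightarrow> x \<in> orthant \<Longrightarrow> ((\<lambda>r. Z c t (vec_upd x i r)) has_real_derivative Zi i c t x) (at (x $ i))"
      "\<And>i c t x. t > - 1 \<Longrightarrow> x \<in> orthant \<Longrightarrow> ((\<lambda>r. Zi i c t (vec_upd x i r)) has_real_derivative Zii i c t x) (at (x $ i))"
    and K: "K \<ge> 0"
    and bd: "\<And>c t x. t > - 1 \<Longrightarrow> x \<in> orthant \<Longrightarrow> \<bar>Z c t x\<bar> \<le> K * exp (- (1/8) * (norm x)\<^sup>2)"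
      "\<And>c t x. t > - 1 \<Longrightarrow> x \<in> orthant \<Longrightarrow> \<bar>Zt c t x\<bar> \<le> K * exp (- (1/8) * (norm x)\<^sup>2)"
      "\<And>c t x. t > - 1 \<Longrightarrow> x \<in> orthant \<Longrightarrow> \<bar>Ztt c t x\<bar> \<le> K * exp (- (1/8) * (norm x)\<^sup>2)"
      "\<And>i c t x. t > - 1 \<Longrightarrow> x \<in> orthant \<Longrightarrow> \<bar>Zi i c t x\<bar> \<le> K * exp (- (1/8) * (norm x)\<^sup>2)"
      "\<And>i c t x. t > - 1 \<Longrightarrow> x \<in> orthant \<Longrightarrow> \<bar>Zii i c t x\<bar> \<le> K * exp (- (1/8) * (norm x)\<^sup>2)"
      "\<And>i c t x. t > - 1 \<Longrightarrow> x \<in> orthant \<Longrightarrow> \<bar>Z c t x * Zi i c t x\<bar> \<le> x $ i * (K * exp (- (1/8) * (norm x)\<^sup>2))"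
    and pde: "\<And>c t x. t > - 1 \<Longrightarrow> x \<in> orthant \<Longrightarrow>
       Ztt c t x + (\<Sum>i\<in>UNIV. Zii i c t x + (2 * \<alpha> $ i + 1) / x $ i * Zi i c t x) = pot c x * Z c t x"
    and pot: "\<And>c x. x \<in> orthant \<Longrightarrow> pot c x \<ge> 0"
begin

abbreviation M where "M \<equiv> laguerre_measure \<alpha>"
abbreviation G where "G x \<equiv> exp (- (1/8) * (norm (x::real^'n))\<^sup>2)"

lemma G01: "0 \<le> G x" "G x \<le> 1" by auto

lemma G_int: "integrable M (\<lambda>x. L * G x)"
  by (intro integrable_mult_right gauss_integrable \<alpha>) simp

definition energy :: "'c set \<Rightarrow> real \<Rightarrow> real^'n \<Rightarrow> real" where
  "energy A t x = (\<Sum>c\<in>A. (Zt c t x)\<^sup>2 + (\<Sum>i\<in>UNIV. (Zi i c t x)\<^sup>2) + pot c x * (Z c t x)\<^sup>2)"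

definition \<Phi> where "\<Phi> t = (\<integral>x. b0 (\<lambda>c. Z c t x) \<partial>M)"
definition \<Phi>1 where "\<Phi>1 t = (\<integral>x. b1 (\<lambda>c. Z c t x) (\<lambda>c. Zt c t x) \<partial>M)"
definition \<Phi>2 where "\<Phi>2 t = (\<integral>x. b2 (\<lambda>c. Z c t x) (\<lambda>c. Zt c t x) (\<lambda>c. Ztt c t x) \<partial>M)"

lemma Z_le_K: "t > - 1 \<Longrightarrow> x \<in> orthant \<Longrightarrow> \<bar>Z c t x\<bar> \<le> K"
  using bd(1)[of t x c] mult_left_mono[OF G01(2)[of x] K] by simp

lemma mult_bound:
  assumes "\<bar>u\<bar> \<le> K * G x" "\<bar>v\<bar> \<le> K * G x"
  shows "\<bar>u * v\<bar> \<le> K\<^sup>2 * G x"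
proof -
  have "\<bar>u * v\<bar> \<le> (K * G x) * (K * G x)" unfolding abs_mult using assms K by (intro mult_mono) auto
  also have "\<dots> = (K\<^sup>2 * G x) * G x" by (simp add: power2_eq_square)
  also have "\<dots> \<le> (K\<^sup>2 * G x) * 1" by (intro mult_left_mono G01) auto
  finally show ?thesis by simp
qed

lemma b0_integrable: "t > - 1 \<Longrightarrow> integrable M (\<lambda>x. b0 (\<lambda>c. Z c t x))"
  and \<Phi>_bounded: "\<exists>C. \<forall>t>-1. \<Phi> t \<le> C"
proof -
  obtain L where L: "L \<ge> 0" "\<And>z g. 0 \<le> g \<Longrightarrow> g \<le> 1 \<Longrightarrow> (\<forall>c. \<bar>z c\<bar> \<le> K * g) \<Longrightarrow> \<bar>b0 z\<bar> \<le> L * g"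
    using b0_bound[OF K] by blast
  have b: "\<bar>b0 (\<lambda>c. Z c t x)\<bar> \<le> L * G x" if "t > - 1" "x \<in> orthant" for t x
    using that by (intro L(2) G01 allI bd)
  have m: "(\<lambda>x. b0 (\<lambda>c. Z c t x)) \<in> borel_measurable M" for t
    by (intro b_measurable(1)[of "\<lambda>c. Z c t" M "\<lambda>c. Z c t"] measurable_laguerre_measure meas)
  have i: "integrable M (\<lambda>x. b0 (\<lambda>c. Z c t x))" if "t > - 1" for t
    using b[OF that] L(1) by (intro Bochner_Integration.integrable_bound[OF G_int[of L] m] AE_I2) simp
  then show "t > - 1 \<Longrightarrow> integrable M (\<lambda>x. b0 (\<lambda>c. Z c t x))" .
  have "\<Phi> t \<le> (\<integral>x. L * G x \<partial>M)" if "t > - 1" for t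
    unfolding \<Phi>_def using i[OF that] G_int b[OF that] by (intro integral_mono) (auto dest: abs_le_D1)
  then show "\<exists>C. \<forall>t>-1. \<Phi> t \<le> C" by blast
qed

lemma \<Phi>_deriv:
  assumes t: "t > - 1"
  shows "(\<Phi> has_real_derivative \<Phi>1 t) (at t)" "(\<Phi>1 has_real_derivative \<Phi>2 t) (at t)"
    and "integrable M (\<lambda>x. b2 (\<lambda>c. Z c t x) (\<lambda>c. Zt c t x) (\<lambda>c. Ztt c t x))"
proof -
  obtain L1 where L1: "L1 \<ge> 0" "\<And>z z' k. (\<forall>c. \<bar>z c\<bar> \<le> K) \<Longrightarrow> 0 \<le> k \<Longrightarrow> (\<forall>c. \<bar>z c * z' c\<bar> \<le> k) \<Longrightarrow> \<bar>b1 z z'\<bar> \<le> L1 * k"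
    using b1_bound[of K] by blast
  obtain L2 where L2: "L2 \<ge> 0" "\<And>z z' z'' g. 0 \<le> g \<Longrightarrow> g \<le> 1 \<Longrightarrow> (\<forall>c. \<bar>z c\<bar> \<le> K * g) \<Longrightarrow> (\<forall>c. \<bar>z' c\<bar> \<le> K * g) \<Longrightarrow> (\<forall>c. \<bar>z'' c\<bar> \<le> K * g)
    \<Longrightarrow> \<bar>b2 z z' z''\<bar> \<le> L2 * g" using b2_bound[OF K] by blast
  define f0 f1 f2 where "f0 t x = b0 (\<lambda>c. Z c t x)" and "f1 t x = b1 (\<lambda>c. Z c t x) (\<lambda>c. Zt c t x)"
    and "f2 t x = b2 (\<lambda>c. Z c t x) (\<lambda>c. Zt c t x) (\<lambda>c. Ztt c t x)" for t x
  have d0: "((\<lambda>t. f0 t x) has_real_derivative f1 t x) (at t)" if "t \<in> {-1<..}" "x \<in> space M" for t x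
    unfolding f0_def f1_def using that by (intro DERIV_b0 dt) auto
  have d1: "((\<lambda>t. f1 t x) has_real_derivative f2 t x) (at t)" if "t \<in> {-1<..}" "x \<in> space M" for t x
    unfolding f1_def f2_def using that by (intro DERIV_b1 dt) auto
  have e1: "\<bar>f1 t x\<bar> \<le> (L1 * K\<^sup>2) * G x" if "t \<in> {-1<..}" "x \<in> space M" for t x
  proof -
    have "\<bar>f1 t x\<bar> \<le> L1 * (K\<^sup>2 * G x)" unfolding f1_def
      using that Z_le_K by (intro L1(2) allI mult_bound bd) auto
    then show ?thesis by simp
  qed
  have e2: "\<bar>f2 t x\<bar> \<le> L2 * G x" if "t \<in> {-1<..}" "x \<in> space M" for t x
    unfolding f2_def using that by (intro L2 G01 allI bd) auto
  have i0: "integrable M (f0 t)" if "t \<in> {-1<..}" for t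
    using b0_integrable that by (simp add: f0_def[abs_def])
  note R1 = has_derivative_integral_dominated[of "{-1<..}" _ M f0 f1, OF _ _ _ d0 e1 G_int i0]
  have i1: "integrable M (f1 t)" if "t \<in> {-1<..}" for t using R1(1) that by simp
  note R2 = has_derivative_integral_dominated[of "{-1<..}" _ M f1 f2, OF _ _ _ d1 e2 G_int i1]
  show "(\<Phi> has_real_derivative \<Phi>1 t) (at t)"
    using R1(2)[of t] t unfolding \<Phi>_def[abs_def] \<Phi>1_def f0_def f1_def by simp
  show "(\<Phi>1 has_real_derivative \<Phi>2 t) (at t)"
    using R2(2)[of t] t unfolding \<Phi>1_def[abs_def] \<Phi>2_def f1_def f2_def by simp
  show "integrable M (\<lambda>x. b2 (\<lambda>c. Z c t x) (\<lambda>c. Zt c t x) (\<lambda>c. Ztt c t x))"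
    using R2(1)[of t] t unfolding f2_def by simp
qed

text \<open>The integrand is the divergence form x_i^(-2\<alpha>_i-1) d_i (x_i^(2\<alpha>_i+1) d_i
  b0), whose integral against the measure should vanish; the dilation identity gives this without
  any discussion at the face x_i = 0.\<close>

lemma spatial_integral:
  assumes t: "t > - 1"
  defines "F i x \<equiv> b2 (\<lambda>c. Z c t x) (\<lambda>c. Zi i c t x) (\<lambda>c. Zii i c t x) + (2 * \<alpha> $ i + 1) / x $ i * b1 (\<lambda>c. Z c t x) (\<lambda>c. Zi i c t x)"
  shows "integrable M (F i)" "(\<integral>x. F i x \<partial>M) = 0"
proof -
  obtain L1 where L1: "L1 \<ge> 0" "\<And>z z' k. (\<forall>c. \<bar>z c\<bar> \<le> K) \<Longrightarrow> 0 \<le> k \<Longrightarrow> (\<forall>c. \<bar>z c * z' c\<bar> \<le> k) \<Longrightarrow> \<bar>b1 z z'\<bar> \<le> L1 * k"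
    using b1_bound[of K] by blast
  obtain L2 where L2: "L2 \<ge> 0" "\<And>z z' z'' g. 0 \<le> g \<Longrightarrow> g \<le> 1 \<Longrightarrow> (\<forall>c. \<bar>z c\<bar> \<le> K * g) \<Longrightarrow> (\<forall>c. \<bar>z' c\<bar> \<le> K * g) \<Longrightarrow> (\<forall>c. \<bar>z'' c\<bar> \<le> K * g)
    \<Longrightarrow> \<bar>b2 z z' z''\<bar> \<le> L2 * g" using b2_bound[OF K] by blast
  define f1 f2 where "f1 x = b1 (\<lambda>c. Z c t x) (\<lambda>c. Zi i c t x)"
    and "f2 x = b2 (\<lambda>c. Z c t x) (\<lambda>c. Zi i c t x) (\<lambda>c. Zii i c t x)" for x
  \<comment> \<open>With h the i-th derivative of \<open>b0\<close> divided by x_i, the integrand is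
    x_i h' + (2 \<alpha>_i + 2) h, exactly the combination in \<open>laguerre_measure_ibp\<close>.
    Linearity of \<open>b1_bound\<close> keeps h bounded.\<close>
  define h where "h x = f1 x / x $ i" for x
  define h' where "h' x = (f2 x * x $ i - f1 x) / (x $ i)\<^sup>2" for x
  have hm: "h \<in> borel_measurable borel" unfolding h_def[abs_def] f1_def
    by (intro borel_measurable_divide b_measurable(2) meas) measurable
  have hb: "\<bar>h x\<bar> \<le> (L1 * K) * G x" if x: "x \<in> orthant" for x
  proof -
    have xi: "x $ i > 0" using x by simp
    have "\<bar>f1 x\<bar> \<le> L1 * (x $ i * (K * G x))" unfolding f1_def
      using t x Z_le_K mult_nonneg_nonneg[OF less_imp_le[OF xi] mult_nonneg_nonneg[OF K G01(1)[of x]]]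
      by (intro L1(2) allI bd) auto
    then show ?thesis using xi by (simp add: h_def divide_le_eq mult_ac)
  qed
  have hi: "integrable M h"
    using hb L1(1) K by (intro Bochner_Integration.integrable_bound[OF G_int[of "L1 * K"] measurable_laguerre_measure[OF hm]] AE_I2) simp
  have der: "((\<lambda>r. h (vec_upd x i r)) has_real_derivative h' x) (at (x $ i))" if x: "x \<in> orthant" for x
  proof -
    have xi: "x $ i > 0" using x by simp
    have "((\<lambda>r. f1 (vec_upd x i r)) has_real_derivative f2 x) (at (x $ i))"
      unfolding f1_def f2_def
      using DERIV_b1[of "\<lambda>c r. Z c t (vec_upd x i r)" "\<lambda>c r. Zi i c t (vec_upd x i r)" "x $ i" "\<lambda>c. Zii i c t x"] dx t x by simp
    from DERIV_divide[OF this DERIV_ident[of "at (x $ i)"]] xi show ?thesis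
      unfolding h_def h'_def by (simp add: power2_eq_square)
  qed
  have xh': "x $ i * h' x = f2 x - h x" if "x \<in> orthant" for x
  proof -
    have "x $ i > 0" using that by simp
    then show ?thesis by (simp add: h'_def h_def power2_eq_square field_simps)
  qed
  have bd': "\<bar>x $ i * h' x\<bar> \<le> (L2 + L1 * K) * G x" if x: "x \<in> orthant" for x
  proof -
    have "\<bar>f2 x\<bar> \<le> L2 * G x" unfolding f2_def using t x by (intro L2 G01 allI bd)
    then show ?thesis using hb[OF x] unfolding xh'[OF x] by (simp add: distrib_right)
  qed
  note ibp = laguerre_measure_ibp[OF \<alpha> hm hi der bd']
  have Feq: "F i x = x $ i * h' x + (2 * \<alpha> $ i + 2) * h x" if "x \<in> orthant" for x
    unfolding xh'[OF that] F_def f1_def[symmetric] f2_def[symmetric] h_def by (simp add: algebra_simps add_divide_distrib)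
  have "integrable M (\<lambda>x. x $ i * h' x + (2 * \<alpha> $ i + 2) * h x)"
    using ibp(1) hi by (intro Bochner_Integration.integrable_add integrable_mult_right)
  then show "integrable M (F i)" using Feq by (subst Bochner_Integration.integrable_cong[OF refl]) auto
  have "(\<integral>x. F i x \<partial>M) = (\<integral>x. x $ i * h' x + (2 * \<alpha> $ i + 2) * h x \<partial>M)"
    using Feq by (intro Bochner_Integration.integral_cong) auto
  also have "\<dots> = 0" using ibp hi by (simp add: algebra_simps)
  finally show "(\<integral>x. F i x \<partial>M) = 0" .
qed

text \<open>The Hessian estimates in the time direction and in all space directions are added. The
  equation turns the acceleration terms into potential terms, and the lower bounds on
  \<open>P\<close> and \<open>R\<close> give these the weights they have in the energies. Since the
  balance \<open>\<tau>\<close> depends on the point, the hypothesis on \<open>s\<close> is for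
  every positive \<open>\<tau>\<close>.\<close>

lemma pointwise_lower:
  assumes t: "t > - 1" and x: "x \<in> orthant" and S: "\<And>\<tau>. \<tau> > 0 \<Longrightarrow> s \<le> \<tau> * energy I t x + energy J t x / \<tau>"
  shows "kap * s \<le> b2 (\<lambda>c. Z c t x) (\<lambda>c. Zt c t x) (\<lambda>c. Ztt c t x) +
    (\<Sum>i\<in>UNIV. b2 (\<lambda>c. Z c t x) (\<lambda>c. Zi i c t x) (\<lambda>c. Zii i c t x) + (2 * \<alpha> $ i + 1) / x $ i * b1 (\<lambda>c. Z c t x) (\<lambda>c. Zi i c t x))"
proof -
  define z where "z c = Z c t x" for c
  define X Y where "X = SX z" and "Y = SY z"
  define \<tau> where "\<tau> = w X Y powr th"
  have XY: "X > 0" "Y > 0" using S_pos by (auto simp: X_def Y_def)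
  note tb = tau_bounds[OF XY, folded \<tau>_def]
  have k0: "kap > 0" by (rule q_bounds)
  define a :: "'n \<Rightarrow> real" where "a i = (2 * \<alpha> $ i + 1) / x $ i" for i
  have l0: "kap * (\<tau> * (\<Sum>c\<in>I. (Zt c t x)\<^sup>2) + (\<Sum>c\<in>J. (Zt c t x)\<^sup>2) / \<tau>) + P X Y * (\<Sum>c\<in>I. z c * Ztt c t x) + R X Y * (\<Sum>c\<in>J. z c * Ztt c t x)
      \<le> b2 z (\<lambda>c. Zt c t x) (\<lambda>c. Ztt c t x)"
    unfolding \<tau>_def X_def Y_def by (rule b2_lower)
  have li: "kap * (\<tau> * (\<Sum>c\<in>I. (Zi i c t x)\<^sup>2) + (\<Sum>c\<in>J. (Zi i c t x)\<^sup>2) / \<tau>)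
        + P X Y * (\<Sum>c\<in>I. z c * (Zii i c t x + a i * Zi i c t x)) + R X Y * (\<Sum>c\<in>J. z c * (Zii i c t x + a i * Zi i c t x))
      \<le> b2 z (\<lambda>c. Zi i c t x) (\<lambda>c. Zii i c t x) + a i * b1 z (\<lambda>c. Zi i c t x)" for i
  proof -
    have "(\<Sum>c\<in>A. z c * (Zii i c t x + a i * Zi i c t x)) = (\<Sum>c\<in>A. z c * Zii i c t x) + a i * (\<Sum>c\<in>A. z c * Zi i c t x)" for A
      by (simp add: sum_distrib_left sum.distrib[symmetric] algebra_simps)
    then show ?thesis using b2_lower[of z "\<lambda>c. Zi i c t x" "\<lambda>c. Zii i c t x", folded X_def Y_def, folded \<tau>_def]
      unfolding b1_def X_def[symmetric] Y_def[symmetric] by (simp add: algebra_simps)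
  qed
  define EI where "EI A = (\<Sum>c\<in>A. (Zt c t x)\<^sup>2) + (\<Sum>i\<in>UNIV. \<Sum>c\<in>A. (Zi i c t x)\<^sup>2)" for A
  have pdeA: "(\<Sum>c\<in>A. z c * Ztt c t x) + (\<Sum>i\<in>UNIV. \<Sum>c\<in>A. z c * (Zii i c t x + a i * Zi i c t x)) = (\<Sum>c\<in>A. pot c x * (z c)\<^sup>2)" for A
  proof -
    have "(\<Sum>i\<in>UNIV. \<Sum>c\<in>A. z c * (Zii i c t x + a i * Zi i c t x)) = (\<Sum>c\<in>A. z c * (\<Sum>i\<in>UNIV. Zii i c t x + a i * Zi i c t x))"
      by (subst sum.swap) (simp add: sum_distrib_left)
    then have "(\<Sum>c\<in>A. z c * Ztt c t x) + (\<Sum>i\<in>UNIV. \<Sum>c\<in>A. z c * (Zii i c t x + a i * Zi i c t x))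
      = (\<Sum>c\<in>A. z c * (Ztt c t x + (\<Sum>i\<in>UNIV. Zii i c t x + a i * Zi i c t x)))"
      by (simp add: sum.distrib[symmetric] distrib_left)
    also have "\<dots> = (\<Sum>c\<in>A. pot c x * (z c)\<^sup>2)"
      using pde[OF t x] by (intro sum.cong refl) (simp add: a_def z_def power2_eq_square mult_ac)
    finally show ?thesis .
  qed
  have energy_eq: "energy A t x = EI A + (\<Sum>c\<in>A. pot c x * (z c)\<^sup>2)" for A
  proof -
    have "(\<Sum>i\<in>UNIV. \<Sum>c\<in>A. (Zi i c t x)\<^sup>2) = (\<Sum>c\<in>A. \<Sum>i\<in>UNIV. (Zi i c t x)\<^sup>2)" by (rule sum.swap)
    then show ?thesis by (simp add: energy_def EI_def z_def sum.distrib)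
  qed
  have potn: "0 \<le> (\<Sum>c\<in>A. pot c x * (z c)\<^sup>2)" for A using pot[OF x] by (intro sum_nonneg) auto
  have "kap * (\<tau> * EI I + EI J / \<tau>) + P X Y * (\<Sum>c\<in>I. pot c x * (z c)\<^sup>2) + R X Y * (\<Sum>c\<in>J. pot c x * (z c)\<^sup>2)
    \<le> b2 z (\<lambda>c. Zt c t x) (\<lambda>c. Ztt c t x) + (\<Sum>i\<in>UNIV. b2 z (\<lambda>c. Zi i c t x) (\<lambda>c. Zii i c t x) + a i * b1 z (\<lambda>c. Zi i c t x))" (is "?l \<le> ?r")
  proof -
    have "?l = (kap * (\<tau> * (\<Sum>c\<in>I. (Zt c t x)\<^sup>2) + (\<Sum>c\<in>J. (Zt c t x)\<^sup>2) / \<tau>) + P X Y * (\<Sum>c\<in>I. z c * Ztt c t x) + R X Y * (\<Sum>c\<in>J. z c * Ztt c t x))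
      + (\<Sum>i\<in>UNIV. kap * (\<tau> * (\<Sum>c\<in>I. (Zi i c t x)\<^sup>2) + (\<Sum>c\<in>J. (Zi i c t x)\<^sup>2) / \<tau>)
        + P X Y * (\<Sum>c\<in>I. z c * (Zii i c t x + a i * Zi i c t x)) + R X Y * (\<Sum>c\<in>J. z c * (Zii i c t x + a i * Zi i c t x)))"
      unfolding pdeA[symmetric] EI_def
      by (simp add: sum.distrib sum_distrib_left[symmetric] sum_divide_distrib[symmetric] add_divide_distrib distrib_left)
    also have "\<dots> \<le> ?r" by (intro add_mono l0 sum_mono li)
    finally show ?thesis .
  qed
  moreover have "kap * \<tau> * (\<Sum>c\<in>I. pot c x * (z c)\<^sup>2) \<le> P X Y * (\<Sum>c\<in>I. pot c x * (z c)\<^sup>2)"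
  proof (rule mult_right_mono[OF _ potn])
    have "0 < kap * \<tau>" using k0 tb(4) by simp
    then show "kap * \<tau> \<le> P X Y" using tb(1) by linarith
  qed
  moreover have "(kap / \<tau>) * (\<Sum>c\<in>J. pot c x * (z c)\<^sup>2) \<le> R X Y * (\<Sum>c\<in>J. pot c x * (z c)\<^sup>2)"
    by (rule mult_right_mono[OF tb(2) potn])
  moreover have "kap * s \<le> kap * (\<tau> * energy I t x + energy J t x / \<tau>)"
    using S[OF tb(4)] k0 by (intro mult_left_mono) auto
  then have "kap * s \<le> kap * (\<tau> * EI I + EI J / \<tau>) + kap * \<tau> * (\<Sum>c\<in>I. pot c x * (z c)\<^sup>2) + (kap / \<tau>) * (\<Sum>c\<in>J. pot c x * (z c)\<^sup>2)"
    unfolding energy_eq by (simp add: algebra_simps add_divide_distrib)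
  ultimately show ?thesis unfolding a_def z_def by linarith
qed

theorem flow_inequality:
  fixes S :: "real \<Rightarrow> real^'n \<Rightarrow> real" and V V1 :: "real \<Rightarrow> real"
  assumes S: "\<And>t x \<tau>. t \<ge> 0 \<Longrightarrow> x \<in> orthant \<Longrightarrow> \<tau> > 0 \<Longrightarrow> \<bar>S t x\<bar> \<le> \<tau> * energy I t x + energy J t x / \<tau>"
    and Si: "\<And>t. t \<ge> 0 \<Longrightarrow> integrable M (S t)"
    and V: "\<And>t. t \<ge> 0 \<Longrightarrow> (V has_real_derivative V1 t) (at t)"
    and V1: "\<And>t. t \<ge> 0 \<Longrightarrow> (V1 has_real_derivative (\<integral>x. S t x \<partial>M)) (at t)"
    and Vb: "\<And>t. t \<ge> 0 \<Longrightarrow> \<bar>V t\<bar> \<le> CV" and Vlim: "(V \<longlongrightarrow> 0) at_top"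
  shows "kap * \<bar>V 0\<bar> \<le> \<Phi> 0"
proof -
  have k0: "kap > 0" by (rule q_bounds)
  obtain C where C: "\<And>t. t > - 1 \<Longrightarrow> \<Phi> t \<le> C" using \<Phi>_bounded by blast
  have \<Phi>0: "0 \<le> \<Phi> t" for t unfolding \<Phi>_def by (intro Bochner_Integration.integral_nonneg b0_nonneg)
  \<comment> \<open>Both signs \<open>\<sigma>\<close> are used to reach the absolute value. At
    infinity only V -> 0 and \<Phi> \<ge> 0 enter.\<close>
  have main: "0 \<le> \<Phi> 0 + (kap * \<sigma>) * V 0" if \<sigma>: "\<bar>\<sigma>\<bar> = 1" for \<sigma>
  proof -
    define F where "F t = \<Phi> t + (kap * \<sigma>) * V t" for t
    have anti: "F t \<le> F 0" if "t \<ge> 0" for t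
    proof (rule convex_bounded_antimono[OF _ _ _ _ that])
      fix t :: real assume t: "t \<ge> 0"
      show "(F has_real_derivative \<Phi>1 t + (kap * \<sigma>) * V1 t) (at t)"
        unfolding F_def[abs_def] using t by (intro DERIV_add DERIV_cmult \<Phi>_deriv V) auto
      show "((\<lambda>t. \<Phi>1 t + (kap * \<sigma>) * V1 t) has_real_derivative \<Phi>2 t + (kap * \<sigma>) * (\<integral>x. S t x \<partial>M)) (at t)"
        using t by (intro DERIV_add DERIV_cmult \<Phi>_deriv V1) auto
      show "F t \<le> C + kap * CV"
      proof -
        have "(kap * \<sigma>) * V t \<le> kap * (\<bar>\<sigma>\<bar> * \<bar>V t\<bar>)"
          using k0 by (simp add: abs_mult[symmetric] mult.assoc)
        also have "\<dots> \<le> kap * CV" using Vb[OF t] k0 \<sigma> by simp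
        finally show ?thesis using C[of t] t by (simp add: F_def)
      qed
      have t1: "t > - 1" using t by simp
      define L where "L x = (\<Sum>i\<in>UNIV. b2 (\<lambda>c. Z c t x) (\<lambda>c. Zi i c t x) (\<lambda>c. Zii i c t x) + (2 * \<alpha> $ i + 1) / x $ i * b1 (\<lambda>c. Z c t x) (\<lambda>c. Zi i c t x))" for x
      have Li: "integrable M L" "(\<integral>x. L x \<partial>M) = 0"
        unfolding L_def using spatial_integral[OF t1]
        by (auto simp: Bochner_Integration.integral_sum)
      have "(\<integral>x. - (kap * \<sigma>) * S t x \<partial>M) \<le> (\<integral>x. b2 (\<lambda>c. Z c t x) (\<lambda>c. Zt c t x) (\<lambda>c. Ztt c t x) + L x \<partial>M)"
      proof (rule integral_mono)
        show "integrable M (\<lambda>x. - (kap * \<sigma>) * S t x)" using Si[OF t] by (intro integrable_mult_right)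
        show "integrable M (\<lambda>x. b2 (\<lambda>c. Z c t x) (\<lambda>c. Zt c t x) (\<lambda>c. Ztt c t x) + L x)"
          using \<Phi>_deriv(3)[OF t1] Li by (intro Bochner_Integration.integrable_add)
        fix x assume "x \<in> space M"
        then have x: "x \<in> orthant" by simp
        have "- \<sigma> * S t x \<le> \<bar>\<sigma>\<bar> * \<bar>S t x\<bar>" by (simp add: abs_mult[symmetric])
        then have "- \<sigma> * S t x \<le> \<bar>S t x\<bar>" using \<sigma> by simp
        then have "kap * (- \<sigma> * S t x) \<le> b2 (\<lambda>c. Z c t x) (\<lambda>c. Zt c t x) (\<lambda>c. Ztt c t x) + L x"
          unfolding L_def using S[OF t x] by (intro pointwise_lower[OF t1 x]) (auto intro: order_trans)
        then show "- (kap * \<sigma>) * S t x \<le> b2 (\<lambda>c. Z c t x) (\<lambda>c. Zt c t x) (\<lambda>c. Ztt c t x) + L x" by simp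
      qed
      also have "\<dots> = \<Phi>2 t" unfolding \<Phi>2_def using \<Phi>_deriv(3)[OF t1] Li by simp
      finally show "0 \<le> \<Phi>2 t + (kap * \<sigma>) * (\<integral>x. S t x \<partial>M)" by simp
    qed
    have "((\<lambda>t. (kap * \<sigma>) * V t) \<longlongrightarrow> (kap * \<sigma>) * 0) at_top" by (intro tendsto_intros Vlim)
    moreover have "eventually (\<lambda>t. (kap * \<sigma>) * V t \<le> F 0) at_top"
      using eventually_ge_at_top[of 0]
    proof eventually_elim
      case (elim t)
      then show ?case using anti[of t] \<Phi>0[of t] by (simp add: F_def)
    qed
    ultimately have "(kap * \<sigma>) * 0 \<le> F 0" by (intro tendsto_upperbound[of _ _ at_top]) auto
    then show ?thesis by (simp add: F_def)
  qed
  show ?thesis using main[of 1] main[of "- 1"] k0 by (auto simp: abs_if)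
qed

end

section \<open>Laguerre functions in several variables\<close>

definition gauss_pderiv :: "real poly \<Rightarrow> real poly" where
  "gauss_pderiv p = pderiv p - [:0, 1:] * p"

lemma DERIV_gauss_poly: "(gauss_poly p has_real_derivative gauss_poly (gauss_pderiv p) x) (at x)"
  unfolding gauss_poly_def[abs_def] gauss_pderiv_def
  by (auto intro!: derivative_eq_intros poly_DERIV simp: algebra_simps)

text \<open>The operator d/dx + x differentiates just the polynomial factor; therefore the image of
  a Laguerre function under \<open>delta j\<close> is again a product, with one factor
  differentiated.\<close>

lemma gauss_pderiv_add: "gauss_poly (gauss_pderiv p) x + x * gauss_poly p x = gauss_poly (pderiv p) x"
  by (simp add: gauss_poly_def gauss_pderiv_def algebra_simps)

lemma poly_gauss_pderiv: "poly (gauss_pderiv p) x = poly (pderiv p) x - x * poly p x"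
  by (simp add: gauss_pderiv_def)

lemma poly_gauss_pderiv2:
  "poly (gauss_pderiv (gauss_pderiv p)) x = poly (pderiv (pderiv p)) x - 2 * x * poly (pderiv p) x + (x\<^sup>2 - 1) * poly p x"
  by (simp add: gauss_pderiv_def pderiv_diff pderiv_mult pderiv_pCons algebra_simps power2_eq_square)

lemma gauss_poly_eqI:
  assumes "poly u x + c * poly v x = d * poly p x"
  shows "gauss_poly u x + c * gauss_poly v x = d * gauss_poly p x"
  using arg_cong[OF assms, of "\<lambda>z. z * exp (- x\<^sup>2 / 2)"]
  by (simp only: gauss_poly_def distrib_right mult.assoc)

lemma lag_poly_eigen:
  assumes "x \<noteq> 0"
  shows "gauss_poly (gauss_pderiv (gauss_pderiv (lag_poly n a))) x + (2 * a + 1) / x * gauss_poly (gauss_pderiv (lag_poly n a)) x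
    = (x\<^sup>2 - (4 * real n + 2 * a + 2)) * gauss_poly (lag_poly n a) x"
proof -
  define p0 p1 p2 where "p0 = poly (lag_poly n a) x" and "p1 = poly (pderiv (lag_poly n a)) x" and "p2 = poly (pderiv (pderiv (lag_poly n a))) x"
  have "x * p2 + (2 * a + 1 - 2 * x\<^sup>2) * p1 + 4 * real n * x * p0 = 0"
    unfolding p0_def p1_def p2_def by (rule lag_poly_ode)
  then have "x * (p2 - 2 * x * p1 + (x\<^sup>2 - 1) * p0 + (2 * a + 1) / x * (p1 - x * p0) - (x\<^sup>2 - (4 * real n + 2 * a + 2)) * p0) = 0"
    using assms by (simp add: field_simps power2_eq_square)
  then have "p2 - 2 * x * p1 + (x\<^sup>2 - 1) * p0 + (2 * a + 1) / x * (p1 - x * p0) = (x\<^sup>2 - (4 * real n + 2 * a + 2)) * p0"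
    using assms by simp
  then show ?thesis
    by (intro gauss_poly_eqI, subst poly_gauss_pderiv2) (simp add: poly_gauss_pderiv p0_def p1_def p2_def)
qed

text \<open>The eigenvalue is that of \<open>lag_poly_eigen\<close>; the potential has grown by 2 +
  (2a + 1) / x^2, the commutator of d/dx + x with its adjoint for the weight x^(2a+1).\<close>

lemma pderiv_lag_poly_eigen:
  assumes "x \<noteq> 0"
  defines "r \<equiv> \<lambda>n a. pderiv (lag_poly n a)"
  shows "gauss_poly (gauss_pderiv (gauss_pderiv (r n a))) x + (2 * a + 1) / x * gauss_poly (gauss_pderiv (r n a)) x
    = (x\<^sup>2 + 2 + (2 * a + 1) / x\<^sup>2 - (4 * real n + 2 * a + 2)) * gauss_poly (r n a) x"
proof -
  define p0 p1 p2 where "p0 = poly (r n a) x" and "p1 = poly (pderiv (r n a)) x" and "p2 = poly (pderiv (pderiv (r n a))) x"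
  have "p2 - 2 * x * p1 + (2 * a + 1) / x * p1 + (4 * real n - 2 - (2 * a + 1) / x\<^sup>2) * p0 = 0"
    unfolding p0_def p1_def p2_def r_def by (rule pderiv_lag_poly_ode[OF assms(1)])
  then have "p2 - 2 * x * p1 + (x\<^sup>2 - 1) * p0 + (2 * a + 1) / x * (p1 - x * p0) = (x\<^sup>2 + 2 + (2 * a + 1) / x\<^sup>2 - (4 * real n + 2 * a + 2)) * p0"
    using assms by (simp add: field_simps)
  then show ?thesis
    by (intro gauss_poly_eqI, subst poly_gauss_pderiv2) (simp add: poly_gauss_pderiv p0_def p1_def p2_def)
qed

definition gp_prod :: "('n::finite \<Rightarrow> real poly) \<Rightarrow> real^'n \<Rightarrow> real" where
  "gp_prod p = tensor (\<lambda>i. gauss_poly (p i))"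

lemma gp_prod_upd: "gp_prod (p(i := u)) x = gauss_poly u (x $ i) * (\<Prod>j\<in>UNIV - {i}. gauss_poly (p j) (x $ j))"
proof -
  have "gp_prod (p(i := u)) = tensor ((\<lambda>j. gauss_poly (p j))(i := gauss_poly u))"
    unfolding gp_prod_def by (rule arg_cong[of _ _ tensor]) auto
  then show ?thesis by (simp add: tensor_upd)
qed

lemma gp_prod_split: "gp_prod p x = gauss_poly (p i) (x $ i) * (\<Prod>j\<in>UNIV - {i}. gauss_poly (p j) (x $ j))"
  using gp_prod_upd[of p i "p i" x] by simp

lemma gp_prod_measurable [measurable]: "gp_prod p \<in> borel_measurable borel"
  unfolding gp_prod_def tensor_def[abs_def] by measurable

lemma DERIV_gp_prod:
  "((\<lambda>r. gp_prod p (vec_upd x i r)) has_real_derivative gp_prod (p(i := gauss_pderiv (p i))) x) (at (x $ i))"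
proof -
  have "(\<Prod>j\<in>UNIV - {i}. gauss_poly (p j) (vec_upd x i r $ j)) = (\<Prod>j\<in>UNIV - {i}. gauss_poly (p j) (x $ j))" for r
    by (intro prod.cong) auto
  then have "(\<lambda>r. gp_prod p (vec_upd x i r)) = (\<lambda>r. gauss_poly (p i) r * (\<Prod>j\<in>UNIV - {i}. gauss_poly (p j) (x $ j)))"
    unfolding gp_prod_split[of p _ i] by simp
  then show ?thesis unfolding gp_prod_upd using DERIV_cmult_right[OF DERIV_gauss_poly] by simp
qed

lemma gp_prod_bound: "\<exists>K\<ge>0. \<forall>x. \<bar>gp_prod p x\<bar> \<le> K * exp (- (1/8) * (norm (x::real^'n))\<^sup>2)"
proof -
  have "\<forall>i. \<exists>K\<ge>0. \<forall>x. \<bar>gauss_poly (p i) x\<bar> \<le> K * exp (- (1/8) * x\<^sup>2)"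
    unfolding gauss_poly_def using gauss_bdd_poly[of "1/2"] by simp
  then obtain K where K: "\<And>i. K i \<ge> 0" "\<And>i x. \<bar>gauss_poly (p i) x\<bar> \<le> K i * exp (- (1/8) * x\<^sup>2)" by metis
  have "\<bar>gp_prod p x\<bar> \<le> (\<Prod>i\<in>UNIV. K i) * exp (- (1/8) * (norm x)\<^sup>2)" for x
    unfolding gp_prod_def tensor_def abs_prod gauss_prod prod.distrib[symmetric]
    using K by (intro prod_mono) auto
  moreover have "(\<Prod>i\<in>UNIV. K i) \<ge> 0" using K by (intro prod_nonneg) auto
  ultimately show ?thesis by blast
qed

lemma gp_prod_in_Lp:
  assumes "\<And>i. \<alpha> $ i > - 1" "p > 0"
  shows "in_Lp (laguerre_measure \<alpha>) p (gp_prod P)"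
proof -
  obtain K where K: "\<And>x. \<bar>gp_prod P x\<bar> \<le> K * exp (- (1/8) * (norm x)\<^sup>2)"
    using gp_prod_bound[of P] by blast
  have "in_Lp (laguerre_measure \<alpha>) p (\<lambda>x. 1 * exp (- (1/8) * (norm x)\<^sup>2))"
    using assms by (rule gauss_in_Lp)
  then show ?thesis
    by (rule in_Lp_bound[of _ _ _ _ K]) (use assms K in \<open>auto intro: measurable_laguerre_measure\<close>)
qed

text \<open>The factors of the Laguerre function with index \<open>k\<close> if \<open>c\<close> is \<open>None\<close>, and of its image under
  \<open>delta j\<close> if \<open>c\<close> is \<open>Some j\<close>.\<close>

definition lag_family :: "real^'n \<Rightarrow> nat^'n \<Rightarrow> 'n option \<Rightarrow> 'n \<Rightarrow> real poly" where
  "lag_family \<alpha> k c i = (if c = Some i then pderiv (lag_poly (k $ i) (\<alpha> $ i)) else lag_poly (k $ i) (\<alpha> $ i))"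

lemma laguerre_fun_eq: "laguerre_fun \<alpha> k = gp_prod (lag_family \<alpha> k None)"
  by (simp add: laguerre_fun_def gp_prod_def tensor_def lag_family_def laguerre_fun1_eq fun_eq_iff)

lemma lag_family_Some: "lag_family \<alpha> k (Some i) = (lag_family \<alpha> k None)(i := pderiv (lag_family \<alpha> k None i))"
  by (auto simp: lag_family_def fun_eq_iff)

lemma delta_gp_prod: "delta i (gp_prod p) x = gp_prod (p(i := pderiv (p i))) x"
proof -
  have "x + t *\<^sub>R axis i 1 = vec_upd x i (t + x $ i)" for t
    by (simp add: vec_eq_iff axis_def)
  then have "partial_deriv i (gp_prod p) x = deriv (\<lambda>t. gp_prod p (vec_upd x i (t + x $ i))) 0"
    by (simp add: partial_deriv_def)
  also have "\<dots> = gp_prod (p(i := gauss_pderiv (p i))) x"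
    using DERIV_gp_prod[of p x i] DERIV_shift[of "\<lambda>r. gp_prod p (vec_upd x i r)" _ 0 "x $ i"]
    by (intro DERIV_imp_deriv) simp
  finally show ?thesis
    by (simp add: delta_def gp_prod_upd gp_prod_split[of p x i] gauss_pderiv_add[symmetric] algebra_simps)
qed

lemma delta_laguerre_fun: "delta i (laguerre_fun \<alpha> k) = gp_prod (lag_family \<alpha> k (Some i))"
  unfolding laguerre_fun_eq lag_family_Some by (rule ext) (rule delta_gp_prod)

lemma lag_family_orthogonal:
  fixes \<alpha> :: "real^'n"
  assumes \<alpha>: "\<And>i. \<alpha> $ i > - 1"
  shows "integrable (laguerre_measure \<alpha>) (\<lambda>x. gp_prod (lag_family \<alpha> k c) x * gp_prod (lag_family \<alpha> m c) x)"
    and "(\<integral>x. gp_prod (lag_family \<alpha> k c) x * gp_prod (lag_family \<alpha> m c) x \<partial>laguerre_measure \<alpha>)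
       = (if k = m then (case c of None \<Rightarrow> 1 | Some j \<Rightarrow> 4 * real (k $ j)) else 0)"
proof -
  define f where "f i x = gauss_poly (lag_family \<alpha> k c i) x * gauss_poly (lag_family \<alpha> m c i) x" for i x
  have eq: "gp_prod (lag_family \<alpha> k c) x * gp_prod (lag_family \<alpha> m c) x = (\<Prod>i\<in>UNIV. f i (x $ i))" for x
    by (simp add: gp_prod_def tensor_def f_def prod.distrib)
  have fm: "f i \<in> borel_measurable borel" for i unfolding f_def[abs_def] by measurable
  have fi: "integrable lborel (\<lambda>t. laguerre_weight (\<alpha> $ i) t * f i t)" for i
    using lag_orthonormal(1)[OF \<alpha>[of i]] pderiv_lag_orthogonal(1)[OF \<alpha>[of i]]
    by (cases "c = Some i") (simp_all add: f_def lag_family_def)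
  define v where "v i = (if k $ i = m $ i then (if c = Some i then 4 * real (k $ i) else 1) else 0)" for i
  have fv: "(\<integral>t. laguerre_weight (\<alpha> $ i) t * f i t \<partial>lborel) = v i" for i
    using lag_orthonormal(2)[OF \<alpha>[of i]] pderiv_lag_orthogonal(2)[OF \<alpha>[of i]]
    by (cases "c = Some i") (simp_all add: f_def lag_family_def v_def)
  note L = laguerre_measure_prod[of f \<alpha>, OF fm fi]
  show "integrable (laguerre_measure \<alpha>) (\<lambda>x. gp_prod (lag_family \<alpha> k c) x * gp_prod (lag_family \<alpha> m c) x)"
    unfolding eq by (rule L(1))
  have "(\<integral>x. gp_prod (lag_family \<alpha> k c) x * gp_prod (lag_family \<alpha> m c) x \<partial>laguerre_measure \<alpha>) = (\<Prod>i\<in>UNIV. v i)"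
    unfolding eq L(2) fv ..
  also have "\<dots> = (if k = m then (case c of None \<Rightarrow> 1 | Some j \<Rightarrow> 4 * real (k $ j)) else 0)"
  proof (cases "k = m")
    case False
    then obtain i where "k $ i \<noteq> m $ i" by (auto simp: vec_eq_iff)
    then have "(\<Prod>i\<in>UNIV. v i) = 0" by (intro prod_zero) (auto simp: v_def intro!: bexI[of _ i])
    then show ?thesis using False by simp
  next
    case True
    show ?thesis
    proof (cases c)
      case (Some j)
      have "(\<Prod>i\<in>UNIV. v i) = (\<Prod>i\<in>UNIV. if i = j then 4 * real (k $ j) else 1)"
        using True Some by (intro prod.cong) (auto simp: v_def)
      then show ?thesis using True Some by simp
    qed (use True in \<open>simp add: v_def\<close>)
  qed
  finally show "(\<integral>x. gp_prod (lag_family \<alpha> k c) x * gp_prod (lag_family \<alpha> m c) x \<partial>laguerre_measure \<alpha>)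
       = (if k = m then (case c of None \<Rightarrow> 1 | Some j \<Rightarrow> 4 * real (k $ j)) else 0)" .
qed

text \<open>The potential of L, for \<open>Some j\<close> increased by the commutator of delta_j
  with its adjoint.\<close>

definition lag_pot :: "real^'n \<Rightarrow> 'n option \<Rightarrow> real^'n \<Rightarrow> real" where
  "lag_pot \<alpha> c x = (norm x)\<^sup>2 + (case c of None \<Rightarrow> 0 | Some j \<Rightarrow> 2 + (2 * \<alpha> $ j + 1) / (x $ j)\<^sup>2)"

lemma lag_family_eigen:
  fixes \<alpha> x :: "real^'n" and k :: "nat^'n" and c :: "'n option"
  defines "p \<equiv> lag_family \<alpha> k c"
  assumes x: "x \<in> orthant"
  shows "(\<Sum>i\<in>UNIV. gp_prod (p(i := gauss_pderiv (gauss_pderiv (p i)))) x + (2 * \<alpha> $ i + 1) / x $ i * gp_prod (p(i := gauss_pderiv (p i))) x)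
    = (lag_pot \<alpha> c x - laguerre_eigenvalue \<alpha> k) * gp_prod p x"
proof -
  define v where "v i = (x $ i)\<^sup>2 + (if c = Some i then 2 + (2 * \<alpha> $ i + 1) / (x $ i)\<^sup>2 else 0) - (4 * real (k $ i) + 2 * \<alpha> $ i + 2)" for i
  have one: "gp_prod (p(i := gauss_pderiv (gauss_pderiv (p i)))) x + (2 * \<alpha> $ i + 1) / x $ i * gp_prod (p(i := gauss_pderiv (p i))) x = v i * gp_prod p x" for i
  proof -
    have xi: "x $ i \<noteq> 0" using x less_irrefl by (metis mem_Collect_eq)
    have "gauss_poly (gauss_pderiv (gauss_pderiv (p i))) (x $ i) + (2 * \<alpha> $ i + 1) / x $ i * gauss_poly (gauss_pderiv (p i)) (x $ i) = v i * gauss_poly (p i) (x $ i)"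
      unfolding p_def lag_family_def v_def
      using lag_poly_eigen[OF xi, of "k $ i" "\<alpha> $ i"] pderiv_lag_poly_eigen[OF xi, of "k $ i" "\<alpha> $ i"]
      by (cases "c = Some i") (simp_all add: add.assoc)
    then show ?thesis unfolding gp_prod_upd gp_prod_split[of p x i] by (simp only: mult.assoc[symmetric] distrib_right[symmetric])
  qed
  have "(\<Sum>i\<in>UNIV. v i) = lag_pot \<alpha> c x - laguerre_eigenvalue \<alpha> k"
  proof -
    have "(\<Sum>i\<in>UNIV. (if c = Some i then 2 + (2 * \<alpha> $ i + 1) / (x $ i)\<^sup>2 else 0)) = (case c of None \<Rightarrow> 0 | Some j \<Rightarrow> 2 + (2 * \<alpha> $ j + 1) / (x $ j)\<^sup>2)"
      by (cases c) auto
    then show ?thesis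
      by (simp add: v_def lag_pot_def laguerre_eigenvalue_def norm_vec_power2 sum.distrib sum_subtractf sum_distrib_left)
  qed
  then show ?thesis unfolding one sum_distrib_right[symmetric] by simp
qed

text \<open>Parity in the i-th coordinate: ordinary factors are even and have odd derivatives,
  whereas the differentiated factor is itself odd. Either way the function or its i-th derivative
  contains a factor x_i.\<close>

lemma lag_family_dvd:
  "if c = Some i then [:0, 1:] dvd lag_family \<alpha> k c i else [:0, 1:] dvd gauss_pderiv (lag_family \<alpha> k c i)"
proof -
  have "[:0, 1:] dvd pderiv (lag_poly n a)" for n a
    by (cases n) (simp_all only: pderiv_lag_poly_0 pderiv_lag_poly_Suc dvd_smult dvd_triv_left dvd_0_right)
  then show ?thesis
    by (auto simp: lag_family_def gauss_pderiv_def simp del: mult_pCons_left intro!: dvd_diff dvd_triv_left)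
qed

lemma laguerre_eigenvalue_pos:
  assumes "\<And>i. \<alpha> $ i > - 1"
  shows "laguerre_eigenvalue \<alpha> (k :: nat^'n) > 0"
proof -
  have "2 * \<alpha> $ i + 2 > 0" for i using assms[of i] by simp
  then have "0 < (\<Sum>i\<in>(UNIV::'n set). 2 * \<alpha> $ i + 2)" by (intro sum_pos) auto
  then show ?thesis by (simp add: laguerre_eigenvalue_def sum.distrib sum_distrib_left sum_nonneg add_nonneg_pos add.assoc)
qed

section \<open>Poisson extensions of finite expansions\<close>

definition lag_mu :: "real^'n \<Rightarrow> nat^'n \<Rightarrow> real" where
  "lag_mu \<alpha> k = sqrt (laguerre_eigenvalue \<alpha> k)"

text \<open>The component \<open>None\<close> of the flow is the Poisson extension of the scalar function, the component
  \<open>Some j\<close> that of the \<open>j\<close>-th coordinate of the vector-valued one.\<close>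

definition lag_flow :: "real^'n \<Rightarrow> (nat^'n) set \<Rightarrow> ('n option \<Rightarrow> nat^'n \<Rightarrow> real) \<Rightarrow> nat
    \<Rightarrow> ('n option \<Rightarrow> nat^'n \<Rightarrow> 'n \<Rightarrow> real poly) \<Rightarrow> 'n option \<Rightarrow> real \<Rightarrow> real^'n \<Rightarrow> real" where
  "lag_flow \<alpha> F a l p c t x = (\<Sum>k\<in>F. a c k * (- lag_mu \<alpha> k) ^ l * exp (- (t * lag_mu \<alpha> k)) * gp_prod (p c k) x)"

lemma lag_flow_measurable: "lag_flow \<alpha> F a l p c t \<in> borel_measurable borel"
  unfolding lag_flow_def[abs_def] by measurable

lemma DERIV_lag_flow_t: "((\<lambda>t. lag_flow \<alpha> F a l p c t x) has_real_derivative lag_flow \<alpha> F a (Suc l) p c t x) (at t)"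
  unfolding lag_flow_def by (auto intro!: derivative_eq_intros sum.cong)

lemma DERIV_lag_flow_x:
  "((\<lambda>r. lag_flow \<alpha> F a l p c t (vec_upd x i r)) has_real_derivative
     lag_flow \<alpha> F a l (\<lambda>c k. (p c k)(i := gauss_pderiv (p c k i))) c t x) (at (x $ i))"
  unfolding lag_flow_def by (intro DERIV_sum DERIV_cmult DERIV_gp_prod)

lemma lag_flow_bound:
  assumes F: "finite F" and \<alpha>: "\<And>i. \<alpha> $ i > - 1"
  shows "\<exists>K\<ge>0. \<forall>t>-1. \<forall>x. \<bar>lag_flow \<alpha> F a l p c t x\<bar> \<le> K * exp (- (1/8) * (norm x)\<^sup>2)"
proof -
  have "\<forall>k. \<exists>K\<ge>0. \<forall>x. \<bar>gp_prod (p c k) x\<bar> \<le> K * exp (- (1/8) * (norm x)\<^sup>2)" using gp_prod_bound by blast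
  then obtain K where K: "\<And>k. K k \<ge> 0" "\<And>k x. \<bar>gp_prod (p c k) x\<bar> \<le> K k * exp (- (1/8) * (norm x)\<^sup>2)" by metis
  define N where "N = (\<Sum>k\<in>F. \<bar>a c k * (- lag_mu \<alpha> k) ^ l\<bar> * exp (lag_mu \<alpha> k) * K k)"
  have "\<bar>lag_flow \<alpha> F a l p c t x\<bar> \<le> N * exp (- (1/8) * (norm x)\<^sup>2)" if t: "t > - 1" for t x
  proof -
    have "\<bar>lag_flow \<alpha> F a l p c t x\<bar> \<le> (\<Sum>k\<in>F. \<bar>a c k * (- lag_mu \<alpha> k) ^ l\<bar> * exp (- (t * lag_mu \<alpha> k)) * \<bar>gp_prod (p c k) x\<bar>)"
      unfolding lag_flow_def by (rule order_trans[OF sum_abs]) (simp add: abs_mult)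
    also have "\<dots> \<le> (\<Sum>k\<in>F. \<bar>a c k * (- lag_mu \<alpha> k) ^ l\<bar> * exp (lag_mu \<alpha> k) * (K k * exp (- (1/8) * (norm x)\<^sup>2)))"
    proof (intro sum_mono mult_mono K)
      fix k
      \<comment> \<open>For t > - 1 each exponential is at most its value at t = - 1.\<close>
      have "0 \<le> (t + 1) * lag_mu \<alpha> k"
        using t laguerre_eigenvalue_pos[OF \<alpha>, of k] by (intro mult_nonneg_nonneg) (auto simp: lag_mu_def)
      then show "exp (- (t * lag_mu \<alpha> k)) \<le> exp (lag_mu \<alpha> k)" by (simp add: algebra_simps)
    qed (use K in auto)
    also have "\<dots> = N * exp (- (1/8) * (norm x)\<^sup>2)" by (simp add: N_def sum_distrib_right mult.assoc)
    finally show ?thesis .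
  qed
  moreover have "N \<ge> 0" unfolding N_def using K by (intro sum_nonneg mult_nonneg_nonneg) auto
  ultimately show ?thesis by blast
qed

lemma lag_flow_bound_all:
  assumes F: "finite F" and \<alpha>: "\<And>i. \<alpha> $ i > - 1"
  shows "\<exists>K\<ge>0. \<forall>c. \<forall>t>-1. \<forall>x. \<bar>lag_flow \<alpha> F a l p c t x\<bar> \<le> K * exp (- (1/8) * (norm (x::real^'n))\<^sup>2)"
proof -
  obtain K where K: "\<And>c. K c \<ge> 0" "\<And>c t x. t > - 1 \<Longrightarrow> \<bar>lag_flow \<alpha> F a l p c t x\<bar> \<le> K c * exp (- (1/8) * (norm x)\<^sup>2)"
    using lag_flow_bound[OF F \<alpha>, of a l p] by metis
  have "\<bar>lag_flow \<alpha> F a l p c t x\<bar> \<le> (\<Sum>c\<in>UNIV. K c) * exp (- (1/8) * (norm x)\<^sup>2)" if "t > - 1" for c t x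
  proof -
    have "K c \<le> (\<Sum>c\<in>UNIV. K c)" using K(1) by (intro member_le_sum) auto
    then have "K c * exp (- (1/8) * (norm x)\<^sup>2) \<le> (\<Sum>c\<in>UNIV. K c) * exp (- (1/8) * (norm x)\<^sup>2)"
      by (intro mult_right_mono) auto
    then show ?thesis by (rule order_trans[OF K(2)[OF that]])
  qed
  moreover have "(\<Sum>c\<in>UNIV. K c) \<ge> 0" using K(1) by (intro sum_nonneg) auto
  ultimately show ?thesis by blast
qed

lemma lag_flow_factor:
  fixes p :: "'n option \<Rightarrow> nat^'n \<Rightarrow> 'n::finite \<Rightarrow> real poly"
  assumes "\<And>k. [:0, 1:] dvd p c k i"
  shows "\<exists>p'. \<forall>t x. lag_flow \<alpha> F a l p c t x = x $ i * lag_flow \<alpha> F a l p' c t x"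
proof -
  obtain u where u: "\<And>k. p c k i = [:0, 1:] * u k" using assms unfolding dvd_def by metis
  define p' :: "'n option \<Rightarrow> nat^'n \<Rightarrow> 'n \<Rightarrow> real poly" where "p' = (\<lambda>c' k. (p c k)(i := u k))"
  have "gp_prod (p c k) x = x $ i * gp_prod (p' c k) x" for k x
    unfolding p'_def gp_prod_upd gp_prod_split[of "p c k" x i] by (simp add: gauss_poly_def u)
  then have "\<forall>t x. lag_flow \<alpha> F a l p c t x = x $ i * lag_flow \<alpha> F a l p' c t x"
    unfolding lag_flow_def by (auto simp: sum_distrib_left intro!: sum.cong)
  then show ?thesis by blast
qed

text \<open>Adding up finitely many constants; this gives a single bound for all components and all
  directions.\<close>

lemma uniform_constant:
  fixes f g :: "'s::finite \<Rightarrow> 'y \<Rightarrow> real"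
  assumes "\<And>s. \<exists>K\<ge>0. \<forall>y\<in>D. f s y \<le> K * g s y" "\<And>s y. y \<in> D \<Longrightarrow> 0 \<le> g s y"
  shows "\<exists>K\<ge>0. \<forall>s. \<forall>y\<in>D. f s y \<le> K * g s y"
proof -
  obtain K where K: "\<And>s. K s \<ge> 0" "\<And>s y. y \<in> D \<Longrightarrow> f s y \<le> K s * g s y" using assms(1) by metis
  have "f s y \<le> (\<Sum>s\<in>UNIV. K s) * g s y" if "y \<in> D" for s y
  proof -
    have "K s \<le> (\<Sum>s\<in>UNIV. K s)" using K(1) by (intro member_le_sum) auto
    then show ?thesis using K(2)[OF that, of s] mult_right_mono[OF _ assms(2)[OF that, of s]] by (meson order_trans)
  qed
  moreover have "(\<Sum>s\<in>UNIV. K s) \<ge> 0" using K(1) by (intro sum_nonneg) auto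
  ultimately show ?thesis by blast
qed

lemma lag_family_sum_orthogonal:
  fixes \<alpha> :: "real^'n" and u v :: "nat^'n \<Rightarrow> real"
  assumes \<alpha>: "\<And>i. \<alpha> $ i > - 1" and F: "finite F"
  shows "integrable (laguerre_measure \<alpha>) (\<lambda>x. (\<Sum>k\<in>F. u k * gp_prod (lag_family \<alpha> k c) x) * (\<Sum>m\<in>F. v m * gp_prod (lag_family \<alpha> m c) x))"
    and "(\<integral>x. (\<Sum>k\<in>F. u k * gp_prod (lag_family \<alpha> k c) x) * (\<Sum>m\<in>F. v m * gp_prod (lag_family \<alpha> m c) x) \<partial>laguerre_measure \<alpha>)
      = (\<Sum>k\<in>F. u k * v k * (case c of None \<Rightarrow> 1 | Some j \<Rightarrow> 4 * real (k $ j)))"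
proof -
  define h where "h k m x = gp_prod (lag_family \<alpha> k c) x * gp_prod (lag_family \<alpha> m c) x" for k m x
  note O = lag_family_orthogonal[OF \<alpha>, of _ c, folded h_def]
  have eq: "(\<Sum>k\<in>F. u k * gp_prod (lag_family \<alpha> k c) x) * (\<Sum>m\<in>F. v m * gp_prod (lag_family \<alpha> m c) x)
    = (\<Sum>k\<in>F. \<Sum>m\<in>F. (u k * v m) * h k m x)" for x
    by (simp add: sum_product h_def mult_ac)
  show "integrable (laguerre_measure \<alpha>) (\<lambda>x. (\<Sum>k\<in>F. u k * gp_prod (lag_family \<alpha> k c) x) * (\<Sum>m\<in>F. v m * gp_prod (lag_family \<alpha> m c) x))"
    unfolding eq by (intro Bochner_Integration.integrable_sum integrable_mult_right O(1))
  have "(\<integral>x. (\<Sum>k\<in>F. \<Sum>m\<in>F. (u k * v m) * h k m x) \<partial>laguerre_measure \<alpha>)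
      = (\<Sum>k\<in>F. \<Sum>m\<in>F. (u k * v m) * (\<integral>x. h k m x \<partial>laguerre_measure \<alpha>))"
    by (subst Bochner_Integration.integral_sum, intro Bochner_Integration.integrable_sum integrable_mult_right O(1))
       (intro sum.cong refl, subst Bochner_Integration.integral_sum, auto intro!: integrable_mult_right O(1))
  also have "\<dots> = (\<Sum>k\<in>F. u k * v k * (case c of None \<Rightarrow> 1 | Some j \<Rightarrow> 4 * real (k $ j)))"
    unfolding O(2) using F by (intro sum.cong refl) (simp add: if_distrib[of "(*) _"] sum.delta cong: if_cong)
  finally show "(\<integral>x. (\<Sum>k\<in>F. u k * gp_prod (lag_family \<alpha> k c) x) * (\<Sum>m\<in>F. v m * gp_prod (lag_family \<alpha> m c) x) \<partial>laguerre_measure \<alpha>)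
      = (\<Sum>k\<in>F. u k * v k * (case c of None \<Rightarrow> 1 | Some j \<Rightarrow> 4 * real (k $ j)))" unfolding eq .
qed

text \<open>\<open>I\<close> indexes the function measured with the exponent that is at least 2 and
  \<open>J\<close> the one measured with the conjugate exponent. The second alternative in
  \<open>IJ\<close> gives the vector-valued function the first role.\<close>

locale laguerre_flow = bellman_sums p q th kap I J e
  for p q th kap e :: real and I J :: "'n::finite option set" +
  fixes \<alpha> :: "real^'n" and F :: "(nat^'n) set" and a :: "'n option \<Rightarrow> nat^'n \<Rightarrow> real"
  assumes half: "\<And>i. \<alpha> $ i \<ge> - 1 / 2" and F: "finite F"
    and IJ: "I = {None} \<and> J = range Some \<or> I = range Some \<and> J = {None}"
begin

lemma \<alpha>1: "\<alpha> $ i > - 1"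
  using half[of i] by simp

abbreviation mu where "mu \<equiv> lag_mu \<alpha>"

lemma mu: "mu k > 0" "(mu k)\<^sup>2 = laguerre_eigenvalue \<alpha> k"
  using laguerre_eigenvalue_pos[of \<alpha> k] \<alpha>1 by (auto simp: lag_mu_def)

definition Z where "Z l = lag_flow \<alpha> F a l (\<lambda>c k. lag_family \<alpha> k c)"
definition Zx where "Zx i = lag_flow \<alpha> F a 0 (\<lambda>c k. (lag_family \<alpha> k c)(i := gauss_pderiv (lag_family \<alpha> k c i)))"
definition Zxx where "Zxx i = lag_flow \<alpha> F a 0 (\<lambda>c k. (lag_family \<alpha> k c)(i := gauss_pderiv (gauss_pderiv (lag_family \<alpha> k c i))))"

text \<open>By parity one of the two factors is x_i times another flow of the same kind, and every
  such flow is bounded by a Gaussian.\<close>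

lemma Zx_product_bound:
  "\<exists>K\<ge>0. \<forall>t>-1. \<forall>x\<in>orthant. \<bar>Z 0 c t x * Zx i c t x\<bar> \<le> x $ i * (K * exp (- (1/8) * (norm x)\<^sup>2))"
proof -
  have main: "\<exists>K\<ge>0. \<forall>t>-1. \<forall>x\<in>orthant. \<bar>f t x * g t x\<bar> \<le> x $ i * (K * exp (- (1/8) * (norm x)\<^sup>2))"
    if f: "\<And>t x. f t x = x $ i * lag_flow \<alpha> F a 0 p' c t x" and g: "\<And>t x. g t x = lag_flow \<alpha> F a 0 p'' c t x" for f g p' p''
  proof -
    obtain K1 where K1: "K1 \<ge> 0" "\<And>t x. t > - 1 \<Longrightarrow> \<bar>lag_flow \<alpha> F a 0 p' c t x\<bar> \<le> K1 * exp (- (1/8) * (norm x)\<^sup>2)"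
      using lag_flow_bound[OF F \<alpha>1, of a 0 p' c] by blast
    obtain K2 where K2: "K2 \<ge> 0" "\<And>t x. t > - 1 \<Longrightarrow> \<bar>lag_flow \<alpha> F a 0 p'' c t x\<bar> \<le> K2 * exp (- (1/8) * (norm x)\<^sup>2)"
      using lag_flow_bound[OF F \<alpha>1, of a 0 p'' c] by blast
    have "\<bar>f t x * g t x\<bar> \<le> x $ i * ((K1 * K2) * exp (- (1/8) * (norm x)\<^sup>2))" if "t > - 1" "x \<in> orthant" for t x
    proof -
      have xi: "0 \<le> x $ i" using that by (simp add: less_imp_le)
      have "\<bar>lag_flow \<alpha> F a 0 p'' c t x\<bar> \<le> K2 * 1"
        by (rule order_trans[OF K2(2)[OF that(1)] mult_left_mono[OF _ K2(1)]]) simp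
      then have "\<bar>lag_flow \<alpha> F a 0 p' c t x\<bar> * \<bar>lag_flow \<alpha> F a 0 p'' c t x\<bar> \<le> (K1 * exp (- (1/8) * (norm x)\<^sup>2)) * (K2 * 1)"
        using K1 that by (intro mult_mono) auto
      from mult_left_mono[OF this xi] show ?thesis using xi by (simp add: f g abs_mult mult_ac)
    qed
    then show ?thesis using K1(1) K2(1) by (intro exI[of _ "K1 * K2"]) auto
  qed
  show ?thesis
  proof (cases "c = Some i")
    case True
    then have "\<And>k. [:0, 1:] dvd lag_family \<alpha> k c i" using lag_family_dvd[of c i \<alpha>] by (auto split: if_splits)
    then obtain p' where "\<And>t x. Z 0 c t x = x $ i * lag_flow \<alpha> F a 0 p' c t x"
      unfolding Z_def using lag_flow_factor[of "\<lambda>c k. lag_family \<alpha> k c" c i] by blast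
    then show ?thesis by (rule main) (simp add: Zx_def)
  next
    case False
    then have "\<And>k. [:0, 1:] dvd ((lag_family \<alpha> k c)(i := gauss_pderiv (lag_family \<alpha> k c i))) i" 
      using lag_family_dvd[of c i \<alpha>] by (simp split: if_splits)
    then obtain p' where p': "\<And>t x. Zx i c t x = x $ i * lag_flow \<alpha> F a 0 p' c t x"
      unfolding Zx_def using lag_flow_factor[of "\<lambda>c k. (lag_family \<alpha> k c)(i := gauss_pderiv (lag_family \<alpha> k c i))" c i] by blast
    have "\<exists>K\<ge>0. \<forall>t>-1. \<forall>x\<in>orthant. \<bar>Zx i c t x * Z 0 c t x\<bar> \<le> x $ i * (K * exp (- (1/8) * (norm x)\<^sup>2))"
      using p' by (rule main) (simp add: Z_def)
    then show ?thesis by (simp add: mult.commute)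
  qed
qed

lemma pde: 
  assumes x: "x \<in> orthant"
  shows "Z 2 c t x + (\<Sum>i\<in>UNIV. Zxx i c t x + (2 * \<alpha> $ i + 1) / x $ i * Zx i c t x) = lag_pot \<alpha> c x * Z 0 c t x"
proof -
  define E where "E k = a c k * exp (- (t * mu k))" for k
  have "(\<Sum>i\<in>UNIV. Zxx i c t x + (2 * \<alpha> $ i + 1) / x $ i * Zx i c t x)
    = (\<Sum>i\<in>UNIV. \<Sum>k\<in>F. E k * (gp_prod ((lag_family \<alpha> k c)(i := gauss_pderiv (gauss_pderiv (lag_family \<alpha> k c i)))) x
         + (2 * \<alpha> $ i + 1) / x $ i * gp_prod ((lag_family \<alpha> k c)(i := gauss_pderiv (lag_family \<alpha> k c i))) x))"
    by (simp add: Zxx_def Zx_def lag_flow_def E_def sum_distrib_left sum.distrib[symmetric] distrib_left mult_ac)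
  also have "\<dots> = (\<Sum>k\<in>F. E k * ((lag_pot \<alpha> c x - laguerre_eigenvalue \<alpha> k) * gp_prod (lag_family \<alpha> k c) x))"
    unfolding lag_family_eigen[OF x, symmetric] by (subst sum.swap) (simp add: sum_distrib_left)
  finally show ?thesis
    by (simp add: Z_def lag_flow_def mu(2)[symmetric] E_def sum_distrib_left sum.distrib[symmetric] algebra_simps)
qed

lemma lag_pot_nonneg: "x \<in> orthant \<Longrightarrow> 0 \<le> lag_pot \<alpha> c x"
proof (cases c)
  case (Some j)
  have "0 \<le> (2 * \<alpha> $ j + 1) / (x $ j)\<^sup>2" using half[of j] by (intro divide_nonneg_nonneg) auto
  then show ?thesis using Some by (simp add: lag_pot_def)
qed (simp add: lag_pot_def)

lemma flow_constant: "\<exists>K. flow p e I J \<alpha> (Z 0) (Z 1) (Z 2) Zx Zxx (lag_pot \<alpha>) K"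
proof -
  let ?g = "\<lambda>x::real^'n. exp (- (1/8) * (norm x)\<^sup>2)"
  obtain K0 where K0: "K0 \<ge> 0" "\<And>c t x. t > - 1 \<Longrightarrow> \<bar>Z 0 c t x\<bar> \<le> K0 * ?g x"
    unfolding Z_def using lag_flow_bound_all[OF F \<alpha>1] by blast
  obtain K1 where K1: "K1 \<ge> 0" "\<And>c t x. t > - 1 \<Longrightarrow> \<bar>Z 1 c t x\<bar> \<le> K1 * ?g x"
    unfolding Z_def using lag_flow_bound_all[OF F \<alpha>1] by blast
  obtain K2 where K2: "K2 \<ge> 0" "\<And>c t x. t > - 1 \<Longrightarrow> \<bar>Z 2 c t x\<bar> \<le> K2 * ?g x"
    unfolding Z_def using lag_flow_bound_all[OF F \<alpha>1] by blast
  \<comment> \<open>Time and point are packed together, and below also direction and component, so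
    that \<open>uniform_constant\<close> yields one constant for a doubly indexed family.\<close>
  define D where "D = {(t :: real, x). t > - 1 \<and> x \<in> (orthant :: (real^'n) set)}"
  have "\<exists>K\<ge>0. \<forall>s. \<forall>y\<in>D. (case (s, y) of ((i, c), (t, x)) \<Rightarrow> \<bar>Zx i c t x\<bar>) \<le> K * (case (s, y) of ((i, c), (t, x)) \<Rightarrow> ?g x)"
    by (rule uniform_constant) (use lag_flow_bound[OF F \<alpha>1] in \<open>auto simp: D_def Zx_def split_beta\<close>, blast)
  then obtain K3 where K30: "K3 \<ge> 0"
    and K31: "\<And>s y. y \<in> D \<Longrightarrow> (case (s, y) of ((i, c), (t, x)) \<Rightarrow> \<bar>Zx i c t x\<bar>) \<le> K3 * (case (s, y) of ((i, c), (t, x)) \<Rightarrow> ?g x)" by blast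
  have K3: "K3 \<ge> 0" "\<And>i c t x. t > - 1 \<Longrightarrow> x \<in> orthant \<Longrightarrow> \<bar>Zx i c t x\<bar> \<le> K3 * ?g x"
    using K30 K31[of "(_, _)" "(_, _)"] by (auto simp: D_def)
  have "\<exists>K\<ge>0. \<forall>s. \<forall>y\<in>D. (case (s, y) of ((i, c), (t, x)) \<Rightarrow> \<bar>Zxx i c t x\<bar>) \<le> K * (case (s, y) of ((i, c), (t, x)) \<Rightarrow> ?g x)"
    by (rule uniform_constant) (use lag_flow_bound[OF F \<alpha>1] in \<open>auto simp: D_def Zxx_def split_beta\<close>, blast)
  then obtain K4 where K40: "K4 \<ge> 0"
    and K41: "\<And>s y. y \<in> D \<Longrightarrow> (case (s, y) of ((i, c), (t, x)) \<Rightarrow> \<bar>Zxx i c t x\<bar>) \<le> K4 * (case (s, y) of ((i, c), (t, x)) \<Rightarrow> ?g x)" by blast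
  have K4: "K4 \<ge> 0" "\<And>i c t x. t > - 1 \<Longrightarrow> x \<in> orthant \<Longrightarrow> \<bar>Zxx i c t x\<bar> \<le> K4 * ?g x"
    using K40 K41[of "(_, _)" "(_, _)"] by (auto simp: D_def)
  have "\<exists>K\<ge>0. \<forall>s. \<forall>y\<in>D. (case (s, y) of ((i, c), (t, x)) \<Rightarrow> \<bar>Z 0 c t x * Zx i c t x\<bar>) \<le> K * (case (s, y) of ((i, c), (t, x)) \<Rightarrow> x $ i * ?g x)"
  proof (rule uniform_constant)
    fix s :: "'n \<times> 'n option"
    obtain i c where s: "s = (i, c)" by (cases s)
    obtain K where "K \<ge> 0" "\<And>t x. t > - 1 \<Longrightarrow> x \<in> orthant \<Longrightarrow> \<bar>Z 0 c t x * Zx i c t x\<bar> \<le> x $ i * (K * ?g x)"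
      using Zx_product_bound[of c i] by blast
    then show "\<exists>K\<ge>0. \<forall>y\<in>D. (case (s, y) of ((i, c), (t, x)) \<Rightarrow> \<bar>Z 0 c t x * Zx i c t x\<bar>) \<le> K * (case (s, y) of ((i, c), (t, x)) \<Rightarrow> x $ i * ?g x)"
      unfolding s D_def by (intro exI[of _ K]) (auto simp: mult_ac)
  qed (auto simp: D_def less_imp_le)
  then obtain K5 where K50: "K5 \<ge> 0"
    and K51: "\<And>s y. y \<in> D \<Longrightarrow> (case (s, y) of ((i, c), (t, x)) \<Rightarrow> \<bar>Z 0 c t x * Zx i c t x\<bar>) \<le> K5 * (case (s, y) of ((i, c), (t, x)) \<Rightarrow> x $ i * ?g x)" by blast
  have K5: "K5 \<ge> 0" "\<And>i c t x. t > - 1 \<Longrightarrow> x \<in> orthant \<Longrightarrow> \<bar>Z 0 c t x * Zx i c t x\<bar> \<le> K5 * (x $ i * ?g x)"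
    using K50 K51[of "(_, _)" "(_, _)"] by (auto simp: D_def)
  define K where "K = K0 + K1 + K2 + K3 + K4 + K5"
  have le: "K0 \<le> K" "K1 \<le> K" "K2 \<le> K" "K3 \<le> K" "K4 \<le> K" "K5 \<le> K"
    using K0 K1 K2 K3 K4 K5 by (auto simp: K_def)
  have up: "k * ?g x \<le> K * ?g x" if "k \<le> K" for k x using that by (intro mult_right_mono) auto
  have "flow p e I J \<alpha> (Z 0) (Z 1) (Z 2) Zx Zxx (lag_pot \<alpha>) K"
  proof (unfold_locales)
    show "\<alpha> $ i > - 1" for i by (rule \<alpha>1)
    show "Z 0 c t \<in> borel_measurable borel" "Z 1 c t \<in> borel_measurable borel" "Zx i c t \<in> borel_measurable borel" for c t i
      unfolding Z_def Zx_def by (rule lag_flow_measurable)+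
    show "((\<lambda>t. Z 0 c t x) has_real_derivative Z 1 c t x) (at t)" "((\<lambda>t. Z 1 c t x) has_real_derivative Z 2 c t x) (at t)" for c t x
      using DERIV_lag_flow_t[of \<alpha> F a 0] DERIV_lag_flow_t[of \<alpha> F a 1] unfolding Z_def by (simp_all add: numeral_2_eq_2)
    show "((\<lambda>r. Z 0 c t (vec_upd x i r)) has_real_derivative Zx i c t x) (at (x $ i))" for i c t x
      unfolding Z_def Zx_def by (rule DERIV_lag_flow_x)
    show "((\<lambda>r. Zx i c t (vec_upd x i r)) has_real_derivative Zxx i c t x) (at (x $ i))" for i c t x
      unfolding Zx_def Zxx_def using DERIV_lag_flow_x[of \<alpha> F a 0 "\<lambda>c k. (lag_family \<alpha> k c)(i := gauss_pderiv (lag_family \<alpha> k c i))" c t x i]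
      by simp
    show "0 \<le> K" using K0 K1 K2 K3 K4 K5 by (simp add: K_def)
    fix c and t :: real and x :: "real^'n" assume tx: "t > - 1" "x \<in> orthant"
    show "\<bar>Z 0 c t x\<bar> \<le> K * ?g x" by (rule order_trans[OF K0(2)[OF tx(1)] up[OF le(1)]])
    show "\<bar>Z 1 c t x\<bar> \<le> K * ?g x" by (rule order_trans[OF K1(2)[OF tx(1)] up[OF le(2)]])
    show "\<bar>Z 2 c t x\<bar> \<le> K * ?g x" by (rule order_trans[OF K2(2)[OF tx(1)] up[OF le(3)]])
    show "\<bar>Zx i c t x\<bar> \<le> K * ?g x" for i by (rule order_trans[OF K3(2)[OF tx] up[OF le(4)]])
    show "\<bar>Zxx i c t x\<bar> \<le> K * ?g x" for i by (rule order_trans[OF K4(2)[OF tx] up[OF le(5)]])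
    show "\<bar>Z 0 c t x * Zx i c t x\<bar> \<le> x $ i * (K * ?g x)" for i
    proof -
      have "K5 * (x $ i * ?g x) \<le> K * (x $ i * ?g x)" using tx by (intro mult_right_mono le mult_nonneg_nonneg) (auto simp: less_imp_le)
      then show ?thesis using K5(2)[OF tx, of c i] by (simp add: mult_ac)
    qed
    show "Z 2 c t x + (\<Sum>i\<in>UNIV. Zxx i c t x + (2 * \<alpha> $ i + 1) / x $ i * Zx i c t x) = lag_pot \<alpha> c x * Z 0 c t x"
      by (rule pde[OF tx(2)])
  next
    show "0 \<le> lag_pot \<alpha> c x" if "x \<in> orthant" for c x using that by (rule lag_pot_nonneg)
  qed
  then show ?thesis by blast
qed

text \<open>The sum on the left is, up to the factor 4, the pairing of the Riesz transforms with the
  vector-valued expansion; \<open>riesz_bilinear\<close> makes this identification.\<close>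

theorem bilinear_regularized:
  "kap * \<bar>\<Sum>j\<in>UNIV. \<Sum>k\<in>F. a None k * a (Some j) k * (real (k $ j) / mu k)\<bar>
     \<le> (\<integral>x. b0 (\<lambda>c. \<Sum>k\<in>F. a c k * gp_prod (lag_family \<alpha> k c) x) \<partial>laguerre_measure \<alpha>)"
proof -
  obtain K where "flow p e I J \<alpha> (Z 0) (Z 1) (Z 2) Zx Zxx (lag_pot \<alpha>) K" using flow_constant by blast
  then interpret fl: flow p q th kap e I J \<alpha> "Z 0" "Z 1" "Z 2" Zx Zxx "lag_pot \<alpha>" K
    unfolding q_def th_def kap_def .
  let ?M = "laguerre_measure \<alpha>"
  \<comment> \<open>\<open>u\<close> is the image under delta_j of the scalar extension and
    \<open>v\<close> the time derivative of the j-th vector component; both are expanded in the same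
    orthogonal functions.\<close>
  define u where "u t j x = (\<Sum>k\<in>F. (a None k * exp (- (t * mu k))) * gp_prod (lag_family \<alpha> k (Some j)) x)" for t j x
  define v where "v t j x = (\<Sum>k\<in>F. (a (Some j) k * (- mu k) * exp (- (t * mu k))) * gp_prod (lag_family \<alpha> k (Some j)) x)" for t j x
  define S where "S t x = (\<Sum>j\<in>UNIV. u t j x * v t j x)" for t x
  define c where "c = (\<lambda>j k. a None k * a (Some j) k * real (k $ j))"
  \<comment> \<open>Orthogonality reduces the integral of \<open>S\<close> to modes - 4 c mu exp (-
    2 t mu); \<open>V\<close> is the second antiderivative that vanishes at infinity.\<close>
  define V where "V t = (\<Sum>j\<in>UNIV. \<Sum>k\<in>F. - (c j k / mu k) * exp (- (2 * t * mu k)))" for t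
  define V1 where "V1 t = (\<Sum>j\<in>UNIV. \<Sum>k\<in>F. 2 * c j k * exp (- (2 * t * mu k)))" for t
  have u_eq: "u t j x = Zx j None t x + x $ j * Z 0 None t x" for t j x
  proof -
    have "gp_prod (lag_family \<alpha> k (Some j)) x = gp_prod ((lag_family \<alpha> k None)(j := gauss_pderiv (lag_family \<alpha> k None j))) x + x $ j * gp_prod (lag_family \<alpha> k None) x" for k
      unfolding lag_family_Some gp_prod_upd gp_prod_split[of "lag_family \<alpha> k None" x j] gauss_pderiv_add[symmetric]
      by (simp add: algebra_simps)
    then show ?thesis
      by (simp add: u_def Zx_def Z_def lag_flow_def sum_distrib_left sum.distrib[symmetric] algebra_simps)
  qed
  have v_eq: "v t j x = Z 1 (Some j) t x" for t j x
    by (simp add: v_def Z_def lag_flow_def)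
  have Sb: "\<bar>S t x\<bar> \<le> \<tau> * fl.energy I t x + fl.energy J t x / \<tau>" if x: "x \<in> orthant" and \<tau>: "\<tau> > 0" for t x \<tau>
  proof -
    \<comment> \<open>delta_j u is d_j u + x_j u. After the square of the sum is split, the x_j^2
      u^2 add up to the potential term of the scalar energy.\<close>
    have U: "(\<Sum>j\<in>UNIV. (u t j x)\<^sup>2) \<le> 2 * fl.energy {None} t x"
    proof -
      have "(u t j x)\<^sup>2 \<le> 2 * (Zx j None t x)\<^sup>2 + 2 * ((x $ j)\<^sup>2 * (Z 0 None t x)\<^sup>2)" for j
        unfolding u_eq using sum_squares_bound[of "Zx j None t x" "x $ j * Z 0 None t x"]
        by (simp add: power2_sum power_mult_distrib)
      then have "(\<Sum>j\<in>UNIV. (u t j x)\<^sup>2) \<le> (\<Sum>j\<in>UNIV. 2 * (Zx j None t x)\<^sup>2 + 2 * ((x $ j)\<^sup>2 * (Z 0 None t x)\<^sup>2))"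
        by (rule sum_mono)
      also have "\<dots> = 2 * (\<Sum>j\<in>UNIV. (Zx j None t x)\<^sup>2) + 2 * ((norm x)\<^sup>2 * (Z 0 None t x)\<^sup>2)"
        by (simp add: sum.distrib sum_distrib_left sum_distrib_right norm_vec_power2)
      also have "\<dots> \<le> 2 * fl.energy {None} t x" unfolding fl.energy_def by (simp add: lag_pot_def)
      finally show ?thesis .
    qed
    have V: "(\<Sum>j\<in>UNIV. (v t j x)\<^sup>2) \<le> fl.energy (range Some) t x"
    proof -
      have "fl.energy (range Some) t x = (\<Sum>j\<in>UNIV. (Z 1 (Some j) t x)\<^sup>2 + (\<Sum>i\<in>UNIV. (Zx i (Some j) t x)\<^sup>2) + lag_pot \<alpha> (Some j) x * (Z 0 (Some j) t x)\<^sup>2)"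
        unfolding fl.energy_def by (subst sum.reindex) auto
      moreover have "(\<Sum>j\<in>UNIV. (v t j x)\<^sup>2) \<le> \<dots>"
        unfolding v_eq using lag_pot_nonneg[OF x] by (intro sum_mono) (simp add: sum_nonneg add.assoc)
      ultimately show ?thesis by simp
    qed
    have Sb': "\<bar>S t x\<bar> \<le> s * fl.energy {None} t x + fl.energy (range Some) t x / s" if s: "s > 0" for s
    proof -
      \<comment> \<open>The weight s/2 in Young's inequality compensates the factor 2 lost in
        \<open>U\<close>.\<close>
      have "\<bar>u t j x * v t j x\<bar> \<le> (s / 2) * (u t j x)\<^sup>2 + (v t j x)\<^sup>2 / s" for j
      proof -
        have "0 \<le> (s * \<bar>u t j x\<bar> - \<bar>v t j x\<bar>)\<^sup>2" by simp
        then have "2 * s * \<bar>u t j x * v t j x\<bar> \<le> s\<^sup>2 * (u t j x)\<^sup>2 + (v t j x)\<^sup>2"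
          by (simp add: power2_diff power_mult_distrib abs_mult)
        also have "\<dots> \<le> s\<^sup>2 * (u t j x)\<^sup>2 + 2 * (v t j x)\<^sup>2" by simp
        finally show ?thesis using s by (simp add: field_simps power2_eq_square)
      qed
      then have "\<bar>S t x\<bar> \<le> (\<Sum>j\<in>UNIV. (s / 2) * (u t j x)\<^sup>2 + (v t j x)\<^sup>2 / s)"
        unfolding S_def by (intro order_trans[OF sum_abs] sum_mono)
      also have "\<dots> = (s / 2) * (\<Sum>j\<in>UNIV. (u t j x)\<^sup>2) + (\<Sum>j\<in>UNIV. (v t j x)\<^sup>2) / s"
        by (simp add: sum.distrib sum_distrib_left sum_divide_distrib)
      also have "\<dots> \<le> (s / 2) * (2 * fl.energy {None} t x) + fl.energy (range Some) t x / s"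
        using s by (intro add_mono mult_left_mono U divide_right_mono V) auto
      finally show ?thesis by simp
    qed
    from IJ show ?thesis
    proof
      \<comment> \<open>Exchanging the roles of the energies replaces the balance by its
        reciprocal.\<close>
      assume "I = range Some \<and> J = {None}"
      then show ?thesis using Sb'[of "1 / \<tau>"] \<tau> by (simp add: add.commute mult.commute)
    qed (use Sb'[OF \<tau>] in simp)
  qed
  have Si: "integrable ?M (S t)" for t
    unfolding S_def[abs_def] u_def v_def by (intro Bochner_Integration.integrable_sum lag_family_sum_orthogonal(1) \<alpha>1 F)
  have Sint: "(\<integral>x. S t x \<partial>?M) = (\<Sum>j\<in>UNIV. \<Sum>k\<in>F. - 4 * (c j k * mu k) * exp (- (2 * t * mu k)))" for t
  proof -
    have "(\<integral>x. S t x \<partial>?M) = (\<Sum>j\<in>UNIV. \<integral>x. u t j x * v t j x \<partial>?M)"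
      unfolding S_def u_def v_def by (intro Bochner_Integration.integral_sum lag_family_sum_orthogonal(1) \<alpha>1 F)
    also have "\<dots> = (\<Sum>j\<in>UNIV. \<Sum>k\<in>F. - 4 * (c j k * mu k) * exp (- (2 * t * mu k)))"
    proof (intro sum.cong refl)
      fix j
      have "exp (- (t * mu k)) * exp (- (t * mu k)) = exp (- (2 * t * mu k))" for k by (simp add: exp_add[symmetric])
      then show "(\<integral>x. u t j x * v t j x \<partial>?M) = (\<Sum>k\<in>F. - 4 * (c j k * mu k) * exp (- (2 * t * mu k)))"
        unfolding u_def v_def lag_family_sum_orthogonal(2)[OF \<alpha>1 F]
        by (intro sum.cong refl) (simp add: c_def)
    qed
    finally show ?thesis .
  qed
  have "kap * \<bar>V 0\<bar> \<le> fl.\<Phi> 0"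
  proof (rule fl.flow_inequality)
    show "\<bar>S t x\<bar> \<le> \<tau> * fl.energy I t x + fl.energy J t x / \<tau>" if "x \<in> orthant" "\<tau> > 0" for t x \<tau>
      using Sb that by blast
    show "integrable ?M (S t)" for t by (rule Si)
    show "(V has_real_derivative V1 t) (at t)" for t
    proof -
      have "mu k \<noteq> 0" for k using mu(1)[of k] by simp
      then show ?thesis unfolding V_def V1_def by (auto intro!: derivative_eq_intros sum.cong)
    qed
    show "(V1 has_real_derivative (\<integral>x. S t x \<partial>?M)) (at t)" for t
      unfolding V1_def Sint by (auto intro!: derivative_eq_intros sum.cong)
    show "\<bar>V t\<bar> \<le> (\<Sum>j\<in>UNIV. \<Sum>k\<in>F. \<bar>c j k / mu k\<bar>)" if "t \<ge> 0" for t
    proof -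
      have "\<bar>- (c j k / mu k) * exp (- (2 * t * mu k))\<bar> \<le> \<bar>c j k / mu k\<bar>" for j k
      proof -
        have "exp (- (2 * t * mu k)) \<le> 1" using that mu(1)[of k] by simp
        from mult_left_mono[OF this abs_ge_zero[of "c j k / mu k"]] show ?thesis unfolding abs_mult abs_minus_cancel by simp
      qed
      then show ?thesis unfolding V_def by (intro order_trans[OF sum_abs] sum_mono)
    qed
    show "(V \<longlongrightarrow> 0) at_top"
    proof -
      have "((\<lambda>t. exp (- (2 * t * mu k))) \<longlongrightarrow> 0) at_top" for k
      proof (rule filterlim_compose[OF exp_at_bot])
        have "filterlim (\<lambda>t. (2 * mu k) * t) at_top at_top"
          using mu(1)[of k] by (intro filterlim_tendsto_pos_mult_at_top[OF tendsto_const _ filterlim_ident]) auto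
        then show "filterlim (\<lambda>t. - (2 * t * mu k)) at_bot at_top"
          by (simp add: filterlim_uminus_at_top[symmetric] mult_ac)
      qed
      then have "((\<lambda>t. - (c j k / mu k) * exp (- (2 * t * mu k))) \<longlongrightarrow> - (c j k / mu k) * 0) at_top" for j k
        by (intro tendsto_intros)
      then have "(V \<longlongrightarrow> (\<Sum>j\<in>(UNIV::'n set). \<Sum>k\<in>F. - (c j k / mu k) * 0)) at_top"
        unfolding V_def[abs_def] by (intro tendsto_sum)
      then show ?thesis by simp
    qed
  qed
  moreover have "\<bar>V 0\<bar> = \<bar>\<Sum>j\<in>UNIV. \<Sum>k\<in>F. a None k * a (Some j) k * (real (k $ j) / mu k)\<bar>"
    by (simp add: V_def c_def sum_negf)
  moreover have "fl.\<Phi> 0 = (\<integral>x. b0 (\<lambda>c. \<Sum>k\<in>F. a c k * gp_prod (lag_family \<alpha> k c) x) \<partial>?M)"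
    unfolding fl.\<Phi>_def by (simp add: Z_def lag_flow_def)
  ultimately show ?thesis by simp
qed

end

section \<open>The bilinear estimate\<close>

lemma gauss_bounded_powr_integrable:
  fixes \<alpha> :: "real^'n"
  assumes \<alpha>: "\<And>i. \<alpha> $ i > - 1" and f: "f \<in> borel_measurable borel" "\<And>x. 0 \<le> f x" "\<And>x. f x \<le> K * exp (- (1/8) * (norm x)\<^sup>2)"
    and r: "r > 0"
  shows "integrable (laguerre_measure \<alpha>) (\<lambda>x. f x powr r)"
proof (rule Bochner_Integration.integrable_bound)
  show "integrable (laguerre_measure \<alpha>) (\<lambda>x. K powr r * exp (- (r/8) * (norm x)\<^sup>2))"
    using r by (intro integrable_mult_right gauss_integrable \<alpha>) auto
  note [measurable] = f(1)
  show "(\<lambda>x. f x powr r) \<in> borel_measurable (laguerre_measure \<alpha>)"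
    by (intro measurable_laguerre_measure) measurable
  have K: "K \<ge> 0"
    using order_trans[OF f(2)[of 0] f(3)[of 0]] by simp
  show "AE x in laguerre_measure \<alpha>. norm (f x powr r) \<le> norm (K powr r * exp (- (r/8) * (norm x)\<^sup>2))"
  proof (rule AE_I2)
    fix x
    have "f x powr r \<le> (K * exp (- (1/8) * (norm x)\<^sup>2)) powr r" using f r by (intro powr_mono2) auto
    also have "\<dots> = K powr r * exp (- (r/8) * (norm x)\<^sup>2)" using K by (simp add: powr_mult exp_powr_real)
    finally show "norm (f x powr r) \<le> norm (K powr r * exp (- (r/8) * (norm x)\<^sup>2))" by simp
  qed
qed

text \<open>Removes the regularisation. For p \<ge> 2 the bound on \<open>b0\<close> tends to the
  p-th and q-th powers of the two functions as the shift goes to 0.\<close>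

lemma bilinear_estimate:
  fixes \<alpha> :: "real^'n" and a :: "'n option \<Rightarrow> nat^'n \<Rightarrow> real" and p :: real and F
  defines "q \<equiv> p / (p - 1)"
  defines "f \<equiv> \<lambda>c x. \<Sum>k\<in>F. a c k * gp_prod (lag_family \<alpha> k c) x"
  assumes p: "p \<ge> 2" and half: "\<And>i. \<alpha> $ i \<ge> - 1 / 2" and F: "finite F"
    and IJ: "I = {None} \<and> J = range Some \<or> I = range Some \<and> J = {None}"
  shows "integrable (laguerre_measure \<alpha>) (\<lambda>x. (\<Sum>c\<in>I. (f c x)\<^sup>2) powr (p / 2))"
    and "integrable (laguerre_measure \<alpha>) (\<lambda>x. (\<Sum>c\<in>J. (f c x)\<^sup>2) powr (q / 2))"
    and "(q - 1) / 8 * \<bar>\<Sum>j\<in>UNIV. \<Sum>k\<in>F. a None k * a (Some j) k * (real (k $ j) / lag_mu \<alpha> k)\<bar>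
     \<le> (q - 1) / 8 * (\<integral>x. (\<Sum>c\<in>I. (f c x)\<^sup>2) powr (p / 2) \<partial>laguerre_measure \<alpha>)
      + ((q - 1) / 8 + 1) * (\<integral>x. (\<Sum>c\<in>J. (f c x)\<^sup>2) powr (q / 2) \<partial>laguerre_measure \<alpha>)"
proof -
  let ?M = "laguerre_measure \<alpha>"
  have \<alpha>: "\<alpha> $ i > - 1" for i using half[of i] by simp
  interpret bellman p q "1 - 2 / p" "(q - 1) / 8"
    unfolding q_def by unfold_locales (rule p)
  define kap th where "kap = (q - 1) / 8" and "th = 1 - 2 / p"
  note qb = q_bounds[folded kap_def th_def]
  define g where "g x = exp (- (1/8) * (norm x)\<^sup>2)" for x :: "real^'n"
  define \<xi> \<eta> where "\<xi> x = (\<Sum>c\<in>I. (f c x)\<^sup>2)" and "\<eta> x = (\<Sum>c\<in>J. (f c x)\<^sup>2)" for x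
  have fm [measurable]: "f c \<in> borel_measurable borel" for c unfolding f_def by measurable
  have [measurable]: "\<xi> \<in> borel_measurable borel" "\<eta> \<in> borel_measurable borel"
    unfolding \<xi>_def[abs_def] \<eta>_def[abs_def] by measurable
  have nn: "0 \<le> \<xi> x" "0 \<le> \<eta> x" for x by (auto simp: \<xi>_def \<eta>_def sum_nonneg)
  obtain K where K: "K \<ge> 0" "\<And>c x. \<bar>f c x\<bar> \<le> K * g x"
  proof -
    obtain K where K: "K \<ge> 0" "\<And>c t x. t > - 1 \<Longrightarrow> \<bar>lag_flow \<alpha> F a 0 (\<lambda>c k. lag_family \<alpha> k c) c t x\<bar> \<le> K * g x"
      using lag_flow_bound_all[OF F \<alpha>, of a 0 "\<lambda>c k. lag_family \<alpha> k c"] unfolding g_def by blast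
    have "\<bar>f c x\<bar> \<le> K * g x" for c x using K(2)[of 0 c x] by (simp add: lag_flow_def f_def)
    with K(1) show ?thesis using that by blast
  qed
  define n where "n = real CARD('n option)"
  have sq: "(\<Sum>c\<in>A. (f c x)\<^sup>2) \<le> (n * K\<^sup>2) * g x" for A x
  proof -
    have g1: "0 \<le> g x" "g x \<le> 1" by (auto simp: g_def)
    have "(f c x)\<^sup>2 \<le> K\<^sup>2 * g x" for c
    proof -
      have "(f c x)\<^sup>2 = \<bar>f c x\<bar>\<^sup>2" by simp
      also have "\<dots> \<le> (K * g x)\<^sup>2" by (intro power_mono K) auto
      also have "\<dots> = K\<^sup>2 * (g x * g x)" by (simp add: power2_eq_square)
      also have "\<dots> \<le> K\<^sup>2 * (g x * 1)" using g1 by (intro mult_left_mono) auto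
      finally show ?thesis by simp
    qed
    then have "(\<Sum>c\<in>A. (f c x)\<^sup>2) \<le> (\<Sum>c\<in>(UNIV::'n option set). K\<^sup>2 * g x)"
      by (intro order_trans[OF sum_mono2[of UNIV A] sum_mono]) auto
    then show ?thesis by (simp add: n_def mult.assoc)
  qed
  define N where "N = n * K\<^sup>2"
  have N: "\<xi> x \<le> N * g x" "\<eta> x \<le> N * g x" for x using sq by (auto simp: \<xi>_def \<eta>_def N_def)
  have N0: "N \<ge> 0" by (simp add: N_def n_def)
  have NN: "\<xi> x \<le> N" "\<eta> x \<le> N" for x
    using N[of x] mult_left_mono[of "g x" 1 N] N0 by (auto simp: g_def)
  have I1: "integrable ?M (\<lambda>x. \<xi> x powr (p / 2))"
    using p nn N by (intro gauss_bounded_powr_integrable[where K=N] \<alpha>) (auto simp: g_def)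
  have I2: "integrable ?M (\<lambda>x. \<eta> x powr (q / 2))"
    using qb nn N by (intro gauss_bounded_powr_integrable[where K=N] \<alpha>) (auto simp: g_def)
  have I3: "integrable ?M \<xi>"
    using gauss_bounded_powr_integrable[of \<alpha> \<xi> N 1] \<alpha> nn N by (simp add: g_def)
  show "integrable ?M (\<lambda>x. (\<Sum>c\<in>I. (f c x)\<^sup>2) powr (p / 2))" "integrable ?M (\<lambda>x. (\<Sum>c\<in>J. (f c x)\<^sup>2) powr (q / 2))"
    using I1 I2 by (auto simp: \<xi>_def \<eta>_def)
  obtain C where C: "C \<ge> 0" "\<And>e x y. 0 < e \<Longrightarrow> e \<le> 1 \<Longrightarrow> 0 \<le> x \<Longrightarrow> x \<le> N \<Longrightarrow> 0 \<le> y \<Longrightarrow> y \<le> N \<Longrightarrow>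
     B (x + e) (y + e) - B e e \<le> C * (x + y powr (q / 2))"
    using B_diff_dominated[of N] by blast
  \<comment> \<open>\<open>D\<close> is an integrable bound for all shifts at once, while
    \<open>U\<close> has the sharp limit but is not integrable for positive shift. Their minimum has
    both properties.\<close>
  define D where "D x = C * (\<xi> x + \<eta> x powr (q / 2))" for x
  have Di: "integrable ?M D" unfolding D_def[abs_def] using I2 I3 by (intro integrable_mult_right Bochner_Integration.integrable_add)
  define e where "e m = 1 / real (Suc m)" for m
  have e: "0 < e m" "e m \<le> 1" for m by (auto simp: e_def)
  have elim: "e \<longlonglongrightarrow> 0" unfolding e_def[abs_def] by (rule LIMSEQ_Suc[OF lim_1_over_n])
  define U where "U r x = kap * ((\<xi> x + r) powr (p / 2) + th * (\<eta> x + r) powr (q / 2)) + \<eta> x powr (q / 2)" for r x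
  have Um: "U r \<in> borel_measurable ?M" "D \<in> borel_measurable ?M" for r
    unfolding U_def[abs_def] D_def[abs_def] by (intro measurable_laguerre_measure; measurable)+
  define X where "X = \<bar>\<Sum>j\<in>UNIV. \<Sum>k\<in>F. a None k * a (Some j) k * (real (k $ j) / lag_mu \<alpha> k)\<bar>"
  have U0: "0 \<le> U r x" if "r \<ge> 0" for r x using qb nn[of x] that by (simp add: U_def)
  have D0: "0 \<le> D x" for x using C(1) nn[of x] by (simp add: D_def)
  have Ui: "integrable ?M (\<lambda>x. min (D x) (U r x))" if "r \<ge> 0" for r
    using U0[OF that] D0 Um by (intro Bochner_Integration.integrable_bound[OF Di]) (auto intro!: AE_I2)
  have step: "kap * X \<le> (\<integral>x. min (D x) (U (e m) x) \<partial>?M)" for m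
  proof -
    interpret L: laguerre_flow p q "1 - 2 / p" "(q - 1) / 8" "e m" I J \<alpha> F a
      unfolding q_def by unfold_locales (use e half F IJ in auto)
    have b0_eq: "L.b0 (\<lambda>c. f c x) = B (\<xi> x + e m) (\<eta> x + e m) - B (e m) (e m)" for x
      by (simp add: L.b0_def L.SX_def L.SY_def \<xi>_def \<eta>_def)
    have le: "L.b0 (\<lambda>c. f c x) \<le> min (D x) (U (e m) x)" for x
      unfolding b0_eq D_def U_def using C(2)[OF e nn(1) NN(1) nn(2) NN(2)] B_diff_upper[OF e nn]
      by (simp add: kap_def th_def)
    have bm: "(\<lambda>x. L.b0 (\<lambda>c. f c x)) \<in> borel_measurable ?M"
      by (rule L.b_measurable(1)[of _ _ f]) (auto intro: measurable_laguerre_measure)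
    have "kap * X \<le> (\<integral>x. L.b0 (\<lambda>c. f c x) \<partial>?M)"
      using L.bilinear_regularized unfolding kap_def X_def f_def .
    also have "\<dots> \<le> (\<integral>x. min (D x) (U (e m) x) \<partial>?M)"
    proof (rule integral_mono)
      show "integrable ?M (\<lambda>x. L.b0 (\<lambda>c. f c x))"
      proof (rule Bochner_Integration.integrable_bound[OF _ bm AE_I2])
        show "integrable ?M (\<lambda>x. min (D x) (U (e m) x))" using Ui[of "e m"] e[of m] by simp
        show "norm (L.b0 (\<lambda>c. f c x)) \<le> norm (min (D x) (U (e m) x))" for x
          using le[of x] L.b0_nonneg[of "\<lambda>c. f c x"] unfolding real_norm_def by linarith
      qed
    qed (use Ui[of "e m"] e[of m] le in auto)
    finally show ?thesis .
  qed
  have "(\<lambda>m. \<integral>x. min (D x) (U (e m) x) \<partial>?M) \<longlonglongrightarrow> (\<integral>x. min (D x) (U 0 x) \<partial>?M)"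
  proof (rule integral_dominated_convergence[OF _ _ Di])
    show "AE x in ?M. (\<lambda>m. min (D x) (U (e m) x)) \<longlonglongrightarrow> min (D x) (U 0 x)"
    proof (rule AE_I2)
      fix x
      have a: "(\<lambda>m. (\<xi> x + e m) powr (p / 2)) \<longlonglongrightarrow> (\<xi> x + 0) powr (p / 2)"
        using p nn e by (intro tendsto_powr' tendsto_intros elim) (auto intro!: always_eventually add_nonneg_nonneg less_imp_le)
      have b: "(\<lambda>m. (\<eta> x + e m) powr (q / 2)) \<longlonglongrightarrow> (\<eta> x + 0) powr (q / 2)"
        using qb nn e by (intro tendsto_powr' tendsto_intros elim) (auto intro!: always_eventually add_nonneg_nonneg less_imp_le)
      show "(\<lambda>m. min (D x) (U (e m) x)) \<longlonglongrightarrow> min (D x) (U 0 x)"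
        unfolding U_def by (intro tendsto_min tendsto_intros a b)
    qed
    show "AE x in ?M. norm (min (D x) (U (e m) x)) \<le> D x" for m
      using U0[of "e m"] D0 e[of m] by (intro AE_I2) auto
  qed (use Um in auto)
  then have "kap * X \<le> (\<integral>x. min (D x) (U 0 x) \<partial>?M)"
    using step by (intro LIMSEQ_le_const) auto
  also have "\<dots> \<le> (\<integral>x. U 0 x \<partial>?M)"
  proof (rule integral_mono)
    show "integrable ?M (U 0)" unfolding U_def[abs_def] using I1 I2
      by (intro Bochner_Integration.integrable_add integrable_mult_right) auto
  qed (use Ui[of 0] in auto)
  also have "\<dots> = kap * (\<integral>x. \<xi> x powr (p / 2) \<partial>?M) + (kap * th + 1) * (\<integral>x. \<eta> x powr (q / 2) \<partial>?M)"
    unfolding U_def using I1 I2 by (simp add: algebra_simps)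
  also have "\<dots> \<le> kap * (\<integral>x. \<xi> x powr (p / 2) \<partial>?M) + (kap + 1) * (\<integral>x. \<eta> x powr (q / 2) \<partial>?M)"
    using qb by (intro add_left_mono mult_right_mono Bochner_Integration.integral_nonneg) auto
  finally show "(q - 1) / 8 * \<bar>\<Sum>j\<in>UNIV. \<Sum>k\<in>F. a None k * a (Some j) k * (real (k $ j) / lag_mu \<alpha> k)\<bar>
     \<le> (q - 1) / 8 * (\<integral>x. (\<Sum>c\<in>I. (f c x)\<^sup>2) powr (p / 2) \<partial>?M)
      + ((q - 1) / 8 + 1) * (\<integral>x. (\<Sum>c\<in>J. (f c x)\<^sup>2) powr (q / 2) \<partial>?M)"
    unfolding kap_def X_def \<xi>_def \<eta>_def .
qed

section \<open>Finite expansions and the normalised bilinear form\<close>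

definition lag_comb :: "real^'n \<Rightarrow> (nat^'n) set \<Rightarrow> (nat^'n \<Rightarrow> real) \<Rightarrow> real^'n \<Rightarrow> real" where
  "lag_comb \<alpha> F c x = (\<Sum>k\<in>F. c k * laguerre_fun \<alpha> k x)"

definition delta_comb :: "real^'n \<Rightarrow> (nat^'n) set \<Rightarrow> ('n \<Rightarrow> nat^'n \<Rightarrow> real) \<Rightarrow> real^'n \<Rightarrow> real^'n" where
  "delta_comb \<alpha> F d x = (\<chi> j. \<Sum>k\<in>F. d j k * delta j (laguerre_fun \<alpha> k) x)"

definition riesz_comb :: "real^'n \<Rightarrow> (nat^'n) set \<Rightarrow> (nat^'n \<Rightarrow> real) \<Rightarrow> real^'n \<Rightarrow> real^'n" where
  "riesz_comb \<alpha> F c = delta_comb \<alpha> F (\<lambda>j k. laguerre_eigenvalue \<alpha> k powr (- 1 / 2) * c k)"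

text \<open>The 40 is 4 times the 10 found in \<open>bilinear_normalized\<close>; the 4 stems from
  the squared norm 4 k_j of \<open>delta j (laguerre_fun \<alpha> k)\<close> in L^2.\<close>

definition riesz_const :: "real \<Rightarrow> real" where
  "riesz_const p = 40 * (max p (p / (p - 1)) - 1)"

lemma lag_comb_in_Lp:
  assumes "\<And>i. \<alpha> $ i > - 1" "p > 0"
  shows "in_Lp (laguerre_measure \<alpha>) p (lag_comb \<alpha> F c)"
  unfolding lag_comb_def[abs_def] laguerre_fun_eq
  using in_Lp_scaleR[OF gp_prod_in_Lp[of \<alpha> p, OF assms]] assms by (intro in_Lp_sum) auto

lemma in_Lp_vec:
  fixes f :: "'a \<Rightarrow> real^'n"
  assumes "\<And>j. in_Lp M p (\<lambda>x. f x $ j)" "p > 0"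
  shows "in_Lp M p f"
proof -
  have eq: "f = (\<lambda>x. \<Sum>j\<in>UNIV. (f x $ j) *\<^sub>R axis j 1)"
    by (simp add: fun_eq_iff vec_eq_iff axis_def if_distrib[of "(*) _"] sum.delta cong: if_cong)
  have "in_Lp M p (\<lambda>x. (f x $ j) *\<^sub>R (axis j 1 :: real^'n))" for j
  proof (rule in_Lp_bound[OF assms(1)[of j] _ assms(2), of _ 1])
    have [measurable]: "(\<lambda>x. f x $ j) \<in> borel_measurable M" using assms(1)[of j] by (simp add: in_Lp_def)
    show "(\<lambda>x. (f x $ j) *\<^sub>R (axis j 1 :: real^'n)) \<in> borel_measurable M" by measurable
  qed simp
  then show ?thesis using assms(2) by (subst eq) (intro in_Lp_sum)
qed

lemma in_Lp_component:
  fixes f :: "'a \<Rightarrow> real^'n"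
  assumes "in_Lp M p f" "p > 0"
  shows "in_Lp M p (\<lambda>x. f x $ j)"
proof (rule in_Lp_bound[OF assms(1) _ assms(2), of _ 1])
  have fm: "f \<in> borel_measurable M" using assms by (simp add: in_Lp_def)
  have "(\<lambda>y::real^'n. y $ j) \<in> borel_measurable borel" by measurable
  from measurable_compose[OF fm this] show "(\<lambda>x. f x $ j) \<in> borel_measurable M" .
qed (use component_le_norm_cart in auto)

lemma delta_comb_in_Lp:
  assumes "\<And>i. \<alpha> $ i > - 1" "p > 0"
  shows "in_Lp (laguerre_measure \<alpha>) p (delta_comb \<alpha> F d)"
proof (rule in_Lp_vec[OF _ assms(2)])
  fix j
  show "in_Lp (laguerre_measure \<alpha>) p (\<lambda>x. delta_comb \<alpha> F d x $ j)"
    unfolding delta_comb_def delta_laguerre_fun vec_lambda_beta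
    using in_Lp_scaleR[OF gp_prod_in_Lp[of \<alpha> p, OF assms]] assms by (intro in_Lp_sum) auto
qed

lemma power2_powr_half: "(x\<^sup>2) powr (r / 2) = \<bar>x :: real\<bar> powr r"
proof -
  have "(x\<^sup>2) powr (r / 2) = (\<bar>x\<bar> powr 2) powr (r / 2)" by simp
  also have "\<dots> = \<bar>x\<bar> powr (2 * (r / 2))" by (rule powr_powr)
  finally show ?thesis by simp
qed

lemma norm_powr_sum_squares: "(\<Sum>j\<in>UNIV. (y $ j)\<^sup>2) powr (r / 2) = norm (y :: real^'n) powr r"
  unfolding norm_vec_power2[symmetric] power2_powr_half by simp

text \<open>With both norms at most 1 the additive estimate becomes a constant. For p < 2 the
  conjugate exponent exceeds 2, and the estimate is used with the two functions exchanged.\<close>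

lemma bilinear_normalized:
  fixes \<alpha> :: "real^'n"
  assumes p: "p > 1" and half: "\<And>i. \<alpha> $ i \<ge> - 1 / 2" and F: "finite F"
    and f: "Lp_norm (laguerre_measure \<alpha>) p (lag_comb \<alpha> F c) \<le> 1"
    and g: "Lp_norm (laguerre_measure \<alpha>) (p / (p - 1)) (delta_comb \<alpha> F d) \<le> 1"
  shows "4 * \<bar>\<Sum>j\<in>UNIV. \<Sum>k\<in>F. c k * d j k * (real (k $ j) / lag_mu \<alpha> k)\<bar> \<le> riesz_const p"
proof -
  let ?M = "laguerre_measure \<alpha>"
  \<comment> \<open>One coefficient family serves both functions, as in the flow.\<close>
  define a where "a = (\<lambda>s k. case s of None \<Rightarrow> c k | Some j \<Rightarrow> d j k)"
  define h where "h s x = (\<Sum>k\<in>F. a s k * gp_prod (lag_family \<alpha> k s) x)" for s x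
  define X where "X = \<bar>\<Sum>j\<in>UNIV. \<Sum>k\<in>F. c k * d j k * (real (k $ j) / lag_mu \<alpha> k)\<bar>"
  have X: "X = \<bar>\<Sum>j\<in>UNIV. \<Sum>k\<in>F. a None k * a (Some j) k * (real (k $ j) / lag_mu \<alpha> k)\<bar>"
    by (simp add: X_def a_def)
  have hN: "(\<Sum>s\<in>{None}. (h s x)\<^sup>2) powr (r / 2) = norm (lag_comb \<alpha> F c x) powr r" for x r
  proof -
    have "h None x = lag_comb \<alpha> F c x" by (simp add: h_def a_def lag_comb_def laguerre_fun_eq)
    then show ?thesis by (simp add: power2_powr_half)
  qed
  have hS: "(\<Sum>s\<in>range Some. (h s x)\<^sup>2) powr (r / 2) = norm (delta_comb \<alpha> F d x) powr r" for x r
  proof -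
    have "h (Some j) x = delta_comb \<alpha> F d x $ j" for j
      by (simp add: h_def a_def delta_comb_def delta_laguerre_fun)
    then show ?thesis unfolding norm_powr_sum_squares[symmetric] by (subst sum.reindex) auto
  qed
  have fin: "4 * X \<le> 40 * (P - 1)" if P: "P \<ge> 2" and IJ: "I = {None} \<and> J = range Some \<or> I = range Some \<and> J = {None}"
    and A: "(\<integral>x. (\<Sum>s\<in>I. (h s x)\<^sup>2) powr (P / 2) \<partial>?M) \<le> 1"
    and Bd: "(\<integral>x. (\<Sum>s\<in>J. (h s x)\<^sup>2) powr (P / (P - 1) / 2) \<partial>?M) \<le> 1" for P I J
  proof -
    define k where "k = (P / (P - 1) - 1) / 8"
    have k: "k * (P - 1) = 1 / 8" "0 < k" "k \<le> 1 / 8" using P by (auto simp: k_def field_simps)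
    have "k * X \<le> k * (\<integral>x. (\<Sum>s\<in>I. (h s x)\<^sup>2) powr (P / 2) \<partial>?M) + (k + 1) * (\<integral>x. (\<Sum>s\<in>J. (h s x)\<^sup>2) powr (P / (P - 1) / 2) \<partial>?M)"
      using bilinear_estimate(3)[OF P half F IJ, of a] unfolding X k_def h_def .
    also have "\<dots> \<le> k * 1 + (k + 1) * 1" using k A Bd by (intro add_mono mult_left_mono) auto
    \<comment> \<open>Since k \<le> 1/8, the sum 2k + 1 is at most 10/8, and k (P - 1) is exactly
      1/8.\<close>
    also have "\<dots> \<le> 10 * (k * (P - 1))" using k by simp
    also have "\<dots> = k * (10 * (P - 1))" by (simp only: mult.left_commute)
    finally have "k * X \<le> k * (10 * (P - 1))" .
    then have "X \<le> 10 * (P - 1)" using k by simp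
    then show ?thesis by simp
  qed
  have le1: "(\<integral>x. norm (u x) powr r \<partial>?M) \<le> 1" if "Lp_norm ?M r u \<le> 1" "r > 0" for u :: "real^'n \<Rightarrow> 'b::euclidean_space" and r
    using that Lp_norm_le_iff[of r 1 ?M u] by simp
  define p' where "p' = p / (p - 1)"
  have p': "p' > 1" "p = p' / (p' - 1)" using p by (auto simp: p'_def field_simps)
  have f1: "(\<integral>x. norm (lag_comb \<alpha> F c x) powr p \<partial>?M) \<le> 1" using le1[OF f] p by simp
  have g1: "(\<integral>x. norm (delta_comb \<alpha> F d x) powr p' \<partial>?M) \<le> 1" using le1[OF g] p unfolding p'_def by simp
  have "4 * X \<le> 40 * (max p p' - 1)"
  proof (cases "p \<ge> 2")
    case True
    then have "p' \<le> p" unfolding p'_def using p by (simp add: divide_le_eq)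
    moreover have "4 * X \<le> 40 * (p - 1)"
      using fin[of p "{None}" "range Some", unfolded hN hS, folded p'_def, OF True _ f1 g1] by blast
    ultimately show ?thesis by (simp add: max_def)
  next
    case False
    then have p2: "p' \<ge> 2" unfolding p'_def using p by (simp add: le_divide_eq)
    have "4 * X \<le> 40 * (p' - 1)"
      using fin[of p' "range Some" "{None}", unfolded hN hS p'(2)[symmetric], OF p2 _ g1 f1] by blast
    then show ?thesis using p2 False by (simp add: max_def)
  qed
  then show ?thesis by (simp add: X_def p'_def riesz_const_def)
qed

text \<open>The estimate for norms at most 1 is made homogeneous by scaling. Orthogonality turns the
  pairing into the diagonal sum, with a factor 4.\<close>

lemma riesz_bilinear:
  fixes \<alpha> :: "real^'n"
  assumes p: "p > 1" and half: "\<And>i. \<alpha> $ i \<ge> - 1 / 2" and F: "finite F"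
  shows "\<bar>\<integral>x. riesz_comb \<alpha> F c x \<bullet> delta_comb \<alpha> F d x \<partial>laguerre_measure \<alpha>\<bar>
    \<le> riesz_const p * Lp_norm (laguerre_measure \<alpha>) p (lag_comb \<alpha> F c) * Lp_norm (laguerre_measure \<alpha>) (p / (p - 1)) (delta_comb \<alpha> F d)"
proof -
  let ?M = "laguerre_measure \<alpha>"
  have \<alpha>: "\<alpha> $ i > - 1" for i using half[of i] by simp
  define \<Sigma> where "\<Sigma> c d = (\<Sum>j\<in>UNIV. \<Sum>k\<in>F. c k * d j k * (real (k $ j) / lag_mu \<alpha> k))" for c and d :: "'n \<Rightarrow> nat^'n \<Rightarrow> real"
  have mu: "laguerre_eigenvalue \<alpha> k powr (- 1 / 2) = 1 / lag_mu \<alpha> k" for k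
    using laguerre_eigenvalue_pos[of \<alpha> k] \<alpha> by (simp add: lag_mu_def powr_half_sqrt[symmetric] powr_minus_divide[symmetric])
  have eq: "(\<integral>x. riesz_comb \<alpha> F c x \<bullet> delta_comb \<alpha> F d x \<partial>?M) = 4 * \<Sigma> c d"
  proof -
    have "(\<integral>x. riesz_comb \<alpha> F c x \<bullet> delta_comb \<alpha> F d x \<partial>?M)
      = (\<integral>x. (\<Sum>j\<in>UNIV. (\<Sum>k\<in>F. (laguerre_eigenvalue \<alpha> k powr (- 1 / 2) * c k) * gp_prod (lag_family \<alpha> k (Some j)) x) *
          (\<Sum>k\<in>F. d j k * gp_prod (lag_family \<alpha> k (Some j)) x)) \<partial>?M)"
      by (simp add: riesz_comb_def delta_comb_def delta_laguerre_fun inner_vec_def)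
    also have "\<dots> = (\<Sum>j\<in>UNIV. \<Sum>k\<in>F. (laguerre_eigenvalue \<alpha> k powr (- 1 / 2) * c k) * d j k * (4 * real (k $ j)))"
      using lag_family_sum_orthogonal[OF \<alpha> F, of _ "Some _"]
      by (subst Bochner_Integration.integral_sum) simp_all
    also have "\<dots> = 4 * \<Sigma> c d" unfolding mu by (simp add: \<Sigma>_def sum_distrib_left mult_ac)
    finally show ?thesis .
  qed
  define A Bd where "A = Lp_norm ?M p (lag_comb \<alpha> F c)" and "Bd = Lp_norm ?M (p / (p - 1)) (delta_comb \<alpha> F d)"
  have nn: "A \<ge> 0" "Bd \<ge> 0" by (auto simp: A_def Bd_def)
  have main: "4 * \<bar>\<Sigma> c d\<bar> \<le> riesz_const p * (A + r) * (Bd + r)" if r: "r > 0" for r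
  proof -
    \<comment> \<open>Dividing by A + r and Bd + r instead of the norms avoids a separate case of
      vanishing norms; r tends to 0 at the end.\<close>
    define s t where "s = 1 / (A + r)" and "t = 1 / (Bd + r)"
    have st: "s > 0" "t > 0" using nn r by (auto simp: s_def t_def)
    have sA: "s * A \<le> 1" "t * Bd \<le> 1" using nn r by (auto simp: s_def t_def divide_le_eq)
    have 1: "lag_comb \<alpha> F (\<lambda>k. s * c k) = (\<lambda>x. s *\<^sub>R lag_comb \<alpha> F c x)"
      by (simp add: lag_comb_def fun_eq_iff sum_distrib_left mult.assoc)
    have 2: "delta_comb \<alpha> F (\<lambda>j k. t * d j k) = (\<lambda>x. t *\<^sub>R delta_comb \<alpha> F d x)"
      by (simp add: delta_comb_def fun_eq_iff vec_eq_iff sum_distrib_left mult.assoc)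
    have pq: "p > 0" "p / (p - 1) > 0" using p by auto
    have "4 * \<bar>\<Sigma> (\<lambda>k. s * c k) (\<lambda>j k. t * d j k)\<bar> \<le> riesz_const p"
      unfolding \<Sigma>_def
      using bilinear_normalized[OF p half F, of "\<lambda>k. s * c k" "\<lambda>j k. t * d j k"] sA st
      unfolding 1 2 Lp_norm_scaleR[OF pq(1)] Lp_norm_scaleR[OF pq(2)] A_def[symmetric] Bd_def[symmetric] by simp
    moreover have "\<Sigma> (\<lambda>k. s * c k) (\<lambda>j k. t * d j k) = (s * t) * \<Sigma> c d"
      by (simp add: \<Sigma>_def sum_distrib_left mult_ac)
    ultimately have "(s * t) * (4 * \<bar>\<Sigma> c d\<bar>) \<le> riesz_const p" using st by (simp add: abs_mult)
    then have "4 * \<bar>\<Sigma> c d\<bar> / ((A + r) * (Bd + r)) \<le> riesz_const p" by (simp add: s_def t_def)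
    moreover have "(A + r) * (Bd + r) > 0" using nn r by simp
    ultimately show ?thesis by (simp add: pos_divide_le_eq mult.assoc)
  qed
  have "((\<lambda>r. riesz_const p * (A + r) * (Bd + r)) \<longlongrightarrow> riesz_const p * (A + 0) * (Bd + 0)) (at_right 0)"
    by (intro tendsto_intros)
  moreover have "eventually (\<lambda>r. 4 * \<bar>\<Sigma> c d\<bar> \<le> riesz_const p * (A + r) * (Bd + r)) (at_right 0)"
    unfolding eventually_at_right_field using main by (intro exI[of _ 1]) auto
  ultimately have "4 * \<bar>\<Sigma> c d\<bar> \<le> riesz_const p * (A + 0) * (Bd + 0)"
    by (intro tendsto_lowerbound[of _ _ "at_right 0"]) auto
  then show ?thesis by (simp add: eq abs_mult A_def Bd_def)
qed

section \<open>Riesz transforms\<close>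

lemma lag_coeff_top: "lag_coeff n a n \<noteq> 0"
  by (simp add: lag_coeff_def)

lemma lag_classical_span:
  "degree p \<le> m \<Longrightarrow> \<exists>b. p = (\<Sum>n\<le>m. smult (b n) (lag_classical n a))"
proof (induction m arbitrary: p)
  case 0
  have l: "lag_classical 0 a = [:lag_coeff 0 a 0:]"
    by (rule poly_eqI) (simp add: coeff_lag_classical lag_coeff_def coeff_pCons split: nat.split)
  obtain c where "p = [:c:]" using 0 by (metis degree_eq_zeroE le_zero_eq)
  then have "p = (\<Sum>n\<le>0. smult (c / lag_coeff 0 a 0) (lag_classical n a))"
    using lag_coeff_top[of 0 a] by (simp add: l)
  then show ?case by (rule exI[of _ "\<lambda>_. c / lag_coeff 0 a 0"])
next
  case (Suc m)
  define c where "c = coeff p (Suc m) / lag_coeff (Suc m) a (Suc m)"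
  define r where "r = p - smult c (lag_classical (Suc m) a)"
  have "degree r \<le> m"
  proof (rule degree_le, intro allI impI)
    fix i assume i: "m < i"
    show "coeff r i = 0"
    proof (cases "i = Suc m")
      case True
      then show ?thesis using lag_coeff_top[of "Suc m" a] by (simp add: r_def c_def coeff_lag_classical)
    next
      case False
      then have "degree p < i" using Suc.prems i by simp
      then show ?thesis using False i by (simp add: r_def coeff_eq_0 coeff_lag_classical lag_coeff_def)
    qed
  qed
  then obtain b where b: "r = (\<Sum>n\<le>m. smult (b n) (lag_classical n a))" using Suc.IH by blast
  have "p = r + smult c (lag_classical (Suc m) a)" by (simp add: r_def)
  also have "\<dots> = (\<Sum>n\<le>Suc m. smult ((b(Suc m := c)) n) (lag_classical n a))" by (simp add: b)
  finally show ?case by blast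
qed

lemma lag_const_pos: "a > - 1 \<Longrightarrow> lag_const n a > 0"
  by (simp add: lag_const_def Gamma_real_pos)

lemma monom_lag_span:
  assumes a: "a > - 1"
  shows "\<exists>b. \<forall>x. x ^ (2 * m) = (\<Sum>n\<le>m. b n * poly (lag_poly n a) x)"
proof -
  obtain b where b: "monom 1 m = (\<Sum>n\<le>m. smult (b n) (lag_classical n a))"
    using lag_classical_span[of "monom 1 m" m a] degree_monom_le by blast
  have "x ^ (2 * m) = (\<Sum>n\<le>m. (b n / lag_const n a) * poly (lag_poly n a) x)" for x
  proof -
    have "x ^ (2 * m) = poly (monom 1 m) (x\<^sup>2)" by (simp add: poly_monom power_mult)
    also have "\<dots> = (\<Sum>n\<le>m. b n * poly (lag_classical n a) (x\<^sup>2))" unfolding b by (simp add: poly_sum)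
    also have "\<dots> = (\<Sum>n\<le>m. (b n / lag_const n a) * poly (lag_poly n a) x)"
    proof (intro sum.cong refl)
      fix n
      show "b n * poly (lag_classical n a) (x\<^sup>2) = (b n / lag_const n a) * poly (lag_poly n a) x"
        using lag_const_pos[OF a, of n] by (simp add: lag_poly_def poly_pcompose power2_eq_square)
    qed
    finally show ?thesis .
  qed
  then show ?thesis by (intro exI[of _ "\<lambda>n. b n / lag_const n a"]) blast
qed

lemma sum_extend:
  fixes u h :: "'k \<Rightarrow> real"
  assumes "finite H" "F \<subseteq> H"
  shows "(\<Sum>k\<in>F. u k * h k) = (\<Sum>k\<in>H. (if k \<in> F then u k else 0) * h k)"
  using assms by (intro sum.mono_neutral_cong_left) auto

text \<open>For \<open>None\<close> the factors span the even polynomials times the Gaussian; for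
  \<open>Some j\<close> the j-th factors span the odd ones, which is the extra factor x that
  \<open>J\<close> records in the density locale.\<close>

lemma lag_family_dense:
  fixes \<alpha> :: "real^'n" and c :: "'n option"
  assumes \<alpha>: "\<And>i. \<alpha> $ i > - 1" and q: "q > 1" and f: "in_Lp (laguerre_measure \<alpha>) q f" and e: "e > 0"
  shows "\<exists>F u. finite F \<and> Lp_norm (laguerre_measure \<alpha>) q (\<lambda>x. f x - (\<Sum>k\<in>F. u k * gp_prod (lag_family \<alpha> k c) x)) < e"
proof -
  define S where "S = {\<lambda>x. \<Sum>k\<in>F. u k * gp_prod (lag_family \<alpha> k c) x | F u. finite F}"
  define fam where "fam n i = (if c = Some i then pderiv (lag_poly n (\<alpha> $ i)) else lag_poly n (\<alpha> $ i))" for n i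
  define \<Phi>0 where "\<Phi>0 i = range (\<lambda>n. gauss_poly (fam n i))" for i
  define J where "J = {i. c = Some i}"
  interpret laguerre_density \<alpha> q S \<Phi>0 J
  proof unfold_locales
    show "(\<lambda>x. 0) \<in> S" unfolding S_def by (auto intro!: exI[of _ "{}"])
    show "(\<lambda>x. g x + h x) \<in> S" if gh: "g \<in> S" "h \<in> S" for g h
    proof -
      obtain F u where g: "finite F" "g = (\<lambda>x. \<Sum>k\<in>F. u k * gp_prod (lag_family \<alpha> k c) x)" using gh(1) by (auto simp: S_def)
      obtain H v where h: "finite H" "h = (\<lambda>x. \<Sum>k\<in>H. v k * gp_prod (lag_family \<alpha> k c) x)" using gh(2) by (auto simp: S_def)
      have "(\<lambda>x. g x + h x) = (\<lambda>x. \<Sum>k\<in>F \<union> H. ((if k \<in> F then u k else 0) + (if k \<in> H then v k else 0)) * gp_prod (lag_family \<alpha> k c) x)"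
        unfolding g(2) h(2) using g(1) h(1)
        by (subst (1 2) sum_extend[of "F \<union> H"]) (auto simp: sum.distrib[symmetric] distrib_right)
      then show ?thesis unfolding S_def using g(1) h(1)
        by (intro CollectI exI[of _ "F \<union> H"] exI[of _ "\<lambda>k. (if k \<in> F then u k else 0) + (if k \<in> H then v k else 0)"] conjI) auto
    qed
    show "(\<lambda>x. r * g x) \<in> S" if gS: "g \<in> S" for g r
    proof -
      obtain F u where g: "finite F" "g = (\<lambda>x. \<Sum>k\<in>F. u k * gp_prod (lag_family \<alpha> k c) x)" using gS by (auto simp: S_def)
      have "(\<lambda>x. r * g x) = (\<lambda>x. \<Sum>k\<in>F. (r * u k) * gp_prod (lag_family \<alpha> k c) x)"
        unfolding g(2) by (simp add: sum_distrib_left mult.assoc)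
      then show ?thesis unfolding S_def using g(1) by (intro CollectI exI conjI)
    qed
    show "gauss_bdd \<phi>" if \<phi>: "\<phi> \<in> \<Phi>0 i" for i \<phi>
    proof -
      obtain p where p: "\<phi> = gauss_poly p" using \<phi> unfolding \<Phi>0_def by blast
      show ?thesis unfolding gauss_bdd_def p
        using gauss_bdd_poly[of "1/2" p] gauss_poly_measurable by (auto simp: gauss_poly_def)
    qed
    show "tensor \<phi> \<in> S" if "\<And>i. \<phi> i \<in> \<Phi>0 i" for \<phi>
    proof -
      have "\<forall>i. \<exists>n. \<phi> i = gauss_poly (fam n i)" using that unfolding \<Phi>0_def by blast
      then obtain n where n: "\<And>i. \<phi> i = gauss_poly (fam (n i) i)" by metis
      define k :: "nat^'n" where "k = (\<chi> i. n i)"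
      have "tensor \<phi> = (\<lambda>x. \<Sum>k\<in>{k}. 1 * gp_prod (lag_family \<alpha> k c) x)"
        by (simp add: gp_prod_def tensor_def lag_family_def n k_def fam_def fun_eq_iff if_distrib cong: if_cong)
      then show ?thesis unfolding S_def by (intro CollectI exI[of _ "{k}"] exI[of _ "\<lambda>_. 1"] conjI) auto
    qed
    show "(\<lambda>x. (if i \<in> J then x else 1) * x ^ (2 * m) * exp (- x\<^sup>2 / 2)) \<in> lin_span (\<Phi>0 i)" for i m
    proof (cases "i \<in> J")
      case False
      obtain b where b: "\<And>x. x ^ (2 * m) = (\<Sum>n\<le>m. b n * poly (lag_poly n (\<alpha> $ i)) x)"
        using monom_lag_span[OF \<alpha>] by blast
      have "(\<lambda>x. (if i \<in> J then x else 1) * x ^ (2 * m) * exp (- x\<^sup>2 / 2)) = (\<lambda>x. \<Sum>n\<in>{..m}. b n * gauss_poly (fam n i) x)"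
        using False by (simp add: b gauss_poly_def fam_def J_def sum_distrib_right mult.assoc)
      moreover have "(\<lambda>x. \<Sum>n\<in>{..m}. b n * gauss_poly (fam n i) x) \<in> lin_span (\<Phi>0 i)"
        by (rule lin_spanI) (auto simp: \<Phi>0_def)
      ultimately show ?thesis by simp
    next
      case True
      have "\<alpha> $ i + 1 > - 1" using \<alpha>[of i] by simp
      then obtain b where b: "\<And>x. x ^ (2 * m) = (\<Sum>n\<le>m. b n * poly (lag_poly n (\<alpha> $ i + 1)) x)"
        using monom_lag_span by blast
      \<comment> \<open>Undoes the factor - 2 sqrt (n + 1) with which x times a polynomial of type
        \<alpha>_i + 1 appears as the derivative of one of type \<alpha>_i.\<close>
      define b' where "b' n = - b n / (2 * sqrt (real (Suc n)))" for n
      have "x * (b n * poly (lag_poly n (\<alpha> $ i + 1)) x) = b' n * poly (pderiv (lag_poly (Suc n) (\<alpha> $ i))) x" for n x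
        by (simp add: b'_def pderiv_lag_poly_Suc del: of_nat_Suc)
      then have "x * x ^ (2 * m) = (\<Sum>n\<le>m. b' n * poly (pderiv (lag_poly (Suc n) (\<alpha> $ i))) x)" for x
        unfolding b sum_distrib_left by simp
      then have "(\<lambda>x. (if i \<in> J then x else 1) * x ^ (2 * m) * exp (- x\<^sup>2 / 2)) = (\<lambda>x. \<Sum>n\<in>{..m}. b' n * gauss_poly (fam (Suc n) i) x)"
        using True by (simp add: gauss_poly_def fam_def J_def sum_distrib_right mult.assoc)
      moreover have "(\<lambda>x. \<Sum>n\<in>{..m}. b' n * gauss_poly (fam (Suc n) i) x) \<in> lin_span (\<Phi>0 i)"
        by (rule lin_spanI) (auto simp: \<Phi>0_def)
      ultimately show ?thesis by simp
    qed
  qed (use \<alpha> q in auto)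
  obtain g where "g \<in> S" "Lp_norm (laguerre_measure \<alpha>) q (\<lambda>x. f x - g x) < e"
    using approx_all[OF f] e unfolding approx_def by blast
  then show ?thesis unfolding S_def by blast
qed

lemma lag_comb_dense:
  fixes \<alpha> :: "real^'n"
  assumes \<alpha>: "\<And>i. \<alpha> $ i > - 1" and p: "p > 1" and f: "in_Lp (laguerre_measure \<alpha>) p f" and e: "e > 0"
  shows "\<exists>F c. finite F \<and> Lp_norm (laguerre_measure \<alpha>) p (\<lambda>x. f x - lag_comb \<alpha> F c x) < e"
  using lag_family_dense[OF assms, of None] unfolding lag_comb_def laguerre_fun_eq .

lemma delta_comb_dense:
  fixes \<alpha> :: "real^'n" and g :: "real^'n \<Rightarrow> real^'n"
  assumes \<alpha>: "\<And>i. \<alpha> $ i > - 1" and p: "p > 1" and g: "in_Lp (laguerre_measure \<alpha>) p g" and e: "e > 0"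
  shows "\<exists>F d. finite F \<and> Lp_norm (laguerre_measure \<alpha>) p (\<lambda>x. g x - delta_comb \<alpha> F d x) < e"
proof -
  let ?M = "laguerre_measure \<alpha>"
  have p0: "p > 0" using p by simp
  \<comment> \<open>One share for each coordinate; the additional 2 makes the final inequality
    strict.\<close>
  define e' where "e' = e / (2 * real CARD('n))"
  have e': "e' > 0" using e by (simp add: e'_def)
  have "\<exists>F u. finite F \<and> Lp_norm ?M p (\<lambda>x. g x $ j - (\<Sum>k\<in>F. u k * delta j (laguerre_fun \<alpha> k) x)) < e'" for j
    using lag_family_dense[OF \<alpha> p in_Lp_component[OF g p0] e', of j "Some j"] unfolding delta_laguerre_fun .
  from choice[OF allI[OF this]] obtain F where
    "\<forall>j. \<exists>u. finite (F j) \<and> Lp_norm ?M p (\<lambda>x. g x $ j - (\<Sum>k\<in>F j. u k * delta j (laguerre_fun \<alpha> k) x)) < e'" ..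
  from choice[OF this] obtain u where Fu:
    "\<forall>j. finite (F j) \<and> Lp_norm ?M p (\<lambda>x. g x $ j - (\<Sum>k\<in>F j. u j k * delta j (laguerre_fun \<alpha> k) x)) < e'" ..
  then have F: "\<And>j. finite (F j)"
    and u: "\<And>j. Lp_norm ?M p (\<lambda>x. g x $ j - (\<Sum>k\<in>F j. u j k * delta j (laguerre_fun \<alpha> k) x)) < e'" by blast+
  define H where "H = (\<Union>j. F j)"
  have H: "finite H" "F j \<subseteq> H" for j using F by (auto simp: H_def)
  define d where "d j k = (if k \<in> F j then u j k else 0)" for j k
  define r where "r x = g x - delta_comb \<alpha> H d x" for x
  have rj: "r x $ j = g x $ j - (\<Sum>k\<in>F j. u j k * delta j (laguerre_fun \<alpha> k) x)" for x j
    by (simp add: r_def delta_comb_def d_def sum_extend[OF H, symmetric])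
  have rL: "in_Lp ?M p r" unfolding r_def[abs_def] using g delta_comb_in_Lp[OF \<alpha> p0] p0 by (intro in_Lp_diff) auto
  have eq: "r = (\<lambda>x. \<Sum>j\<in>UNIV. (r x $ j) *\<^sub>R axis j 1)"
    by (simp add: fun_eq_iff vec_eq_iff axis_def if_distrib[of "(*) _"] sum.delta cong: if_cong)
  have nj: "Lp_norm ?M p (\<lambda>x. (r x $ j) *\<^sub>R (axis j 1 :: real^'n)) = Lp_norm ?M p (\<lambda>x. r x $ j)" for j
    by (rule Lp_norm_cong) simp
  have inj: "in_Lp ?M p (\<lambda>x. (r x $ j) *\<^sub>R (axis j 1 :: real^'n))" for j
  proof (rule in_Lp_bound[OF in_Lp_component[OF rL p0, of j] _ p0, of _ 1])
    have [measurable]: "(\<lambda>x. r x $ j) \<in> borel_measurable ?M" using in_Lp_component[OF rL p0, of j] by (simp add: in_Lp_def)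
    show "(\<lambda>x. (r x $ j) *\<^sub>R (axis j 1 :: real^'n)) \<in> borel_measurable ?M" by measurable
  qed simp
  have "Lp_norm ?M p (\<lambda>x. \<Sum>j\<in>UNIV. (r x $ j) *\<^sub>R (axis j 1 :: real^'n)) \<le> (\<Sum>j\<in>UNIV. Lp_norm ?M p (\<lambda>x. (r x $ j) *\<^sub>R (axis j 1 :: real^'n)))"
    by (rule Minkowski_sum[OF p inj])
  also have "\<dots> \<le> (\<Sum>j\<in>(UNIV::'n set). e')"
    unfolding nj unfolding rj using u by (intro sum_mono less_imp_le)
  also have "\<dots> < e" using e by (simp add: e'_def)
  finally have "Lp_norm ?M p r < e" unfolding eq[symmetric] .
  then show ?thesis using H(1) unfolding r_def by blast
qed

section \<open>Extension by density\<close>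

lemma comb_diff:
  fixes F H c d
  assumes "finite F" "finite H"
  defines "e \<equiv> \<lambda>k. (if k \<in> F then c k else 0) - (if k \<in> H then d k else 0)"
  shows "lag_comb \<alpha> F c x - lag_comb \<alpha> H d x = lag_comb \<alpha> (F \<union> H) e x"
    and "riesz_comb \<alpha> F c x - riesz_comb \<alpha> H d x = riesz_comb \<alpha> (F \<union> H) e x"
proof -
  have *: "(\<Sum>k\<in>F. c k * h k) - (\<Sum>k\<in>H. d k * h k) = (\<Sum>k\<in>F \<union> H. e k * h k)" for h :: "_ \<Rightarrow> real"
    using assms(1,2) unfolding e_def
    by (subst (1 2) sum_extend[of "F \<union> H"]) (auto simp: sum_subtractf[symmetric] left_diff_distrib)
  show "lag_comb \<alpha> F c x - lag_comb \<alpha> H d x = lag_comb \<alpha> (F \<union> H) e x"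
    unfolding lag_comb_def by (rule *)
  show "riesz_comb \<alpha> F c x - riesz_comb \<alpha> H d x = riesz_comb \<alpha> (F \<union> H) e x"
    using *[of "\<lambda>k. laguerre_eigenvalue \<alpha> k powr (- 1 / 2) * delta _ (laguerre_fun \<alpha> k) x"]
    by (simp add: riesz_comb_def delta_comb_def vec_eq_iff mult_ac)
qed

lemma delta_comb_extend:
  assumes "finite H" "F \<subseteq> H"
  shows "delta_comb \<alpha> F d = delta_comb \<alpha> H (\<lambda>j k. if k \<in> F then d j k else 0)"
  by (simp add: delta_comb_def fun_eq_iff vec_eq_iff sum_extend[OF assms])

lemma lag_riesz_extend:
  assumes "finite H" "F \<subseteq> H"
  shows "lag_comb \<alpha> F c = lag_comb \<alpha> H (\<lambda>k. if k \<in> F then c k else 0)"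
    and "riesz_comb \<alpha> F c = riesz_comb \<alpha> H (\<lambda>k. if k \<in> F then c k else 0)"
  unfolding riesz_comb_def delta_comb_extend[OF assms]
  by (auto simp: lag_comb_def delta_comb_def fun_eq_iff vec_eq_iff sum_extend[OF assms] intro!: sum.cong)

lemma riesz_const_nonneg: "p > 1 \<Longrightarrow> riesz_const p \<ge> 0"
  by (simp add: riesz_const_def max_def)

text \<open>Duality, with delta expansions as dense test class. The expansions of \<open>f\<close>
  and of the test function are first written over a common index set, as the bilinear estimate
  requires.\<close>

lemma riesz_comb_bound:
  fixes \<alpha> :: "real^'n"
  assumes p: "p > 1" and half: "\<And>i. \<alpha> $ i \<ge> - 1 / 2" and F: "finite F"
  shows "Lp_norm (laguerre_measure \<alpha>) p (riesz_comb \<alpha> F c) \<le> riesz_const p * Lp_norm (laguerre_measure \<alpha>) p (lag_comb \<alpha> F c)"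
proof -
  have \<alpha>: "\<alpha> $ i > - 1" for i using half[of i] by simp
  have p0: "p > 0" using p by simp
  define q where "q = p / (p - 1)"
  note q = conjugate_exponent[OF p, folded q_def]
  define G where "G = {delta_comb \<alpha> H d | H d. finite H}"
  show ?thesis
  proof (rule Lp_norm_le_dual[OF p q(1,2), where G=G])
    show "in_Lp (laguerre_measure \<alpha>) p (riesz_comb \<alpha> F c)"
      unfolding riesz_comb_def by (rule delta_comb_in_Lp[OF \<alpha> p0])
    show "0 \<le> riesz_const p * Lp_norm (laguerre_measure \<alpha>) p (lag_comb \<alpha> F c)"
      using riesz_const_nonneg[OF p] by simp
    show "in_Lp (laguerre_measure \<alpha>) q g" if "g \<in> G" for g
      using that q(1) delta_comb_in_Lp[OF \<alpha>, of q] by (auto simp: G_def)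
    show "\<exists>g'\<in>G. Lp_norm (laguerre_measure \<alpha>) q (\<lambda>x. g x - g' x) < e" if "in_Lp (laguerre_measure \<alpha>) q g" "e > 0" for g :: "real^'n \<Rightarrow> real^'n" and e
      using delta_comb_dense[OF \<alpha> q(1) that] unfolding G_def by blast
    show "\<bar>\<integral>x. riesz_comb \<alpha> F c x \<bullet> g x \<partial>laguerre_measure \<alpha>\<bar>
       \<le> riesz_const p * Lp_norm (laguerre_measure \<alpha>) p (lag_comb \<alpha> F c) * Lp_norm (laguerre_measure \<alpha>) q g" if "g \<in> G" for g
    proof -
      obtain H d where g: "finite H" "g = delta_comb \<alpha> H d" using \<open>g \<in> G\<close> by (auto simp: G_def)
      have U: "finite (F \<union> H)" using F g by simp
      show ?thesis
        unfolding g(2) lag_riesz_extend[OF U Un_upper1] delta_comb_extend[OF U Un_upper2] q_def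
        by (rule riesz_bilinear[OF p half U])
    qed
  qed
qed

text \<open>By orthonormality the coefficients outside \<open>F\<close> vanish, so partial sums no
  longer change once they contain \<open>F\<close>.\<close>

lemma riesz_term_sum:
  fixes \<alpha> :: "real^'n"
  assumes \<alpha>: "\<And>i. \<alpha> $ i > - 1" and F: "finite F" "F \<subseteq> H" "finite H"
  shows "(\<Sum>k\<in>H. riesz_term \<alpha> i (lag_comb \<alpha> F c) k x) = riesz_comb \<alpha> F c x $ i"
proof -
  have coef: "(\<integral>y. lag_comb \<alpha> F c y * laguerre_fun \<alpha> k y \<partial>laguerre_measure \<alpha>) = (if k \<in> F then c k else 0)" for k
  proof -
    have U: "finite (insert k F)" using F by simp
    have "(\<integral>y. lag_comb \<alpha> F c y * laguerre_fun \<alpha> k y \<partial>laguerre_measure \<alpha>)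
      = (\<integral>y. (\<Sum>m\<in>insert k F. (if m \<in> F then c m else 0) * gp_prod (lag_family \<alpha> m None) y)
           * (\<Sum>m\<in>insert k F. (if m = k then 1 else 0) * gp_prod (lag_family \<alpha> m None) y) \<partial>laguerre_measure \<alpha>)"
    proof (rule Bochner_Integration.integral_cong[OF refl])
      fix y
      have "(\<Sum>m\<in>insert k F. (if m = k then 1 else 0) * gp_prod (lag_family \<alpha> m None) y) = laguerre_fun \<alpha> k y"
        using U by (simp add: laguerre_fun_eq if_distrib[of "\<lambda>z. z * _"] sum.delta cong: if_cong del: sum.insert sum.insert_if)
      moreover have "lag_comb \<alpha> F c y = (\<Sum>m\<in>insert k F. (if m \<in> F then c m else 0) * gp_prod (lag_family \<alpha> m None) y)"
        unfolding lag_comb_def laguerre_fun_eq by (rule sum_extend[OF U]) auto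
      ultimately show "lag_comb \<alpha> F c y * laguerre_fun \<alpha> k y = (\<Sum>m\<in>insert k F. (if m \<in> F then c m else 0) * gp_prod (lag_family \<alpha> m None) y)
           * (\<Sum>m\<in>insert k F. (if m = k then 1 else 0) * gp_prod (lag_family \<alpha> m None) y)" by simp
    qed
    also have "\<dots> = (if k \<in> F then c k else 0)"
      unfolding lag_family_sum_orthogonal(2)[OF \<alpha> U] using U
      by (simp add: if_distrib[of "\<lambda>z. _ * z"] sum.delta cong: if_cong del: sum.insert sum.insert_if)
    finally show ?thesis .
  qed
  have "(\<Sum>k\<in>H. riesz_term \<alpha> i (lag_comb \<alpha> F c) k x)
     = (\<Sum>k\<in>F. laguerre_eigenvalue \<alpha> k powr (- 1 / 2) * c k * delta i (laguerre_fun \<alpha> k) x)"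
    unfolding riesz_term_def coef using F by (intro sum.mono_neutral_cong_right) auto
  then show ?thesis by (simp add: riesz_comb_def delta_comb_def)
qed

text \<open>On finite expansions the net of partial sums in \<open>is_riesz\<close> is eventually
  constant, so convergence in L^2 is equality almost everywhere, coordinate by coordinate.\<close>

lemma is_riesz_vector_lag_comb_iff:
  fixes \<alpha> :: "real^'n"
  assumes \<alpha>: "\<And>i. \<alpha> $ i > - 1" and F: "finite F" and g: "g \<in> borel_measurable (laguerre_measure \<alpha>)"
  shows "is_riesz_vector \<alpha> (lag_comb \<alpha> F c) g \<longleftrightarrow> (AE x in laguerre_measure \<alpha>. g x = riesz_comb \<alpha> F c x)"
proof -
  let ?M = "laguerre_measure \<alpha>"
  define r where "r = riesz_comb \<alpha> F c"
  have r2: "in_Lp ?M 2 r" unfolding r_def riesz_comb_def by (rule delta_comb_in_Lp[OF \<alpha>]) simp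
  have rj: "in_Lp ?M 2 (\<lambda>x. r x $ i)" for i by (rule in_Lp_component[OF r2]) simp
  have gj: "(\<lambda>x. g x $ i) \<in> borel_measurable ?M" for i
  proof -
    have "(\<lambda>y::real^'n. y $ i) \<in> borel_measurable borel" by measurable
    from measurable_compose[OF g this] show ?thesis .
  qed
  have f2: "in_Lp ?M 2 (lag_comb \<alpha> F c)" by (rule lag_comb_in_Lp[OF \<alpha>]) simp
  have ev: "eventually (\<lambda>H. Lp_norm ?M 2 (\<lambda>x. g x $ i - (\<Sum>k\<in>H. riesz_term \<alpha> i (lag_comb \<alpha> F c) k x)) = Lp_norm ?M 2 (\<lambda>x. g x $ i - r x $ i))
     (finite_subsets_at_top UNIV)" for i
    unfolding eventually_finite_subsets_at_top r_def
    using F by (intro exI[of _ F]) (auto simp: riesz_term_sum[OF \<alpha> F])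
  have lim: "((\<lambda>H. Lp_norm ?M 2 (\<lambda>x. g x $ i - (\<Sum>k\<in>H. riesz_term \<alpha> i (lag_comb \<alpha> F c) k x))) \<longlongrightarrow> 0) (finite_subsets_at_top UNIV)
     \<longleftrightarrow> Lp_norm ?M 2 (\<lambda>x. g x $ i - r x $ i) = 0" for i
    using tendsto_cong[OF ev[of i], of 0] by (simp add: tendsto_const_iff)
  have one: "is_riesz \<alpha> i (lag_comb \<alpha> F c) (\<lambda>x. g x $ i) \<longleftrightarrow> (AE x in ?M. g x $ i = r x $ i)" for i
  proof
    assume "is_riesz \<alpha> i (lag_comb \<alpha> F c) (\<lambda>x. g x $ i)"
    then have a: "in_Lp ?M 2 (\<lambda>x. g x $ i)" "Lp_norm ?M 2 (\<lambda>x. g x $ i - r x $ i) = 0"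
      using lim by (auto simp: is_riesz_def)
    then show "AE x in ?M. g x $ i = r x $ i"
      using Lp_norm_eq_0_iff[of 2 ?M "\<lambda>x. g x $ i - r x $ i"] in_Lp_diff[OF a(1) rj] by simp
  next
    assume ae: "AE x in ?M. g x $ i = r x $ i"
    have "(\<lambda>x. r x $ i) \<in> borel_measurable ?M" using rj[of i] by (simp add: in_Lp_def)
    from Lp_cong_AE(2)[OF ae gj this, of 2] have gi: "in_Lp ?M 2 (\<lambda>x. g x $ i)" using rj[of i] by (simp only:)
    have "Lp_norm ?M 2 (\<lambda>x. g x $ i - r x $ i) = 0"
      using Lp_norm_eq_0_iff[of 2 ?M "\<lambda>x. g x $ i - r x $ i"] in_Lp_diff[OF gi rj] ae by simp
    then show "is_riesz \<alpha> i (lag_comb \<alpha> F c) (\<lambda>x. g x $ i)"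
      unfolding is_riesz_def using lim gi f2 by blast
  qed
  show ?thesis
    unfolding is_riesz_vector_def one vec_eq_iff r_def[symmetric]
  proof
    assume "\<forall>i. AE x in ?M. g x $ i = r x $ i"
    then show "AE x in ?M. \<forall>i. g x $ i = r x $ i" by (intro eventually_all_finite) blast
  next
    assume "AE x in ?M. \<forall>i. g x $ i = r x $ i"
    then show "\<forall>i. AE x in ?M. g x $ i = r x $ i" by (auto elim: eventually_mono)
  qed
qed

text \<open>The value of the extension at \<open>f\<close> is described by its distance to the
  transform of every finite expansion. In this form uniform continuity can be read off directly,
  without passing through linearity.\<close>

lemma riesz_extension_exists:
  fixes \<alpha> :: "real^'n"
  assumes p: "p > 1" and half: "\<And>i. \<alpha> $ i \<ge> - 1 / 2" and f: "in_Lp (laguerre_measure \<alpha>) p f"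
  shows "\<exists>h. in_Lp (laguerre_measure \<alpha>) p h \<and> (\<forall>F c. finite F \<longrightarrow>
     Lp_norm (laguerre_measure \<alpha>) p (\<lambda>x. h x - riesz_comb \<alpha> F c x) \<le> riesz_const p * Lp_norm (laguerre_measure \<alpha>) p (\<lambda>x. f x - lag_comb \<alpha> F c x))"
proof -
  let ?M = "laguerre_measure \<alpha>"
  have \<alpha>: "\<alpha> $ i > - 1" for i using half[of i] by simp
  have p0: "p > 0" using p by simp
  define C where "C = riesz_const p"
  have C: "C \<ge> 0" unfolding C_def by (rule riesz_const_nonneg[OF p])
  have rL: "in_Lp ?M p (riesz_comb \<alpha> F c)" for F c unfolding riesz_comb_def by (rule delta_comb_in_Lp[OF \<alpha> p0])
  have lL: "in_Lp ?M p (lag_comb \<alpha> F c)" for F c by (rule lag_comb_in_Lp[OF \<alpha> p0])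
  have rd: "Lp_norm ?M p (\<lambda>x. riesz_comb \<alpha> F c x - riesz_comb \<alpha> H d x) \<le> C * (Lp_norm ?M p (\<lambda>x. f x - lag_comb \<alpha> F c x) + Lp_norm ?M p (\<lambda>x. f x - lag_comb \<alpha> H d x))"
    if "finite F" "finite H" for F H c d
  proof -
    have "Lp_norm ?M p (\<lambda>x. riesz_comb \<alpha> F c x - riesz_comb \<alpha> H d x) \<le> C * Lp_norm ?M p (\<lambda>x. lag_comb \<alpha> F c x - lag_comb \<alpha> H d x)"
      unfolding comb_diff[OF that] C_def using that by (intro riesz_comb_bound[OF p half]) simp
    also have "\<dots> \<le> C * (Lp_norm ?M p (\<lambda>x. lag_comb \<alpha> F c x - f x) + Lp_norm ?M p (\<lambda>x. f x - lag_comb \<alpha> H d x))"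
      by (intro mult_left_mono Minkowski_diff p lL f C)
    finally show ?thesis by (simp add: Lp_norm_minus_commute[of ?M p "lag_comb \<alpha> F c"])
  qed
  \<comment> \<open>Small enough that the transforms of consecutive approximants differ by at most
    (1/2)^n; C + 1 keeps the denominator positive.\<close>
  define \<delta> where "\<delta> n = (1/2) ^ n / (2 * (C + 1))" for n :: nat
  have \<delta>: "\<delta> n > 0" "\<delta> (Suc n) \<le> \<delta> n" "\<delta> n \<le> (1/2) ^ n" "C * (2 * \<delta> n) \<le> (1/2) ^ n" for n
  proof -
    show \<delta>0: "\<delta> n > 0" using C by (simp add: \<delta>_def)
    have "\<delta> (Suc n) = \<delta> n / 2" by (simp add: \<delta>_def)
    then show "\<delta> (Suc n) \<le> \<delta> n" using \<delta>0 by simp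
    have "(1/2) ^ n / (2 * (C + 1)) \<le> (1/2) ^ n / 1" using C by (intro divide_left_mono) auto
    then show "\<delta> n \<le> (1/2) ^ n" by (simp add: \<delta>_def)
    have "C * (2 * (z / (2 * (C + 1)))) = (C / (C + 1)) * z" for z using C by (simp add: divide_simps)
    then have "C * (2 * \<delta> n) = (C / (C + 1)) * (1/2) ^ n" unfolding \<delta>_def .
    also have "\<dots> \<le> 1 * (1/2) ^ n" using C by (intro mult_right_mono) auto
    finally show "C * (2 * \<delta> n) \<le> (1/2) ^ n" by simp
  qed
  have "\<forall>n. \<exists>F c. finite F \<and> Lp_norm ?M p (\<lambda>x. f x - lag_comb \<alpha> F c x) < \<delta> n"
    using lag_comb_dense[OF \<alpha> p f \<delta>(1)] by blast
  from choice[OF this] obtain F where "\<forall>n. \<exists>c. finite (F n) \<and> Lp_norm ?M p (\<lambda>x. f x - lag_comb \<alpha> (F n) c x) < \<delta> n" ..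
  from choice[OF this] obtain c where "\<forall>n. finite (F n) \<and> Lp_norm ?M p (\<lambda>x. f x - lag_comb \<alpha> (F n) (c n) x) < \<delta> n" ..
  then have F: "\<And>n. finite (F n)" and c: "\<And>n. Lp_norm ?M p (\<lambda>x. f x - lag_comb \<alpha> (F n) (c n) x) < \<delta> n" by blast+
  have "Lp_norm ?M p (\<lambda>x. riesz_comb \<alpha> (F (Suc n)) (c (Suc n)) x - riesz_comb \<alpha> (F n) (c n) x) \<le> (1/2) ^ n" for n
  proof -
    have "C * (Lp_norm ?M p (\<lambda>x. f x - lag_comb \<alpha> (F (Suc n)) (c (Suc n)) x) + Lp_norm ?M p (\<lambda>x. f x - lag_comb \<alpha> (F n) (c n) x)) \<le> C * (2 * \<delta> n)"
      using c[of n] c[of "Suc n"] \<delta>(2)[of n] C by (intro mult_left_mono) auto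
    then show ?thesis using rd[OF F[of "Suc n"] F[of n], of "c (Suc n)" "c n"] \<delta>(4)[of n] by linarith
  qed
  from Lp_complete[OF p rL this] obtain h where h: "in_Lp ?M p h"
    "\<And>n. Lp_norm ?M p (\<lambda>x. riesz_comb \<alpha> (F n) (c n) x - h x) \<le> 2 * (1/2) ^ n" by blast
  have "Lp_norm ?M p (\<lambda>x. h x - riesz_comb \<alpha> H d x) \<le> C * Lp_norm ?M p (\<lambda>x. f x - lag_comb \<alpha> H d x)" if H: "finite H" for H d
  proof (rule LIMSEQ_le_const)
    define L where "L = Lp_norm ?M p (\<lambda>x. f x - lag_comb \<alpha> H d x)"
    have "(\<lambda>n. (2 + C) * (1/2) ^ n + C * L) \<longlonglongrightarrow> (2 + C) * 0 + C * L"
      by (intro tendsto_intros LIMSEQ_power_zero) simp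
    then show "(\<lambda>n. (2 + C) * (1/2) ^ n + C * L) \<longlonglongrightarrow> C * Lp_norm ?M p (\<lambda>x. f x - lag_comb \<alpha> H d x)"
      by (simp add: L_def)
    have "Lp_norm ?M p (\<lambda>x. h x - riesz_comb \<alpha> H d x) \<le> (2 + C) * (1/2) ^ n + C * L" for n
    proof -
      have "Lp_norm ?M p (\<lambda>x. h x - riesz_comb \<alpha> H d x) \<le> Lp_norm ?M p (\<lambda>x. h x - riesz_comb \<alpha> (F n) (c n) x) + Lp_norm ?M p (\<lambda>x. riesz_comb \<alpha> (F n) (c n) x - riesz_comb \<alpha> H d x)"
        by (intro Minkowski_diff p h rL)
      moreover have "Lp_norm ?M p (\<lambda>x. h x - riesz_comb \<alpha> (F n) (c n) x) \<le> 2 * (1/2) ^ n"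
        using h(2)[of n] by (simp add: Lp_norm_minus_commute[of ?M p h])
      moreover have "Lp_norm ?M p (\<lambda>x. riesz_comb \<alpha> (F n) (c n) x - riesz_comb \<alpha> H d x) \<le> C * ((1/2) ^ n + L)"
        using rd[OF F H, of n "c n" d] mult_left_mono[OF _ C, of "Lp_norm ?M p (\<lambda>x. f x - lag_comb \<alpha> (F n) (c n) x) + L" "(1/2) ^ n + L"]
          c[of n] \<delta>(3)[of n] unfolding L_def by simp
      ultimately show ?thesis by (simp add: algebra_simps)
    qed
    then show "\<exists>N. \<forall>n\<ge>N. Lp_norm ?M p (\<lambda>x. h x - riesz_comb \<alpha> H d x) \<le> (2 + C) * (1/2) ^ n + C * L" by blast
  qed
  then show ?thesis using h(1) unfolding C_def by blast
qed

theorem theorem12: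
  fixes \<alpha> :: "real ^ 'n" and p :: real
  assumes "\<And>i. \<alpha> $ i \<ge> - 1 / 2" and "1 < p"
  shows "(\<exists>T. riesz_continuous_extension \<alpha> p T) \<and>
    (\<forall>T. riesz_continuous_extension \<alpha> p T \<longrightarrow>
      (\<forall>f. in_Lp (laguerre_measure \<alpha>) p f \<longrightarrow>
        Lp_norm (laguerre_measure \<alpha>) p (T f)
          \<le> 48 * (max p (p / (p - 1)) - 1) * Lp_norm (laguerre_measure \<alpha>) p f))"
proof -
  let ?M = "laguerre_measure \<alpha>"
  note p = assms(2)
  have \<alpha>: "\<alpha> $ i > - 1" for i using assms(1)[of i] by simp
  have p0: "p > 0" using p by simp
  define C where "C = riesz_const p"
  have C: "C \<ge> 0" unfolding C_def by (rule riesz_const_nonneg[OF p])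
  have C48: "C \<le> 48 * (max p (p / (p - 1)) - 1)"
    unfolding C_def riesz_const_def using p by (intro mult_right_mono) auto
  have rL: "in_Lp ?M p (riesz_comb \<alpha> F c)" for F c unfolding riesz_comb_def by (rule delta_comb_in_Lp[OF \<alpha> p0])
  have lL: "in_Lp ?M p (lag_comb \<alpha> F c)" for F c by (rule lag_comb_in_Lp[OF \<alpha> p0])
  have lin: "laguerre_lin \<alpha> = {lag_comb \<alpha> F c | F c. finite F}"
    unfolding laguerre_lin_def lag_comb_def[abs_def] ..
  define good where "good f h \<longleftrightarrow> in_Lp ?M p h \<and> (\<forall>F c. finite F \<longrightarrow>
     Lp_norm ?M p (\<lambda>x. h x - riesz_comb \<alpha> F c x) \<le> C * Lp_norm ?M p (\<lambda>x. f x - lag_comb \<alpha> F c x))" for f and h :: "real^'n \<Rightarrow> real^'n"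
  \<comment> \<open>The value is chosen separately for each \<open>f\<close>; the Lipschitz estimate
    \<open>lip\<close> shows that the choices fit together.\<close>
  define T where "T f = (SOME h. good f h)" for f
  have T: "good f (T f)" if "in_Lp ?M p f" for f
    using someI_ex[OF riesz_extension_exists[OF p assms(1) that], folded C_def, folded good_def] unfolding T_def .
  have "riesz_continuous_extension \<alpha> p T"
    unfolding riesz_continuous_extension_def
  proof (intro conjI allI impI ballI)
    show "in_Lp ?M p (T f)" if "in_Lp ?M p f" for f using T[OF that] by (simp add: good_def)
    show "is_riesz_vector \<alpha> f (T f)" if fl: "f \<in> laguerre_lin \<alpha>" for f
    proof -
      obtain F c where f: "finite F" "f = lag_comb \<alpha> F c" using fl unfolding lin by blast
      have g: "good f (T f)" using T[of f] lL f by simp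
      then have "Lp_norm ?M p (\<lambda>x. T f x - riesz_comb \<alpha> F c x) \<le> C * Lp_norm ?M p (\<lambda>x. f x - lag_comb \<alpha> F c x)"
        using f(1) by (simp add: good_def)
      then have "Lp_norm ?M p (\<lambda>x. T f x - riesz_comb \<alpha> F c x) \<le> 0" unfolding f(2) by simp
      then have "Lp_norm ?M p (\<lambda>x. T f x - riesz_comb \<alpha> F c x) = 0"
        by (rule antisym) simp
      then have "AE x in ?M. T f x = riesz_comb \<alpha> F c x"
        using Lp_norm_eq_0_iff[OF p0, of ?M "\<lambda>x. T f x - riesz_comb \<alpha> F c x"] g rL p0 by (simp add: good_def in_Lp_diff)
      then show ?thesis unfolding f(2)
        using is_riesz_vector_lag_comb_iff[OF \<alpha> f(1)] g f(2) by (simp add: good_def in_Lp_def)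
    qed
    \<comment> \<open>\<open>T f\<close> and \<open>T g\<close> are compared with the transform of
      one and the same finite expansion close to \<open>f\<close>.\<close>
    have lip: "Lp_norm ?M p (\<lambda>x. T g x - T f x) \<le> C * Lp_norm ?M p (\<lambda>x. g x - f x)" if f: "in_Lp ?M p f" and g: "in_Lp ?M p g" for f g
    proof (rule field_le_epsilon)
      fix e :: real assume e: "e > 0"
      define r where "r = e / (2 * (C + 1))"
      have r: "r > 0" "C * (2 * r) \<le> e" using e C by (auto simp: r_def field_simps)
      obtain F c where F: "finite F" "Lp_norm ?M p (\<lambda>x. f x - lag_comb \<alpha> F c x) < r"
        using lag_comb_dense[OF \<alpha> p f r(1)] by blast
      have "Lp_norm ?M p (\<lambda>x. T g x - T f x) \<le> Lp_norm ?M p (\<lambda>x. T g x - riesz_comb \<alpha> F c x) + Lp_norm ?M p (\<lambda>x. riesz_comb \<alpha> F c x - T f x)"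
        using T[OF f] T[OF g] by (intro Minkowski_diff p rL) (auto simp: good_def)
      also have "\<dots> \<le> C * Lp_norm ?M p (\<lambda>x. g x - lag_comb \<alpha> F c x) + C * Lp_norm ?M p (\<lambda>x. f x - lag_comb \<alpha> F c x)"
        using T[OF f] T[OF g] F(1) by (intro add_mono) (auto simp: good_def Lp_norm_minus_commute[of ?M p "riesz_comb \<alpha> F c"])
      also have "\<dots> \<le> C * (Lp_norm ?M p (\<lambda>x. g x - f x) + Lp_norm ?M p (\<lambda>x. f x - lag_comb \<alpha> F c x)) + C * Lp_norm ?M p (\<lambda>x. f x - lag_comb \<alpha> F c x)"
        by (intro add_right_mono mult_left_mono Minkowski_diff p f g lL C)
      also have "\<dots> = C * Lp_norm ?M p (\<lambda>x. g x - f x) + C * (2 * Lp_norm ?M p (\<lambda>x. f x - lag_comb \<alpha> F c x))"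
        by (simp add: algebra_simps)
      also have "\<dots> \<le> C * Lp_norm ?M p (\<lambda>x. g x - f x) + C * (2 * r)"
        using F(2) C by (intro add_left_mono mult_left_mono) auto
      finally show "Lp_norm ?M p (\<lambda>x. T g x - T f x) \<le> C * Lp_norm ?M p (\<lambda>x. g x - f x) + e" using r(2) by simp
    qed
    show "\<exists>\<eta>>0. \<forall>g. in_Lp ?M p g \<longrightarrow> Lp_norm ?M p (\<lambda>x. g x - f x) < \<eta> \<longrightarrow> Lp_norm ?M p (\<lambda>x. T g x - T f x) < \<epsilon>"
      if f: "in_Lp ?M p f" and \<epsilon>: "\<epsilon> > 0" for f \<epsilon>
    proof (intro exI[of _ "\<epsilon> / (C + 1)"] conjI allI impI)
      show "0 < \<epsilon> / (C + 1)" using \<epsilon> C by simp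
      fix g assume g: "in_Lp ?M p g" "Lp_norm ?M p (\<lambda>x. g x - f x) < \<epsilon> / (C + 1)"
      have "Lp_norm ?M p (\<lambda>x. T g x - T f x) \<le> C * Lp_norm ?M p (\<lambda>x. g x - f x)" by (rule lip[OF f g(1)])
      also have "\<dots> \<le> (C + 1) * Lp_norm ?M p (\<lambda>x. g x - f x)" by (intro mult_right_mono) auto
      also have "\<dots> < \<epsilon>" using g(2) C by (simp add: field_simps)
      finally show "Lp_norm ?M p (\<lambda>x. T g x - T f x) < \<epsilon>" .
    qed
  qed
  \<comment> \<open>An arbitrary extension agrees almost everywhere with the finite formula on the
    span; continuity at the single point \<open>f\<close> then transfers the bound.\<close>
  moreover have "Lp_norm ?M p (S f) \<le> 48 * (max p (p / (p - 1)) - 1) * Lp_norm ?M p f"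
    if S: "riesz_continuous_extension \<alpha> p S" and f: "in_Lp ?M p f" for S f
  proof -
    have SL: "in_Lp ?M p (S g)" if "in_Lp ?M p g" for g
      using S that unfolding riesz_continuous_extension_def by blast
    have "Lp_norm ?M p (S f) \<le> C * Lp_norm ?M p f"
    proof (rule field_le_epsilon)
      fix e :: real assume e: "e > 0"
      obtain \<eta> where \<eta>: "\<eta> > 0" "\<And>g. in_Lp ?M p g \<Longrightarrow> Lp_norm ?M p (\<lambda>x. g x - f x) < \<eta> \<Longrightarrow> Lp_norm ?M p (\<lambda>x. S g x - S f x) < e / 2"
        using S f e half_gt_zero[OF e] unfolding riesz_continuous_extension_def by meson
      define r where "r = min \<eta> (e / (2 * (C + 1)))"
      have r: "r > 0" "r \<le> \<eta>" "C * r \<le> e / 2"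
      proof -
        show "r > 0" "r \<le> \<eta>" using \<eta> e C by (auto simp: r_def)
        have "C * r \<le> C * (e / (2 * (C + 1)))" using C by (intro mult_left_mono) (auto simp: r_def)
        also have "\<dots> \<le> e / 2" using e C by (simp add: field_simps)
        finally show "C * r \<le> e / 2" .
      qed
      obtain F c where F: "finite F" "Lp_norm ?M p (\<lambda>x. f x - lag_comb \<alpha> F c x) < r"
        using lag_comb_dense[OF \<alpha> p f r(1)] by blast
      define g where "g = lag_comb \<alpha> F c"
      have gL: "in_Lp ?M p g" unfolding g_def by (rule lL)
      have fg: "Lp_norm ?M p (\<lambda>x. g x - f x) < r" using F(2) by (simp add: g_def Lp_norm_minus_commute[of ?M p f])
      have "is_riesz_vector \<alpha> g (S g)"
        using S F(1) unfolding riesz_continuous_extension_def lin g_def by blast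
      then have "AE x in ?M. S g x = riesz_comb \<alpha> F c x"
        using is_riesz_vector_lag_comb_iff[OF \<alpha> F(1), of "S g" c] SL[OF gL] by (simp add: g_def in_Lp_def)
      then have "Lp_norm ?M p (S g) = Lp_norm ?M p (riesz_comb \<alpha> F c)"
        using SL[OF gL] rL[of F c] by (intro Lp_cong_AE(1)) (auto simp: in_Lp_def)
      also have "\<dots> \<le> C * Lp_norm ?M p g" unfolding C_def g_def by (rule riesz_comb_bound[OF p assms(1) F(1)])
      also have "\<dots> \<le> C * (Lp_norm ?M p (\<lambda>x. g x - f x) + Lp_norm ?M p f)"
        by (intro mult_left_mono Lp_norm_le_add_diff p gL f C)
      also have "\<dots> \<le> C * (r + Lp_norm ?M p f)" using fg C by (intro mult_left_mono) auto
      finally have 1: "Lp_norm ?M p (S g) \<le> C * Lp_norm ?M p f + e / 2" using r(3) by (simp add: distrib_left)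
      have "Lp_norm ?M p (S f) \<le> Lp_norm ?M p (\<lambda>x. S f x - S g x) + Lp_norm ?M p (S g)"
        by (intro Lp_norm_le_add_diff p SL f gL)
      moreover have "Lp_norm ?M p (\<lambda>x. S f x - S g x) < e / 2"
        using \<eta>(2)[OF gL] fg r(2) by (simp add: Lp_norm_minus_commute[of ?M p "S f"])
      ultimately show "Lp_norm ?M p (S f) \<le> C * Lp_norm ?M p f + e" using 1 by simp
    qed
    also have "\<dots> \<le> 48 * (max p (p / (p - 1)) - 1) * Lp_norm ?M p f" by (intro mult_right_mono C48) simp
    finally show ?thesis .
  qed
  ultimately show ?thesis by blast
qed

end
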